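(* Let $\underline A=(A_1,\dots,A_m)\in{\rm Mat}(d,\mathbb{R})^m$ and let $1\le i\le k\le d$. Assume: (1) $\underline A$ has constant rank $k$, i.e. $\mathrm{rank}(A_j)=k$ for all $1\le j\le m$; (2) $\mathrm{rank}(A_a A_b)=k$ for every $a,b\in\{1,\dots,m\}$; (3) $L_i(\underline A)>L_{i+1}(\underline A)$; (4) the random cocycle $\wedge_i\underline A=(\wedge_iA_1,\dots,\wedge_iA_m)$ is irreducible. Then: (a) there exist a neighborhood $\mathcal V$ of $\underline A$ in $\mathcal C_k(d)$ and constants $\varepsilon_0>0$, $C<\infty$, $c>0$ such that for every $\underline B\in\mathcal V$, every $n\in\mathbb N$ and every $0<\varepsilon<\varepsilon_0$, $$\mathbf p\Big\{\omega\in X:\ \Big|\tfrac1n\log\|\wedge_i\mathbf B^n(\omega)\|-L_1(\wedge_i\underline B)\Big|>\varepsilon\Big\}\le C\,e^{-n\,c\,\varepsilon^2},$$ i.e. the cocycles $\wedge_i\underline B$, $\underline B\in\mathcal V$, satisfy a uniform large deviations estimate of exponential type; (b) the function $\mathcal C_k(d)\ni\underline B\mapsto L_1(\underline B)+\cdots+L_i(\underline B)$ is Hölder continuous on some neighborhood of $\underline A$ in $\mathcal C_k(d)$.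
   Context: Fix integers $m,d\ge1$ and a probability vector $\underline p=(p_1,\dots,p_m)$ with all $p_j>0$. Let $X=\{1,\dots,m\}^{\mathbb N}$ with the Bernoulli product measure $\mathbf p=\underline p^{\mathbb N}$ and the left shift $\sigma$. A random cocycle is a tuple $\underline B=(B_1,\dots,B_m)\in\mathscr C(d):={\rm Mat}(d,\mathbb R)^m$ (with its Euclidean topology/metric as $\mathbb R^{md^2}$); it defines $\mathbf B(\omega)=B_{\omega_0}$ and $\mathbf B^n(\omega)=B_{\omega_{n-1}}\cdots B_{\omega_1}B_{\omega_0}$. For $1\le j\le d$, the $j$-th Lyapunov exponent $L_j(\underline B)\in[-\infty,\infty)$ is the $\mathbf p$-almost surely constant limit $\lim_{n\to\infty}\frac1n\log s_j(\mathbf B^n(\omega))$, where $s_1\ge\dots\ge s_d\ge0$ are singular values (with $\log0=-\infty$). $\mathcal C_k(d)$ denotes the set of $\underline B\in\mathscr C(d)$ with $\mathrm{rank}(B_j)=k$ for all $j$, with the subspace topology. For a matrix $A$, $\wedge_iA$ is its $i$-th exterior power (the matrix of $i\times i$ minors), so $\wedge_i(AB)=\wedge_iA\,\wedge_iB$ and $\|\wedge_iA\|=s_1(A)\cdots s_i(A)$; $\wedge_i\underline B=(\wedge_iB_1,\dots,\wedge_iB_m)$ and $\wedge_i\mathbf B^n(\omega)=\wedge_i(\mathbf B^n(\omega))$; $L_1(\wedge_i\underline B)=L_1(\underline B)+\dots+L_i(\underline B)$. A tuple $(D_1,\dots,D_m)$ of $N\times N$ real matrices is called reducible if there exist subspaces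 $V_1,\dots,V_m$ with $\{0\}\ne V_j\subsetneq\mathrm{Range}(D_j)$ and $D_aV_b=V_a$ for all $a,b\in\{1,\dots,m\}$; otherwise it is irreducible. *)

theory Defs
  imports "HOL-Probability.Probability" "Jordan_Normal_Form.DL_Rank_Submatrix"
          "Jordan_Normal_Form.Char_Poly"
begin

text \<open>Matrices are JNF matrices of type real mat; a random cocycle with alphabet
  the finite type 'a (m = CARD('a)) is a map 'a => real mat.\<close>

definition vnorm :: "real vec \<Rightarrow> real" where
  "vnorm v = sqrt (\<Sum>j<dim_vec v. (vec_index v j)^2)"

definition opnorm :: "real mat \<Rightarrow> real" where
  "opnorm M = Sup {vnorm (mult_mat_vec M v) | v. v \<in> carrier_vec (dim_col M) \<and> vnorm v = 1}"

definition sv_sq_list :: "real mat \<Rightarrow> real list" where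
  "sv_sq_list M = (THE ev. length ev = dim_col M \<and> sorted_wrt (\<ge>) ev \<and>
      char_poly (transpose_mat M * M) = prod_list (map (\<lambda>e. [:- e, 1:]) ev))"

definition sval :: "nat \<Rightarrow> real mat \<Rightarrow> real" where
  "sval j M = (if 1 \<le> j \<and> j \<le> dim_col M then sqrt (sv_sq_list M ! (j - 1)) else 0)"

text \<open>Exterior power: matrix of i x i minors, rows/columns indexed by the
  strictly increasing i-tuples of row/column indices (lexicographic order).\<close>
definition ext_idx :: "nat \<Rightarrow> nat \<Rightarrow> nat list list" where
  "ext_idx d i = filter (sorted_wrt (<)) (List.n_lists i [0..<d])"

definition ext_dim :: "nat \<Rightarrow> nat \<Rightarrow> nat" where
  "ext_dim d i = length (ext_idx d i)"

definition ext_pow :: "nat \<Rightarrow> real mat \<Rightarrow> real mat" where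
  "ext_pow i A = (let I = ext_idx (dim_row A) i in
     mat (length I) (length I)
       (\<lambda>(r, c). det (submatrix A (set (I ! r)) (set (I ! c)))))"

definition ext_cocycle :: "nat \<Rightarrow> ('a \<Rightarrow> real mat) \<Rightarrow> 'a \<Rightarrow> real mat" where
  "ext_cocycle i B = (\<lambda>a. ext_pow i (B a))"

definition bern :: "'a pmf \<Rightarrow> (nat \<Rightarrow> 'a) measure" where
  "bern P = Pi\<^sub>M UNIV (\<lambda>_::nat. measure_pmf P)"

fun cpow :: "nat \<Rightarrow> ('a \<Rightarrow> real mat) \<Rightarrow> nat \<Rightarrow> (nat \<Rightarrow> 'a) \<Rightarrow> real mat" where
  "cpow N B 0 \<omega> = 1\<^sub>m N"
| "cpow N B (Suc n) \<omega> = B (\<omega> n) * cpow N B n \<omega>"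

definition elog :: "real \<Rightarrow> ereal" where
  "elog x = (if x = 0 then - \<infinity> else ereal (ln x))"

definition lyap :: "'a pmf \<Rightarrow> nat \<Rightarrow> ('a \<Rightarrow> real mat) \<Rightarrow> nat \<Rightarrow> ereal" where
  "lyap P N B j = (THE L. AE \<omega> in bern P.
      (\<lambda>n. elog (sval j (cpow N B n \<omega>)) / ereal (real n)) \<longlonglongrightarrow> L)"

definition Ck :: "nat \<Rightarrow> nat \<Rightarrow> ('a \<Rightarrow> real mat) \<Rightarrow> bool" where
  "Ck d k B = (\<forall>a. B a \<in> carrier_mat d d \<and> vec_space.rank d (B a) = k)"

definition cdist :: "nat \<Rightarrow> ('a::finite \<Rightarrow> real mat) \<Rightarrow> ('a \<Rightarrow> real mat) \<Rightarrow> real" where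
  "cdist d B B' = sqrt (\<Sum>a\<in>UNIV. \<Sum>r<d. \<Sum>c<d. (B a $$ (r, c) - B' a $$ (r, c))^2)"

definition lin_subsp :: "nat \<Rightarrow> real vec set \<Rightarrow> bool" where
  "lin_subsp N V = (V \<subseteq> carrier_vec N \<and> 0\<^sub>v N \<in> V \<and>
      (\<forall>u\<in>V. \<forall>v\<in>V. u + v \<in> V) \<and> (\<forall>t::real. \<forall>v\<in>V. t \<cdot>\<^sub>v v \<in> V))"

definition mat_range :: "nat \<Rightarrow> real mat \<Rightarrow> real vec set" where
  "mat_range N D = (\<lambda>v. mult_mat_vec D v) ` carrier_vec N"

definition reducible :: "nat \<Rightarrow> ('a \<Rightarrow> real mat) \<Rightarrow> bool" where
  "reducible N D = (\<exists>V :: 'a \<Rightarrow> real vec set. \<forall>a.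
      lin_subsp N (V a) \<and> V a \<noteq> {0\<^sub>v N} \<and> V a \<subset> mat_range N (D a) \<and>
      (\<forall>b. (\<lambda>v. mult_mat_vec (D a) v) ` V b = V a))"

definition irreducible_cocycle :: "nat \<Rightarrow> ('a \<Rightarrow> real mat) \<Rightarrow> bool" where
  "irreducible_cocycle N D = (\<not> reducible N D)"

end

theory Submission
  imports Defs "Jordan_Normal_Form.Schur_Decomposition"
begin

text \<open>
Let \<open>D\<^sub>a\<close> be the \<open>i\<close>-th exterior power of \<open>A\<^sub>a\<close>. Constant rank of the products makes every \<open>D\<^sub>c\<close> injective on the
range of every \<open>D\<^sub>a\<close>, with uniform bounds, so that logarithmic growth rates of vectors in these ranges are bounded. The gap
\<open>L\<^sub>i > L\<^sub>i\<^sub>+\<^sub>1\<close> says that the second exterior power of \<open>D\<^sup>n\<close> is almost surely exponentially small compared with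
\<open>\<parallel>D\<^sup>n\<parallel>\<^sup>2\<close>. A vector \<open>v\<close> whose orbit is almost surely negligible against \<open>\<parallel>D\<^sup>n\<parallel>\<close> lies in an invariant family of subspaces,
hence vanishes by irreducibility; the probability that an orbit is negligible is harmonic, and compactness shows that it is
zero for all \<open>v \<noteq> 0\<close>. Consequently the expectation of \<open>(\<parallel>\<And>\<^sup>2 D\<^sup>n\<parallel> / \<parallel>D\<^sup>n v\<parallel>\<^sup>2)\<^sup>\<alpha>\<close> is at most some
\<open>\<theta> < 1\<close> for suitable \<open>n\<close> and \<open>\<alpha>\<close>, uniformly in the unit vector \<open>v\<close>: the transition operator contracts
\<open>\<alpha>\<close>-Hoelder functions of the direction. This is an open condition within matrices of constant rank, whose ranges move continuously.

For a contracting cocycle the Poisson equation for the function \<open>v \<mapsto> E ln \<parallel>D v\<parallel> - L\<close> has a bounded solution, which turns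
\<open>ln \<parallel>D\<^sup>n v\<parallel> - n L\<close> into a martingale with bounded increments plus a bounded term; exponential moments give the large
deviations. Comparing \<open>E ln \<parallel>D\<^sup>n v\<parallel>\<close> for two nearby cocycles after a number of steps logarithmic in their distance gives
Hoelder continuity of \<open>L\<close>. Kingman's theorem and the identity \<open>\<parallel>\<And>\<^sup>j M\<parallel> = s\<^sub>1(M) \<cdots> s\<^sub>j(M)\<close> relate \<open>L\<close> to the
Lyapunov exponents.
\<close>

section \<open>The Bernoulli shift\<close>

text \<open>The matrices are singular, so they do not act on the whole projective space. The chain
  lives on nonzero vectors in the range of the last letter, and the condition rank(A_a A_b) = k
  keeps such vectors from dying. Vectors of different ranges are not compared directly: after one
  common letter both lie in the same range, which explains many shifts by one letter.

  Irreducibility is applied to a linear object. Vectors negligible along almost every orbit are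
  closed under sums, so they form one invariant family of subspaces, and no finite unions of
  subspaces have to be excluded. The gap also shows that the ratio |D^n v| / |D^n| settles
  exponentially fast: smallness at one time persists, which is what makes a compactness argument
  over varying times possible.

  Uniformity is a matter of bookkeeping: every constant of a contracting cocycle is a function of a
  short list of numbers (upper and lower bounds, contraction data), and all neighbours share one
  such list.\<close>

definition pre :: "nat \<Rightarrow> (nat \<Rightarrow> 'a) \<Rightarrow> 'a list" where
  "pre n \<omega> = map \<omega> [0..<n]"

definition lshift :: "nat \<Rightarrow> (nat \<Rightarrow> 'a) \<Rightarrow> nat \<Rightarrow> 'a" where
  "lshift k \<omega> = (\<lambda>i. \<omega> (k + i))"

lemma length_pre [simp]: "length (pre n \<omega>) = n"
  by (simp add: pre_def)

lemma pre_nonempty: "1 \<le> n \<Longrightarrow> pre n \<omega> \<noteq> []"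
  using length_pre[of n \<omega>] by (metis list.size(3) not_one_le_zero)

lemma pre_0 [simp]: "pre 0 \<omega> = []"
  by (simp add: pre_def)

lemma pre_Suc_case_nat [simp]: "pre (Suc n) (case_nat c \<omega>) = c # pre n \<omega>"
  by (simp add: pre_def upt_conv_Cons map_Suc_upt[symmetric] del: upt_Suc)

lemma pre_Suc: "pre (Suc n) \<omega> = pre n \<omega> @ [\<omega> n]"
  by (simp add: pre_def)

lemma pre_add: "pre (n + m) \<omega> = pre n \<omega> @ pre m (lshift n \<omega>)"
  by (rule nth_equalityI) (auto simp: pre_def lshift_def nth_append)

lemma lshift_0 [simp]: "lshift 0 \<omega> = \<omega>"
  by (simp add: lshift_def)

lemma lshift_lshift: "lshift k (lshift l \<omega>) = lshift (l + k) \<omega>"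
  by (simp add: lshift_def add.assoc)

lemma lshift_Suc_case_nat [simp]: "lshift (Suc k) (case_nat c \<omega>) = lshift k \<omega>"
  by (simp add: lshift_def)

lemma space_bern [simp]: "space (bern P) = UNIV"
  by (simp add: bern_def space_PiM)

lemma sequence_space_pmf: "sequence_space (measure_pmf P)"
  unfolding sequence_space_def by (rule product_prob_spaceI) (rule measure_pmf.prob_space_axioms)

lemma prob_space_bern: "prob_space (bern P)"
  unfolding bern_def by (rule prob_space_PiM) (rule measure_pmf.prob_space_axioms)

lemma measurable_coord [measurable]: "(\<lambda>\<omega>. \<omega> i) \<in> measurable (bern P) (count_space UNIV)"
proof -
  have "(\<lambda>\<omega>. \<omega> i) \<in> measurable (bern P) (measure_pmf P)"
    unfolding bern_def by (rule measurable_component_singleton) simp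
  then show ?thesis by (simp add: measurable_def)
qed

lemma measurable_lshift [measurable]: "lshift k \<in> measurable (bern P) (bern P)"
proof -
  have "(\<lambda>\<omega> i. \<omega> (k + i)) \<in> measurable (bern P) (bern P)"
    unfolding bern_def by (intro measurable_PiM_single' measurable_component_singleton) auto
  then show ?thesis by (simp add: lshift_def[abs_def])
qed

lemma measurable_pre [measurable]:
  "pre n \<in> measurable (bern (P :: 'a::finite pmf)) (count_space UNIV)"
proof (induction n)
  case 0
  have "pre 0 = (\<lambda>\<omega>::nat \<Rightarrow> 'a. [])" by auto
  then show ?case by simp
next
  case (Suc n)
  have "pre (Suc n) = (\<lambda>\<omega>::nat \<Rightarrow> 'a. pre n \<omega> @ [\<omega> n])" by (auto simp: pre_Suc)
  moreover have "(\<lambda>\<omega>. pre n \<omega> @ [\<omega> n]) \<in> measurable (bern P) (count_space UNIV)"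
    by (rule measurable_compose_countable[OF _ Suc, of "\<lambda>w \<omega>. w @ [\<omega> n]"])
       (rule measurable_compose[OF measurable_coord], simp)
  ultimately show ?case by simp
qed

lemma measurable_fun_pre [measurable]:
  "(\<lambda>\<omega>. F (pre n \<omega>)) \<in> measurable (bern (P :: 'a::finite pmf)) (count_space UNIV)"
  by (rule measurable_compose[OF measurable_pre]) simp

lemma borel_measurable_fun_pre [measurable]:
  fixes F :: "'a::finite list \<Rightarrow> real"
  shows "(\<lambda>\<omega>. F (pre n \<omega>)) \<in> borel_measurable (bern P)"
  by (rule measurable_compose[OF measurable_pre]) simp

lemma borel_measurable_fun_pre_shift [measurable]:
  fixes F :: "'a::finite list \<Rightarrow> real"
  shows "(\<lambda>\<omega>. F (pre n (lshift k \<omega>))) \<in> borel_measurable (bern P)"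
  by (rule measurable_compose[OF measurable_lshift borel_measurable_fun_pre])

text \<open>The Bernoulli measure is the image of the letter distribution times itself under
  prepending a letter. Conditioning on the first letter in this way yields shift invariance,
  independence of prefixes and, later, harmonicity of \<open>gz\<close>.\<close>

lemma measure_bern_step:
  fixes P :: "'a::finite pmf"
  assumes Z: "Z \<in> sets (bern P)"
  shows "measure (bern P) Z = (\<Sum>c\<in>UNIV. pmf P c * measure (bern P) {\<omega>. case_nat c \<omega> \<in> Z})"
proof -
  interpret sequence_space "measure_pmf P" by (rule sequence_space_pmf)
  interpret B: prob_space "bern P" by (rule prob_space_bern)
  have S: "Pi\<^sub>M UNIV (\<lambda>i::nat. measure_pmf P) = bern P" by (simp add: bern_def)
  let ?g = "\<lambda>(s, \<omega>). case_nat s \<omega>"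
  have meas: "?g \<in> measurable (measure_pmf P \<Otimes>\<^sub>M bern P) (bern P)"
    unfolding bern_def by measurable
  let ?Y = "?g -` Z \<inter> space (measure_pmf P \<Otimes>\<^sub>M bern P)"
  have Y: "?Y \<in> sets (measure_pmf P \<Otimes>\<^sub>M bern P)"
    by (rule measurable_sets[OF meas Z])
  have "emeasure (bern P) Z = emeasure (distr (measure_pmf P \<Otimes>\<^sub>M bern P) (bern P) ?g) Z"
    using PiM_iter unfolding S by simp
  also have "\<dots> = emeasure (measure_pmf P \<Otimes>\<^sub>M bern P) ?Y"
    by (rule emeasure_distr[OF meas Z])
  also have "\<dots> = (\<integral>\<^sup>+x. emeasure (bern P) (Pair x -` ?Y) \<partial>measure_pmf P)"
    by (rule B.emeasure_pair_measure_alt[OF Y])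
  also have "\<dots> = (\<integral>\<^sup>+x. emeasure (bern P) {\<omega>. case_nat x \<omega> \<in> Z} \<partial>measure_pmf P)"
    by (intro nn_integral_cong arg_cong2[where f=emeasure] refl)
       (auto simp: space_pair_measure)
  also have "\<dots> = (\<Sum>x\<in>set_pmf P. emeasure (bern P) {\<omega>. case_nat x \<omega> \<in> Z} * pmf P x)"
    by (rule nn_integral_measure_pmf_finite) simp_all
  also have "\<dots> = (\<Sum>x\<in>UNIV. ennreal (pmf P x * measure (bern P) {\<omega>. case_nat x \<omega> \<in> Z}))"
    by (rule sum.mono_neutral_cong_left)
       (auto simp: B.emeasure_eq_measure ennreal_mult' mult.commute set_pmf_eq)
  also have "\<dots> = ennreal (\<Sum>x\<in>UNIV. pmf P x * measure (bern P) {\<omega>. case_nat x \<omega> \<in> Z})"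
    by (rule sum_ennreal) simp
  finally show ?thesis
    by (simp add: B.emeasure_eq_measure sum_nonneg)
qed

lemma sets_pre_shift:
  fixes P :: "'a::finite pmf"
  assumes "Z \<in> sets (bern P)"
  shows "{\<omega>. pre n \<omega> = w \<and> lshift n \<omega> \<in> Z} \<in> sets (bern P)"
proof -
  have "{\<omega> \<in> space (bern P). pre n \<omega> = w \<and> lshift n \<omega> \<in> Z} \<in> sets (bern P)"
    using assms by measurable
  then show ?thesis by simp
qed

text \<open>Independence of a prefix and the shifted sequence, by peeling off letters. It turns
  invariance properties of an event into the hypothesis of \<open>zero_one_prefix\<close>.\<close>

lemma measure_pre_shift:
  fixes P :: "'a::finite pmf"
  assumes Z: "Z \<in> sets (bern P)"
  shows "measure (bern P) {\<omega>. pre (length w) \<omega> = w \<and> lshift (length w) \<omega> \<in> Z}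
      = prod_list (map (pmf P) w) * measure (bern P) Z"
proof (induction w)
  case Nil
  then show ?case by simp
next
  case (Cons c w)
  have "measure (bern P) {\<omega>. pre (length (c # w)) \<omega> = c # w \<and> lshift (length (c # w)) \<omega> \<in> Z}
     = (\<Sum>x\<in>UNIV. pmf P x * measure (bern P) {\<omega>. x = c \<and> pre (length w) \<omega> = w \<and> lshift (length w) \<omega> \<in> Z})"
    by (subst measure_bern_step[OF sets_pre_shift[OF Z]]) simp
  also have "\<dots> = (\<Sum>x\<in>UNIV. if x = c then pmf P c * measure (bern P) {\<omega>. pre (length w) \<omega> = w \<and> lshift (length w) \<omega> \<in> Z} else 0)"
    by (intro sum.cong) auto
  finally show ?case by (simp add: Cons)
qed

lemma measure_pre:
  fixes P :: "'a::finite pmf"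
  shows "measure (bern P) {\<omega>. pre (length w) \<omega> = w} = prod_list (map (pmf P) w)"
proof -
  interpret B: prob_space "bern P" by (rule prob_space_bern)
  show ?thesis
    using measure_pre_shift[OF sets.top, where w=w and P=P] B.prob_space by simp
qed

lemma sets_vimage_shift:
  "Z \<in> sets (bern P) \<Longrightarrow> {\<omega>. lshift k \<omega> \<in> Z} \<in> sets (bern P)"
  using measurable_sets[OF measurable_lshift, of Z P k] by (simp add: vimage_def)

lemma distr_shift: "distr (bern P) (bern P) (lshift k) = bern (P :: 'a::finite pmf)"
proof (induction k)
  case 0
  have "lshift 0 = (\<lambda>\<omega>::nat \<Rightarrow> 'a. \<omega>)" by auto
  then show ?case by (simp add: distr_id2)
next
  case (Suc k)
  interpret B: prob_space "bern P" by (rule prob_space_bern)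
  have 1: "distr (bern P) (bern P) (lshift 1) = bern P"
  proof (rule measure_eqI)
    fix Z assume "Z \<in> sets (distr (bern P) (bern P) (lshift 1))"
    then have Z: "Z \<in> sets (bern P)" by simp
    have "measure (bern P) {\<omega>. lshift 1 \<omega> \<in> Z} = measure (bern P) Z"
      by (subst measure_bern_step[OF sets_vimage_shift[OF Z]])
         (simp add: sum_distrib_right[symmetric] sum_pmf_eq_1)
    then show "emeasure (distr (bern P) (bern P) (lshift 1)) Z = emeasure (bern P) Z"
      by (simp add: emeasure_distr[OF measurable_lshift Z] B.emeasure_eq_measure vimage_def)
  qed simp
  have "distr (bern P) (bern P) (lshift (Suc k)) = distr (bern P) (bern P) (lshift 1 \<circ> lshift k)"
    by (simp add: lshift_lshift comp_def)
  also have "\<dots> = distr (distr (bern P) (bern P) (lshift k)) (bern P) (lshift 1)"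
    by (rule distr_distr[symmetric]) measurable
  finally show ?case unfolding Suc 1 .
qed

lemma measure_vimage_shift:
  fixes P :: "'a::finite pmf"
  assumes "Z \<in> sets (bern P)"
  shows "measure (bern P) {\<omega>. lshift k \<omega> \<in> Z} = measure (bern P) Z"
  using measure_distr[OF measurable_lshift assms, of k] by (simp add: distr_shift vimage_def)

lemma integral_shift:
  fixes f :: "(nat \<Rightarrow> 'a::finite) \<Rightarrow> real"
  assumes "f \<in> borel_measurable (bern P)"
  shows "(\<integral>\<omega>. f (lshift k \<omega>) \<partial>bern P) = (\<integral>\<omega>. f \<omega> \<partial>bern P)"
  using integral_distr[OF measurable_lshift assms, of k] by (simp add: distr_shift)

lemma sets_bern_subset:
  "sets (bern (P :: 'a::finite pmf)) \<subseteq> sigma_sets UNIV {{\<omega>. pre n \<omega> \<in> F} | n F. True}"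
proof -
  have "sets (bern P) = sigma_sets (\<Pi>\<^sub>E i\<in>UNIV. space (measure_pmf P))
      {{f\<in>\<Pi>\<^sub>E i\<in>UNIV. space (measure_pmf P). f i \<in> A} |i A. i \<in> UNIV \<and> A \<in> sets (measure_pmf P)}"
    unfolding bern_def by (rule sets_PiM_single)
  also have "\<dots> \<subseteq> sigma_sets UNIV {{\<omega>. pre n \<omega> \<in> F} | n F. True}"
  proof -
    have "{f. f i \<in> A} \<in> {{\<omega>. pre n \<omega> \<in> F} | n F. True}" for i and A :: "'a set"
    proof -
      have "{f. f i \<in> A} = {\<omega>. pre (Suc i) \<omega> \<in> {w. w ! i \<in> A}}"
        by (auto simp: pre_def simp del: upt_Suc)
      then show ?thesis by blast
    qed
    then show ?thesis by (auto intro!: sigma_sets_mono')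
  qed
  finally show ?thesis .
qed

text \<open>Prefix events generate the sigma-algebra and are closed under intersection, so
  independence extends from words to all events, in particular to \<open>E\<close> itself: p = p^2.
  The hypothesis speaks of words because one of the two uses concerns an event that is not shift
  invariant.\<close>

lemma zero_one_prefix:
  fixes P :: "'a::finite pmf"
  assumes E: "E \<in> sets (bern P)"
    and ind: "\<And>w. measure (bern P) (E \<inter> {\<omega>. pre (length w) \<omega> = w})
          = measure (bern P) E * measure (bern P) {\<omega>. pre (length w) \<omega> = w}"
  shows "measure (bern P) E = 0 \<or> measure (bern P) E = 1"
proof -
  interpret B: prob_space "bern P" by (rule prob_space_bern)
  let ?G = "{{\<omega> :: nat \<Rightarrow> 'a. pre n \<omega> \<in> F} | n F. True}"
  have setsG: "{\<omega>. pre n \<omega> \<in> F} \<in> sets (bern P)" for n and F :: "'a list set"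
  proof -
    have "{\<omega> \<in> space (bern P). pre n \<omega> \<in> F} \<in> sets (bern P)" by measurable
    then show ?thesis by simp
  qed
  have Int_st: "Int_stable ?G"
  proof (rule Int_stableI, clarify)
    fix n m and F F' :: "'a list set"
    have "{\<omega>. pre n \<omega> \<in> F} \<inter> {\<omega>. pre m \<omega> \<in> F'}
        = {\<omega>. pre (max n m) \<omega> \<in> {w. take n w \<in> F \<and> take m w \<in> F'}}"
      by (auto simp: pre_def take_map min_absorb2)
    then show "\<exists>n' F''. {\<omega>. pre n \<omega> \<in> F} \<inter> {\<omega>. pre m \<omega> \<in> F'} = {\<omega>. pre n' \<omega> \<in> F''} \<and> True"
      by blast
  qed
  have cyl: "measure (bern P) (E \<inter> {\<omega>. pre n \<omega> \<in> F})
        = measure (bern P) E * measure (bern P) {\<omega>. pre n \<omega> \<in> F}" for n and F :: "'a list set"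
  proof -
    let ?W = "{w \<in> F. length w = n}"
    have fin: "finite ?W"
      by (rule finite_subset[OF _ finite_lists_length_eq[of "UNIV :: 'a set" n]]) auto
    have eq: "{\<omega>. pre n \<omega> \<in> F} = (\<Union>w\<in>?W. {\<omega>. pre (length w) \<omega> = w})" by auto
    have s1: "{\<omega>. pre (length w) \<omega> = w} \<in> sets (bern P)" for w :: "'a list"
      using setsG[of "length w" "{w}"] by simp
    have "measure (bern P) (E \<inter> {\<omega>. pre n \<omega> \<in> F})
        = measure (bern P) (\<Union>w\<in>?W. E \<inter> {\<omega>. pre (length w) \<omega> = w})"
      by (rule arg_cong[where f="measure (bern P)"]) auto
    also have "\<dots> = (\<Sum>w\<in>?W. measure (bern P) (E \<inter> {\<omega>. pre (length w) \<omega> = w}))"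
      using fin s1 E by (intro B.finite_measure_finite_Union) (auto simp: disjoint_family_on_def)
    also have "\<dots> = measure (bern P) E * (\<Sum>w\<in>?W. measure (bern P) {\<omega>. pre (length w) \<omega> = w})"
      unfolding sum_distrib_left by (intro sum.cong refl ind)
    also have "(\<Sum>w\<in>?W. measure (bern P) {\<omega>. pre (length w) \<omega> = w})
        = measure (bern P) (\<Union>w\<in>?W. {\<omega>. pre (length w) \<omega> = w})"
      using fin s1 by (intro B.finite_measure_finite_Union[symmetric]) (auto simp: disjoint_family_on_def)
    finally show ?thesis by (simp only: eq[symmetric])
  qed
  have sub: "sigma_sets UNIV ?G \<subseteq> sets (bern P)"
    using sets.sigma_sets_subset[of ?G "bern P"] setsG by auto
  have GP: "?G \<subseteq> Pow UNIV" by simp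
  have all: "measure (bern P) (E \<inter> A) = measure (bern P) E * measure (bern P) A"
    if A: "A \<in> sigma_sets UNIV ?G" for A
    using Int_st GP A
  proof (induction rule: sigma_sets_induct_disjoint)
    case (basic A)
    then show ?case using cyl by auto
  next
    case empty
    then show ?case by simp
  next
    case (compl A)
    have A: "A \<in> sets (bern P)" using compl(1) sub by auto
    have "E \<inter> (UNIV - A) = E - (E \<inter> A)" by auto
    then have "measure (bern P) (E \<inter> (UNIV - A)) = measure (bern P) E - measure (bern P) E * measure (bern P) A"
      using A E compl(2) by (simp add: B.finite_measure_Diff sets.Int)
    moreover have "measure (bern P) (UNIV - A) = 1 - measure (bern P) A"
      using B.prob_compl[OF A] by simp
    ultimately show ?case by (simp only: right_diff_distrib mult_1_right)
  next
    case (union A)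
    have A: "A i \<in> sets (bern P)" for i using union(2) sub by auto
    have s1: "(\<lambda>i. measure (bern P) (E \<inter> A i)) sums measure (bern P) (\<Union>i. E \<inter> A i)"
      using A E union(1) by (intro B.finite_measure_UNION) (auto simp: disjoint_family_on_def)
    have s2: "(\<lambda>i. measure (bern P) (A i)) sums measure (bern P) (\<Union>i. A i)"
      using A union(1) by (intro B.finite_measure_UNION) auto
    have "(\<lambda>i. measure (bern P) (E \<inter> A i)) sums (measure (bern P) E * measure (bern P) (\<Union>i. A i))"
      using sums_mult[OF s2, of "measure (bern P) E"] union(3) by simp
    then have "measure (bern P) (\<Union>i. E \<inter> A i) = measure (bern P) E * measure (bern P) (\<Union>i. A i)"
      using s1 sums_unique2 by blast
    then show ?case by simp
  qed
  have "measure (bern P) (E \<inter> E) = measure (bern P) E * measure (bern P) E"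
    using all E sets_bern_subset by blast
  then show ?thesis by simp
qed

text \<open>Only the inclusion of the preimage in \<open>E\<close> is assumed; both have the same
  measure, so they agree up to a null set. On the prefix \<open>w\<close> the event \<open>E\<close>
  may then be replaced by a condition on the shifted sequence, which is independent of
  \<open>w\<close>.\<close>

lemma zero_one_shift:
  fixes P :: "'a::finite pmf"
  assumes E: "E \<in> sets (bern P)"
    and sub: "\<And>\<omega>. lshift 1 \<omega> \<in> E \<Longrightarrow> \<omega> \<in> E"
  shows "measure (bern P) E = 0 \<or> measure (bern P) E = 1"
proof (rule zero_one_prefix[OF E])
  interpret B: prob_space "bern P" by (rule prob_space_bern)
  fix w :: "'a list"
  let ?n = "length w" let ?C = "{\<omega>. pre ?n \<omega> = w}"
  have subk: "lshift k \<omega> \<in> E \<Longrightarrow> \<omega> \<in> E" for k \<omega>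
  proof (induction k arbitrary: \<omega>)
    case (Suc k)
    have "lshift 1 (lshift k \<omega>) \<in> E" using Suc(2) by (simp add: lshift_lshift)
    then show ?case using sub Suc(1) by blast
  qed simp
  let ?S = "{\<omega>. lshift ?n \<omega> \<in> E}"
  have S: "?S \<in> sets (bern P)" by (rule sets_vimage_shift[OF E])
  have C: "?C \<in> sets (bern P)"
    using sets_pre_shift[OF sets.top, of ?n w P] by simp
  have "?S \<subseteq> E" using subk by auto
  then have "measure (bern P) (E - ?S) = 0"
    using B.finite_measure_Diff[OF E S] measure_vimage_shift[OF E] by simp
  then have null: "AE \<omega> in bern P. \<omega> \<notin> E - ?S"
    using E S by (intro AE_not_in null_setsI) (auto simp: B.emeasure_eq_measure)
  have "measure (bern P) (E \<inter> ?C) = measure (bern P) {\<omega>. pre ?n \<omega> = w \<and> lshift ?n \<omega> \<in> E}"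
  proof (rule B.finite_measure_eq_AE)
    show "AE \<omega> in bern P. (\<omega> \<in> E \<inter> ?C) = (\<omega> \<in> {\<omega>. pre ?n \<omega> = w \<and> lshift ?n \<omega> \<in> E})"
      using null by eventually_elim (use \<open>?S \<subseteq> E\<close> in auto)
  qed (use E C sets_pre_shift[OF E] in auto)
  then show "measure (bern P) (E \<inter> ?C) = measure (bern P) E * measure (bern P) ?C"
    by (simp add: measure_pre_shift[OF E] measure_pre)
qed

section \<open>Kingman's theorem for functions of prefixes\<close>

text \<open>Expectation over the first \<open>n\<close> letters, with the first letter as outermost
  variable; this matches \<open>fold\<close>, which applies the first letter first. As a finite
  recursion it makes linearity and conditioning on a prefix (\<open>wex_append\<close>) plain
  inductions.\<close>

primrec wex :: "'a::finite pmf \<Rightarrow> nat \<Rightarrow> ('a list \<Rightarrow> real) \<Rightarrow> real" where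
  "wex P 0 F = F []"
| "wex P (Suc n) F = (\<Sum>c\<in>UNIV. pmf P c * wex P n (\<lambda>w. F (c # w)))"

lemma wex_mono: "(\<And>w. length w = n \<Longrightarrow> F w \<le> G w) \<Longrightarrow> wex P n F \<le> wex P n G"
  by (induction n arbitrary: F G) (auto intro!: sum_mono mult_left_mono)

lemma wex_const [simp]: "wex P n (\<lambda>_. c) = c"
  by (induction n) (simp_all add: sum_distrib_right[symmetric] sum_pmf_eq_1)

lemma wex_add: "wex P n (\<lambda>w. F w + G w) = wex P n F + wex P n G"
  by (induction n arbitrary: F G) (simp_all add: distrib_left sum.distrib)

lemma wex_cmult: "wex P n (\<lambda>w. c * F w) = c * wex P n F"
  by (induction n arbitrary: F) (simp_all add: sum_distrib_left mult.left_commute)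

lemma wex_diff: "wex P n (\<lambda>w. F w - G w) = wex P n F - wex P n G"
  using wex_add[of P n F "\<lambda>w. -1 * G w"] wex_cmult[of P n "-1" G] by simp

lemma wex_sum: "finite I \<Longrightarrow> wex P n (\<lambda>w. \<Sum>i\<in>I. F i w) = (\<Sum>i\<in>I. wex P n (F i))"
  by (induction I rule: finite_induct) (simp_all add: wex_add)

lemma wex_nonneg: "(\<And>w. length w = n \<Longrightarrow> 0 \<le> F w) \<Longrightarrow> 0 \<le> wex P n F"
  using wex_mono[of n "\<lambda>_. 0" F P] by simp

lemma wex_abs: "\<bar>wex P n F\<bar> \<le> wex P n (\<lambda>w. \<bar>F w\<bar>)"
proof -
  have "wex P n F \<le> wex P n (\<lambda>w. \<bar>F w\<bar>)" by (rule wex_mono) auto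
  moreover have "wex P n (\<lambda>w. (-1) * F w) \<le> wex P n (\<lambda>w. \<bar>F w\<bar>)" by (rule wex_mono) auto
  ultimately show ?thesis unfolding wex_cmult by auto
qed

lemma wex_append: "wex P (n + m) F = wex P n (\<lambda>u. wex P m (\<lambda>w. F (u @ w)))"
  by (induction n arbitrary: F) simp_all

lemma measure_pre_in:
  fixes P :: "'a::finite pmf"
  shows "measure (bern P) {\<omega>. pre n \<omega> \<in> F} = wex P n (\<lambda>w. if w \<in> F then 1 else 0)"
proof (induction n arbitrary: F)
  case 0
  interpret B: prob_space "bern P" by (rule prob_space_bern)
  show ?case using B.prob_space by simp
next
  case (Suc n)
  have "{\<omega> \<in> space (bern P). pre (Suc n) \<omega> \<in> F} \<in> sets (bern P)" by measurable
  then have Z: "{\<omega>. pre (Suc n) \<omega> \<in> F} \<in> sets (bern P)" by simp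
  have "measure (bern P) {\<omega>. pre (Suc n) \<omega> \<in> F}
      = (\<Sum>c\<in>UNIV. pmf P c * measure (bern P) {\<omega>. pre n \<omega> \<in> {w. c # w \<in> F}})"
    by (subst measure_bern_step[OF Z]) simp
  then show ?case unfolding Suc by simp
qed

lemma integrable_bern_bounded:
  fixes f :: "(nat \<Rightarrow> 'a) \<Rightarrow> real"
  assumes "f \<in> borel_measurable (bern P)" "\<And>\<omega>. \<bar>f \<omega>\<bar> \<le> C"
  shows "integrable (bern P) f"
proof -
  interpret B: prob_space "bern P" by (rule prob_space_bern)
  show ?thesis using assms by (intro B.integrable_const_bound[where B=C]) auto
qed

text \<open>The covering argument of Katznelson and Weiss: cut the orbit at the first times at which the average
  falls below \<open>L\<close>; the places where no such time is found within a long window have small probability.\<close>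
lemma subadditive_lower_bound:
  fixes P :: "'a::finite pmf" and g :: "nat \<Rightarrow> (nat \<Rightarrow> 'a) \<Rightarrow> real"
  assumes meas [measurable]: "\<And>n. g n \<in> borel_measurable (bern P)"
    and bnd: "\<And>n \<omega>. \<bar>g n \<omega>\<bar> \<le> C * real n"
    and sub: "\<And>n m \<omega>. g (n + m) \<omega> \<le> g n \<omega> + g m (lshift n \<omega>)"
    and L: "\<And>n. L * real n \<le> (\<integral>\<omega>. g n \<omega> \<partial>bern P)"
    and e: "e > 0"
  shows "AE \<omega> in bern P. \<forall>\<^sub>F n in sequentially. (L - e) * real n \<le> g n \<omega>"
proof -
  interpret B: prob_space "bern P" by (rule prob_space_bern)
  define r where "r = L - e / 2"
  \<comment> \<open>The slack lets \<open>E\<close> (liminf of the averages below \<open>r\<close>)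
    be expressed with strict gaps. Passing from \<open>d j\<close> to \<open>d (Suc j)\<close> gains
    an amount linear in \<open>n\<close>, which absorbs the bounded cost of one extra letter; this
    makes \<open>E\<close> stable under prepending letters.\<close>
  define d where "d = (\<lambda>j::nat. e / 2 / real (Suc j))"
  have d: "d j > 0" "d j \<le> e / 2" for j using e by (auto simp: d_def field_simps)
  have C0: "C \<ge> 0" using bnd[of 1 undefined] by simp
  define E where "E = {\<omega>. \<exists>j. \<forall>k. \<exists>n. n \<ge> k \<and> g n \<omega> < (r - d j) * real n}"
  have "{\<omega> \<in> space (bern P). \<exists>j. \<forall>k. \<exists>n. n \<ge> k \<and> g n \<omega> < (r - d j) * real n} \<in> sets (bern P)"
    by measurable
  then have E_sets: "E \<in> sets (bern P)" by (simp add: E_def)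
  have E_shift: "\<omega> \<in> E" if h: "lshift 1 \<omega> \<in> E" for \<omega>
  proof -
    obtain j where j: "\<forall>k. \<exists>n\<ge>k. g n (lshift 1 \<omega>) < (r - d j) * real n"
      using h unfolding E_def by blast
    let ?j = "Suc j"
    have lt: "d ?j < d j" using e by (auto simp: d_def field_simps)
    obtain K :: nat where K: "real K * (d j - d ?j) > C + \<bar>r - d ?j\<bar>"
      using ex_less_of_nat_mult[of "d j - d ?j"] lt by auto
    have "\<exists>n\<ge>k. g n \<omega> < (r - d ?j) * real n" for k
    proof -
      obtain n where n: "n \<ge> max k K" "g n (lshift 1 \<omega>) < (r - d j) * real n"
        using j by blast
      have "real K * (d j - d ?j) \<le> real n * (d j - d ?j)"
        using n lt by (intro mult_right_mono) auto
      then have n1: "C + \<bar>r - d ?j\<bar> < real n * (d j - d ?j)" using K by linarith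
      have "g (1 + n) \<omega> \<le> g 1 \<omega> + g n (lshift 1 \<omega>)" by (rule sub)
      also have "\<dots> < C + (r - d j) * real n" using bnd[of 1 \<omega>] n(2) by simp
      also have "\<dots> = C + (r - d ?j) * real n - real n * (d j - d ?j)" by (simp add: algebra_simps)
      also have "\<dots> \<le> (r - d ?j) * real n - \<bar>r - d ?j\<bar>" using n1 by linarith
      also have "\<dots> \<le> (r - d ?j) * real (1 + n)" by (simp add: algebra_simps abs_if)
      finally show ?thesis using n(1) by (intro exI[of _ "1 + n"]) auto
    qed
    then show ?thesis unfolding E_def by blast
  qed
  have "measure (bern P) E \<noteq> 1"
  proof
    assume E1: "measure (bern P) E = 1"
    define bad where "bad = (\<lambda>N::nat. {\<omega>. \<forall>n\<in>{1..N}. r * real n \<le> g n \<omega>})"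
    have "{\<omega> \<in> space (bern P). \<forall>n\<in>{1..N}. r * real n \<le> g n \<omega>} \<in> sets (bern P)" for N
      by measurable
    then have bad_sets: "bad N \<in> sets (bern P)" for N by (simp add: bad_def)
    have "(\<lambda>N. measure (bern P) (bad N)) \<longlonglongrightarrow> measure (bern P) (\<Inter>N. bad N)"
      using bad_sets by (intro B.finite_Lim_measure_decseq) (auto simp: decseq_def bad_def)
    moreover have "measure (bern P) (\<Inter>N. bad N) = 0"
    proof -
      have "(\<Inter>N. bad N) \<subseteq> space (bern P) - E"
      proof
        fix \<omega> assume w: "\<omega> \<in> (\<Inter>N. bad N)"
        show "\<omega> \<in> space (bern P) - E"
        proof (rule ccontr)
          assume "\<omega> \<notin> space (bern P) - E"
          then obtain j where j: "\<forall>k. \<exists>n. n \<ge> k \<and> g n \<omega> < (r - d j) * real n"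
            unfolding E_def by auto
          from j[rule_format, of 1] obtain n where n: "n \<ge> 1" "g n \<omega> < (r - d j) * real n" by blast
          have "(r - d j) * real n \<le> r * real n" using d(1)[of j] by (intro mult_right_mono) auto
          moreover have "\<omega> \<in> bad n" using w by blast
          then have "r * real n \<le> g n \<omega>" using n(1) by (auto simp: bad_def)
          ultimately show False using n by linarith
        qed
      qed
      then have "measure (bern P) (\<Inter>N. bad N) \<le> measure (bern P) (space (bern P) - E)"
        using sets.compl_sets[OF E_sets] by (intro B.finite_measure_mono) auto
      also have "\<dots> = 0" using B.prob_compl[OF E_sets] E1 by simp
      finally show ?thesis by (simp add: measure_le_0_iff)
    qed
    ultimately have lim: "(\<lambda>N. measure (bern P) (bad N)) \<longlonglongrightarrow> 0" by simp
    \<comment> \<open>Price of a bad position: one letter costs at most \<open>C\<close> instead of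
      \<open>r\<close>. The same price per letter pays for a final stretch no longer than the
      window.\<close>
    define D where "D = C + \<bar>r\<bar>"
    have D0: "D \<ge> 0" using C0 by (simp add: D_def)
    have "\<forall>\<^sub>F N in sequentially. measure (bern P) (bad N) < e / 4 / (D + 1)"
      using D0 e by (intro order_tendstoD(2)[OF lim]) auto
    then obtain N where N: "measure (bern P) (bad N) < e / 4 / (D + 1)"
      by (auto simp: eventually_sequentially)
    have path: "g n \<omega> \<le> r * real n + D * (\<Sum>k<n. indicator (bad N) (lshift k \<omega>)) + D * real N" for n \<omega>
    proof (induction n arbitrary: \<omega> rule: less_induct)
      case (less n)
      let ?ind = "\<lambda>n \<omega>. (\<Sum>k<n. indicator (bad N) (lshift k \<omega>)) :: real"
      have ind_add: "?ind (a + b) \<omega> = ?ind a \<omega> + ?ind b (lshift a \<omega>)" for a b \<omega>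
        by (induction b) (simp_all add: lshift_lshift algebra_simps)
      show ?case
      proof (cases "n \<le> N")
        case True
        have "g n \<omega> \<le> C * real n" using bnd[of n \<omega>] by simp
        also have "\<dots> \<le> r * real n + D * real n" by (simp add: D_def algebra_simps abs_if mult_right_mono)
        also have "\<dots> \<le> r * real n + D * real N" using True D0 by (simp add: mult_left_mono)
        finally have "g n \<omega> \<le> r * real n + D * real N" .
        moreover have "0 \<le> D * ?ind n \<omega>" using D0 by (intro mult_nonneg_nonneg sum_nonneg) auto
        ultimately show ?thesis by linarith
      next
        case False
        obtain t where t: "1 \<le> t" "t \<le> n" "g t \<omega> \<le> r * real t + D * ?ind t \<omega>"
        proof (cases "\<omega> \<in> bad N")
          case True
          have "g 1 \<omega> \<le> C" using bnd[of 1 \<omega>] by simp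
          then have "g 1 \<omega> \<le> r * real 1 + D * ?ind 1 \<omega>"
            using True by (simp add: D_def abs_if)
          then show ?thesis using False by (intro that[of 1]) auto
        next
          case ne: False
          then obtain t where "t \<in> {1..N}" "g t \<omega> < r * real t" unfolding bad_def by force
          then have "g t \<omega> \<le> r * real t + D * ?ind t \<omega>"
            using D0 by (smt (verit) mult_nonneg_nonneg sum_nonneg indicator_pos_le)
          then show ?thesis using False \<open>t \<in> {1..N}\<close> by (intro that[of t]) auto
        qed
        have n: "n = t + (n - t)" using t by simp
        have "g n \<omega> \<le> g t \<omega> + g (n - t) (lshift t \<omega>)" using sub[of t "n - t" \<omega>] t by simp
        also have "g (n - t) (lshift t \<omega>) \<le> r * real (n - t) + D * ?ind (n - t) (lshift t \<omega>) + D * real N"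
          using t by (intro less) auto
        finally have "g n \<omega> \<le> r * (real t + real (n - t)) + D * (?ind t \<omega> + ?ind (n - t) (lshift t \<omega>)) + D * real N"
          using t(3) by (simp add: algebra_simps)
        also have "real t + real (n - t) = real n" using t by simp
        also have "?ind t \<omega> + ?ind (n - t) (lshift t \<omega>) = ?ind (t + (n - t)) \<omega>"
          by (rule ind_add[symmetric])
        also have "t + (n - t) = n" using t by simp
        finally show ?thesis .
      qed
    qed
    have ind_meas [measurable]: "(\<lambda>\<omega>. indicator (bad N) (lshift k \<omega>) :: real) \<in> borel_measurable (bern P)" for k
      by (rule measurable_compose[OF measurable_lshift borel_measurable_indicator[OF bad_sets]])
    have ind_int: "integrable (bern P) (\<lambda>\<omega>. indicator (bad N) (lshift k \<omega>) :: real)" for k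
      by (rule integrable_bern_bounded[where C=1, OF ind_meas]) (simp add: indicator_def)
    have ind_val: "(\<integral>\<omega>. indicator (bad N) (lshift k \<omega>) \<partial>bern P) = measure (bern P) (bad N)" for k
      using integral_shift[of "indicator (bad N)" P k] bad_sets by simp
    have avg: "L * real n \<le> r * real n + D * (real n * measure (bern P) (bad N)) + D * real N" for n
    proof -
      have "L * real n \<le> (\<integral>\<omega>. g n \<omega> \<partial>bern P)" by (rule L)
      also have "\<dots> \<le> (\<integral>\<omega>. r * real n + D * (\<Sum>k<n. indicator (bad N) (lshift k \<omega>)) + D * real N \<partial>bern P)"
      proof (rule integral_mono)
        show "integrable (bern P) (g n)"
          by (rule integrable_bern_bounded[where C="C * real n"]) (auto simp: bnd)
      qed (use path ind_int in auto)
      also have "\<dots> = r * real n + D * (real n * measure (bern P) (bad N)) + D * real N"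
        using ind_int B.prob_space by (simp add: ind_val)
      finally show ?thesis .
    qed
    \<comment> \<open>Of the margin \<open>e / 2\<close> between \<open>L\<close> and
      \<open>r\<close>, bad positions use \<open>e / 4\<close>; the boundary term
      \<open>D * real N\<close> is pushed below the other quarter by taking \<open>n\<close>
      large.\<close>
    have Dm: "D * measure (bern P) (bad N) \<le> e / 4"
    proof -
      have "D * measure (bern P) (bad N) \<le> (D + 1) * (e / 4 / (D + 1))"
        using N D0 by (intro mult_mono) auto
      also have "\<dots> = e / 4" using D0 by (simp add: field_simps)
      finally show ?thesis .
    qed
    obtain n :: nat where n: "real n * (e / 4) > D * real N"
      using ex_less_of_nat_mult[of "e / 4"] e by auto
    have "L * real n \<le> (L - e / 2) * real n + real n * (D * measure (bern P) (bad N)) + D * real N"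
      using avg[of n] by (simp add: r_def mult_ac)
    also have "\<dots> \<le> (L - e / 2) * real n + real n * (e / 4) + D * real N"
      using mult_left_mono[OF Dm, of "real n"] by linarith
    also have "\<dots> < (L - e / 2) * real n + real n * (e / 4) + real n * (e / 4)" using n by linarith
    also have "\<dots> = L * real n" by (simp add: algebra_simps)
    finally show False by simp
  qed
  then have "measure (bern P) E = 0"
    using zero_one_shift[OF E_sets] E_shift by blast
  then have "AE \<omega> in bern P. \<omega> \<notin> E"
    using E_sets by (intro AE_not_in null_setsI) (auto simp: B.emeasure_eq_measure)
  then show ?thesis
  proof eventually_elim
    case (elim \<omega>)
    then obtain k where k: "\<And>n. n \<ge> k \<Longrightarrow> (r - d 0) * real n \<le> g n \<omega>"
      unfolding E_def by (force simp: not_less)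
    have "r - d 0 = L - e" by (simp add: r_def d_def)
    then show ?case using k by (auto simp: eventually_sequentially)
  qed
qed

text \<open>Both halves come from \<open>subadditive_lower_bound\<close>. For the lower half it is
  applied to \<open>f\<close>. For the upper half it is applied to the negated sums of
  \<open>f\<close> over all windows of a fixed length \<open>m\<close>: these are additive, hence
  subadditive with either sign, and \<open>f\<close> is dominated by 1/m times the window sum up to
  a constant.\<close>

theorem kingman_prefix:
  fixes P :: "'a::finite pmf" and f :: "'a list \<Rightarrow> real"
  assumes bnd: "\<And>w. \<bar>f w\<bar> \<le> C * real (length w)"
    and sub: "\<And>u w. f (u @ w) \<le> f u + f w"
  shows "\<exists>l. AE \<omega> in bern P. (\<lambda>n. f (pre n \<omega>) / real n) \<longlonglongrightarrow> l"
proof -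
  interpret B: prob_space "bern P" by (rule prob_space_bern)
  define a where "a = (\<lambda>n. \<integral>\<omega>. f (pre n \<omega>) \<partial>bern P)"
  have C0: "C \<ge> 0" using bnd[of "[undefined]"] by simp
  have int: "integrable (bern P) (\<lambda>\<omega>. f (pre n (lshift k \<omega>)))" for n k
    by (rule integrable_bern_bounded[where C="C * real n"]) (use bnd[of "pre n _"] in auto)
  have abnd: "\<bar>a n\<bar> \<le> C * real n" for n
  proof -
    have "\<bar>a n\<bar> \<le> (\<integral>\<omega>. \<bar>f (pre n \<omega>)\<bar> \<partial>bern P)" unfolding a_def by (rule integral_abs_bound)
    also have "\<dots> \<le> (\<integral>\<omega>. C * real n \<partial>bern P)"
      using int[of n 0] bnd[of "pre n _"] by (intro integral_mono) auto
    finally show ?thesis using B.prob_space by simp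
  qed
  define L where "L = (INF n\<in>{1..}. a n / real n)"
  have bdd: "bdd_below ((\<lambda>n. a n / real n) ` {1..})"
  proof (rule bdd_belowI2[where m="-C"])
    fix n :: nat assume "n \<in> {1..}"
    then show "- C \<le> a n / real n" using abnd[of n] by (auto simp: field_simps abs_le_iff)
  qed
  have L: "L * real n \<le> a n" for n
  proof (cases "n = 0")
    case True then show ?thesis using abnd[of 0] by simp
  next
    case False
    then have "L \<le> a n / real n" unfolding L_def by (intro cINF_lower[OF bdd]) auto
    then show ?thesis using False by (simp add: field_simps)
  qed
  have lower: "AE \<omega> in bern P. \<forall>\<^sub>F n in sequentially. (L - e) * real n \<le> f (pre n \<omega>)" if "e > 0" for e
    by (rule subadditive_lower_bound[where C=C])
       (use bnd[of "pre _ _"] sub L that in \<open>auto simp: pre_add a_def\<close>)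
  have upper: "AE \<omega> in bern P. \<forall>\<^sub>F n in sequentially. f (pre n \<omega>) \<le> (L + e) * real n" if e: "e > 0" for e
  proof -
    have "\<exists>m\<in>{1..}. a m / real m < L + e / 3"
      using e cINF_less_iff[OF _ bdd, of "L + e / 3"] by (auto simp: L_def)
    then obtain m where m: "m \<ge> 1" "a m / real m < L + e / 3" by auto
    let ?S = "\<lambda>n \<omega>. \<Sum>k<n. f (pre m (lshift k \<omega>))"
    have S_add: "?S (s + t) \<omega> = ?S s \<omega> + ?S t (lshift s \<omega>)" for s t \<omega>
      by (induction t) (simp_all add: lshift_lshift algebra_simps)
    have bm: "\<bar>f (pre m \<omega>)\<bar> \<le> C * real m" for \<omega> using bnd[of "pre m \<omega>"] by simp
    have Sb: "\<bar>?S n \<omega>\<bar> \<le> C * real m * real n" for n \<omega>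
    proof -
      have "\<bar>?S n \<omega>\<bar> \<le> (\<Sum>k<n. C * real m)" by (rule sum_abs[THEN order_trans]) (intro sum_mono bm)
      then show ?thesis by (simp add: mult_ac)
    qed
    have "AE \<omega> in bern P. \<forall>\<^sub>F n in sequentially. (- a m - e / 3) * real n \<le> - ?S n \<omega>"
    proof (rule subadditive_lower_bound[where C="C * real m"])
      fix n
      have "(\<integral>\<omega>. ?S n \<omega> \<partial>bern P) = (\<Sum>k<n. \<integral>\<omega>. f (pre m (lshift k \<omega>)) \<partial>bern P)"
        by (rule Bochner_Integration.integral_sum) (rule int)
      also have "\<dots> = real n * a m"
        using integral_shift[of "\<lambda>\<omega>. f (pre m \<omega>)" P] by (simp add: a_def)
      finally show "- a m * real n \<le> (\<integral>\<omega>. - ?S n \<omega> \<partial>bern P)" by simp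
    qed (use e Sb S_add in auto)
    then show ?thesis
    proof eventually_elim
      case (elim \<omega>)
      \<comment> \<open>For each offset \<open>r < m\<close> the prefix is cut at \<open>r\<close>,
        \<open>r + m\<close>, and so on; adding the \<open>m\<close> estimates uses every window at
        most once. Taking one block less than fits leaves room for all offsets. Incomplete ends cost
        3 m C per offset and the windows missing at the end another 2 m m C, which gives the
        5.\<close>
      have key: "real m * f (pre n \<omega>) \<le> ?S n \<omega> + 5 * real m * real m * C" if n: "n \<ge> 2 * m" for n
      proof -
        define q where "q = n div m - 1"
        have nm: "n div m \<ge> 1" using n m by (metis One_nat_def Suc_leI div_greater_zero_iff dual_order.trans less_eq_Suc_le mult_2 le_add1)
        have dm: "n = m * (n div m) + n mod m" "n mod m < m" using m by auto
        have qm: "m * q = m * (n div m) - m" by (simp add: q_def diff_mult_distrib2)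
        have mm: "m \<le> m * (n div m)" using nm by simp
        have qn: "m * q + m \<le> n" "n < m * q + 2 * m" using dm mm qm by linarith+
        have blk: "f (pre (m * j) \<omega>') \<le> (\<Sum>l<j. f (pre m (lshift (m * l) \<omega>')))" for j \<omega>'
        proof (induction j)
          case 0
          show ?case using bnd[of "[]"] by simp
        next
          case (Suc j)
          have "f (pre (m * Suc j) \<omega>') = f (pre (m * j + m) \<omega>')" by (simp add: add.commute)
          also have "\<dots> \<le> f (pre (m * j) \<omega>') + f (pre m (lshift (m * j) \<omega>'))"
            by (simp add: pre_add sub)
          finally show ?case using Suc by simp
        qed
        have one: "f (pre n \<omega>) \<le> 3 * real m * C + (\<Sum>l<q. f (pre m (lshift (r + m * l) \<omega>)))" if r: "r < m" for r
        proof -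
          define z where "z = n - r - m * q"
          have z: "n = r + (m * q + z)" "z \<le> 2 * m" using qn r by (auto simp: z_def)
          have "f (pre n \<omega>) \<le> f (pre r \<omega>) + (f (pre (m * q) (lshift r \<omega>)) + f (pre z (lshift (m * q) (lshift r \<omega>))))"
            unfolding z(1) pre_add using sub by (meson add_left_mono order_trans)
          also have "f (pre r \<omega>) \<le> C * real m"
            using bnd[of "pre r \<omega>"] r C0 by (smt (verit) length_pre mult_left_mono of_nat_less_iff)
          also have "f (pre z (lshift (m * q) (lshift r \<omega>))) \<le> C * real (2 * m)"
            using bnd[of "pre z (lshift (m * q) (lshift r \<omega>))"] z(2) C0
            by (smt (verit) length_pre mult_left_mono of_nat_le_iff)
          also have "f (pre (m * q) (lshift r \<omega>)) \<le> (\<Sum>l<q. f (pre m (lshift (r + m * l) \<omega>)))"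
            using blk[of q "lshift r \<omega>"] by (simp add: lshift_lshift)
          finally show ?thesis by (simp add: algebra_simps)
        qed
        have "real m * f (pre n \<omega>) = (\<Sum>r<m. f (pre n \<omega>))" by simp
        also have "\<dots> \<le> (\<Sum>r<m. 3 * real m * C + (\<Sum>l<q. f (pre m (lshift (r + m * l) \<omega>))))"
          by (rule sum_mono) (use one in auto)
        also have "\<dots> = 3 * real m * real m * C + (\<Sum>l<q. \<Sum>r<m. f (pre m (lshift (r + m * l) \<omega>)))"
          by (simp add: sum.distrib) (rule sum.swap)
        also have "(\<Sum>l<q. \<Sum>r<m. f (pre m (lshift (r + m * l) \<omega>))) = ?S (q * m) \<omega>"
        proof -
          have "(\<Sum>r<m. f (pre m (lshift (r + m * l) \<omega>))) = sum (\<lambda>k. f (pre m (lshift k \<omega>))) {l * m..<l * m + m}" for l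
            by (rule sum.reindex_bij_witness[of _ "\<lambda>k. k - l * m" "\<lambda>r. r + m * l"]) (auto simp: mult.commute)
          then show ?thesis using sum.nat_group[of "\<lambda>k. f (pre m (lshift k \<omega>))" m q] by simp
        qed
        also have "?S (q * m) \<omega> \<le> ?S n \<omega> + 2 * real m * real m * C"
        proof -
          have n: "n = q * m + (n - q * m)" using qn by (simp add: mult.commute)
          have "?S (q * m + (n - q * m)) \<omega> = ?S (q * m) \<omega> + ?S (n - q * m) (lshift (q * m) \<omega>)"
            by (rule S_add)
          then have "?S n \<omega> = ?S (q * m) \<omega> + ?S (n - q * m) (lshift (q * m) \<omega>)"
            using n by simp
          moreover have "\<bar>?S (n - q * m) (lshift (q * m) \<omega>)\<bar> \<le> C * real m * real (n - q * m)" by (rule Sb)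
          moreover have "C * real m * real (n - q * m) \<le> C * real m * real (2 * m)"
          proof (rule mult_left_mono)
            show "real (n - q * m) \<le> real (2 * m)"
              unfolding of_nat_le_iff using qn by (simp add: mult.commute)
          qed (use C0 in simp)
          ultimately show ?thesis by (simp add: algebra_simps abs_le_iff)
        qed
        finally show ?thesis by (simp add: algebra_simps)
      qed
      obtain k where k: "\<And>n. n \<ge> k \<Longrightarrow> (- a m - e / 3) * real n \<le> - ?S n \<omega>"
        using elim by (auto simp: eventually_sequentially)
      obtain k' :: nat where k': "real k' * (e / 3) > 5 * real m * C"
        using ex_less_of_nat_mult[of "e / 3" "5 * real m * C"] e by (auto simp del: times_divide_eq_right)
      have "f (pre n \<omega>) \<le> (L + e) * real n" if n: "n \<ge> max k (max k' (2 * m))" for n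
      proof -
        have "real m * f (pre n \<omega>) \<le> (a m + e / 3) * real n + 5 * real m * real m * C"
          using key[of n] k[of n] n by (simp add: algebra_simps)
        then have 1: "real m * f (pre n \<omega>) \<le> a m * real n + e / 3 * real n + 5 * real m * real m * C"
          by (simp add: algebra_simps)
        have "a m \<le> real m * (L + e / 3)" using m by (simp add: field_simps)
        then have 2: "a m * real n \<le> real m * (L + e / 3) * real n" by (intro mult_right_mono) auto
        have 3: "e / 3 * real n \<le> real m * (e / 3 * real n)"
          using mult_right_mono[of 1 "real m" "e / 3 * real n"] m e by simp
        have "5 * real m * C \<le> real n * (e / 3)"
        proof -
          have "real k' * (e / 3) \<le> real n * (e / 3)" using n e by (intro mult_right_mono) auto
          then show ?thesis using k' by linarith
        qed
        then have 4: "real m * (5 * real m * C) \<le> real m * (real n * (e / 3))" by (intro mult_left_mono) auto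
        have "real m * (L + e / 3) * real n + real m * (e / 3 * real n) + real m * (real n * (e / 3))
            = real m * ((L + e) * real n)" by (simp add: algebra_simps)
        then have "real m * f (pre n \<omega>) \<le> real m * ((L + e) * real n)"
          using 1 2 3 4 by (simp add: mult_ac)
        then show ?thesis using m by simp
      qed
      then show ?case unfolding eventually_sequentially
        by (intro exI[of _ "max k (max k' (2 * m))"]) blast
    qed
  qed
  have "AE \<omega> in bern P. \<forall>j. (\<forall>\<^sub>F n in sequentially. (L - 1 / real (Suc j)) * real n \<le> f (pre n \<omega>))
      \<and> (\<forall>\<^sub>F n in sequentially. f (pre n \<omega>) \<le> (L + 1 / real (Suc j)) * real n)"
    unfolding AE_all_countable
  proof
    fix j
    show "AE \<omega> in bern P. (\<forall>\<^sub>F n in sequentially. (L - 1 / real (Suc j)) * real n \<le> f (pre n \<omega>))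
      \<and> (\<forall>\<^sub>F n in sequentially. f (pre n \<omega>) \<le> (L + 1 / real (Suc j)) * real n)"
      using lower[of "1 / real (Suc j)"] upper[of "1 / real (Suc j)"] by auto
  qed
  then have "AE \<omega> in bern P. (\<lambda>n. f (pre n \<omega>) / real n) \<longlonglongrightarrow> L"
  proof eventually_elim
    case (elim \<omega>)
    show ?case
    proof (rule tendstoI)
      fix e :: real assume "e > 0"
      then obtain j where j: "1 / real (Suc j) < e" using nat_approx_posE by blast
      have ev: "\<forall>\<^sub>F n in sequentially. (L - 1 / real (Suc j)) * real n \<le> f (pre n \<omega>)"
        "\<forall>\<^sub>F n in sequentially. f (pre n \<omega>) \<le> (L + 1 / real (Suc j)) * real n"
        using elim by auto
      show "\<forall>\<^sub>F n in sequentially. dist (f (pre n \<omega>) / real n) L < e"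
        using ev eventually_gt_at_top[of 0]
      proof eventually_elim
        case (elim n)
        have "L - 1 / real (Suc j) \<le> f (pre n \<omega>) / real n" "f (pre n \<omega>) / real n \<le> L + 1 / real (Suc j)"
          using elim by (simp_all add: pos_le_divide_eq pos_divide_le_eq)
        then have "\<bar>f (pre n \<omega>) / real n - L\<bar> \<le> 1 / real (Suc j)" unfolding abs_le_iff by linarith
        then show ?case using j by (simp add: dist_real_def)
      qed
    qed
  qed
  then show ?thesis by blast
qed

section \<open>Contracting cocycles\<close>

text \<open>A sequence type makes one normed space serve all dimensions: the vectors of dimension N are those with
  \<open>suppN N\<close>, and the operators satisfy \<open>opN N\<close>.\<close>
type_synonym rvec = "nat \<Rightarrow>\<^sub>C real"

definition ev :: "nat \<Rightarrow> rvec" where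
  "ev j = Bcontfun (\<lambda>x. if x = j then 1 else 0)"

lemma ev_apply [simp]: "ev j x = (if x = j then 1 else 0)"
proof -
  have "range (\<lambda>x. if x = j then 1 else 0 :: real) \<subseteq> {0, 1}" by auto
  then have "bounded (range (\<lambda>x. if x = j then 1 else 0 :: real))"
    by (rule bounded_subset[rotated]) simp
  then have "(\<lambda>x. if x = j then 1 else 0 :: real) \<in> bcontfun"
    by (auto simp: bcontfun_def)
  then show ?thesis by (simp add: ev_def Bcontfun_inverse)
qed

lemma sum_bcontfun_apply [simp]:
  "apply_bcontfun (sum f I) x = (\<Sum>i\<in>I. apply_bcontfun (f i :: rvec) x)"
  by (induction I rule: infinite_finite_induct) simp_all

definition suppN :: "nat \<Rightarrow> rvec \<Rightarrow> bool" where
  "suppN N v \<longleftrightarrow> (\<forall>p\<ge>N. v p = 0)"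

lemma abs_apply_le_norm: "\<bar>apply_bcontfun (v :: rvec) p\<bar> \<le> norm v"
  using norm_bounded[of v p] by simp

lemma suppN_decomp: "suppN N v \<Longrightarrow> v = (\<Sum>q<N. v q *\<^sub>R ev q)"
  by (rule bcontfun_eqI) (auto simp: suppN_def if_distrib cong: if_cong)

text \<open>The norm is the supremum norm, so finitely many coordinates suffice to attain it.
  \<open>norm_swap_le\<close> builds its test vector from such a coordinate.\<close>

lemma suppN_norm_attained:
  assumes "suppN N v" "v \<noteq> 0"
  obtains p where "p < N" "\<bar>v p\<bar> = norm v"
proof -
  have "N \<noteq> 0"
  proof
    assume "N = 0"
    then have "v = 0" using assms(1) by (intro bcontfun_eqI) (auto simp: suppN_def)
    then show False using assms by simp
  qed
  have "Max ((\<lambda>p. \<bar>v p\<bar>) ` {..<N}) \<in> (\<lambda>p. \<bar>v p\<bar>) ` {..<N}"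
    using \<open>N \<noteq> 0\<close> by (intro Max_in) auto
  then obtain p where p0: "p < N" "Max ((\<lambda>p. \<bar>v p\<bar>) ` {..<N}) = \<bar>v p\<bar>" by auto
  have p: "p \<in> {..<N}" "\<And>q. q < N \<Longrightarrow> \<bar>v q\<bar> \<le> \<bar>v p\<bar>"
    using p0 by (auto simp: p0(2)[symmetric] intro!: Max_ge)
  have "norm v \<le> \<bar>v p\<bar>"
  proof (rule norm_bound)
    fix x show "norm (v x) \<le> \<bar>v p\<bar>"
      using p(2)[of x] assms(1) by (cases "x < N") (auto simp: suppN_def)
  qed
  then have "\<bar>v p\<bar> = norm v" using abs_apply_le_norm[of v p] by simp
  then show ?thesis using p(1) by (intro that) auto
qed

lemma norm_ev [simp]: "norm (ev q) = 1"
proof (rule antisym)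
  show "norm (ev q) \<le> 1" by (rule norm_bound) auto
  show "1 \<le> norm (ev q)" using abs_apply_le_norm[of "ev q" q] by simp
qed

text \<open>A bounded sequence need not be a finite combination of the \<open>ev q\<close>, so the
  expansion has to be demanded: it says that coordinates from \<open>N\<close> on are ignored and
  that \<open>T\<close> is determined by its first \<open>N\<close> columns.\<close>

definition opN :: "nat \<Rightarrow> (rvec \<Rightarrow> rvec) \<Rightarrow> bool" where
  "opN N T \<longleftrightarrow> linear T \<and> (\<forall>v. T v = (\<Sum>q<N. v q *\<^sub>R T (ev q))) \<and> (\<forall>v. suppN N (T v))"

lemma opN_linear: "opN N T \<Longrightarrow> linear T"
  and opN_expand: "opN N T \<Longrightarrow> T v = (\<Sum>q<N. v q *\<^sub>R T (ev q))"
  and opN_supp: "opN N T \<Longrightarrow> suppN N (T v)"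
  unfolding opN_def by blast+

text \<open>Stands for the operator norm, to which it is equivalent in fixed dimension. It is
  submultiplicative, and estimates made column by column can simply be added.\<close>

definition nm :: "nat \<Rightarrow> (rvec \<Rightarrow> rvec) \<Rightarrow> real" where
  "nm N T = (\<Sum>q<N. norm (T (ev q)))"

lemma nm_nonneg: "0 \<le> nm N T"
  by (simp add: nm_def sum_nonneg)

lemma opN_norm_le: "opN N T \<Longrightarrow> norm (T v) \<le> nm N T * norm v"
proof -
  assume T: "opN N T"
  have "norm (T v) = norm (\<Sum>q<N. v q *\<^sub>R T (ev q))" using opN_expand[OF T, of v] by simp
  also have "\<dots> \<le> (\<Sum>q<N. norm (T (ev q)) * norm v)"
    by (rule norm_sum[THEN order_trans]) (auto intro!: sum_mono mult_right_mono abs_apply_le_norm simp: mult.commute)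
  finally show ?thesis by (simp add: nm_def sum_distrib_right)
qed

text \<open>\<open>wd\<close> is the l1-norm of the wedge of two vectors, \<open>m2\<close> that of the second exterior power of an operator,
  and \<open>dl\<close> the resulting distance of two directions.\<close>
definition wd :: "nat \<Rightarrow> rvec \<Rightarrow> rvec \<Rightarrow> real" where
  "wd N v w = (\<Sum>p<N. \<Sum>q<N. \<bar>v p * w q - v q * w p\<bar>)"

lemma wd_nonneg: "0 \<le> wd N v w"
  by (simp add: wd_def sum_nonneg)

lemma wd_term: fixes v w :: rvec shows "p < N \<Longrightarrow> q < N \<Longrightarrow> \<bar>v p * w q - v q * w p\<bar> \<le> wd N v w"
proof -
  assume "p < N" "q < N"
  then have "\<bar>v p * w q - v q * w p\<bar> \<le> (\<Sum>q<N. \<bar>v p * w q - v q * w p\<bar>)"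
    by (intro member_le_sum) auto
  also have "\<dots> \<le> wd N v w"
    unfolding wd_def using \<open>p < N\<close>
    by (intro member_le_sum[of p _ "\<lambda>p. \<Sum>q<N. \<bar>v p * w q - v q * w p\<bar>"]) (auto intro: sum_nonneg)
  finally show ?thesis .
qed

lemma wd_le: fixes v w :: rvec shows "wd N v w \<le> 2 * (real N)\<^sup>2 * (norm v * norm w)"
proof -
  have "\<bar>v p * w q - v q * w p\<bar> \<le> 2 * (norm v * norm w)" for p q
  proof -
    have "\<bar>v p * w q\<bar> \<le> norm v * norm w" "\<bar>v q * w p\<bar> \<le> norm v * norm w"
      unfolding abs_mult by (intro mult_mono abs_apply_le_norm; simp)+
    then show ?thesis by linarith
  qed
  then have "wd N v w \<le> (\<Sum>p<N. \<Sum>q<N. 2 * (norm v * norm w))"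
    unfolding wd_def by (intro sum_mono)
  then show ?thesis by (simp add: power2_eq_square mult_ac)
qed

definition m2 :: "nat \<Rightarrow> (rvec \<Rightarrow> rvec) \<Rightarrow> real" where
  "m2 N T = (\<Sum>q<N. \<Sum>s<N. wd N (T (ev q)) (T (ev s)))"

lemma m2_nonneg: "0 \<le> m2 N T"
  by (simp add: m2_def sum_nonneg wd_nonneg)

text \<open>Cauchy-Binet for two columns. Expanding a minor of \<open>T v\<close>,
  \<open>T w\<close> gives the products \<open>v q * w s\<close>; adding the same expansion with
  \<open>q\<close> and \<open>s\<close> exchanged turns them into minors of \<open>v\<close>,
  \<open>w\<close>, with a factor 2 on the left.\<close>

lemma wd_image_le:
  assumes T: "opN N T"
  shows "wd N (T v) (T w) \<le> m2 N T * wd N v w"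
proof -
  let ?b = "\<lambda>p r q s. T (ev q) p * T (ev s) r - T (ev q) r * T (ev s) p"
  have a2: "\<And>x::real. 2 * \<bar>x\<bar> = \<bar>x + x\<bar>" by simp
  have a3: "\<And>x y::real. 2 * \<bar>x\<bar> \<le> y \<Longrightarrow> \<bar>x\<bar> \<le> y" by linarith
  have X: "\<bar>T v p * T w r - T v r * T w p\<bar> \<le> (\<Sum>q<N. \<Sum>s<N. wd N v w * \<bar>?b p r q s\<bar>)" (is "\<bar>?X\<bar> \<le> _") for p r
  proof -
    have e: "T v p = (\<Sum>q<N. v q * T (ev q) p)" for v p
      using arg_cong[OF opN_expand[OF T, of v], of "\<lambda>f. apply_bcontfun f p"] by simp
    have 1: "?X = (\<Sum>q<N. \<Sum>s<N. v q * w s * ?b p r q s)"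
      unfolding e[of v] e[of w] sum_product sum_subtractf[symmetric]
      by (intro sum.cong refl) (simp add: algebra_simps)
    have 2: "?X = (\<Sum>q<N. \<Sum>s<N. - (v s * w q * ?b p r q s))"
      unfolding 1 by (subst sum.swap, intro sum.cong refl) (simp add: algebra_simps)
    have "?X + ?X = (\<Sum>q<N. \<Sum>s<N. v q * w s * ?b p r q s) + (\<Sum>q<N. \<Sum>s<N. - (v s * w q * ?b p r q s))"
      by (rule arg_cong2[where f="(+)", OF 1 2])
    also have "\<dots> = (\<Sum>q<N. \<Sum>s<N. v q * w s * ?b p r q s + - (v s * w q * ?b p r q s))"
      by (simp only: sum.distrib)
    also have "\<dots> = (\<Sum>q<N. \<Sum>s<N. (v q * w s - v s * w q) * ?b p r q s)"
      by (simp only: left_diff_distrib add_uminus_conv_diff)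
    finally have E2: "?X + ?X = (\<Sum>q<N. \<Sum>s<N. (v q * w s - v s * w q) * ?b p r q s)" .
    then have "2 * \<bar>?X\<bar> = \<bar>\<Sum>q<N. \<Sum>s<N. (v q * w s - v s * w q) * ?b p r q s\<bar>"
      by (simp only: a2 E2)
    also have "\<dots> \<le> (\<Sum>q<N. \<Sum>s<N. \<bar>(v q * w s - v s * w q) * ?b p r q s\<bar>)"
      by (rule sum_abs[THEN order_trans]) (intro sum_mono sum_abs)
    also have "\<dots> \<le> (\<Sum>q<N. \<Sum>s<N. wd N v w * \<bar>?b p r q s\<bar>)"
      unfolding abs_mult by (intro sum_mono mult_right_mono wd_term) auto
    finally show ?thesis by (rule a3)
  qed
  have "wd N (T v) (T w) \<le> (\<Sum>p<N. \<Sum>r<N. \<Sum>q<N. \<Sum>s<N. wd N v w * \<bar>?b p r q s\<bar>)"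
    unfolding wd_def[of N "T v"] by (intro sum_mono X)
  also have "\<dots> = (\<Sum>p<N. \<Sum>q<N. \<Sum>r<N. \<Sum>s<N. wd N v w * \<bar>?b p r q s\<bar>)"
    by (rule sum.cong[OF refl], rule sum.swap)
  also have "\<dots> = (\<Sum>q<N. \<Sum>p<N. \<Sum>r<N. \<Sum>s<N. wd N v w * \<bar>?b p r q s\<bar>)"
    by (rule sum.swap)
  also have "\<dots> = (\<Sum>q<N. \<Sum>p<N. \<Sum>s<N. \<Sum>r<N. wd N v w * \<bar>?b p r q s\<bar>)"
    by (rule sum.cong[OF refl], rule sum.cong[OF refl], rule sum.swap)
  also have "\<dots> = (\<Sum>q<N. \<Sum>s<N. \<Sum>p<N. \<Sum>r<N. wd N v w * \<bar>?b p r q s\<bar>)"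
    by (rule sum.cong[OF refl], rule sum.swap)
  also have "\<dots> = m2 N T * wd N v w"
    by (simp add: m2_def wd_def[of N "T _"] sum_distrib_left[symmetric] mult.commute)
  finally show ?thesis .
qed

text \<open>If \<open>y\<close> attains its norm at \<open>p\<close>, the vector
  \<open>y p *\<^sub>R x - x p *\<^sub>R y\<close> has minors of \<open>x\<close>, \<open>y\<close>
  as coordinates, so its norm is at most \<open>wd N x y\<close>. Applying \<open>T\<close> to it
  compares \<open>norm (T x)\<close> with \<open>norm (T y)\<close>, and the vector itself replaces
  \<open>\<bar>x p\<bar>\<close> by \<open>norm x\<close>.\<close>

lemma norm_swap_le:
  assumes T: "linear T" and K: "\<And>v. suppN N v \<Longrightarrow> norm (T v) \<le> K * norm v" "K \<ge> 0"
    and x: "suppN N x" and y: "suppN N y"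
  shows "\<bar>norm (T x) * norm y - norm x * norm (T y)\<bar> \<le> 2 * K * wd N x y"
proof (cases "y = 0")
  case True
  then show ?thesis using linear_0[OF T] K(2) by (simp add: wd_nonneg)
next
  case False
  then obtain p where p: "p < N" "\<bar>y p\<bar> = norm y" using suppN_norm_attained[OF y] by blast
  let ?z = "y p *\<^sub>R x - x p *\<^sub>R y"
  have zs: "suppN N ?z" using x y by (auto simp: suppN_def)
  have z: "norm ?z \<le> wd N x y"
  proof (rule norm_bound)
    fix j show "norm (?z j) \<le> wd N x y"
    proof (cases "j < N")
      case True
      then show ?thesis using wd_term[OF p(1) True, of x y] by (simp add: mult_ac abs_minus_commute)
    next
      case False
      then show ?thesis using zs wd_nonneg by (simp add: suppN_def)
    qed
  qed
  have Tz: "norm (T ?z) \<le> K * wd N x y"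
    using K(1)[OF zs] z K(2) by (meson mult_left_mono order_trans)
  have "T ?z = y p *\<^sub>R T x - x p *\<^sub>R T y"
    by (simp add: linear_diff[OF T] linear_scale[OF T])
  then have 1: "\<bar>norm (T x) * norm y - \<bar>x p\<bar> * norm (T y)\<bar> \<le> K * wd N x y"
    using Tz norm_triangle_ineq3[of "y p *\<^sub>R T x" "x p *\<^sub>R T y"] p(2) by (simp add: mult.commute)
  have "\<bar>norm x * norm y - \<bar>x p\<bar> * norm y\<bar> \<le> wd N x y"
    using z norm_triangle_ineq3[of "y p *\<^sub>R x" "x p *\<^sub>R y"] p(2) by (simp add: mult.commute)
  then have "norm (T y) * \<bar>norm x * norm y - \<bar>x p\<bar> * norm y\<bar> \<le> K * norm y * wd N x y"
    using K(1)[OF y] K(2) by (intro mult_mono) auto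
  moreover have "norm (T y) * \<bar>norm x * norm y - \<bar>x p\<bar> * norm y\<bar> = norm y * \<bar>norm x * norm (T y) - \<bar>x p\<bar> * norm (T y)\<bar>"
    unfolding left_diff_distrib[symmetric] abs_mult by simp
  ultimately have "norm y * \<bar>norm x * norm (T y) - \<bar>x p\<bar> * norm (T y)\<bar> \<le> norm y * (K * wd N x y)"
    by (simp add: mult_ac)
  then have "\<bar>norm x * norm (T y) - \<bar>x p\<bar> * norm (T y)\<bar> \<le> K * wd N x y"
    using False by simp
  then show ?thesis using 1 by linarith
qed

definition dl :: "nat \<Rightarrow> rvec \<Rightarrow> rvec \<Rightarrow> real" where
  "dl N v w = wd N v w / (norm v * norm w)"

lemma dl_nonneg: "0 \<le> dl N v w"
  by (simp add: dl_def wd_nonneg)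

lemma dl_le: "dl N v w \<le> 2 * (real N)\<^sup>2"
proof (cases "v = 0 \<or> w = 0")
  case True then show ?thesis by (auto simp: dl_def)
next
  case False
  then show ?thesis using wd_le[of N v w] by (simp add: dl_def divide_le_eq)
qed

section \<open>Scalar inequalities for exponentials, powers and logarithms\<close>

lemma exp_le_quadratic:
  fixes x :: real assumes "\<bar>x\<bar> \<le> 1" shows "exp x \<le> 1 + x + x\<^sup>2"
proof (cases "x \<ge> 0")
  case True then show ?thesis using exp_bound[of x] assms by simp
next
  case False
  define y where "y = - x"
  have y: "0 < y" "y \<le> 1" using False assms by (auto simp: y_def)
  have "exp x = 1 / exp y" by (simp add: y_def exp_minus field_simps)
  also have "\<dots> \<le> 1 / (1 + y)" using y exp_ge_add_one_self[of y] by (intro divide_left_mono) auto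
  also have "\<dots> \<le> 1 - y + y\<^sup>2"
  proof -
    have "(1 - y + y\<^sup>2) * (1 + y) = 1 + y ^ 3" by (simp add: algebra_simps power2_eq_square power3_eq_cube)
    moreover have "1 + y ^ 3 \<ge> 1" using y by simp
    ultimately show ?thesis using y by (simp add: pos_divide_le_eq)
  qed
  finally show ?thesis by (simp add: y_def)
qed

lemma powr_le_of_nonneg:
  fixes t x :: real assumes "0 \<le> t" "t \<le> 1" "1 \<le> x" shows "x powr t \<le> x"
  using powr_mono[OF assms(2,3)] assms(3) by simp

lemma abs_ln_diff_le:
  fixes x y m :: real assumes "0 < m" "m \<le> x" "m \<le> y"
  shows "\<bar>ln x - ln y\<bar> \<le> \<bar>x - y\<bar> / m"
proof -
  have *: "ln x - ln y \<le> \<bar>x - y\<bar> / m" if "m \<le> x" "m \<le> y" for x y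
  proof -
    have xy: "0 < x" "0 < y" using that assms by auto
    have "ln x - ln y = ln (x / y)" using xy by (simp add: ln_div)
    also have "\<dots> \<le> x / y - 1" using xy by (intro ln_le_minus_one) simp
    also have "\<dots> = (x - y) / y" using xy by (simp add: field_simps)
    also have "\<dots> \<le> \<bar>x - y\<bar> / y" using xy by (intro divide_right_mono) auto
    also have "\<dots> \<le> \<bar>x - y\<bar> / m" using that assms by (intro divide_left_mono) auto
    finally show ?thesis .
  qed
  show ?thesis using *[OF assms(2,3)] *[OF assms(3,2)] by (simp add: abs_le_iff abs_minus_commute)
qed

section \<open>Cocycles bounded below on their ranges\<close>

locale linear_cocycle =
  fixes P :: "'a::finite pmf" and N :: nat and D :: "'a \<Rightarrow> rvec \<Rightarrow> rvec"
    and kap K :: real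
  assumes op: "opN N (D a)"
    and kap: "0 < kap" "kap \<le> 1" and K: "1 \<le> K"
    and lower: "kap * norm (D a x) \<le> norm (D c (D a x))"
    and upper: "norm (D a v) \<le> K * norm v"
begin

text \<open>States of the chain. The assumption \<open>lower\<close> is the quantitative form of the
  rank condition on products: a state stays nonzero under every letter and shrinks at most by the
  factor \<open>kap\<close>, so its logarithmic growth per letter is bounded.\<close>

definition st :: "'a \<Rightarrow> rvec \<Rightarrow> bool" where
  "st a v \<longleftrightarrow> v \<noteq> 0 \<and> v \<in> range (D a)"

lemma st_supp: "st a v \<Longrightarrow> suppN N v"
  using opN_supp[OF op] by (auto simp: st_def)

lemma st_lower: "st a v \<Longrightarrow> kap * norm v \<le> norm (D c v)"
  using lower by (auto simp: st_def)

lemma st_step: "st a v \<Longrightarrow> st c (D c v)"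
proof -
  assume v: "st a v"
  have "0 < kap * norm v" using v kap by (simp add: st_def)
  then have "norm (D c v) > 0" using st_lower[OF v, of c] by linarith
  then show ?thesis by (auto simp: st_def)
qed

text \<open>One and the same letter \<open>b\<close> serves all states over \<open>a\<close>: two
  vectors starting in one range stay in a common range, where the contraction hypothesis can be
  applied again.\<close>

lemma fold_st: "st a v \<Longrightarrow> \<exists>b. \<forall>u. st a u \<longrightarrow> st b (fold D w u)"
proof (induction w arbitrary: a v)
  case (Cons c w)
  obtain b where "\<forall>u. st c u \<longrightarrow> st b (fold D w u)" using Cons.IH[OF st_step[OF Cons.prems]] by blast
  then show ?case using st_step by (intro exI[of _ b]) (auto intro: st_step)
qed auto

text \<open>The empty word acts as the identity of the whole sequence space, which does not satisfy
  \<open>opN N\<close>; hence the recurring condition \<open>w \<noteq> []\<close>.\<close>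

lemma opN_fold: "w \<noteq> [] \<Longrightarrow> opN N (fold D w)"
proof (induction w rule: rev_induct)
  case (snoc c w)
  show ?case
  proof (cases "w = []")
    case True
    then show ?thesis using op by (simp add: eta_contract_eq)
  next
    case False
    then have w: "opN N (fold D w)" using snoc by simp
    have lin: "linear (\<lambda>v. D c (fold D w v))"
      using linear_compose[OF opN_linear[OF w] opN_linear[OF op]] by (simp add: comp_def)
    have "D c (fold D w v) = (\<Sum>q<N. v q *\<^sub>R D c (fold D w (ev q)))" for v
      using arg_cong[OF opN_expand[OF w, of v], of "D c"]
      by (simp add: linear_sum[OF opN_linear[OF op]] linear_scale[OF opN_linear[OF op]])
    then have "opN N (\<lambda>v. D c (fold D w v))"
      unfolding opN_def using lin opN_supp[OF op] by blast
    then show ?thesis by (simp add: comp_def)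
  qed
qed simp

lemma linear_fold: "linear (fold D w)"
  using opN_linear[OF opN_fold[of w]] by (cases "w = []") (auto simp: linear_id[unfolded id_def] id_def)

lemma norm_fold_upper: "norm (fold D w v) \<le> K ^ length w * norm v"
proof (induction w arbitrary: v)
  case (Cons c w)
  have "norm (fold D (c # w) v) \<le> K ^ length w * norm (D c v)" using Cons by simp
  also have "\<dots> \<le> K ^ length w * (K * norm v)" using K by (intro mult_left_mono upper) auto
  finally show ?case by (simp add: mult_ac)
qed simp

lemma norm_fold_lower: "st a v \<Longrightarrow> kap ^ length w * norm v \<le> norm (fold D w v)"
proof (induction w arbitrary: a v)
  case (Cons c w)
  have "kap ^ length w * (kap * norm v) \<le> kap ^ length w * norm (D c v)"
    using kap by (intro mult_left_mono st_lower[OF Cons.prems]) auto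
  also have "\<dots> \<le> norm (fold D w (D c v))" by (rule Cons.IH[OF st_step[OF Cons.prems]])
  finally show ?case by (simp add: mult_ac)
qed simp

end

text \<open>The data \<open>q0\<close>, \<open>c0\<close> provide for every letter a column bounded
  below, which starts orbits and bounds \<open>nm\<close> from below. The contraction holds in the
  mean, for a power of the distance and after \<open>n0\<close> letters, and it concerns two vectors
  in one range.\<close>

locale contracting_cocycle = linear_cocycle P N D kap K
  for P :: "'a::finite pmf" and N D kap K +
  fixes alpha theta c0 :: real and n0 :: nat and q0 :: "'a \<Rightarrow> nat"
  assumes alpha: "0 < alpha" "alpha \<le> 1" and theta: "0 < theta" "theta < 1"
    and n0: "1 \<le> n0" and c0: "0 < c0" "c0 \<le> 1"
    and q0: "q0 a < N" "c0 \<le> norm (D a (ev (q0 a)))"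
    and contraction: "\<lbrakk>v \<in> range (D a); w \<in> range (D a); v \<noteq> 0; w \<noteq> 0\<rbrakk> \<Longrightarrow>
      wex P n0 (\<lambda>u. dl N (fold D u v) (fold D u w) powr alpha) \<le> theta * dl N v w powr alpha"
begin

text \<open>\<open>M\<close> bounds \<open>dl\<close>, \<open>l0\<close> the logarithmic growth per
  letter, \<open>CL\<close> is a Hoelder constant of that growth and \<open>rho\<close> the
  contraction rate per letter. \<open>G * rho ^ n\<close> bounds the distance of \<open>U n\<close>
  from \<open>L\<close>, its sum \<open>H\<close> bounds the corrector \<open>h\<close>, and
  \<open>R\<close> the martingale increments. In \<open>C1\<close>, \<open>C2\<close> the exponent
  \<open>2 * H + l0\<close> pays for removing \<open>h\<close> and for the first letter. All are
  functions of the numerical parameters, not of the operators.\<close>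

definition M where "M = 2 * (real N)\<^sup>2"
definition l0 where "l0 = ln (K / kap)"
definition rho where "rho = theta powr (1 / real n0)"
definition CL where "CL = 2 * K / kap * M"
definition G where "G = 2 * l0 + CL * (M / theta) / rho"
definition H where "H = G / (1 - rho)"
definition R where "R = 2 * l0 + 2 * H + 1"
definition C1 where "C1 = real N * real N * K * exp (2 * H + l0)"
definition C2 where "C2 = exp (2 * H + l0) / c0"

section \<open>Expected logarithmic increments and the Poisson equation\<close>

definition lr where "lr c v = ln (norm (D c v)) - ln (norm v)"
definition xi where "xi v = (\<Sum>c\<in>UNIV. pmf P c * lr c v)"
text \<open>Expected logarithmic increment at time \<open>n\<close>, that is, the transition
  operator applied \<open>n\<close> times to \<open>xi\<close>. It approaches \<open>L\<close> at a
  geometric rate uniformly in the starting state, so the series \<open>h\<close> converges.\<close>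

definition U where "U n v = wex P n (\<lambda>w. xi (fold D w v))"
definition s0 where "s0 = D undefined (ev (q0 undefined))"
definition L where "L = lim (\<lambda>n. U n s0)"
definition h where "h v = (\<Sum>n. U n v - L)"

lemma M_ge1: "1 \<le> M"
proof -
  have "1 \<le> N" using q0(1)[of undefined] by simp
  then have "1 \<le> real N" by simp
  then have "1 * 1 \<le> real N * real N" by (intro mult_mono) auto
  then show ?thesis by (simp add: M_def power2_eq_square)
qed

lemma l0_nonneg: "0 \<le> l0"
  using kap K by (simp add: l0_def)

lemma rho: "0 < rho" "rho < 1"
proof -
  show "0 < rho" using theta by (simp add: rho_def)
  have "theta powr (1 / real n0) < 1 powr (1 / real n0)"
    using theta n0 by (intro powr_less_mono2) auto
  then show "rho < 1" by (simp add: rho_def)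
qed

lemma CL_nonneg: "0 \<le> CL"
  using K kap M_ge1 by (simp add: CL_def)

lemma G_nonneg: "0 \<le> G"
  using l0_nonneg CL_nonneg M_ge1 theta rho by (simp add: G_def)

lemma H_nonneg: "0 \<le> H"
  using G_nonneg rho by (simp add: H_def)

lemma R_ge1: "1 \<le> R"
  using l0_nonneg H_nonneg by (simp add: R_def)

lemma st_s0: "st undefined s0"
proof -
  have "0 < norm s0" using q0(2)[of undefined] c0 unfolding s0_def by linarith
  then show ?thesis by (auto simp: st_def s0_def)
qed

lemma lr_bound: "st a v \<Longrightarrow> \<bar>lr c v\<bar> \<le> l0"
proof -
  assume v: "st a v"
  have n: "0 < norm v" "0 < norm (D c v)" using v st_step[OF v, of c] by (auto simp: st_def)
  have "lr c v \<le> ln (K * norm v) - ln (norm v)"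
    using n upper[of c v] unfolding lr_def by (intro diff_right_mono ln_mono) auto
  also have "\<dots> = ln K" using n K by (simp add: ln_mult)
  finally have 1: "lr c v \<le> ln K" .
  have "ln (kap * norm v) - ln (norm v) \<le> lr c v"
    using n st_lower[OF v, of c] kap unfolding lr_def by (intro diff_right_mono ln_mono) auto
  then have 2: "ln kap \<le> lr c v" using n kap by (simp add: ln_mult)
  have "ln kap \<le> 0" "0 \<le> ln K" using kap K by auto
  moreover have "l0 = ln K - ln kap" using kap K by (simp add: l0_def ln_div)
  ultimately show ?thesis using 1 2 by linarith
qed

lemma avg_abs_le:
  assumes "\<And>c. \<bar>f c\<bar> \<le> b" shows "\<bar>\<Sum>c\<in>UNIV. pmf P c * f c\<bar> \<le> (b::real)"
proof -
  have "\<bar>\<Sum>c\<in>UNIV. pmf P c * f c\<bar> \<le> (\<Sum>c\<in>UNIV. pmf P c * b)"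
    by (rule sum_abs[THEN order_trans]) (auto intro!: sum_mono mult_left_mono assms simp: abs_mult)
  then show ?thesis by (simp add: sum_distrib_right[symmetric] sum_pmf_eq_1)
qed

lemma xi_bound: "st a v \<Longrightarrow> \<bar>xi v\<bar> \<le> l0"
  unfolding xi_def by (rule avg_abs_le) (rule lr_bound)

lemma dl_powr_le: "dl N v w \<le> M * dl N v w powr alpha"
proof (cases "dl N v w = 0")
  case False
  then have d: "0 < dl N v w" using dl_nonneg[of N v w] by simp
  have "dl N v w = dl N v w powr (1 - alpha) * dl N v w powr alpha"
    using d by (simp add: powr_add[symmetric])
  also have "\<dots> \<le> M * dl N v w powr alpha"
  proof (rule mult_right_mono)
    have "dl N v w powr (1 - alpha) \<le> M powr (1 - alpha)"
      using alpha d dl_le[of N v w] by (intro powr_mono2) (auto simp: M_def)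
    also have "\<dots> \<le> M" using alpha M_ge1 by (intro powr_le_of_nonneg) auto
    finally show "dl N v w powr (1 - alpha) \<le> M" .
  qed simp
  finally show ?thesis .
qed simp

text \<open>By ln x \<le> x - 1 the difference is at most the relative error of a cross product of
  norms, which \<open>norm_swap_le\<close> estimates by \<open>wd\<close>; \<open>lower\<close>
  turns the denominator into that of \<open>dl\<close>, and the boundedness of \<open>dl\<close>
  allows the smaller power \<open>alpha\<close>.\<close>

lemma lr_lipschitz:
  assumes v: "st a v" and w: "st a w"
  shows "\<bar>lr c v - lr c w\<bar> \<le> CL * dl N v w powr alpha"
proof -
  have *: "lr c v - lr c w \<le> CL * dl N v w powr alpha" if v: "st a v" and w: "st a w" for v w
  proof -
    have n: "0 < norm v" "0 < norm (D c v)" "0 < norm w" "0 < norm (D c w)"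
      using v w st_step[OF v, of c] st_step[OF w, of c] by (auto simp: st_def)
    let ?r = "(norm (D c v) * norm w) / (norm v * norm (D c w))"
    have "lr c v - lr c w = ln ?r"
      using n by (simp add: lr_def ln_div ln_mult)
    also have "\<dots> \<le> ?r - 1" using n by (intro ln_le_minus_one) simp
    also have "\<dots> = (norm (D c v) * norm w - norm v * norm (D c w)) / (norm v * norm (D c w))"
      using n by (simp add: field_simps)
    also have "\<dots> \<le> (2 * K * wd N v w) / (norm v * norm (D c w))"
      using norm_swap_le[OF opN_linear[OF op] upper _ st_supp[OF v] st_supp[OF w], of c] K n
      by (intro divide_right_mono) auto
    also have "\<dots> \<le> (2 * K * wd N v w) / (norm v * (kap * norm w))"
      using n st_lower[OF w, of c] K kap wd_nonneg[of N v w]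
      by (intro divide_left_mono mult_left_mono) auto
    also have "\<dots> = 2 * K / kap * dl N v w" by (simp add: dl_def)
    also have "\<dots> \<le> 2 * K / kap * (M * dl N v w powr alpha)"
      using K kap by (intro mult_left_mono dl_powr_le) auto
    finally show ?thesis by (simp add: CL_def mult_ac)
  qed
  have "dl N w v = dl N v w" by (simp add: dl_def wd_def mult_ac abs_minus_commute)
  then show ?thesis using *[OF v w] *[OF w v] by (simp add: abs_le_iff)
qed

lemma xi_lipschitz:
  assumes v: "st a v" and w: "st a w"
  shows "\<bar>xi v - xi w\<bar> \<le> CL * dl N v w powr alpha"
proof -
  have "xi v - xi w = (\<Sum>c\<in>UNIV. pmf P c * (lr c v - lr c w))"
    by (simp add: xi_def sum_subtractf right_diff_distrib)
  then show ?thesis using avg_abs_le[OF lr_lipschitz[OF v w]] by simp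
qed

text \<open>Blocks of \<open>n0\<close> letters are split off at the end of the word: given the
  earlier letters, both vectors are states over one letter, so each complete block gains a factor
  \<open>theta\<close>, and an incomplete one is bounded by \<open>M\<close>.\<close>

lemma iterate_contraction:
  assumes v: "st a v" and w: "st a w"
  shows "wex P n (\<lambda>u. dl N (fold D u v) (fold D u w) powr alpha) \<le> M * theta ^ (n div n0)"
proof (induction n rule: less_induct)
  case (less n)
  show ?case
  proof (cases "n < n0")
    case True
    have "wex P n (\<lambda>u. dl N (fold D u v) (fold D u w) powr alpha) \<le> wex P n (\<lambda>u. M)"
    proof (rule wex_mono)
      fix u :: "'a list"
      have "dl N (fold D u v) (fold D u w) powr alpha \<le> M powr alpha"
        using alpha dl_le[of N "fold D u v" "fold D u w"] dl_nonneg[of N "fold D u v" "fold D u w"]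
        by (intro powr_mono2) (auto simp: M_def)
      also have "\<dots> \<le> M" using alpha M_ge1 by (intro powr_le_of_nonneg) auto
      finally show "dl N (fold D u v) (fold D u w) powr alpha \<le> M" .
    qed
    then show ?thesis using True by simp
  next
    case False
    let ?d = "\<lambda>u. dl N (fold D u v) (fold D u w) powr alpha"
    have "wex P n ?d = wex P (n - n0 + n0) ?d" using False by simp
    also have "\<dots> = wex P (n - n0) (\<lambda>u. wex P n0 (\<lambda>x. dl N (fold D x (fold D u v)) (fold D x (fold D u w)) powr alpha))"
      by (subst wex_append) simp
    also have "\<dots> \<le> wex P (n - n0) (\<lambda>u. theta * ?d u)"
    proof (rule wex_mono)
      fix u :: "'a list"
      obtain b where "st b (fold D u v)" "st b (fold D u w)" using fold_st[OF v] v w by blast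
      then show "wex P n0 (\<lambda>x. dl N (fold D x (fold D u v)) (fold D x (fold D u w)) powr alpha) \<le> theta * ?d u"
        by (intro contraction[of _ b]) (auto simp: st_def)
    qed
    also have "\<dots> = theta * wex P (n - n0) ?d" by (rule wex_cmult)
    also have "\<dots> \<le> theta * (M * theta ^ ((n - n0) div n0))"
      using False n0 theta by (intro mult_left_mono less) auto
    also have "\<dots> = M * theta ^ (n div n0)" using False n0 by (simp add: le_div_geq)
    finally show ?thesis .
  qed
qed

lemma theta_div_le: "theta ^ (n div n0) \<le> rho ^ n / theta"
proof -
  have "real n \<le> real n0 * real (n div n0) + real n0"
  proof -
    have "n \<le> n0 * (n div n0) + n0" using n0 by (metis add_left_mono less_imp_le_nat mod_less_divisor mult_div_mod_eq not_one_le_zero zero_less_iff_neq_zero order.trans le_refl)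
    then show ?thesis by (metis of_nat_add of_nat_le_iff of_nat_mult)
  qed
  then have "real n / real n0 - 1 \<le> real (n div n0)" using n0 by (simp add: field_simps)
  then have "theta powr real (n div n0) \<le> theta powr (real n / real n0 - 1)"
    using theta by (intro powr_mono') auto
  moreover have "theta powr (real n / real n0 - 1) = rho ^ n / theta"
    using theta by (simp add: rho_def powr_diff powr_powr[symmetric] powr_realpow[symmetric] powr_powr)
  ultimately show ?thesis using theta by (simp add: powr_realpow)
qed

lemma U_lipschitz:
  assumes v: "st a v" and w: "st a w"
  shows "\<bar>U n v - U n w\<bar> \<le> CL * (M / theta) * rho ^ n"
proof -
  have "\<bar>U n v - U n w\<bar> = \<bar>wex P n (\<lambda>u. xi (fold D u v) - xi (fold D u w))\<bar>"
    by (simp add: U_def wex_diff)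
  also have "\<dots> \<le> wex P n (\<lambda>u. \<bar>xi (fold D u v) - xi (fold D u w)\<bar>)" by (rule wex_abs)
  also have "\<dots> \<le> wex P n (\<lambda>u. CL * dl N (fold D u v) (fold D u w) powr alpha)"
  proof (rule wex_mono)
    fix u :: "'a list"
    obtain b where "st b (fold D u v)" "st b (fold D u w)" using fold_st[OF v] v w by blast
    then show "\<bar>xi (fold D u v) - xi (fold D u w)\<bar> \<le> CL * dl N (fold D u v) (fold D u w) powr alpha"
      by (rule xi_lipschitz)
  qed
  also have "\<dots> = CL * wex P n (\<lambda>u. dl N (fold D u v) (fold D u w) powr alpha)" by (rule wex_cmult)
  also have "\<dots> \<le> CL * (M * theta ^ (n div n0))"
    by (intro mult_left_mono iterate_contraction[OF v w] CL_nonneg)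
  also have "\<dots> \<le> CL * (M * (rho ^ n / theta))"
    using M_ge1 by (intro mult_left_mono theta_div_le CL_nonneg) auto
  finally show ?thesis by (simp add: mult_ac)
qed

lemma U_Suc: "U (Suc n) v = (\<Sum>c\<in>UNIV. pmf P c * U n (D c v))"
  by (simp add: U_def)

text \<open>The states may lie over different letters. One common letter is spent to bring both into
  the range of \<open>D c\<close>, where \<open>U_lipschitz\<close> applies; this is the reason for
  \<open>Suc n\<close>.\<close>

lemma U_osc:
  assumes v: "st a v" and w: "st b w"
  shows "\<bar>U (Suc n) v - U (Suc n) w\<bar> \<le> CL * (M / theta) * rho ^ n"
proof -
  have "U (Suc n) v - U (Suc n) w = (\<Sum>c\<in>UNIV. pmf P c * (U n (D c v) - U n (D c w)))"
    by (simp add: U_Suc sum_subtractf right_diff_distrib)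
  then show ?thesis
    using avg_abs_le[OF U_lipschitz[OF st_step[OF v] st_step[OF w]]] by simp
qed

text \<open>Further letters in front only average \<open>U (Suc n)\<close> over other states, so the
  oscillation bound also controls later times; this yields the Cauchy property in time.\<close>

lemma U_osc_later:
  assumes v: "st a v" and w: "st b w"
  shows "\<bar>U (j + Suc n) v - U (Suc n) w\<bar> \<le> CL * (M / theta) * rho ^ n"
proof -
  have "U (j + Suc n) v = wex P j (\<lambda>u. U (Suc n) (fold D u v))"
    unfolding U_def by (subst wex_append) simp
  then have "\<bar>U (j + Suc n) v - U (Suc n) w\<bar> = \<bar>wex P j (\<lambda>u. U (Suc n) (fold D u v) - U (Suc n) w)\<bar>"
    by (simp add: wex_diff)
  also have "\<dots> \<le> wex P j (\<lambda>u. \<bar>U (Suc n) (fold D u v) - U (Suc n) w\<bar>)" by (rule wex_abs)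
  also have "\<dots> \<le> wex P j (\<lambda>u. CL * (M / theta) * rho ^ n)"
  proof (rule wex_mono)
    fix u :: "'a list"
    obtain b' where "st b' (fold D u v)" using fold_st[OF v] v by blast
    then show "\<bar>U (Suc n) (fold D u v) - U (Suc n) w\<bar> \<le> CL * (M / theta) * rho ^ n"
      using w by (rule U_osc)
  qed
  finally show ?thesis by simp
qed

lemma U_tendsto_L: "(\<lambda>n. U n s0) \<longlonglongrightarrow> L"
proof -
  have z: "(\<lambda>n. CL * (M / theta) * rho ^ n) \<longlonglongrightarrow> CL * (M / theta) * 0"
    using rho by (intro tendsto_mult tendsto_const LIMSEQ_realpow_zero) auto
  have "Cauchy (\<lambda>n. U n s0)"
  proof (rule metric_CauchyI)
    fix e :: real assume e: "e > 0"
    have "\<forall>\<^sub>F n in sequentially. CL * (M / theta) * rho ^ n < e / 2"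
      using order_tendstoD(2)[OF z, of "e / 2"] e by simp
    then obtain n where n: "CL * (M / theta) * rho ^ n < e / 2"
      by (auto simp: eventually_sequentially)
    have c: "\<bar>U m s0 - U (Suc n) s0\<bar> < e / 2" if "m \<ge> Suc n" for m
      using U_osc_later[OF st_s0 st_s0, of "m - Suc n" n] n unfolding le_add_diff_inverse2[OF that] by linarith
    have "dist (U m s0) (U m' s0) < e" if "m \<ge> Suc n" "m' \<ge> Suc n" for m m'
      using c[OF that(1)] c[OF that(2)] unfolding dist_real_def by linarith
    then show "\<exists>M. \<forall>m\<ge>M. \<forall>n\<ge>M. dist (U m s0) (U n s0) < e" by blast
  qed
  then show ?thesis unfolding L_def by (simp add: Cauchy_convergent convergent_LIMSEQ_iff[symmetric])
qed

lemma U_bound: "st a v \<Longrightarrow> \<bar>U n v\<bar> \<le> l0"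
proof (induction n arbitrary: a v)
  case 0
  then show ?case using xi_bound by (simp add: U_def)
next
  case (Suc n)
  then show ?case unfolding U_Suc by (intro avg_abs_le) (auto intro: st_step)
qed

lemma L_bound: "\<bar>L\<bar> \<le> l0"
  using tendsto_rabs[OF U_tendsto_L] by (rule LIMSEQ_le_const2) (auto intro: U_bound[OF st_s0])

text \<open>For \<open>n = 0\<close> no letter is available to merge the ranges and the trivial
  bound \<open>2 * l0\<close> is used; at later times the letter spent accounts for the division by
  \<open>rho\<close>. \<open>G\<close> adds both constants.\<close>

lemma U_close:
  assumes v: "st a v"
  shows "\<bar>U n v - L\<bar> \<le> G * rho ^ n"
proof (cases n)
  case 0
  have "\<bar>U n v - L\<bar> \<le> 2 * l0" using U_bound[OF v, of n] L_bound by linarith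
  also have "\<dots> \<le> G" using CL_nonneg M_ge1 theta rho by (simp add: G_def)
  finally show ?thesis using 0 by simp
next
  case (Suc m)
  have "(\<lambda>j. \<bar>U n v - U (j + n) s0\<bar>) \<longlonglongrightarrow> \<bar>U n v - L\<bar>"
    by (intro tendsto_intros LIMSEQ_ignore_initial_segment[OF U_tendsto_L])
  then have "\<bar>U n v - L\<bar> \<le> CL * (M / theta) * rho ^ m"
    using U_osc_later[OF st_s0 v, of _ m]
    by (intro LIMSEQ_le_const2) (auto simp: Suc abs_minus_commute)
  also have "\<dots> = CL * (M / theta) / rho * rho ^ n" using rho by (simp add: Suc)
  also have "\<dots> \<le> G * rho ^ n"
    using l0_nonneg rho by (intro mult_right_mono) (auto simp: G_def)
  finally show ?thesis .
qed

lemma summable_U: "st a v \<Longrightarrow> summable (\<lambda>n. U n v - L)"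
  using rho U_close by (intro summable_comparison_test'[OF summable_mult[OF summable_geometric[of rho], of G], of 0]) auto

lemma h_bound: "st a v \<Longrightarrow> \<bar>h v\<bar> \<le> H"
proof -
  assume v: "st a v"
  have s: "summable (\<lambda>n. G * rho ^ n)" using rho by (intro summable_mult summable_geometric) auto
  have sa: "summable (\<lambda>n. \<bar>U n v - L\<bar>)"
    using U_close[OF v] by (intro summable_comparison_test'[OF s, of 0]) auto
  have "\<bar>h v\<bar> \<le> (\<Sum>n. \<bar>U n v - L\<bar>)" unfolding h_def by (rule summable_rabs[OF sa])
  also have "\<dots> \<le> (\<Sum>n. G * rho ^ n)" by (rule suminf_le[OF U_close[OF v] sa s])
  also have "\<dots> = H" using rho by (simp add: suminf_mult suminf_geometric H_def summable_geometric)
  finally show ?thesis .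
qed

text \<open>Averaging over the next letter maps \<open>U n\<close> to \<open>U (Suc n)\<close>, so
  it shifts the series defining \<open>h\<close> by one term; the term lost is
  \<open>xi v - L\<close>.\<close>

lemma poisson:
  assumes v: "st a v"
  shows "(\<Sum>c\<in>UNIV. pmf P c * h (D c v)) = h v - (xi v - L)"
proof -
  have "(\<lambda>n. \<Sum>c\<in>UNIV. pmf P c * (U n (D c v) - L)) sums (\<Sum>c\<in>UNIV. pmf P c * h (D c v))"
    unfolding h_def by (intro sums_sum sums_mult summable_sums summable_U[OF st_step[OF v]])
  moreover have "(\<Sum>c\<in>UNIV. pmf P c * (U n (D c v) - L)) = U (Suc n) v - L" for n
    by (simp add: U_Suc right_diff_distrib sum_subtractf sum_distrib_right[symmetric] sum_pmf_eq_1)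
  ultimately have "(\<lambda>n. U (Suc n) v - L) sums (\<Sum>c\<in>UNIV. pmf P c * h (D c v))" by simp
  then have "(\<lambda>n. U n v - L) sums ((\<Sum>c\<in>UNIV. pmf P c * h (D c v)) + (U 0 v - L))"
    by (subst (asm) sums_Suc_iff) simp
  then have "h v = (\<Sum>c\<in>UNIV. pmf P c * h (D c v)) + (U 0 v - L)"
    unfolding h_def by (rule sums_unique[symmetric])
  then show ?thesis by (simp add: U_def)
qed

text \<open>The centred increments: \<open>h\<close> solves the Poisson equation, so along a word the \<open>X\<close> are bounded
  martingale differences whose sum is \<open>ln \<parallel>fold D w v\<parallel> - n L\<close> up to a bounded term.\<close>
definition X where "X c v = lr c v - L + h (D c v) - h v"

section \<open>Exponential moments and large deviations\<close>

lemma X_mean: "st a v \<Longrightarrow> (\<Sum>c\<in>UNIV. pmf P c * X c v) = 0"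
  using poisson[of a v]
  by (simp add: X_def distrib_left right_diff_distrib sum.distrib sum_subtractf
      sum_distrib_right[symmetric] sum_pmf_eq_1 xi_def)

lemma X_bound: "st a v \<Longrightarrow> \<bar>X c v\<bar> \<le> R"
  using lr_bound[of a v c] L_bound h_bound[of a v] h_bound[OF st_step[of a v c]]
  by (auto simp: X_def R_def)

text \<open>Second-order expansion of the exponential: the linear term has mean zero by the Poisson
  equation, and the condition on \<open>t\<close> keeps the exponent where the quadratic bound
  holds.\<close>

lemma mgf_step:
  assumes v: "st a v" and t: "\<bar>t\<bar> * R \<le> 1"
  shows "(\<Sum>c\<in>UNIV. pmf P c * exp (t * X c v)) \<le> exp (t\<^sup>2 * R\<^sup>2)"
proof -
  have tx: "\<bar>t * X c v\<bar> \<le> \<bar>t\<bar> * R" for c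
    unfolding abs_mult using X_bound[OF v] by (intro mult_left_mono) auto
  have "exp (t * X c v) \<le> 1 + t * X c v + t\<^sup>2 * R\<^sup>2" for c
  proof -
    have "exp (t * X c v) \<le> 1 + t * X c v + (t * X c v)\<^sup>2"
      using tx[of c] t by (intro exp_le_quadratic) linarith
    moreover have "(t * X c v)\<^sup>2 \<le> (\<bar>t\<bar> * R)\<^sup>2" using tx[of c] by (intro abs_le_square_iff[THEN iffD1]) (simp add: abs_mult R_ge1 order_trans[OF _ R_ge1])
    ultimately show ?thesis by (simp add: power_mult_distrib)
  qed
  then have "(\<Sum>c\<in>UNIV. pmf P c * exp (t * X c v)) \<le> (\<Sum>c\<in>UNIV. pmf P c * (1 + t * X c v + t\<^sup>2 * R\<^sup>2))"
    by (intro sum_mono mult_left_mono) auto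
  also have "\<dots> = (\<Sum>c\<in>UNIV. pmf P c * (1 + t\<^sup>2 * R\<^sup>2)) + t * (\<Sum>c\<in>UNIV. pmf P c * X c v)"
    unfolding sum_distrib_left sum.distrib[symmetric]
    by (intro sum.cong refl) (simp only: distrib_left mult.assoc mult.left_commute mult.commute add_ac)
  also have "\<dots> = 1 + t\<^sup>2 * R\<^sup>2"
    by (simp only: X_mean[OF v] sum_distrib_right[symmetric] sum_pmf_eq_1[of UNIV P] finite_class.finite_UNIV top_greatest)
       simp
  also have "\<dots> \<le> exp (t\<^sup>2 * R\<^sup>2)" by (rule exp_ge_add_one_self)
  finally show ?thesis .
qed

lemma mgf:
  assumes "st a v" and t: "\<bar>t\<bar> * R \<le> 1"
  shows "wex P n (\<lambda>w. exp (t * (ln (norm (fold D w v)) - ln (norm v) - n * L + h (fold D w v) - h v)))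
     \<le> exp (n * (t\<^sup>2 * R\<^sup>2))"
  using assms(1)
proof (induction n arbitrary: a v)
  case (Suc n)
  let ?e = "\<lambda>n w v. exp (t * (ln (norm (fold D w v)) - ln (norm v) - real n * L + h (fold D w v) - h v))"
  have split: "?e (Suc n) (c # w) v = exp (t * X c v) * ?e n w (D c v)" for c w
    by (simp add: exp_add[symmetric] X_def lr_def algebra_simps)
  have "wex P (Suc n) (\<lambda>w. ?e (Suc n) w v) = (\<Sum>c\<in>UNIV. pmf P c * (exp (t * X c v) * wex P n (\<lambda>w. ?e n w (D c v))))"
    unfolding wex.simps(2) split wex_cmult ..
  also have "\<dots> \<le> (\<Sum>c\<in>UNIV. pmf P c * (exp (t * X c v) * exp (n * (t\<^sup>2 * R\<^sup>2))))"
    using Suc.IH[OF st_step[OF Suc.prems]] by (intro sum_mono mult_left_mono) auto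
  also have "\<dots> = (\<Sum>c\<in>UNIV. pmf P c * exp (t * X c v)) * exp (n * (t\<^sup>2 * R\<^sup>2))"
    by (simp add: sum_distrib_right mult_ac)
  also have "\<dots> \<le> exp (t\<^sup>2 * R\<^sup>2) * exp (n * (t\<^sup>2 * R\<^sup>2))"
    by (intro mult_right_mono mgf_step[OF Suc.prems t]) auto
  finally show ?case by (simp add: exp_add[symmetric] algebra_simps)
qed simp

text \<open>Since \<open>R \<ge> 1\<close>, the condition on \<open>t\<close> forces
  \<open>\<bar>t\<bar> \<le> 1\<close>, so dropping the corrector \<open>h\<close> costs a factor
  \<open>exp (2 * H)\<close> independent of \<open>t\<close>.\<close>

lemma mgf_norm:
  assumes v: "st a v" and t: "\<bar>t\<bar> * R \<le> 1"
  shows "wex P n (\<lambda>w. norm (fold D w v) powr t)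
     \<le> norm v powr t * exp (t * n * L + n * (t\<^sup>2 * R\<^sup>2) + 2 * H)"
proof -
  have t1: "\<bar>t\<bar> \<le> 1" using mult_left_mono[OF R_ge1, of "\<bar>t\<bar>"] t by simp
  have "norm (fold D w v) powr t \<le> norm v powr t * exp (t * n * L + 2 * H) *
      exp (t * (ln (norm (fold D w v)) - ln (norm v) - n * L + h (fold D w v) - h v))" for w
  proof -
    obtain b where b: "st b (fold D w v)" using fold_st[OF v] v by blast
    have n: "0 < norm v" "0 < norm (fold D w v)" using v b by (auto simp: st_def)
    have "\<bar>t * (h v - h (fold D w v))\<bar> \<le> 1 * (2 * H)"
      unfolding abs_mult using t1 h_bound[OF v] h_bound[OF b] by (intro mult_mono) auto
    then have hh: "t * (h v - h (fold D w v)) \<le> 2 * H" by linarith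
    have "norm (fold D w v) powr t = exp (t * ln (norm (fold D w v)))" using n by (simp add: powr_def)
    also have "\<dots> \<le> exp (t * ln (norm v) + (t * n * L + 2 * H) +
       t * (ln (norm (fold D w v)) - ln (norm v) - n * L + h (fold D w v) - h v))"
      using hh by (simp add: algebra_simps)
    finally show ?thesis using n by (simp add: exp_add powr_def)
  qed
  then have "wex P n (\<lambda>w. norm (fold D w v) powr t) \<le> norm v powr t * exp (t * n * L + 2 * H) *
      wex P n (\<lambda>w. exp (t * (ln (norm (fold D w v)) - ln (norm v) - n * L + h (fold D w v) - h v)))"
    unfolding wex_cmult[symmetric] by (rule wex_mono)
  also have "\<dots> \<le> norm v powr t * exp (t * n * L + 2 * H) * exp (n * (t\<^sup>2 * R\<^sup>2))"
    by (intro mult_left_mono mgf[OF v t]) auto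
  finally show ?thesis by (simp add: exp_add mult_ac)
qed

lemma nm_fold_pos: "w \<noteq> [] \<Longrightarrow> 0 < nm N (fold D w)"
proof -
  assume "w \<noteq> []"
  then obtain c w' where w: "w = c # w'" by (cases w) auto
  have "st c (D c (ev (q0 c)))" using q0(2)[of c] c0 by (auto simp: st_def)
  then obtain b where "st b (fold D w' (D c (ev (q0 c))))" using fold_st by blast
  then have "0 < norm (fold D w (ev (q0 c)))" by (simp add: w st_def)
  also have "\<dots> \<le> nm N (fold D w)" unfolding nm_def
    using q0(1) by (intro member_le_sum[of _ _ "\<lambda>q. norm (fold D w (ev q))"]) auto
  finally show ?thesis .
qed

text \<open>A basis vector need not be a state, but its image under the first letter is zero or a
  state; hence \<open>Suc m\<close>. The power of the sum of columns is bounded through the largest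
  column, which gives one factor \<open>N\<close>; the sum over columns gives another.\<close>

lemma mgf_nm_upper:
  fixes t :: real
  assumes t: "0 < t" "t * R \<le> 1"
  shows "wex P (Suc m) (\<lambda>w. nm N (fold D w) powr t)
     \<le> C1 * exp (t * Suc m * L + Suc m * (t\<^sup>2 * R\<^sup>2))"
proof -
  have t1: "t \<le> 1" using mult_left_mono[OF R_ge1, of t] t by linarith
  have N1: "1 \<le> real N" using q0(1)[of undefined] by simp
  let ?E = "K * exp (t * m * L + m * (t\<^sup>2 * R\<^sup>2) + 2 * H)"
  have one: "wex P m (\<lambda>w. norm (fold D w (D c (ev q))) powr t) \<le> ?E" for c q
  proof (cases "D c (ev q) = 0")
    case True
    then have "norm (fold D w (D c (ev q))) = 0" for w using linear_0[OF linear_fold] by simp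
    then show ?thesis using K by simp
  next
    case False
    then have s: "st c (D c (ev q))" by (auto simp: st_def)
    have "wex P m (\<lambda>w. norm (fold D w (D c (ev q))) powr t)
      \<le> norm (D c (ev q)) powr t * exp (t * m * L + m * (t\<^sup>2 * R\<^sup>2) + 2 * H)"
      using t by (intro mgf_norm[OF s]) simp
    also have "norm (D c (ev q)) powr t \<le> K powr t"
      using upper[of c "ev q"] t by (intro powr_mono2) auto
    also have "K powr t \<le> K" using t t1 K by (intro powr_le_of_nonneg) auto
    finally show ?thesis by (simp add: mult_right_mono)
  qed
  have pt: "nm N T powr t \<le> real N * (\<Sum>q<N. norm (T (ev q)) powr t)" for T
  proof -
    obtain p where p: "p < N" "\<And>q. q < N \<Longrightarrow> norm (T (ev q)) \<le> norm (T (ev p))"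
    proof -
      have "Max ((\<lambda>q. norm (T (ev q))) ` {..<N}) \<in> (\<lambda>q. norm (T (ev q))) ` {..<N}"
        using N1 by (intro Max_in) (auto simp: lessThan_empty_iff)
      then obtain p where p: "p < N" "Max ((\<lambda>q. norm (T (ev q))) ` {..<N}) = norm (T (ev p))" by auto
      show ?thesis
      proof (rule that[OF p(1)])
        fix q assume "q < N"
        then show "norm (T (ev q)) \<le> norm (T (ev p))"
          unfolding p(2)[symmetric] by (intro Max_ge) auto
      qed
    qed
    have "nm N T \<le> real N * norm (T (ev p))" unfolding nm_def
      using sum_bounded_above[of "{..<N}" "\<lambda>q. norm (T (ev q))" "norm (T (ev p))"] p(2) by simp
    then have "nm N T powr t \<le> (real N * norm (T (ev p))) powr t"
      using t by (intro powr_mono2 nm_nonneg) auto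
    also have "\<dots> = real N powr t * norm (T (ev p)) powr t" by (simp add: powr_mult)
    also have "\<dots> \<le> real N * norm (T (ev p)) powr t"
      using t t1 N1 by (intro mult_right_mono powr_le_of_nonneg) auto
    also have "\<dots> \<le> real N * (\<Sum>q<N. norm (T (ev q)) powr t)"
      using p(1) by (intro mult_left_mono member_le_sum[of p _ "\<lambda>q. norm (T (ev q)) powr t"]) auto
    finally show ?thesis .
  qed
  have "wex P (Suc m) (\<lambda>w. nm N (fold D w) powr t)
    \<le> wex P (Suc m) (\<lambda>w. real N * (\<Sum>q<N. norm (fold D w (ev q)) powr t))"
    by (rule wex_mono) (rule pt)
  also have "\<dots> = (\<Sum>c\<in>UNIV. pmf P c * (real N * (\<Sum>q<N. wex P m (\<lambda>w. norm (fold D w (D c (ev q))) powr t))))"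
    by (simp add: wex_cmult wex_sum sum_distrib_left mult_ac)
  also have "\<dots> \<le> (\<Sum>c\<in>UNIV. pmf P c * (real N * (\<Sum>q<N. ?E)))"
    using one by (intro sum_mono mult_left_mono) auto
  also have "\<dots> = real N * (\<Sum>q<N. ?E)"
    by (simp only: sum_distrib_right[symmetric] sum_pmf_eq_1[of UNIV P] finite_class.finite_UNIV top_greatest mult_1)
  also have "\<dots> = real N * real N * ?E" by simp
  finally have 1: "wex P (Suc m) (\<lambda>w. nm N (fold D w) powr t) \<le> real N * real N * ?E" .
  have 2: "?E \<le> K * exp (t * Suc m * L + Suc m * (t\<^sup>2 * R\<^sup>2) + (2 * H + l0))"
  proof -
    have "\<bar>t * L\<bar> \<le> 1 * l0" unfolding abs_mult using t t1 L_bound by (intro mult_mono) auto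
    then have "0 \<le> t * L + l0" by linarith
    moreover have "0 \<le> t\<^sup>2 * R\<^sup>2" by simp
    ultimately have "t * m * L + m * (t\<^sup>2 * R\<^sup>2) + 2 * H \<le> t * Suc m * L + Suc m * (t\<^sup>2 * R\<^sup>2) + (2 * H + l0)"
      unfolding of_nat_Suc distrib_left distrib_right mult_1_left mult_1_right by linarith
    then show ?thesis using K by simp
  qed
  have "real N * real N * ?E \<le> real N * real N * (K * exp (t * Suc m * L + Suc m * (t\<^sup>2 * R\<^sup>2) + (2 * H + l0)))"
    by (intro mult_left_mono 2) auto
  also have "\<dots> = C1 * exp (t * Suc m * L + Suc m * (t\<^sup>2 * R\<^sup>2))"
    unfolding C1_def exp_add by simp
  finally show ?thesis using 1 by linarith
qed

text \<open>A negative power calls for a lower bound on the norm, so one good column per first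
  letter, \<open>q0 c\<close>, suffices in place of a sum over all columns.\<close>

lemma mgf_nm_lower:
  fixes t :: real
  assumes t: "0 < t" "t * R \<le> 1"
  shows "wex P (Suc m) (\<lambda>w. nm N (fold D w) powr (-t))
     \<le> C2 * exp (- t * Suc m * L + Suc m * (t\<^sup>2 * R\<^sup>2))"
proof -
  have t1: "t \<le> 1" using mult_left_mono[OF R_ge1, of t] t by linarith
  let ?E = "1 / c0 * exp (- t * m * L + m * (t\<^sup>2 * R\<^sup>2) + 2 * H)"
  have one: "wex P m (\<lambda>w. norm (fold D w (D c (ev (q0 c)))) powr (-t)) \<le> ?E" for c
  proof -
    have s: "st c (D c (ev (q0 c)))" using q0(2)[of c] c0 by (auto simp: st_def)
    have "wex P m (\<lambda>w. norm (fold D w (D c (ev (q0 c)))) powr (-t))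
      \<le> norm (D c (ev (q0 c))) powr (-t) * exp ((-t) * m * L + m * ((-t)\<^sup>2 * R\<^sup>2) + 2 * H)"
      using t by (intro mgf_norm[OF s]) simp
    also have "norm (D c (ev (q0 c))) powr (-t) \<le> c0 powr (-t)"
      using q0(2)[of c] t c0 by (intro powr_mono2') auto
    also have "c0 powr (-t) = (1 / c0) powr t" using c0 by (simp add: powr_minus_divide powr_divide)
    also have "\<dots> \<le> 1 / c0" using t t1 c0 by (intro powr_le_of_nonneg) auto
    finally show ?thesis by (simp add: mult_right_mono)
  qed
  have "wex P (Suc m) (\<lambda>w. nm N (fold D w) powr (-t))
      = (\<Sum>c\<in>UNIV. pmf P c * wex P m (\<lambda>w. nm N (fold D (c # w)) powr (-t)))" by simp
  also have "\<dots> \<le> (\<Sum>c\<in>UNIV. pmf P c * ?E)"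
  proof (intro sum_mono mult_left_mono)
    fix c
    have "wex P m (\<lambda>w. nm N (fold D (c # w)) powr (-t)) \<le> wex P m (\<lambda>w. norm (fold D w (D c (ev (q0 c)))) powr (-t))"
    proof (rule wex_mono)
      fix w :: "'a list"
      have s: "st c (D c (ev (q0 c)))" using q0(2)[of c] c0 by (auto simp: st_def)
      then obtain b where "st b (fold D w (D c (ev (q0 c))))" using fold_st by blast
      then have p: "0 < norm (fold D w (D c (ev (q0 c))))" by (simp add: st_def)
      have "norm (fold D (c # w) (ev (q0 c))) \<le> nm N (fold D (c # w))" unfolding nm_def
        using q0(1) by (intro member_le_sum[of _ _ "\<lambda>q. norm (fold D (c # w) (ev q))"]) auto
      then show "nm N (fold D (c # w)) powr (-t) \<le> norm (fold D w (D c (ev (q0 c)))) powr (-t)"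
        using p t by (intro powr_mono2') auto
    qed
    then show "wex P m (\<lambda>w. nm N (fold D (c # w)) powr (-t)) \<le> ?E" using one[of c] by linarith
  qed auto
  also have "\<dots> = ?E" by (simp only: sum_distrib_right[symmetric] sum_pmf_eq_1[of UNIV P] finite_class.finite_UNIV top_greatest mult_1)
  finally have 1: "wex P (Suc m) (\<lambda>w. nm N (fold D w) powr (-t)) \<le> ?E" .
  have 2: "?E \<le> 1 / c0 * exp (- t * Suc m * L + Suc m * (t\<^sup>2 * R\<^sup>2) + (2 * H + l0))"
  proof -
    have "\<bar>t * L\<bar> \<le> 1 * l0" unfolding abs_mult using t t1 L_bound by (intro mult_mono) auto
    then have "0 \<le> - t * L + l0" by linarith
    moreover have "0 \<le> t\<^sup>2 * R\<^sup>2" by simp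
    ultimately have "- t * m * L + m * (t\<^sup>2 * R\<^sup>2) + 2 * H \<le> - t * Suc m * L + Suc m * (t\<^sup>2 * R\<^sup>2) + (2 * H + l0)"
      unfolding of_nat_Suc distrib_left distrib_right mult_1_left mult_1_right by linarith
    then have "exp (- t * m * L + m * (t\<^sup>2 * R\<^sup>2) + 2 * H) \<le> exp (- t * Suc m * L + Suc m * (t\<^sup>2 * R\<^sup>2) + (2 * H + l0))"
      by (simp only: exp_le_cancel_iff)
    then show ?thesis using c0 by (intro mult_left_mono) auto
  qed
  have "1 / c0 * exp (- t * Suc m * L + Suc m * (t\<^sup>2 * R\<^sup>2) + (2 * H + l0))
      = C2 * exp (- t * Suc m * L + Suc m * (t\<^sup>2 * R\<^sup>2))"
    unfolding C2_def exp_add by simp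
  then show ?thesis using 1 2 by linarith
qed

theorem large_deviations:
  assumes n: "1 \<le> n" and e: "0 < e" "e \<le> 2 * R"
  shows "wex P n (\<lambda>w. if \<bar>ln (nm N (fold D w)) - n * L\<bar> > n * e then 1 else 0)
    \<le> (C1 + C2) * exp (- (n * e\<^sup>2 / (4 * R\<^sup>2)))"
proof -
  obtain m where m: "n = Suc m" using n by (cases n) auto
  \<comment> \<open>The minimiser of \<open>t\<^sup>2 * R\<^sup>2 - t * e\<close>, with minimum -
    e^2 / (4 R^2); the bound \<open>e \<le> 2 * R\<close> says exactly that
    \<open>t * R \<le> 1\<close>.\<close>
  define t where "t = e / (2 * R\<^sup>2)"
  have R: "R > 0" using R_ge1 by simp
  have t: "0 < t" "t * R \<le> 1" using e R by (auto simp: t_def field_simps power2_eq_square)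
  let ?ind = "\<lambda>w. if \<bar>ln (nm N (fold D w)) - n * L\<bar> > n * e then 1 else (0::real)"
  have "?ind w \<le> exp (- t * n * (L + e)) * nm N (fold D w) powr t + exp (t * n * (L - e)) * nm N (fold D w) powr (-t)"
    if w: "length w = n" for w
  proof -
    have pos: "0 < nm N (fold D w)" using w m by (intro nm_fold_pos) auto
    let ?y = "ln (nm N (fold D w))"
    have p: "nm N (fold D w) powr s = exp (s * ?y)" for s using pos by (simp add: powr_def)
    show ?thesis
    proof (cases "\<bar>?y - n * L\<bar> > n * e")
      case False
      then show ?thesis by simp
    next
      case True
      then consider "?y > n * (L + e)" | "?y < n * (L - e)" by (auto simp: abs_if algebra_simps split: if_splits)
      then show ?thesis
      proof cases
        case 1
        then have "0 \<le> t * (?y - n * (L + e))" using t by (intro mult_nonneg_nonneg) auto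
        then have "1 \<le> exp (- t * n * (L + e)) * exp (t * ?y)" by (simp add: exp_add[symmetric] algebra_simps)
        then show ?thesis using True by (simp add: p add_increasing2)
      next
        case 2
        then have "0 \<le> t * (n * (L - e) - ?y)" using t by (intro mult_nonneg_nonneg) auto
        then have "1 \<le> exp (t * n * (L - e)) * exp ((-t) * ?y)" by (simp add: exp_add[symmetric] algebra_simps)
        then show ?thesis using True by (simp add: p add_increasing)
      qed
    qed
  qed
  then have "wex P n ?ind \<le> wex P n (\<lambda>w. exp (- t * n * (L + e)) * nm N (fold D w) powr t + exp (t * n * (L - e)) * nm N (fold D w) powr (-t))"
    by (rule wex_mono)
  also have "\<dots> = exp (- t * n * (L + e)) * wex P n (\<lambda>w. nm N (fold D w) powr t)
      + exp (t * n * (L - e)) * wex P n (\<lambda>w. nm N (fold D w) powr (-t))"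
    by (simp only: wex_add wex_cmult)
  also have "\<dots> \<le> exp (- t * n * (L + e)) * (C1 * exp (t * n * L + n * (t\<^sup>2 * R\<^sup>2)))
      + exp (t * n * (L - e)) * (C2 * exp (- t * n * L + n * (t\<^sup>2 * R\<^sup>2)))"
    unfolding m by (intro add_mono mult_left_mono mgf_nm_upper mgf_nm_lower t) auto
  also have "\<dots> = (C1 + C2) * exp (n * (t\<^sup>2 * R\<^sup>2 - t * e))"
    by (simp add: distrib_right mult.left_commute[of _ C1] mult.left_commute[of _ C2] exp_add[symmetric])
       (simp add: algebra_simps)
  also have "t\<^sup>2 * R\<^sup>2 - t * e = - (e\<^sup>2 / (4 * R\<^sup>2))"
    using R by (simp add: t_def field_simps power2_eq_square)
  finally show ?thesis by simp
qed

section \<open>Hoelder dependence of the exponent on the cocycle\<close>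

definition Q where "Q = 2 * K / kap"
definition E1 where "E1 = 2 * real N * (2 * K)\<^sup>2 / (kap * c0)"
text \<open>\<open>Q\<close> is the rate at which the distance of two orbits grows relative to their
  length. Stopping after about ln (1/z) / (2 ln Q) letters leaves an error of order z^(1/2) from the
  perturbation and z^(- ln rho / (2 ln Q)) from the convergence of \<open>U n\<close>;
  \<open>beta\<close> is the smaller exponent.\<close>

definition beta where "beta = min (1 / 2) (- ln rho / (2 * ln Q))"
definition CH where "CH = 2 * G / rho + E1"

lemma Q_gt1: "1 < Q"
  using K kap by (simp add: Q_def field_simps)

lemma beta: "0 < beta" "beta \<le> 1 / 2"
  using rho Q_gt1 by (auto simp: beta_def divide_neg_pos)

lemma E1_nonneg: "0 \<le> E1"
  using K kap c0 by (simp add: E1_def)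

text \<open>Expresses \<open>U\<close> through expected logarithms of orbits, which can be compared
  word by word between two cocycles.\<close>

lemma U_eq_ln:
  "U n v = wex P (n + 1) (\<lambda>w. ln (norm (fold D w v))) - wex P n (\<lambda>w. ln (norm (fold D w v)))"
proof -
  have "xi x = (\<Sum>c\<in>UNIV. pmf P c * ln (norm (D c x))) - ln (norm x)" for x
    by (simp add: xi_def lr_def right_diff_distrib sum_subtractf sum_distrib_right[symmetric] sum_pmf_eq_1)
  then have "U n v = wex P n (\<lambda>w. (\<Sum>c\<in>UNIV. pmf P c * ln (norm (D c (fold D w v)))) - ln (norm (fold D w v)))"
    by (simp add: U_def)
  moreover have "wex P (n + 1) (\<lambda>w. ln (norm (fold D w v)))
      = wex P n (\<lambda>w. \<Sum>c\<in>UNIV. pmf P c * ln (norm (D c (fold D w v))))"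
    by (subst wex_append) simp
  ultimately show ?thesis by (simp add: wex_diff)
qed

lemma fold_s0_lower: "kap ^ length w * c0 \<le> norm (fold D w s0)"
proof -
  have "kap ^ length w * c0 \<le> kap ^ length w * norm s0"
    using q0(2)[of undefined] kap by (intro mult_left_mono) (auto simp: s0_def)
  then show ?thesis using norm_fold_lower[OF st_s0, of w] by linarith
qed

lemma fold_s0_upper: "norm (fold D w s0) \<le> K ^ (length w + 1)"
proof -
  have "norm (fold D w s0) \<le> K ^ length w * norm s0" by (rule norm_fold_upper)
  also have "\<dots> \<le> K ^ length w * K"
    using upper[of undefined "ev (q0 undefined)"] K by (intro mult_left_mono) (auto simp: s0_def)
  finally show ?thesis by (simp add: mult.commute)
qed

end

text \<open>Both cocycles share all parameters, so \<open>U n\<close> converges to either exponent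
  with the same \<open>G\<close> and \<open>rho\<close>, while for fixed \<open>n\<close> the two
  values of \<open>U n\<close> differ by at most \<open>E1 * Q ^ n * z\<close>. One error decreases
  and the other increases with \<open>n\<close>, which is chosen to balance them.\<close>

theorem exponent_holder:
  fixes P :: "'a::finite pmf" and z :: real
  assumes A: "contracting_cocycle P N D kap K alpha theta c0 n0 q0"
    and B: "contracting_cocycle P N D' kap K alpha theta c0 n0 q0"
    and z: "0 \<le> z" "z \<le> 1"
    and diff: "\<And>a q. q < N \<Longrightarrow> norm (D a (ev q) - D' a (ev q)) \<le> z"
  shows "\<bar>contracting_cocycle.L P D q0 - contracting_cocycle.L P D' q0\<bar>
    \<le> contracting_cocycle.CH N kap K theta c0 n0 * z powr contracting_cocycle.beta kap K theta n0"
proof -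
  interpret A: contracting_cocycle P N D kap K alpha theta c0 n0 q0 by (rule A)
  interpret B: contracting_cocycle P N D' kap K alpha theta c0 n0 q0 by (rule B)
  have N1: "1 \<le> real N" using A.q0(1)[of undefined] by simp
  have dd: "norm (D c x - D' c x) \<le> real N * z * norm x" for c x
  proof -
    have "D c x - D' c x = (\<Sum>q<N. x q *\<^sub>R (D c (ev q) - D' c (ev q)))"
      using opN_expand[OF A.op, of c x] opN_expand[OF B.op, of c x]
      by (simp add: scaleR_diff_right sum_subtractf)
    also have "norm \<dots> \<le> (\<Sum>q<N. norm (x q *\<^sub>R (D c (ev q) - D' c (ev q))))" by (rule norm_sum)
    also have "\<dots> \<le> (\<Sum>q<N. norm x * z)"
      by (intro sum_mono) (auto intro!: mult_mono abs_apply_le_norm diff)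
    finally show ?thesis by (simp add: mult_ac)
  qed
  have fd: "norm (fold D w A.s0 - fold D' w B.s0) \<le> real N * (2 * K) ^ (length w + 1) * z" for w
  proof (induction w rule: rev_induct)
    case Nil
    have "1 * z \<le> (real N * (2 * K)) * z" 
      using z N1 A.K mult_mono[of 1 "real N" 1 "2 * K"] by (intro mult_right_mono) auto
    moreover have "norm (A.s0 - B.s0) \<le> z"
      unfolding A.s0_def B.s0_def by (rule diff) (rule A.q0)
    ultimately show ?case by simp
  next
    case (snoc c w)
    let ?x = "fold D w A.s0" and ?y = "fold D' w B.s0" and ?n = "length w"
    have "D c ?x - D' c ?y = D c (?x - ?y) + (D c ?y - D' c ?y)"
      by (simp add: linear_diff[OF opN_linear[OF A.op]])
    then have "norm (D c ?x - D' c ?y) \<le> norm (D c (?x - ?y)) + norm (D c ?y - D' c ?y)"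
      using norm_triangle_ineq by metis
    also have "\<dots> \<le> K * norm (?x - ?y) + real N * z * norm ?y"
      by (intro add_mono A.upper dd)
    also have "\<dots> \<le> K * (real N * (2 * K) ^ (?n + 1) * z) + real N * z * (2 * K) ^ (?n + 1)"
    proof (intro add_mono mult_left_mono snoc)
      have "norm ?y \<le> K ^ (?n + 1)" by (rule B.fold_s0_upper)
      also have "\<dots> \<le> (2 * K) ^ (?n + 1)" using A.K by (intro power_mono) auto
      finally show "norm ?y \<le> (2 * K) ^ (?n + 1)" .
    qed (use A.K z in auto)
    \<comment> \<open>\<open>K\<close> comes from the propagated error and 1 from the new one; both
      fit into \<open>2 * K\<close> as \<open>K \<ge> 1\<close>.\<close>
    also have "\<dots> = (K + 1) * (real N * (2 * K) ^ (?n + 1) * z)" by (simp add: algebra_simps)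
    also have "\<dots> \<le> (2 * K) * (real N * (2 * K) ^ (?n + 1) * z)"
      using A.K z by (intro mult_right_mono) auto
    finally show ?case by (simp add: mult_ac)
  qed
  have ld: "\<bar>ln (norm (fold D w A.s0)) - ln (norm (fold D' w B.s0))\<bar>
      \<le> real N * (2 * K) ^ (n + 2) * z / (kap ^ (n + 1) * c0)" if w: "length w \<le> n + 1" for w n
  proof -
    let ?x = "fold D w A.s0" and ?y = "fold D' w B.s0"
    have pos: "0 < kap ^ (n + 1) * c0" using A.kap A.c0 by simp
    have "kap ^ (n + 1) \<le> kap ^ length w" using A.kap w by (intro power_decreasing) auto
    then have k: "kap ^ (n + 1) * c0 \<le> kap ^ length w * c0" using A.c0 by (intro mult_right_mono) auto
    have "\<bar>ln (norm ?x) - ln (norm ?y)\<bar> \<le> \<bar>norm ?x - norm ?y\<bar> / (kap ^ (n + 1) * c0)"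
      using k A.fold_s0_lower[of w] B.fold_s0_lower[of w] by (intro abs_ln_diff_le pos) linarith+
    also have "\<dots> \<le> (real N * (2 * K) ^ (n + 2) * z) / (kap ^ (n + 1) * c0)"
    proof (rule divide_right_mono)
      have "\<bar>norm ?x - norm ?y\<bar> \<le> norm (?x - ?y)" by (rule norm_triangle_ineq3)
      also have "\<dots> \<le> real N * (2 * K) ^ (length w + 1) * z" by (rule fd)
      also have "\<dots> \<le> real N * (2 * K) ^ (n + 2) * z"
        using A.K z w by (intro mult_right_mono mult_left_mono power_increasing) auto
      finally show "\<bar>norm ?x - norm ?y\<bar> \<le> real N * (2 * K) ^ (n + 2) * z" .
    qed (use pos in simp)
    finally show ?thesis .
  qed
  have Ud: "\<bar>A.U n A.s0 - B.U n B.s0\<bar> \<le> A.E1 * A.Q ^ n * z" for n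
  proof -
    let ?d = "\<lambda>w. ln (norm (fold D w A.s0)) - ln (norm (fold D' w B.s0))"
    let ?b = "real N * (2 * K) ^ (n + 2) * z / (kap ^ (n + 1) * c0)"
    have w1: "\<bar>wex P k ?d\<bar> \<le> ?b" if "k \<le> n + 1" for k
    proof -
      have "\<bar>wex P k ?d\<bar> \<le> wex P k (\<lambda>w. \<bar>?d w\<bar>)" by (rule wex_abs)
      also have "\<dots> \<le> wex P k (\<lambda>w. ?b)" using that by (intro wex_mono ld) auto
      finally show ?thesis by simp
    qed
    have "A.U n A.s0 - B.U n B.s0 = wex P (n + 1) ?d - wex P n ?d"
      unfolding A.U_eq_ln B.U_eq_ln by (simp add: wex_diff del: wex.simps)
    then have "\<bar>A.U n A.s0 - B.U n B.s0\<bar> \<le> \<bar>wex P (n + 1) ?d\<bar> + \<bar>wex P n ?d\<bar>"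
      by (simp only: abs_triangle_ineq4)
    also have "\<dots> \<le> ?b + ?b" by (intro add_mono w1) auto
    also have "\<dots> = A.E1 * A.Q ^ n * z"
      using A.kap A.c0 by (simp add: A.E1_def A.Q_def power_divide power_add power_mult_distrib field_simps power2_eq_square)
    finally show ?thesis .
  qed
  have main: "\<bar>A.L - B.L\<bar> \<le> 2 * A.G * A.rho ^ n + A.E1 * A.Q ^ n * z" for n
    using A.U_close[OF A.st_s0, of n] B.U_close[OF B.st_s0, of n] Ud[of n] by linarith
  show ?thesis
  \<comment> \<open>For \<open>z = 0\<close> the balancing number of letters is infinite, so
    \<open>n\<close> is sent to infinity instead.\<close>
  proof (cases "z = 0")
    case True
    have "(\<lambda>n. 2 * A.G * A.rho ^ n) \<longlonglongrightarrow> 2 * A.G * 0"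
      using A.rho by (intro tendsto_mult tendsto_const LIMSEQ_realpow_zero) auto
    then have "\<bar>A.L - B.L\<bar> \<le> 2 * A.G * 0"
      using main True by (intro LIMSEQ_le_const[of _ _ "\<bar>A.L - B.L\<bar>"]) auto
    then show ?thesis using True by simp
  next
    case False
    then have z0: "0 < z" using z by simp
    have lQ: "0 < ln A.Q" using A.Q_gt1 by simp
    define y where "y = ln (1 / z) / (2 * ln A.Q)"
    have "0 \<le> ln (1 / z)" using z0 z by (intro ln_ge_zero) simp
    then have y0: "0 \<le> y" unfolding y_def using lQ by (intro divide_nonneg_pos) auto
    define n where "n = nat \<lfloor>y\<rfloor>"
    have n: "real n \<le> y" "y - 1 \<le> real n" using y0 unfolding n_def by linarith+
    have "A.Q ^ n * z \<le> z powr (1 / 2)"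
    proof -
      have "A.Q ^ n = A.Q powr real n" using A.Q_gt1 by (simp add: powr_realpow)
      also have "\<dots> \<le> A.Q powr y" using A.Q_gt1 n by (intro powr_mono) auto
      also have "\<dots> = exp (- (1 / 2) * ln z)" using A.Q_gt1 lQ z0 by (simp add: powr_def y_def ln_div field_simps)
      also have "\<dots> = z powr (- (1 / 2))" using z0 by (simp add: powr_def)
      finally have "A.Q ^ n * z \<le> z powr (- (1 / 2)) * z powr 1" using z0 by (intro mult_mono) auto
      then show ?thesis unfolding powr_add[symmetric] by simp
    qed
    also have "\<dots> \<le> z powr A.beta" using z0 z A.beta by (intro powr_mono') auto
    finally have 1: "A.Q ^ n * z \<le> z powr A.beta" .
    have "A.rho ^ n = A.rho powr real n" using A.rho by (simp add: powr_realpow)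
    also have "\<dots> \<le> A.rho powr (y - 1)" using A.rho n by (intro powr_mono') auto
    also have "\<dots> = exp (y * ln A.rho) / A.rho"
      using A.rho by (simp add: powr_diff) (simp add: powr_def)
    also have "exp (y * ln A.rho) = exp (- ln A.rho / (2 * ln A.Q) * ln z)"
      using z0 by (simp add: y_def ln_div)
    also have "\<dots> = z powr (- ln A.rho / (2 * ln A.Q))" using z0 by (simp add: powr_def)
    also have "z powr (- ln A.rho / (2 * ln A.Q)) / A.rho \<le> z powr A.beta / A.rho"
      using z0 z A.rho by (intro divide_right_mono powr_mono') (auto simp: A.beta_def)
    finally have 2: "A.rho ^ n \<le> z powr A.beta / A.rho" .
    have "\<bar>A.L - B.L\<bar> \<le> 2 * A.G * A.rho ^ n + A.E1 * (A.Q ^ n * z)" using main[of n] by (simp add: mult.assoc)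
    also have "\<dots> \<le> 2 * A.G * (z powr A.beta / A.rho) + A.E1 * z powr A.beta"
      using A.G_nonneg A.E1_nonneg 1 2 by (intro add_mono mult_left_mono) auto
    also have "\<dots> = A.CH * z powr A.beta" by (simp add: A.CH_def algebra_simps)
    finally show ?thesis .
  qed
qed

section \<open>Contraction from irreducibility\<close>

text \<open>The sequence space is infinite-dimensional, so compactness is built up by dimension:
  each cube is a continuous image of the previous one times an interval.\<close>

lemma compact_unit_cube: "compact {v :: rvec. suppN N v \<and> (\<forall>q. \<bar>v q\<bar> \<le> 1)}"
proof (induction N)
  case 0
  have "{v :: rvec. suppN 0 v \<and> (\<forall>q. \<bar>v q\<bar> \<le> 1)} = {0}"
    by (auto simp: suppN_def intro!: bcontfun_eqI)
  then show ?case by simp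
next
  case (Suc N)
  let ?f = "\<lambda>x :: rvec \<times> real. fst x + snd x *\<^sub>R ev N"
  have "{v :: rvec. suppN (Suc N) v \<and> (\<forall>q. \<bar>v q\<bar> \<le> 1)}
      = ?f ` ({v. suppN N v \<and> (\<forall>q. \<bar>v q\<bar> \<le> 1)} \<times> {-1..1})"
  proof (intro equalityI subsetI)
    fix v :: rvec assume v: "v \<in> {v :: rvec. suppN (Suc N) v \<and> (\<forall>q. \<bar>v q\<bar> \<le> 1)}"
    let ?u = "v - v N *\<^sub>R ev N"
    have "?u \<in> {v. suppN N v \<and> (\<forall>q. \<bar>v q\<bar> \<le> 1)}"
    proof -
      have "?u q = 0" if "q \<ge> N" for q
        using v that by (cases "q = N") (auto simp: suppN_def)
      moreover have "\<bar>?u q\<bar> \<le> 1" for q using v by auto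
      ultimately show ?thesis unfolding suppN_def by blast
    qed
    moreover have "v N \<in> {-1..1}" using v by (auto simp: abs_le_iff minus_le_iff)
    ultimately show "v \<in> ?f ` ({v. suppN N v \<and> (\<forall>q. \<bar>v q\<bar> \<le> 1)} \<times> {-1..1})"
      by (intro image_eqI[of _ _ "(?u, v N)"]) auto
  next
    fix v assume "v \<in> ?f ` ({v. suppN N v \<and> (\<forall>q. \<bar>v q\<bar> \<le> 1)} \<times> {-1..1})"
    then show "v \<in> {v. suppN (Suc N) v \<and> (\<forall>q. \<bar>v q\<bar> \<le> 1)}"
      by (auto simp: suppN_def)
  qed
  moreover have "compact (?f ` ({v. suppN N v \<and> (\<forall>q. \<bar>v q\<bar> \<le> 1)} \<times> {-1..1}))"
    by (intro compact_continuous_image compact_Times Suc compact_Icc continuous_intros)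
  ultimately show ?case by simp
qed

lemma tendsto_apply_bcontfun:
  assumes "(v :: nat \<Rightarrow> rvec) \<longlonglongrightarrow> l" shows "(\<lambda>k. v k q) \<longlonglongrightarrow> l q"
proof (rule Lim_null_comparison[THEN LIM_zero_cancel])
  show "\<forall>\<^sub>F k in sequentially. norm (v k q - l q) \<le> norm (v k - l)"
    using abs_apply_le_norm[of "v _ - l" q] by (intro always_eventually) auto
  show "(\<lambda>k. norm (v k - l)) \<longlonglongrightarrow> 0" using assms by (simp add: LIM_zero tendsto_norm_zero)
qed

lemma opN_continuous:
  assumes T: "opN N T" and v: "(v :: nat \<Rightarrow> rvec) \<longlonglongrightarrow> l" shows "(\<lambda>k. T (v k)) \<longlonglongrightarrow> T l"
proof -
  have "(\<lambda>k. \<Sum>q<N. v k q *\<^sub>R T (ev q)) \<longlonglongrightarrow> (\<Sum>q<N. l q *\<^sub>R T (ev q))"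
    by (intro tendsto_intros tendsto_apply_bcontfun v)
  then show ?thesis by (simp only: opN_expand[OF T, symmetric])
qed

text \<open>The inverse is written through finitely many coordinates, hence passes to limits
  coordinatewise. It serves to show that the range of \<open>T\<close> is closed, so that limits of
  unit vectors in a range are again states.\<close>

lemma opN_right_inverse:
  assumes T: "opN N T"
  shows "\<exists>G. \<forall>v \<in> range T. T (\<Sum>q<N. apply_bcontfun v q *\<^sub>R G q) = v"
proof -
  obtain g where g: "linear g" "\<forall>v\<in>range T. T (g v) = v"
    using linear_exists_right_inverse_on[OF opN_linear[OF T] subspace_UNIV] by auto
  have "T (\<Sum>q<N. apply_bcontfun v q *\<^sub>R g (ev q)) = v" if "v \<in> range T" for v
  proof -
    have "suppN N v" using that opN_supp[OF T] by auto
    then have e: "(\<Sum>q<N. v q *\<^sub>R ev q) = v" by (rule suppN_decomp[symmetric])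
    have "g (\<Sum>q<N. v q *\<^sub>R ev q) = (\<Sum>q<N. v q *\<^sub>R g (ev q))"
      by (simp add: linear_sum[OF g(1)] linear_scale[OF g(1)])
    then have "T (\<Sum>q<N. v q *\<^sub>R g (ev q)) = T (g v)" unfolding e by simp
    then show ?thesis using g(2) that by simp
  qed
  then show ?thesis by (intro exI[of _ "\<lambda>q. g (ev q)"] ballI)
qed

lemma range_sphere_seq_compact:
  assumes T: "opN N T" and v: "\<And>k::nat. v k \<in> range T" "\<And>k. norm (v k) = 1"
  obtains l r where "l \<in> range T" "norm l = 1" "strict_mono (r :: nat \<Rightarrow> nat)" "(v \<circ> r) \<longlonglongrightarrow> l"
proof -
  have K: "\<forall>k. v k \<in> {v. suppN N v \<and> (\<forall>q. \<bar>v q\<bar> \<le> 1)}"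
  proof
    fix k
    obtain x where "v k = T x" using v(1)[of k] by blast
    then have "suppN N (v k)" by (simp add: opN_supp[OF T])
    moreover have "\<bar>v k q\<bar> \<le> 1" for q using abs_apply_le_norm[of "v k" q] v(2)[of k] by simp
    ultimately show "v k \<in> {v. suppN N v \<and> (\<forall>q. \<bar>v q\<bar> \<le> 1)}" by blast
  qed
  obtain l r where lr: "strict_mono (r :: nat \<Rightarrow> nat)" "(v \<circ> r) \<longlonglongrightarrow> l"
    by (rule seq_compactE[OF compact_imp_seq_compact[OF compact_unit_cube] K])
  obtain G where G: "\<And>v. v \<in> range T \<Longrightarrow> T (\<Sum>q<N. apply_bcontfun v q *\<^sub>R G q) = v"
    using opN_right_inverse[OF T] by blast
  have "(\<lambda>k. \<Sum>q<N. (v \<circ> r) k q *\<^sub>R G q) \<longlonglongrightarrow> (\<Sum>q<N. l q *\<^sub>R G q)"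
    by (intro tendsto_intros tendsto_apply_bcontfun lr)
  then have "(\<lambda>k. T (\<Sum>q<N. (v \<circ> r) k q *\<^sub>R G q)) \<longlonglongrightarrow> T (\<Sum>q<N. l q *\<^sub>R G q)"
    by (rule opN_continuous[OF T])
  then have "(v \<circ> r) \<longlonglongrightarrow> T (\<Sum>q<N. l q *\<^sub>R G q)"
    using G[OF v(1)] by (simp add: comp_def)
  then have 1: "l \<in> range T" using LIMSEQ_unique[OF lr(2)] by blast
  have "(\<lambda>k. norm ((v \<circ> r) k)) \<longlonglongrightarrow> norm l" by (intro tendsto_norm lr)
  then have "norm l = 1" using v(2) by (simp add: comp_def LIMSEQ_const_iff)
  then show ?thesis using that 1 lr by blast
qed

lemma injective_self_map_onto:
  assumes W: "Real_Vector_Spaces.subspace W" "\<And>v. v \<in> W \<Longrightarrow> suppN N v"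
    and f: "linear f" "\<And>v. v \<in> W \<Longrightarrow> f v \<in> W" "\<And>v. v \<in> W \<Longrightarrow> f v = 0 \<Longrightarrow> v = 0"
  shows "f ` W = W"
proof
  show "f ` W \<subseteq> W" using f(2) by auto
  have inj: "inj_on f W"
  proof (rule inj_onI)
    fix x y assume "x \<in> W" "y \<in> W" "f x = f y"
    then have "x - y \<in> W" "f (x - y) = 0"
      using W(1) f(1) by (auto simp: subspace_diff linear_diff)
    then show "x = y" using f(3) by force
  qed
  obtain B where B: "B \<subseteq> W" "independent B" "W \<subseteq> span B"
    using maximal_independent_subset by blast
  have "W \<subseteq> span (ev ` {..<N})"
  proof
    fix v assume "v \<in> W"
    then have "v = (\<Sum>q<N. v q *\<^sub>R ev q)" using W(2) suppN_decomp by blast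
    also have "\<dots> \<in> span (ev ` {..<N})" by (intro span_sum span_scale span_base) auto
    finally show "v \<in> span (ev ` {..<N})" .
  qed
  then have finB: "finite B" using independent_span_bound[of "ev ` {..<N}" B] B by auto
  have spB: "span B = W" using B W(1) by (simp add: span_minimal subset_antisym)
  have injB: "inj_on f (span B)" using inj spB by simp
  have indf: "independent (f ` B)"
    using linear_independent_injective_image[OF f(1) B(2) injB] .
  have fBW: "f ` B \<subseteq> span B" using B(1) f(2) spB by auto
  have card: "card (f ` B) = card B"
    using inj B(1) by (intro card_image) (rule inj_on_subset)
  show "W \<subseteq> f ` W"
  proof
    fix y assume y: "y \<in> W"
    have "y \<in> span (f ` B)"
    proof (rule ccontr)
      assume ny: "y \<notin> span (f ` B)"
      then have "independent (insert y (f ` B))" using indf by (rule independent_insertI)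
      moreover have "insert y (f ` B) \<subseteq> span B" using fBW y spB by auto
      ultimately have "card (insert y (f ` B)) \<le> card B"
        using independent_span_bound[OF finB] by blast
      moreover have "y \<notin> f ` B" using ny span_base[of y "f ` B"] by auto
      ultimately show False using card finB by simp
    qed
    then show "y \<in> f ` W" using linear_span_image[OF f(1), of B] spB by simp
  qed
qed

lemma (in linear_cocycle) fold_in_range: "w \<noteq> [] \<Longrightarrow> fold D w x \<in> range (D (last w))"
  by (cases w rule: rev_cases) auto

lemma (in linear_cocycle) m2_fold_le: "m2 N (fold D w) \<le> 2 * real N ^ 4 * (K ^ length w)\<^sup>2"
proof -
  have "wd N (fold D w (ev q)) (fold D w (ev s)) \<le> 2 * (real N)\<^sup>2 * (K ^ length w * K ^ length w)" for q s
  proof -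
    have "norm (fold D w (ev q)) * norm (fold D w (ev s)) \<le> K ^ length w * K ^ length w"
      using norm_fold_upper[of w "ev q"] norm_fold_upper[of w "ev s"] K by (intro mult_mono) auto
    then have "2 * (real N)\<^sup>2 * (norm (fold D w (ev q)) * norm (fold D w (ev s))) \<le> 2 * (real N)\<^sup>2 * (K ^ length w * K ^ length w)"
      by (intro mult_left_mono) auto
    then show ?thesis using wd_le[of N "fold D w (ev q)" "fold D w (ev s)"] by linarith
  qed
  then have "m2 N (fold D w) \<le> (\<Sum>q<N. \<Sum>s<N. 2 * (real N)\<^sup>2 * (K ^ length w * K ^ length w))"
    unfolding m2_def by (intro sum_mono)
  then show ?thesis by (simp add: power2_eq_square eval_nat_numeral mult_ac)
qed

text \<open>\<open>onto\<close> is the second half of the rank condition: D c D a has the same range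
  as D c, so prepending a letter loses at most a constant factor of the norm. \<open>decay\<close>
  expresses the gap: all directions but one are exponentially suppressed relative to the
  norm.\<close>

locale irreducible_linear_cocycle = linear_cocycle +
  fixes g :: real
  assumes pos: "0 < pmf P c"
    and onto: "\<exists>y. D c x = D c (D a y)"
    and nonzero: "\<exists>x. D a x \<noteq> 0"
    and irreducible: "\<not> (\<exists>W. \<forall>a. Real_Vector_Spaces.subspace (W a) \<and> W a \<noteq> {0} \<and> W a \<subset> range (D a) \<and> (\<forall>b. D a ` W b = W a))"
    and g: "0 < g"
    and decay: "AE \<omega> in bern P. \<forall>\<^sub>F n in sequentially.
        m2 N (fold D (pre n \<omega>)) \<le> exp (- g * real n) * (nm N (fold D (pre n \<omega>)))\<^sup>2"
begin

section \<open>Growth of a vector relative to the norm of the product\<close>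

lemma nm_pos: "w \<noteq> [] \<Longrightarrow> 0 < nm N (fold D w)"
proof -
  assume "w \<noteq> []"
  then obtain c w' where w: "w = c # w'" by (cases w) auto
  obtain x where x: "D c x \<noteq> 0" using nonzero by blast
  then have "st c (D c x)" by (auto simp: st_def)
  then obtain b where "st b (fold D w' (D c x))" using fold_st by blast
  then have nz: "fold D w x \<noteq> 0" by (simp add: w st_def)
  have "norm (fold D w x) \<le> nm N (fold D w) * norm x"
    using w by (intro opN_norm_le opN_fold) auto
  then have "nm N (fold D w) \<noteq> 0" using nz by auto
  then show ?thesis using nm_nonneg[of N "fold D w"] by linarith
qed

definition r where "r w v = norm (fold D w v) / nm N (fold D w)"

lemma r_nonneg: "0 \<le> r w v"
  by (simp add: r_def nm_nonneg)

lemma r_diff_le: "w \<noteq> [] \<Longrightarrow> r w v \<le> r w u + norm (v - u)"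
proof -
  assume w: "w \<noteq> []"
  have "norm (fold D w v) \<le> norm (fold D w u) + norm (fold D w (v - u))"
    using norm_triangle_ineq[of "fold D w u" "fold D w (v - u)"] by (simp add: linear_diff[OF linear_fold])
  also have "\<dots> \<le> norm (fold D w u) + nm N (fold D w) * norm (v - u)"
    using opN_norm_le[OF opN_fold[OF w]] by simp
  finally have "norm (fold D w v) / nm N (fold D w) \<le> (norm (fold D w u) + nm N (fold D w) * norm (v - u)) / nm N (fold D w)"
    using nm_pos[OF w] by (intro divide_right_mono) auto
  then show ?thesis using nm_pos[OF w] by (simp add: r_def add_divide_distrib)
qed

lemma r_scale: "r w (s *\<^sub>R v) = \<bar>s\<bar> * r w v"
  by (simp add: r_def linear_scale[OF linear_fold])

definition Cr where "Cr = 4 * K * real N ^ 3 / kap"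

text \<open>The difference of the two quotients is a cross difference between
  \<open>fold D w v\<close> and the columns of \<open>fold D w\<close>; by
  \<open>norm_swap_le\<close> and \<open>wd_image_le\<close> it is governed by the second exterior
  power. Under \<open>decay\<close> these bounds are summable along an orbit.\<close>

lemma r_step:
  assumes w: "w \<noteq> []"
  shows "\<bar>r (w @ [c]) v - r w v\<bar> \<le> Cr * (m2 N (fold D w) / (nm N (fold D w))\<^sup>2) * norm v"
proof -
  let ?T = "fold D w" and ?T' = "fold D (w @ [c])"
  have T: "opN N ?T" by (rule opN_fold[OF w])
  have n: "0 < nm N ?T" "0 < nm N ?T'" using w by (auto intro: nm_pos simp del: fold_append)
  have n': "kap * nm N ?T \<le> nm N ?T'"
  proof -
    have "kap * norm (?T (ev q)) \<le> norm (?T' (ev q))" for q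
    proof -
      obtain z where "?T (ev q) = D (last w) z" using fold_in_range[OF w] by blast
      then show ?thesis using lower[of "last w" z c] by simp
    qed
    then show ?thesis unfolding nm_def sum_distrib_left by (intro sum_mono)
  qed
  have one: "\<bar>norm (?T' v) * norm (?T (ev q)) - norm (?T v) * norm (?T' (ev q))\<bar> \<le> 4 * K * (real N)\<^sup>2 * m2 N ?T * norm v" for q
  proof -
    have "\<bar>norm (D c (?T v)) * norm (?T (ev q)) - norm (?T v) * norm (D c (?T (ev q)))\<bar> \<le> 2 * K * wd N (?T v) (?T (ev q))"
      using K by (intro norm_swap_le opN_linear[OF op] upper opN_supp[OF T]) auto
    also have "\<dots> \<le> 2 * K * (m2 N ?T * (2 * (real N)\<^sup>2 * (norm v * norm (ev q))))"
      using K by (intro mult_left_mono order_trans[OF wd_image_le[OF T]] wd_le m2_nonneg) auto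
    finally show ?thesis by (simp add: mult_ac)
  qed
  have "\<bar>norm (?T' v) * nm N ?T - norm (?T v) * nm N ?T'\<bar>
     = \<bar>\<Sum>q<N. norm (?T' v) * norm (?T (ev q)) - norm (?T v) * norm (?T' (ev q))\<bar>"
    by (simp add: nm_def sum_distrib_left sum_subtractf)
  also have "\<dots> \<le> (\<Sum>q<N. 4 * K * (real N)\<^sup>2 * m2 N ?T * norm v)"
    by (rule sum_abs[THEN order_trans]) (intro sum_mono one)
  also have "\<dots> = 4 * K * real N ^ 3 * m2 N ?T * norm v" by (simp add: power2_eq_square power3_eq_cube)
  finally have num: "\<bar>norm (?T' v) * nm N ?T - norm (?T v) * nm N ?T'\<bar> \<le> 4 * K * real N ^ 3 * m2 N ?T * norm v" .
  have "r (w @ [c]) v - r w v = (norm (?T' v) * nm N ?T - norm (?T v) * nm N ?T') / (nm N ?T' * nm N ?T)"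
    unfolding r_def using n by (simp add: field_simps)
  then have "\<bar>r (w @ [c]) v - r w v\<bar> = \<bar>norm (?T' v) * nm N ?T - norm (?T v) * nm N ?T'\<bar> / (nm N ?T' * nm N ?T)"
    using n by (simp add: abs_mult)
  also have "\<dots> \<le> (4 * K * real N ^ 3 * m2 N ?T * norm v) / (nm N ?T' * nm N ?T)"
    using n num by (intro divide_right_mono) auto
  also have "\<dots> \<le> (4 * K * real N ^ 3 * m2 N ?T * norm v) / (kap * nm N ?T * nm N ?T)"
    using n n' kap K m2_nonneg[of N ?T] by (intro divide_left_mono mult_right_mono mult_pos_pos) auto
  also have "\<dots> = Cr * (m2 N ?T / (nm N ?T)\<^sup>2) * norm v"
    by (simp add: Cr_def power2_eq_square)
  finally show ?thesis .
qed

text \<open>Makes the random time in \<open>decay\<close> deterministic: the decay holds from the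
  fixed time \<open>m\<close> on, and the probability of \<open>Gd m\<close> tends to 1.\<close>

definition Gd where "Gd m = {\<omega>. \<forall>n\<ge>m. m2 N (fold D (pre n \<omega>)) \<le> exp (- g * real n) * (nm N (fold D (pre n \<omega>)))\<^sup>2}"

lemma Gd_sets: "Gd m \<in> sets (bern P)"
proof -
  have "{\<omega> \<in> space (bern P). \<forall>n. n \<ge> m \<longrightarrow> m2 N (fold D (pre n \<omega>)) \<le> exp (- g * real n) * (nm N (fold D (pre n \<omega>)))\<^sup>2} \<in> sets (bern P)"
    by measurable
  then show ?thesis by (simp add: Gd_def)
qed

lemma Gd_prob: "(\<lambda>m. measure (bern P) (Gd m)) \<longlonglongrightarrow> 1"
proof -
  interpret B: prob_space "bern P" by (rule prob_space_bern)
  have "(\<lambda>m. measure (bern P) (Gd m)) \<longlonglongrightarrow> measure (bern P) (\<Union>m. Gd m)"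
    using Gd_sets by (intro B.finite_Lim_measure_incseq) (auto simp: incseq_def Gd_def)
  moreover have "measure (bern P) (\<Union>m. Gd m) = 1"
  proof (rule B.prob_eq_1[THEN iffD2])
    show "AE \<omega> in bern P. \<omega> \<in> (\<Union>m. Gd m)"
      using decay by eventually_elim (auto simp: Gd_def eventually_sequentially)
  qed (use Gd_sets in auto)
  ultimately show ?thesis by simp
qed

definition Cs where "Cs = Cr / (1 - exp (- g))"

lemma Cs_nonneg: "0 \<le> Cs"
  using K kap g by (simp add: Cs_def Cr_def)

text \<open>Sums \<open>r_step\<close> over a geometric series. On \<open>Gd m\<close> a small
  relative growth at a single time therefore stays small at all later times;
  \<open>r_uniform\<close> passes from one time to the limit in this way.\<close>

lemma r_later:
  assumes w: "\<omega> \<in> Gd m" and n: "m \<le> n" "1 \<le> n" and v: "norm v = 1"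
  shows "r (pre (n + j) \<omega>) v \<le> r (pre n \<omega>) v + Cs * exp (- g * real n)"
proof -
  let ?q = "exp (- g)"
  have q: "0 < ?q" "?q < 1" using g by auto
  have Cr: "0 \<le> Cr" using K kap by (simp add: Cr_def)
  have "r (pre (n + j) \<omega>) v \<le> r (pre n \<omega>) v + Cr * (exp (- g * real n) * (\<Sum>i<j. ?q ^ i))"
  proof (induction j)
    case 0
    then show ?case by simp
  next
    case (Suc j)
    let ?w = "pre (n + j) \<omega>"
    have ne: "?w \<noteq> []" using n by (metis add_is_0 length_pre list.size(3) not_one_le_zero)
    have "m2 N (fold D ?w) \<le> exp (- g * real (n + j)) * (nm N (fold D ?w))\<^sup>2"
      using w n(1) trans_le_add1[of m n j] unfolding Gd_def by blast
    then have "m2 N (fold D ?w) / (nm N (fold D ?w))\<^sup>2 \<le> exp (- g * real (n + j))"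
      using nm_pos[OF ne] by (simp add: pos_divide_le_eq)
    then have "Cr * (m2 N (fold D ?w) / (nm N (fold D ?w))\<^sup>2) * norm v \<le> Cr * exp (- g * real (n + j))"
      unfolding v mult_1_right using Cr by (rule mult_left_mono)
    moreover have "exp (- g * real (n + j)) = exp (- g * real n) * ?q ^ j"
      by (simp add: exp_add[symmetric] exp_of_nat_mult[symmetric] algebra_simps)
    moreover have "pre (n + Suc j) \<omega> = ?w @ [\<omega> (n + j)]" using pre_Suc[of "n + j" \<omega>] by simp
    ultimately have "r (pre (n + Suc j) \<omega>) v \<le> r ?w v + Cr * (exp (- g * real n) * ?q ^ j)"
      using r_step[OF ne, of "\<omega> (n + j)" v] by (simp add: abs_le_iff)
    then show ?case using Suc by (simp add: algebra_simps)
  qed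
  moreover have "(\<Sum>i<j. ?q ^ i) \<le> 1 / (1 - ?q)"
    using q by (simp add: sum_gp_strict divide_right_mono)
  then have "Cr * (exp (- g * real n) * (\<Sum>i<j. ?q ^ i)) \<le> Cr * (exp (- g * real n) * (1 / (1 - ?q)))"
    using Cr by (intro mult_left_mono) auto
  ultimately show ?thesis by (simp add: Cs_def mult_ac)
qed

text \<open>Convergence of \<open>r\<close> to 0, spelled out with countable quantifiers so that
  measurability is immediate.\<close>

definition Z where "Z v = {\<omega>. \<forall>j. \<exists>m. \<forall>n\<ge>m. r (pre n \<omega>) v < 1 / real (Suc j)}"

lemma Z_sets: "Z v \<in> sets (bern P)"
proof -
  have "{\<omega> \<in> space (bern P). \<forall>j. \<exists>m. \<forall>n. n \<ge> m \<longrightarrow> r (pre n \<omega>) v < 1 / real (Suc j)} \<in> sets (bern P)"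
    by measurable
  then show ?thesis by (simp add: Z_def)
qed

lemma Z_iff: "\<omega> \<in> Z v \<longleftrightarrow> (\<lambda>n. r (pre n \<omega>) v) \<longlonglongrightarrow> 0"
proof
  assume z: "\<omega> \<in> Z v"
  show "(\<lambda>n. r (pre n \<omega>) v) \<longlonglongrightarrow> 0"
  proof (rule tendstoI)
    fix e :: real assume "e > 0"
    then obtain j where j: "1 / real (Suc j) < e" using nat_approx_posE by blast
    obtain m where "\<And>n. n \<ge> m \<Longrightarrow> r (pre n \<omega>) v < 1 / real (Suc j)" using z unfolding Z_def by blast
    then show "\<forall>\<^sub>F n in sequentially. dist (r (pre n \<omega>) v) 0 < e"
      unfolding eventually_sequentially using r_nonneg j by (intro exI[of _ m]) force
  qed
next
  assume "(\<lambda>n. r (pre n \<omega>) v) \<longlonglongrightarrow> 0"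
  then have "\<forall>\<^sub>F n in sequentially. r (pre n \<omega>) v < 1 / real (Suc j)" for j
    by (rule order_tendstoD) simp
  then show "\<omega> \<in> Z v" by (auto simp: Z_def eventually_sequentially)
qed

text \<open>An extra first letter hardly affects the norm of a product. One direction is
  boundedness; the other uses \<open>onto\<close> to write each column of the shorter product as the
  longer product applied to one of finitely many fixed vectors \<open>Y b c q\<close>.\<close>

lemma nm_cons_bounds:
  "\<exists>C\<ge>1. \<forall>w c. w \<noteq> [] \<longrightarrow> nm N (fold D w) \<le> C * nm N (fold D (c # w)) \<and> nm N (fold D (c # w)) \<le> C * nm N (fold D w)"
proof -
  define Y where "Y = (\<lambda>b c q. SOME y. D b (ev q) = D b (D c y))"
  have Y: "D b (ev q) = D b (D c (Y b c q))" for b c q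
    unfolding Y_def by (rule someI_ex[OF onto])
  define C where "C = 1 + real N * K + real N * (\<Sum>b\<in>UNIV. \<Sum>c\<in>UNIV. \<Sum>q<N. norm (Y b c q))"
  have Yb: "norm (Y b c q) \<le> (\<Sum>b\<in>UNIV. \<Sum>c\<in>UNIV. \<Sum>q<N. norm (Y b c q))" if "q < N" for b c q
  proof -
    have "norm (Y b c q) \<le> (\<Sum>q<N. norm (Y b c q))" using that by (intro member_le_sum) auto
    also have "\<dots> \<le> (\<Sum>c\<in>UNIV. \<Sum>q<N. norm (Y b c q))"
      by (intro member_le_sum[of c _ "\<lambda>c. \<Sum>q<N. norm (Y b c q)"]) (auto intro: sum_nonneg)
    also have "\<dots> \<le> (\<Sum>b\<in>UNIV. \<Sum>c\<in>UNIV. \<Sum>q<N. norm (Y b c q))"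
      by (intro member_le_sum[of b _ "\<lambda>b. \<Sum>c\<in>UNIV. \<Sum>q<N. norm (Y b c q)"]) (auto intro!: sum_nonneg)
    finally show ?thesis .
  qed
  have S0: "0 \<le> (\<Sum>b\<in>UNIV. \<Sum>c\<in>UNIV. \<Sum>q<N. norm (Y b c q))" by (intro sum_nonneg) auto
  have "nm N (fold D w) \<le> C * nm N (fold D (c # w))" if w: "w \<noteq> []" for w c
  proof -
    obtain b w' where w': "w = b # w'" using w by (cases w) auto
    have o: "opN N (fold D (c # w))" by (rule opN_fold) simp
    have "norm (fold D w (ev q)) \<le> nm N (fold D (c # w)) * (\<Sum>b\<in>UNIV. \<Sum>c\<in>UNIV. \<Sum>q<N. norm (Y b c q))" if "q < N" for q
    proof -
      have "fold D w (ev q) = fold D (c # w) (Y b c q)" using Y[of b q c] by (simp add: w')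
      also have "norm \<dots> \<le> nm N (fold D (c # w)) * norm (Y b c q)" by (rule opN_norm_le[OF o])
      also have "\<dots> \<le> nm N (fold D (c # w)) * (\<Sum>b\<in>UNIV. \<Sum>c\<in>UNIV. \<Sum>q<N. norm (Y b c q))"
        using Yb[OF that] nm_nonneg by (intro mult_left_mono) auto
      finally show ?thesis .
    qed
    then have "nm N (fold D w) \<le> (\<Sum>q<N. nm N (fold D (c # w)) * (\<Sum>b\<in>UNIV. \<Sum>c\<in>UNIV. \<Sum>q<N. norm (Y b c q)))"
      unfolding nm_def[of N "fold D w"] by (intro sum_mono) auto
    also have "\<dots> = (real N * (\<Sum>b\<in>UNIV. \<Sum>c\<in>UNIV. \<Sum>q<N. norm (Y b c q))) * nm N (fold D (c # w))" by simp
    also have "\<dots> \<le> C * nm N (fold D (c # w))"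
      using nm_nonneg K by (intro mult_right_mono) (auto simp: C_def)
    finally show ?thesis .
  qed
  moreover have "nm N (fold D (c # w)) \<le> C * nm N (fold D w)" if w: "w \<noteq> []" for w c
  proof -
    have "norm (fold D w (D c (ev q))) \<le> nm N (fold D w) * K" for q
    proof -
      have "norm (fold D w (D c (ev q))) \<le> nm N (fold D w) * norm (D c (ev q))"
        by (rule opN_norm_le[OF opN_fold[OF w]])
      also have "\<dots> \<le> nm N (fold D w) * K"
        using upper[of c "ev q"] nm_nonneg by (intro mult_left_mono) auto
      finally show ?thesis .
    qed
    then have "nm N (fold D (c # w)) \<le> (\<Sum>q<N. nm N (fold D w) * K)"
      unfolding nm_def[of N "fold D (c # w)"] by (intro sum_mono) simp
    also have "\<dots> = (real N * K) * nm N (fold D w)" by simp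
    also have "\<dots> \<le> C * nm N (fold D w)"
      using nm_nonneg S0 by (intro mult_right_mono) (auto simp: C_def)
    finally show ?thesis .
  qed
  moreover have "1 \<le> C" using K S0 by (simp add: C_def)
  ultimately show ?thesis by blast
qed

lemma Z_case_nat: "case_nat c \<omega> \<in> Z v \<longleftrightarrow> \<omega> \<in> Z (D c v)"
proof -
  obtain C where C: "C \<ge> 1" "\<And>w c. w \<noteq> [] \<Longrightarrow> nm N (fold D w) \<le> C * nm N (fold D (c # w))"
    "\<And>w c. w \<noteq> [] \<Longrightarrow> nm N (fold D (c # w)) \<le> C * nm N (fold D w)"
    using nm_cons_bounds by metis
  have b: "r (c # w) v \<le> C * r w (D c v)" "r w (D c v) \<le> C * r (c # w) v" if w: "w \<noteq> []" for w
  proof -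
    have n: "0 < nm N (fold D w)" "0 < nm N (fold D (c # w))" by (rule nm_pos[OF w], rule nm_pos, simp)
    have "norm (fold D w (D c v)) * nm N (fold D w) \<le> norm (fold D w (D c v)) * (C * nm N (fold D (c # w)))"
      by (intro mult_left_mono C w) auto
    then show "r (c # w) v \<le> C * r w (D c v)" using n by (simp add: r_def field_simps del: fold_simps)
    have "norm (fold D w (D c v)) * nm N (fold D (c # w)) \<le> norm (fold D w (D c v)) * (C * nm N (fold D w))"
      by (intro mult_left_mono C w) auto
    then show "r w (D c v) \<le> C * r (c # w) v" using n by (simp add: r_def field_simps del: fold_simps)
  qed
  have ne: "pre n \<omega> \<noteq> []" if "1 \<le> n" for n using that by (metis length_pre list.size(3) not_one_le_zero)
  have "(\<lambda>n. r (pre n (case_nat c \<omega>)) v) \<longlonglongrightarrow> 0 \<longleftrightarrow> (\<lambda>n. r (c # pre n \<omega>) v) \<longlonglongrightarrow> 0"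
    by (subst filterlim_sequentially_Suc[symmetric]) simp
  also have "\<dots> \<longleftrightarrow> (\<lambda>n. r (pre n \<omega>) (D c v)) \<longlonglongrightarrow> 0"
  proof
    assume *: "(\<lambda>n. r (c # pre n \<omega>) v) \<longlonglongrightarrow> 0"
    show "(\<lambda>n. r (pre n \<omega>) (D c v)) \<longlonglongrightarrow> 0"
    proof (rule tendsto_sandwich[OF _ _ tendsto_const])
      show "(\<lambda>n. C * r (c # pre n \<omega>) v) \<longlonglongrightarrow> 0" using tendsto_mult_right_zero[OF *] by simp
      show "\<forall>\<^sub>F n in sequentially. r (pre n \<omega>) (D c v) \<le> C * r (c # pre n \<omega>) v"
        using eventually_ge_at_top[of 1] by eventually_elim (intro b ne)
    qed (simp add: r_nonneg)
  next
    assume *: "(\<lambda>n. r (pre n \<omega>) (D c v)) \<longlonglongrightarrow> 0"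
    show "(\<lambda>n. r (c # pre n \<omega>) v) \<longlonglongrightarrow> 0"
    proof (rule tendsto_sandwich[OF _ _ tendsto_const])
      show "(\<lambda>n. C * r (pre n \<omega>) (D c v)) \<longlonglongrightarrow> 0" using tendsto_mult_right_zero[OF *] by simp
      show "\<forall>\<^sub>F n in sequentially. r (c # pre n \<omega>) v \<le> C * r (pre n \<omega>) (D c v)"
        using eventually_ge_at_top[of 1] by eventually_elim (intro b ne)
    qed (simp add: r_nonneg)
  qed
  finally show ?thesis by (simp add: Z_iff)
qed

lemma Z_shift: "\<omega> \<in> Z v \<longleftrightarrow> lshift n \<omega> \<in> Z (fold D (pre n \<omega>) v)"
proof (induction n arbitrary: v \<omega>)
  case (Suc n)
  have dec: "\<omega> = case_nat (\<omega> 0) (lshift 1 \<omega>)" by (auto simp: lshift_def split: nat.split)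
  have "\<omega> \<in> Z v \<longleftrightarrow> lshift 1 \<omega> \<in> Z (D (\<omega> 0) v)" by (subst dec) (rule Z_case_nat)
  also have "\<dots> \<longleftrightarrow> lshift n (lshift 1 \<omega>) \<in> Z (fold D (pre n (lshift 1 \<omega>)) (D (\<omega> 0) v))" by (rule Suc)
  also have "fold D (pre n (lshift 1 \<omega>)) (D (\<omega> 0) v) = fold D (pre (Suc n) \<omega>) v"
    by (subst (2) dec) simp
  finally show ?case by (simp add: lshift_lshift)
qed simp

section \<open>The probability of slow growth\<close>

definition gz where "gz v = measure (bern P) (Z v)"

lemma gz_le1: "gz v \<le> 1"
  unfolding gz_def by (rule prob_space.prob_le_1[OF prob_space_bern])

lemma gz_harmonic: "gz v = (\<Sum>c\<in>UNIV. pmf P c * gz (D c v))"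
  unfolding gz_def by (subst measure_bern_step[OF Z_sets]) (simp add: Z_case_nat)

lemma gz_scale: "s \<noteq> 0 \<Longrightarrow> gz (s *\<^sub>R v) = gz v"
proof -
  assume s: "s \<noteq> 0"
  have "Z (s *\<^sub>R v) = Z v"
    using s tendsto_mult_left_iff[of "\<bar>s\<bar>" _ 0] by (auto simp: set_eq_iff Z_iff r_scale)
  then show ?thesis by (simp add: gz_def)
qed

text \<open>Maximum principle: every letter has positive probability, so one strictly smaller
  successor would make the average strictly smaller.\<close>

lemma gz_harmonic_max:
  assumes "\<And>c. gz (D c v) \<le> gz v" shows "gz (D c v) = gz v"
proof (rule ccontr)
  assume ne: "gz (D c v) \<noteq> gz v"
  have "(\<Sum>c\<in>UNIV. pmf P c * gz (D c v)) < (\<Sum>c\<in>UNIV. pmf P c * gz v)"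
  proof (rule sum_strict_mono_ex1)
    show "\<exists>c\<in>UNIV. pmf P c * gz (D c v) < pmf P c * gz v"
      using assms[of c] ne pos[of c] by (intro bexI[of _ c]) auto
  qed (auto intro!: mult_left_mono assms)
  also have "\<dots> = gz v" by (simp add: sum_distrib_right[symmetric] sum_pmf_eq_1)
  finally show False using gz_harmonic[of v] by simp
qed

text \<open>Almost surely slow vectors form an invariant family of subspaces, which irreducibility forces to be trivial.\<close>
definition W where "W a = {v \<in> range (D a). gz v = 1}"

lemma gz1_iff: "gz v = 1 \<longleftrightarrow> (AE \<omega> in bern P. \<omega> \<in> Z v)"
  unfolding gz_def by (rule prob_space.prob_eq_1[OF prob_space_bern Z_sets])

lemma subspace_range: "Real_Vector_Spaces.subspace (range (D a))"
  using linear_subspace_image[OF opN_linear[OF op] subspace_UNIV] .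

lemma subspace_W: "Real_Vector_Spaces.subspace (W a)"
proof (rule subspaceI)
  have "Z 0 = UNIV" by (auto simp: Z_def r_def linear_0[OF linear_fold])
  then have "gz 0 = 1" using prob_space.prob_space[OF prob_space_bern, of P] by (simp add: gz_def)
  then show "0 \<in> W a" using subspace_0[OF subspace_range] by (simp add: W_def)
  fix x assume x: "x \<in> W a"
  show "c *\<^sub>R x \<in> W a" for c
    using x subspace_scale[OF subspace_range] gz_scale[of c x] \<open>0 \<in> W a\<close> by (cases "c = 0") (auto simp: W_def)
  fix y assume y: "y \<in> W a"
  have "AE \<omega> in bern P. \<omega> \<in> Z x" "AE \<omega> in bern P. \<omega> \<in> Z y" using x y by (auto simp: W_def gz1_iff)
  then have "AE \<omega> in bern P. \<omega> \<in> Z (x + y)"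
  proof eventually_elim
    case (elim \<omega>)
    have le: "r w (x + y) \<le> r w x + r w y" for w
      unfolding r_def add_divide_distrib[symmetric] linear_add[OF linear_fold]
      by (intro divide_right_mono norm_triangle_ineq nm_nonneg)
    have lim: "(\<lambda>n. r (pre n \<omega>) x + r (pre n \<omega>) y) \<longlonglongrightarrow> 0"
      using tendsto_add[of "\<lambda>n. r (pre n \<omega>) x" 0 _ "\<lambda>n. r (pre n \<omega>) y" 0] elim by (simp add: Z_iff)
    show ?case unfolding Z_iff
      by (rule tendsto_sandwich[OF _ _ tendsto_const lim]) (simp_all add: r_nonneg le)
  qed
  then show "x + y \<in> W a" using x y subspace_add[OF subspace_range] by (auto simp: W_def gz1_iff)
qed

lemma W_step: "v \<in> W a \<Longrightarrow> D c v \<in> W c"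
  using gz_harmonic_max[of v c] gz_le1 by (auto simp: W_def)

lemma D_inj_range: "v \<in> range (D a) \<Longrightarrow> D c v = 0 \<Longrightarrow> v = 0"
proof -
  assume "v \<in> range (D a)" and z: "D c v = 0"
  then obtain x where "v = D a x" by blast
  then have "kap * norm v \<le> 0" using lower[of a x c] z by simp
  then show "v = 0" using kap by (simp add: mult_le_0_iff)
qed

text \<open>The inclusion follows from the maximum principle, as 1 is the largest value of
  \<open>gz\<close>. For equality, D a D c maps the finite-dimensional space \<open>W a\<close>
  injectively into itself, hence onto; then \<open>D a\<close> is cancelled, being injective on the
  range of \<open>D c\<close>.\<close>

lemma W_image: "D c ` W a = W c"
proof
  show "D c ` W a \<subseteq> W c" using W_step by auto
  have lin: "linear (D a \<circ> D c)" by (rule linear_compose) (rule opN_linear[OF op])+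
  have onto: "(D a \<circ> D c) ` W a = W a"
  proof (rule injective_self_map_onto[OF subspace_W _ lin])
    fix v assume v: "v \<in> W a"
    show "suppN N v" using v opN_supp[OF op] by (auto simp: W_def)
    show "(D a \<circ> D c) v \<in> W a" using W_step[OF W_step[OF v]] by simp
    assume "(D a \<circ> D c) v = 0"
    then have "D c v = 0" using D_inj_range[of "D c v" c a] by auto
    then show "v = 0" using v D_inj_range[of v a c] by (auto simp: W_def)
  qed
  show "W c \<subseteq> D c ` W a"
  proof
    fix y assume y: "y \<in> W c"
    then have "D a y \<in> (D a \<circ> D c) ` W a" using W_step onto by blast
    then obtain x where x: "x \<in> W a" "D a y = D a (D c x)" by auto
    have "y - D c x \<in> range (D c)" using y by (auto simp: W_def intro: subspace_diff[OF subspace_range])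
    moreover have "D a (y - D c x) = 0" using x by (simp add: linear_diff[OF opN_linear[OF op]])
    ultimately have "y = D c x" using D_inj_range by fastforce
    then show "y \<in> D c ` W a" using x by auto
  qed
qed

text \<open>The quotients \<open>r\<close> of the vectors \<open>D a (ev q)\<close> add up to the
  norm of the product with \<open>a\<close> prepended divided by the norm without it. This stays
  above \<open>1 / C\<close>, so they cannot all tend to 0.\<close>

lemma W_proper: "W a \<noteq> range (D a)"
proof
  assume eq: "W a = range (D a)"
  obtain C where C: "C \<ge> 1" "\<And>w c. w \<noteq> [] \<Longrightarrow> nm N (fold D w) \<le> C * nm N (fold D (c # w))"
    using nm_cons_bounds by metis
  have "AE \<omega> in bern P. \<forall>q\<in>{..<N}. \<omega> \<in> Z (D a (ev q))"
    using eq by (intro AE_finite_allI) (auto simp: W_def gz1_iff[symmetric])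
  then have "AE \<omega> in bern P. False"
  proof eventually_elim
    case (elim \<omega>)
    have "(\<lambda>n. \<Sum>q<N. r (pre n \<omega>) (D a (ev q))) \<longlonglongrightarrow> (\<Sum>q<N. 0)"
      using elim by (intro tendsto_sum) (auto simp: Z_iff)
    then have "\<forall>\<^sub>F n in sequentially. (\<Sum>q<N. r (pre n \<omega>) (D a (ev q))) < 1 / C"
      using C(1) by (intro order_tendstoD(2)) auto
    then obtain m where m: "\<And>n. n \<ge> m \<Longrightarrow> (\<Sum>q<N. r (pre n \<omega>) (D a (ev q))) < 1 / C"
      by (auto simp: eventually_sequentially)
    let ?w = "pre (Suc m) \<omega>"
    have ne: "?w \<noteq> []" by (metis length_pre list.size(3) Zero_not_Suc)
    have n: "0 < nm N (fold D ?w)" by (rule nm_pos[OF ne])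
    have "(\<Sum>q<N. r ?w (D a (ev q))) = nm N (fold D (a # ?w)) / nm N (fold D ?w)"
      by (simp add: r_def nm_def sum_divide_distrib)
    moreover have "1 / C \<le> nm N (fold D (a # ?w)) / nm N (fold D ?w)"
      using C(1) C(2)[OF ne, of a] n by (simp add: field_simps)
    ultimately show ?case using m[of "Suc m"] by simp
  qed
  then show False using prob_space.prob_eq_1[OF prob_space_bern, of "{}" P] by simp
qed

lemma W_trivial: "W a = {0}"
proof (rule ccontr)
  assume ne: "W a \<noteq> {0}"
  have "Real_Vector_Spaces.subspace (W c) \<and> W c \<noteq> {0} \<and> W c \<subset> range (D c) \<and> (\<forall>b. D c ` W b = W c)" for c
  proof (intro conjI allI)
    show "Real_Vector_Spaces.subspace (W c)" by (rule subspace_W)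
    show "W c \<subset> range (D c)" using W_proper[of c] by (auto simp: W_def)
    show "D c ` W b = W c" for b by (rule W_image)
    obtain v where v: "v \<in> W a" "v \<noteq> 0" using ne subspace_0[OF subspace_W] by blast
    then have "D c v \<in> W c" "D c v \<noteq> 0" using W_step D_inj_range[of v a c] by (auto simp: W_def)
    then show "W c \<noteq> {0}" by auto
  qed
  then show False using irreducible by blast
qed

section \<open>Semicontinuity, compactness and uniformity in the vector\<close>

lemma limsup_prob:
  assumes F: "\<And>k. F k \<in> sets (bern P)" and b: "\<And>k::nat. b - 1 / real (Suc k) \<le> measure (bern P) (F k)"
  shows "b \<le> measure (bern P) (\<Inter>k. \<Union>j\<in>{k..}. F j)"
proof -
  interpret B: prob_space "bern P" by (rule prob_space_bern)
  have U: "(\<Union>j\<in>{k..}. F j) \<in> sets (bern P)" for k using F by auto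
  have "(\<lambda>k. measure (bern P) (\<Union>j\<in>{k..}. F j)) \<longlonglongrightarrow> measure (bern P) (\<Inter>k. \<Union>j\<in>{k..}. F j)"
  proof (rule B.finite_Lim_measure_decseq)
    show "range (\<lambda>k. \<Union>j\<in>{k..}. F j) \<subseteq> sets (bern P)" using U by auto
    show "decseq (\<lambda>k. \<Union>j\<in>{k..}. F j)" unfolding decseq_def by (intro allI impI UN_mono) auto
  qed
  moreover have "b - 1 / real (Suc k) \<le> measure (bern P) (\<Union>j\<in>{k..}. F j)" for k
    using B.finite_measure_mono[of "F k" "\<Union>j\<in>{k..}. F j"] U[of k] b[of k] by force
  moreover have "(\<lambda>k. b - 1 / real (Suc k)) \<longlonglongrightarrow> b - 0"
    by (intro tendsto_diff tendsto_const LIMSEQ_Suc[OF lim_1_over_n])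
  ultimately show ?thesis using LIMSEQ_le[of _ "b - 0"] by fastforce
qed

text \<open>\<open>r w\<close> is 1-Lipschitz in the vector, uniformly in the word. If an orbit is
  slow for infinitely many \<open>v j\<close>, its relative growth at \<open>l\<close> is eventually
  below every positive bound; \<open>limsup_prob\<close> transfers the probabilities.\<close>

lemma gz_usc:
  assumes lim: "v \<longlonglongrightarrow> l" and b: "\<And>k::nat. b - 1 / real (Suc k) \<le> gz (v k)"
  shows "b \<le> gz l"
proof -
  interpret B: prob_space "bern P" by (rule prob_space_bern)
  have "b \<le> measure (bern P) (\<Inter>k. \<Union>j\<in>{k..}. Z (v j))"
    using b by (intro limsup_prob Z_sets) (auto simp: gz_def)
  also have "\<dots> \<le> measure (bern P) (Z l)"
  proof (rule B.finite_measure_mono[OF _ Z_sets], rule subsetI)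
    fix \<omega> assume w: "\<omega> \<in> (\<Inter>k. \<Union>j\<in>{k..}. Z (v j))"
    show "\<omega> \<in> Z l" unfolding Z_iff
    proof (rule tendstoI)
      fix e :: real assume e: "e > 0"
      obtain k where k: "\<And>j. j \<ge> k \<Longrightarrow> norm (v j - l) < e / 2"
        using lim e unfolding LIMSEQ_iff by (metis half_gt_zero)
      obtain j where j: "j \<ge> k" "\<omega> \<in> Z (v j)" using w by blast
      then have "\<forall>\<^sub>F n in sequentially. r (pre n \<omega>) (v j) < e / 2"
        using e by (intro order_tendstoD(2)) (auto simp: Z_iff)
      then show "\<forall>\<^sub>F n in sequentially. dist (r (pre n \<omega>) l) 0 < e"
        using eventually_ge_at_top[of 1]
      proof eventually_elim
        case (elim n)
        have "pre n \<omega> \<noteq> []" using elim(2) by (metis length_pre list.size(3) not_one_le_zero)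
        then have "r (pre n \<omega>) l \<le> r (pre n \<omega>) (v j) + norm (l - v j)" by (rule r_diff_le)
        then show ?case using elim(1) k[OF j(1)] r_nonneg[of "pre n \<omega>" l] by (simp add: norm_minus_commute)
      qed
    qed
  qed
  finally show ?thesis by (simp add: gz_def)
qed

text \<open>A maximiser \<open>l\<close> of \<open>gz\<close> exists by compactness and
  \<open>gz_usc\<close>, and by the maximum principle \<open>gz\<close> keeps its value along all
  orbits of \<open>l\<close>. By \<open>Z_shift\<close> the event \<open>Z l\<close> is then
  independent of every prefix, so it has probability 0 or 1. A positive maximum would equal 1 and
  put \<open>l\<close> into \<open>W b\<close>, which is trivial.\<close>

lemma gz_zero:
  assumes v: "st a v" shows "gz v = 0"
proof (rule ccontr)
  assume nz: "gz v \<noteq> 0"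
  define S where "S = {gz u | u a. st a u \<and> norm u = 1}"
  have norml: "gz u = gz (u /\<^sub>R norm u)" "st b (u /\<^sub>R norm u)" "norm (u /\<^sub>R norm u) = 1" if "st b u" for b u
    using that gz_scale[of "inverse (norm u)" u] subspace_scale[OF subspace_range] by (auto simp: st_def)
  have bdd: "bdd_above S" using gz_le1 by (auto simp: S_def intro!: bdd_aboveI[of _ 1])
  have le: "gz u \<le> Sup S" if "st b u" for b u
  proof -
    have "gz u \<in> S" using norml[OF that] by (auto simp: S_def)
    then show ?thesis using bdd by (rule cSup_upper)
  qed
  have Sne: "S \<noteq> {}" using norml[OF v] by (auto simp: S_def)
  have "\<exists>u a. st a u \<and> norm u = 1 \<and> Sup S - 1 / real (Suc k) < gz u" for k
  proof -
    have "Sup S - 1 / real (Suc k) < Sup S" by simp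
    then obtain s where "s \<in> S" "Sup S - 1 / real (Suc k) < s" using less_cSup_iff[OF Sne bdd] by blast
    then show ?thesis by (auto simp: S_def)
  qed
  then obtain u a' where u: "\<And>k. st (a' k) (u k)" "\<And>k. norm (u k) = 1" "\<And>k. Sup S - 1 / real (Suc k) < gz (u k)"
    by metis
  \<comment> \<open>There are finitely many letters, so infinitely many of the approximating states
    lie over one of them; compactness is available in a single range.\<close>
  obtain b where b: "infinite (a' -` {b})"
    using pigeonhole_infinite[of "UNIV :: nat set" a'] by (auto simp: vimage_def)
  define s where "s = enumerate (a' -` {b})"
  have s: "strict_mono s" "\<And>k. a' (s k) = b"
    using strict_mono_enumerate[OF b] enumerate_in_set[OF b] by (auto simp: s_def)
  obtain l t where l: "l \<in> range (D b)" "norm l = 1" "strict_mono t" "((u \<circ> s) \<circ> t) \<longlonglongrightarrow> l"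
  proof (rule range_sphere_seq_compact[OF op, of "u \<circ> s" b])
    show "(u \<circ> s) k \<in> range (D b)" for k using u(1)[of "s k"] s(2)[of k] by (auto simp: st_def)
    show "norm ((u \<circ> s) k) = 1" for k using u(2) by simp
  qed blast
  have st: "st b l" using l by (auto simp: st_def)
  have "Sup S \<le> gz l"
  proof (rule gz_usc[OF l(4)])
    fix k
    have "k \<le> s (t k)" using seq_suble[OF strict_mono_o[OF s(1) l(3)], of k] by simp
    then have "1 / real (Suc (s (t k))) \<le> 1 / real (Suc k)" by (intro divide_left_mono) auto
    then show "Sup S - 1 / real (Suc k) \<le> gz ((u \<circ> s \<circ> t) k)" using u(3)[of "s (t k)"] by simp
  qed
  then have gl: "gz l = Sup S" using le[OF st] by simp
  have orb: "gz (fold D w x) = Sup S" if "st c x" "gz x = Sup S" for c x w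
    using that
  proof (induction w arbitrary: c x)
    case (Cons d w)
    have "gz (D d x) = gz x" using le[OF st_step[OF Cons.prems(1)]] Cons.prems(2) by (intro gz_harmonic_max) simp
    then show ?case using Cons.IH[OF st_step[OF Cons.prems(1)]] Cons.prems(2) by simp
  qed simp
  have "measure (bern P) (Z l) = 0 \<or> measure (bern P) (Z l) = 1"
  proof (rule zero_one_prefix[OF Z_sets])
    fix w :: "'a list"
    have "Z l \<inter> {\<omega>. pre (length w) \<omega> = w} = {\<omega>. pre (length w) \<omega> = w \<and> lshift (length w) \<omega> \<in> Z (fold D w l)}"
    proof (rule Set.set_eqI)
      fix \<omega>
      show "\<omega> \<in> Z l \<inter> {\<omega>. pre (length w) \<omega> = w}
          \<longleftrightarrow> \<omega> \<in> {\<omega>. pre (length w) \<omega> = w \<and> lshift (length w) \<omega> \<in> Z (fold D w l)}"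
        unfolding Int_iff mem_Collect_eq using Z_shift[of \<omega> l "length w"] by metis
    qed
    then show "measure (bern P) (Z l \<inter> {\<omega>. pre (length w) \<omega> = w})
      = measure (bern P) (Z l) * measure (bern P) {\<omega>. pre (length w) \<omega> = w}"
      using orb[OF st gl, of w] gl by (simp add: measure_pre_shift[OF Z_sets] measure_pre gz_def)
  qed
  moreover have "0 < gz v"
    using nz measure_nonneg[of "bern P" "Z v"] by (simp add: gz_def zero_less_measure_iff)
  then have "0 < gz l" using gl le[OF v] by linarith
  ultimately have "gz l = 1" by (auto simp: gz_def)
  then have "l \<in> W b" using l by (simp add: W_def)
  then show False using W_trivial l by auto
qed

text \<open>Otherwise there are unit states and times \<open>n k \<ge> k\<close> with relative
  growth at most 1/(k+1) on a set of probability above \<open>eta\<close>. Intersecting with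
  \<open>Gd m\<close> makes the smallness persist, and for a limit \<open>l\<close> of these states
  the event \<open>Z l\<close> would have probability at least \<open>eta / 2\<close>, against
  \<open>gz_zero\<close>.\<close>

lemma r_uniform:
  assumes eta: "0 < eta"
  shows "\<exists>tau n1. 0 < tau \<and> tau \<le> 1 \<and> (\<forall>n\<ge>n1. \<forall>a v. st a v \<and> norm v = 1 \<longrightarrow>
     measure (bern P) {\<omega>. r (pre n \<omega>) v \<le> tau} \<le> eta)"
proof (rule ccontr)
  interpret B: prob_space "bern P" by (rule prob_space_bern)
  assume neg: "\<not> ?thesis"
  have "\<exists>n\<ge>k. \<exists>a v. st a v \<and> norm v = 1 \<and> eta < measure (bern P) {\<omega>. r (pre n \<omega>) v \<le> 1 / real (Suc k)}" for k
  proof (rule ccontr)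
    assume "\<not> ?thesis"
    then have "\<forall>n\<ge>k. \<forall>a v. st a v \<and> norm v = 1 \<longrightarrow> measure (bern P) {\<omega>. r (pre n \<omega>) v \<le> 1 / real (Suc k)} \<le> eta"
      by (auto simp: not_less)
    then have "0 < 1 / real (Suc k) \<and> 1 / real (Suc k) \<le> 1 \<and> (\<forall>n\<ge>k. \<forall>a v. st a v \<and> norm v = 1 \<longrightarrow>
        measure (bern P) {\<omega>. r (pre n \<omega>) v \<le> 1 / real (Suc k)} \<le> eta)" by simp
    then show False using neg by blast
  qed
  then obtain n a' u where u: "\<And>k. n k \<ge> k" "\<And>k. st (a' k) (u k)" "\<And>k. norm (u k) = 1"
    "\<And>k. eta < measure (bern P) {\<omega>. r (pre (n k) \<omega>) (u k) \<le> 1 / real (Suc k)}"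
    by metis
  have "\<forall>\<^sub>F m in sequentially. 1 - eta / 2 < measure (bern P) (Gd m)"
    using eta by (intro order_tendstoD(1)[OF Gd_prob]) auto
  then obtain m where m: "1 - eta / 2 < measure (bern P) (Gd m)" by (auto simp: eventually_sequentially)
  obtain b where b: "infinite (a' -` {b})"
    using pigeonhole_infinite[of "UNIV :: nat set" a'] by (auto simp: vimage_def)
  define s where "s = enumerate (a' -` {b})"
  have s: "strict_mono s" "\<And>k. a' (s k) = b"
    using strict_mono_enumerate[OF b] enumerate_in_set[OF b] by (auto simp: s_def)
  obtain l t where l: "l \<in> range (D b)" "norm l = 1" "strict_mono t" "((u \<circ> s) \<circ> t) \<longlonglongrightarrow> l"
  proof (rule range_sphere_seq_compact[OF op, of "u \<circ> s" b])
    show "(u \<circ> s) k \<in> range (D b)" for k using u(2)[of "s k"] s(2)[of k] by (auto simp: st_def)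
    show "norm ((u \<circ> s) k) = 1" for k using u(3) by simp
  qed blast
  have st: "st b l" using l by (auto simp: st_def)
  define h where "h = s \<circ> t"
  have h: "k \<le> h k" for k using seq_suble[OF strict_mono_o[OF s(1) l(3)], of k] by (simp add: h_def)
  have hl: "(\<lambda>k. u (h k)) \<longlonglongrightarrow> l" using l(4) by (simp add: h_def comp_def)
  define E where "E = (\<lambda>k. {\<omega>. r (pre (n (h k)) \<omega>) (u (h k)) \<le> 1 / real (Suc (h k))})"
  have E: "E k \<in> sets (bern P)" for k
  proof -
    have "{\<omega> \<in> space (bern P). r (pre (n (h k)) \<omega>) (u (h k)) \<le> 1 / real (Suc (h k))} \<in> sets (bern P)" by measurable
    then show ?thesis by (simp add: E_def)
  qed
  have "eta / 2 \<le> measure (bern P) (\<Inter>k. \<Union>j\<in>{k..}. E j \<inter> Gd m)"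
  proof (rule limsup_prob)
    fix k
    have "measure (bern P) (E k) \<le> measure (bern P) (E k \<inter> Gd m) + measure (bern P) (space (bern P) - Gd m)"
      using B.finite_measure_mono[of "E k" "(E k \<inter> Gd m) \<union> (space (bern P) - Gd m)"]
        measure_Un_le[of "E k \<inter> Gd m" "bern P" "space (bern P) - Gd m"] E[of k] Gd_sets[of m] sets.compl_sets[OF Gd_sets[of m]]
      by (auto simp: subset_iff)
    moreover have "eta < measure (bern P) (E k)" using u(4)[of "h k"] by (simp add: E_def)
    ultimately have "eta / 2 \<le> measure (bern P) (E k \<inter> Gd m)"
      using B.prob_compl[OF Gd_sets, of m] m by linarith
    moreover have "0 \<le> 1 / real (Suc k)" by simp
    ultimately show "eta / 2 - 1 / real (Suc k) \<le> measure (bern P) (E k \<inter> Gd m)" by linarith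
  qed (use E Gd_sets in auto)
  also have "\<dots> \<le> measure (bern P) (Z l)"
  proof (rule B.finite_measure_mono[OF _ Z_sets], rule subsetI)
    fix \<omega> assume w: "\<omega> \<in> (\<Inter>k. \<Union>j\<in>{k..}. E j \<inter> Gd m)"
    have wG: "\<omega> \<in> Gd m" using w by blast
    show "\<omega> \<in> Z l" unfolding Z_iff
    proof (rule tendstoI)
      fix e :: real assume e: "e > 0"
      have "(\<lambda>k. norm (l - u (h k)) + 1 / real (Suc k) + Cs * exp (- g * real k)) \<longlonglongrightarrow> norm (l - l) + 0 + Cs * 0"
      proof (intro tendsto_add tendsto_mult tendsto_norm tendsto_diff tendsto_const hl LIMSEQ_Suc[OF lim_1_over_n])
        have "(\<lambda>k. exp (- g) ^ k) \<longlonglongrightarrow> 0" using g by (intro LIMSEQ_realpow_zero) auto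
        then show "(\<lambda>k. exp (- g * real k)) \<longlonglongrightarrow> 0"
          by (simp add: exp_of_nat_mult[symmetric] mult.commute)
      qed
      then have "\<forall>\<^sub>F k in sequentially. norm (l - u (h k)) + 1 / real (Suc k) + Cs * exp (- g * real k) < e"
        using e by (intro order_tendstoD(2)) auto
      then obtain k where k: "\<And>j. j \<ge> k \<Longrightarrow> norm (l - u (h j)) + 1 / real (Suc j) + Cs * exp (- g * real j) < e"
        by (auto simp: eventually_sequentially)
      obtain j where j: "j \<ge> max (max k m) 1" "\<omega> \<in> E j" using w by blast
      let ?n = "n (h j)"
      have nj: "j \<le> ?n" using u(1)[of "h j"] h[of j] by linarith
      have ne: "pre ?n \<omega> \<noteq> []" using nj j(1) by (metis length_pre list.size(3) le_zero_eq max.bounded_iff not_one_le_zero)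
      have "r (pre ?n \<omega>) l \<le> r (pre ?n \<omega>) (u (h j)) + norm (l - u (h j))" by (rule r_diff_le[OF ne])
      also have "r (pre ?n \<omega>) (u (h j)) \<le> 1 / real (Suc (h j))" using j(2) by (simp add: E_def)
      also have "1 / real (Suc (h j)) \<le> 1 / real (Suc j)" using h[of j] by (intro divide_left_mono) auto
      finally have 1: "r (pre ?n \<omega>) l \<le> 1 / real (Suc j) + norm (l - u (h j))" by simp
      have "exp (- g * real ?n) \<le> exp (- g * real j)" using g nj by simp
      then have 2: "Cs * exp (- g * real ?n) \<le> Cs * exp (- g * real j)" using Cs_nonneg by (intro mult_left_mono)
      have "dist (r (pre n' \<omega>) l) 0 < e" if "n' \<ge> ?n" for n'
      proof -
        have "r (pre (?n + (n' - ?n)) \<omega>) l \<le> r (pre ?n \<omega>) l + Cs * exp (- g * real ?n)"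
          using nj j(1) l(2) by (intro r_later[OF wG]) auto
        then have "r (pre n' \<omega>) l < e" using 1 2 k[of j] j(1) that by simp
        then show ?thesis using r_nonneg[of "pre n' \<omega>" l] by simp
      qed
      then show "\<forall>\<^sub>F n in sequentially. dist (r (pre n \<omega>) l) 0 < e"
        unfolding eventually_sequentially by blast
    qed
  qed
  finally show False using gz_zero[OF st] eta by (simp add: gz_def)
qed

text \<open>The logarithm \<open>X\<close> of the quotient has mean at most -1: up to a constant it
  is at most - g n off a set of probability at most \<open>2 * eta\<close>, and it is at most
  \<open>C0 * n\<close> everywhere. As \<open>X\<close> is bounded by \<open>R\<close>, a small
  power \<open>alpha\<close> turns the negative mean into an expectation below 1.\<close>

theorem uniform_contraction:
  "\<exists>n0\<ge>1. \<exists>alpha theta. 0 < alpha \<and> alpha \<le> 1 \<and> 0 < theta \<and> theta < 1 \<and>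
     (\<forall>a v. v \<in> range (D a) \<and> norm v = 1 \<longrightarrow>
        wex P n0 (\<lambda>w. (m2 N (fold D w) / (norm (fold D w v))\<^sup>2) powr alpha) \<le> theta)"
proof -
  interpret B: prob_space "bern P" by (rule prob_space_bern)
  have N1: "1 \<le> real N"
  proof -
    have "N \<noteq> 0"
    proof
      assume "N = 0"
      then have "nm N (fold D [undefined]) = 0" by (simp add: nm_def)
      then show False using nm_pos[of "[undefined]"] by (metis less_irrefl list.distinct(1))
    qed
    then show ?thesis by simp
  qed
  define lk where "lk = ln (K / kap)"
  have lk: "0 \<le> lk" using K kap by (simp add: lk_def)
  define C0 where "C0 = ln (2 * real N ^ 4) + 2 * lk"
  have N4: "1 \<le> 2 * real N ^ 4" using N1 one_le_power[of "real N" 4] by linarith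
  have C0: "0 \<le> C0" using lk N4 by (simp add: C0_def)
  \<comment> \<open>With this value the exceptional set, of probability at most
    \<open>2 * eta\<close>, costs at most half of the gain g n.\<close>
  define eta where "eta = g / (4 * (C0 + g))"
  have eta: "0 < eta" using g C0 by (simp add: eta_def)
  obtain tau n1 where tau: "0 < tau" "tau \<le> 1"
    and n1: "\<And>n a v. n \<ge> n1 \<Longrightarrow> st a v \<Longrightarrow> norm v = 1 \<Longrightarrow> measure (bern P) {\<omega>. r (pre n \<omega>) v \<le> tau} \<le> eta"
    using r_uniform[OF eta] by blast
  have "\<forall>\<^sub>F m in sequentially. 1 - eta < measure (bern P) (Gd m)"
    using eta by (intro order_tendstoD(1)[OF Gd_prob]) auto
  then obtain n2 where n2: "\<And>m. m \<ge> n2 \<Longrightarrow> 1 - eta < measure (bern P) (Gd m)" by (auto simp: eventually_sequentially)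
  \<comment> \<open>From \<open>n3\<close> on, the remaining half g n / 2 exceeds the loss
    \<open>- 2 * ln tau\<close> by more than 1.\<close>
  obtain n3 :: nat where n3: "1 - 2 * ln tau < real n3 * (g / 2)"
    using ex_less_of_nat_mult[of "g / 2" "1 - 2 * ln tau"] g by auto
  define n where "n = max (max n1 n2) (max n3 1)"
  have n: "n \<ge> n1" "n \<ge> n2" "n \<ge> n3" "n \<ge> 1" by (auto simp: n_def)
  \<comment> \<open>\<open>m2\<close> may vanish, for instance if \<open>N = 1\<close>. The floor
    \<open>dlt\<close> keeps the logarithm finite; it does not disturb the good estimate because
    \<open>kap ^ n\<close> bounds the orbit of a unit state from below.\<close>
  define dlt where "dlt = exp (- g * n) * (kap ^ n)\<^sup>2"
  have dlt: "0 < dlt" using kap by (simp add: dlt_def)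
  define R where "R = C0 * n + g * n + 2 * n * lk + 1"
  have R1: "1 \<le> R" using C0 g lk by (simp add: R_def)
  \<comment> \<open>Makes the second-order term \<open>alpha\<^sup>2 * R\<^sup>2\<close> half of the
    first-order gain \<open>alpha\<close>.\<close>
  define alpha where "alpha = 1 / (2 * R\<^sup>2)"
  have R2: "1 \<le> R\<^sup>2" using R1 by (simp add: one_le_power)
  have al: "0 < alpha" "alpha \<le> 1" "alpha * R \<le> 1"
  proof -
    have "0 < R\<^sup>2" using R2 by linarith
    then show "0 < alpha" unfolding alpha_def by simp
    show "alpha \<le> 1" using R2 \<open>0 < R\<^sup>2\<close> unfolding alpha_def by (simp add: pos_divide_le_eq del: zero_less_power2)
    have "alpha * R = 1 / (2 * R)" using R1 by (simp add: alpha_def power2_eq_square)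
    also have "\<dots> \<le> 1" using R1 by simp
    finally show "alpha * R \<le> 1" .
  qed
  define X where "X = (\<lambda>v w. ln (max (m2 N (fold D w)) dlt / (norm (fold D w v))\<^sup>2))"
  let ?F = "\<lambda>v. {w. r w v \<le> tau} \<union> {w. \<not> m2 N (fold D w) \<le> exp (- g * n) * (nm N (fold D w))\<^sup>2}"
  have kpow: "ln (K ^ n) = n * ln K" "ln (kap ^ n) = n * ln kap" using K kap by (auto simp: ln_realpow)
  have lkd: "lk = ln K - ln kap" using K kap by (simp add: lk_def ln_div)
  have main: "wex P n (\<lambda>w. (m2 N (fold D w) / (norm (fold D w v))\<^sup>2) powr alpha) \<le> 1 - alpha / 2"
    if v: "v \<in> range (D a)" "norm v = 1" for a v
  proof -
    have stv: "st a v" using v by (auto simp: st_def)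
    have props: "0 < norm (fold D w v)" "kap ^ n \<le> norm (fold D w v)" "norm (fold D w v) \<le> K ^ n"
      if "length w = n" for w
    proof -
      show k: "kap ^ n \<le> norm (fold D w v)" using norm_fold_lower[OF stv, of w] that v by simp
      then show "0 < norm (fold D w v)" using kap by (meson less_le_trans zero_less_power)
      show "norm (fold D w v) \<le> K ^ n" using norm_fold_upper[of w v] that v by simp
    qed
    have Xval: "X v w = ln (max (m2 N (fold D w)) dlt) - 2 * ln (norm (fold D w v))" if "length w = n" for w
      using props(1)[OF that] dlt by (simp add: X_def ln_div ln_realpow less_max_iff_disj)
    have Xup: "X v w \<le> C0 * n" if w: "length w = n" for w
    proof -
      have "dlt \<le> 1 * 1" unfolding dlt_def using g kap by (intro mult_mono power_le_one) auto
      also have "1 * 1 \<le> 2 * real N ^ 4 * (K ^ n)\<^sup>2"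
        using N4 K by (intro mult_mono one_le_power) auto
      finally have "max (m2 N (fold D w)) dlt \<le> 2 * real N ^ 4 * (K ^ n)\<^sup>2"
        using m2_fold_le[of w] w by simp
      then have "ln (max (m2 N (fold D w)) dlt) \<le> ln (2 * real N ^ 4 * (K ^ n)\<^sup>2)"
        using dlt by (intro ln_mono) (auto simp: less_max_iff_disj)
      also have "\<dots> = ln (2 * real N ^ 4) + 2 * (n * ln K)"
        using N4 K kpow by (subst ln_mult) (auto simp: ln_realpow)
      finally have "X v w \<le> ln (2 * real N ^ 4) + 2 * (n * ln K) - 2 * ln (norm (fold D w v))"
        using Xval[OF w] by simp
      moreover have "n * ln kap \<le> ln (norm (fold D w v))"
        using props[OF w] kap kpow(2)[symmetric] by (simp only:) (intro ln_mono, auto)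
      moreover have "ln (2 * real N ^ 4) \<le> n * ln (2 * real N ^ 4)"
        using n(4) N4 mult_right_mono[of 1 "real n" "ln (2 * real N ^ 4)"] by simp
      ultimately show ?thesis by (simp add: C0_def lkd algebra_simps)
    qed
    have Xlow: "- R \<le> X v w" if w: "length w = n" for w
    proof -
      have "ln dlt \<le> ln (max (m2 N (fold D w)) dlt)" using dlt by (intro ln_mono) auto
      moreover have "ln dlt = - g * n + 2 * (n * ln kap)"
        using kap by (simp add: dlt_def ln_mult ln_realpow)
      moreover have "ln (norm (fold D w v)) \<le> n * ln K"
        using props[OF w] K kpow(1)[symmetric] by (simp only:) (intro ln_mono, auto)
      ultimately have "- g * n + 2 * (n * ln kap) - 2 * (n * ln K) \<le> X v w" using Xval[OF w] by linarith
      moreover have "0 \<le> C0 * n" using C0 by simp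
      ultimately show ?thesis by (simp add: R_def lkd algebra_simps)
    qed
    have Xgood: "X v w \<le> - g * n - 2 * ln tau" if w: "length w = n" and good: "w \<notin> ?F v" for w
    proof -
      have ne: "w \<noteq> []" using w n(4) by auto
      have np: "0 < nm N (fold D w)" by (rule nm_pos[OF ne])
      have rt: "tau * nm N (fold D w) \<le> norm (fold D w v)"
        using good np by (simp add: r_def field_simps not_le)
      have a1: "m2 N (fold D w) \<le> exp (- g * n) / tau\<^sup>2 * (norm (fold D w v))\<^sup>2"
      proof -
        have "(tau * nm N (fold D w))\<^sup>2 \<le> (norm (fold D w v))\<^sup>2" using rt tau np by (intro power_mono) auto
        then have "exp (- g * n) / tau\<^sup>2 * (tau * nm N (fold D w))\<^sup>2 \<le> exp (- g * n) / tau\<^sup>2 * (norm (fold D w v))\<^sup>2"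
          by (intro mult_left_mono) auto
        then have "exp (- g * n) * (nm N (fold D w))\<^sup>2 \<le> exp (- g * n) / tau\<^sup>2 * (norm (fold D w v))\<^sup>2"
          using tau by (simp add: power_mult_distrib)
        then show ?thesis using good by (simp add: not_le)
      qed
      have a2: "dlt \<le> exp (- g * n) / tau\<^sup>2 * (norm (fold D w v))\<^sup>2"
        unfolding dlt_def
      proof (intro mult_mono power_mono)
        have "tau\<^sup>2 \<le> 1" using tau by (simp add: power_le_one)
        then show "exp (- g * real n) \<le> exp (- g * real n) / tau\<^sup>2" using tau by (simp add: field_simps)
      qed (use props[OF w] kap in auto)
      have "max (m2 N (fold D w)) dlt / (norm (fold D w v))\<^sup>2 \<le> exp (- g * n) / tau\<^sup>2"
        using a1 a2 props(1)[OF w] by (simp add: pos_divide_le_eq)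
      then have "X v w \<le> ln (exp (- g * n) / tau\<^sup>2)"
        unfolding X_def using dlt props(1)[OF w] by (intro ln_mono divide_pos_pos) (auto simp: less_max_iff_disj)
      also have "\<dots> = - g * n - 2 * ln tau" using tau by (simp add: ln_div ln_realpow)
      finally show ?thesis .
    qed
    let ?b = "\<lambda>w. if w \<in> ?F v then 1 else (0::real)"
    have "X v w \<le> (- g * n - 2 * ln tau) + (C0 + g) * n * ?b w" if w: "length w = n" for w
    proof (cases "w \<in> ?F v")
      case True
      have "ln tau \<le> 0" using tau by simp
      then have "X v w \<le> (- g * n - 2 * ln tau) + (C0 + g) * n"
        using Xup[OF w] by (simp add: algebra_simps)
      then show ?thesis using True by simp
    next
      case False
      then show ?thesis using Xgood[OF w False] by simp
    qed
    then have "wex P n (X v) \<le> wex P n (\<lambda>w. (- g * n - 2 * ln tau) + (C0 + g) * n * ?b w)"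
      by (rule wex_mono)
    also have "\<dots> = (- g * n - 2 * ln tau) + (C0 + g) * n * wex P n ?b"
      by (simp only: wex_add wex_cmult wex_const)
    finally have wX: "wex P n (X v) \<le> (- g * n - 2 * ln tau) + (C0 + g) * n * wex P n ?b" .
    have "wex P n ?b \<le> 2 * eta"
    proof -
      have "wex P n ?b = measure (bern P) {\<omega>. pre n \<omega> \<in> ?F v}" by (rule measure_pre_in[symmetric])
      also have "{\<omega>. pre n \<omega> \<in> ?F v} \<subseteq> {\<omega>. r (pre n \<omega>) v \<le> tau} \<union> (space (bern P) - Gd n)"
        by (auto simp: Gd_def)
      then have "measure (bern P) {\<omega>. pre n \<omega> \<in> ?F v} \<le> measure (bern P) ({\<omega>. r (pre n \<omega>) v \<le> tau} \<union> (space (bern P) - Gd n))"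
      proof (rule B.finite_measure_mono)
        have "{\<omega> \<in> space (bern P). r (pre n \<omega>) v \<le> tau} \<in> sets (bern P)" by measurable
        then show "{\<omega>. r (pre n \<omega>) v \<le> tau} \<union> (space (bern P) - Gd n) \<in> sets (bern P)"
          using sets.compl_sets[OF Gd_sets[of n]] by (intro sets.Un) auto
      qed
      also have "\<dots> \<le> measure (bern P) {\<omega>. r (pre n \<omega>) v \<le> tau} + measure (bern P) (space (bern P) - Gd n)"
      proof (rule measure_Un_le)
        have "{\<omega> \<in> space (bern P). r (pre n \<omega>) v \<le> tau} \<in> sets (bern P)" by measurable
        then show "{\<omega>. r (pre n \<omega>) v \<le> tau} \<in> sets (bern P)" by simp
      qed (rule sets.compl_sets[OF Gd_sets])
      also have "\<dots> \<le> eta + eta"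
        using n1[OF n(1) stv v(2)] n2[OF n(2)] B.prob_compl[OF Gd_sets, of n] by linarith
      finally show ?thesis by simp
    qed
    then have "(C0 + g) * n * wex P n ?b \<le> (C0 + g) * n * (2 * eta)"
      using C0 g by (intro mult_left_mono) auto
    then have "wex P n (X v) \<le> (- g * n - 2 * ln tau) + (C0 + g) * n * (2 * eta)"
      using wX by linarith
    also have "(C0 + g) * n * (2 * eta) = g * n / 2"
      using C0 g by (simp add: eta_def field_simps)
    also have "(- g * n - 2 * ln tau) + g * n / 2 \<le> -1"
    proof -
      have "real n3 * (g / 2) \<le> n * (g / 2)" using n(3) g by (intro mult_right_mono) auto
      then have "1 - 2 * ln tau < n * (g / 2)" using n3 by linarith
      then show ?thesis by (simp add: algebra_simps)
    qed
    finally have Xm: "wex P n (X v) \<le> -1" .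
    have pe: "\<And>x::real. 0 < x \<Longrightarrow> x powr alpha = exp (alpha * ln x)" by (simp add: powr_def)
    have "(m2 N (fold D w) / (norm (fold D w v))\<^sup>2) powr alpha \<le> 1 + alpha * X v w + alpha\<^sup>2 * R\<^sup>2"
      if w: "length w = n" for w
    proof -
      have "0 \<le> g * n + 2 * n * lk + 1" using g lk by simp
      then have XR: "\<bar>X v w\<bar> \<le> R" using Xup[OF w] Xlow[OF w] unfolding R_def abs_le_iff by linarith
      have p: "0 < max (m2 N (fold D w)) dlt / (norm (fold D w v))\<^sup>2"
        using dlt props(1)[OF w] by (intro divide_pos_pos) (auto simp: less_max_iff_disj)
      have "(m2 N (fold D w) / (norm (fold D w v))\<^sup>2) powr alpha
          \<le> (max (m2 N (fold D w)) dlt / (norm (fold D w v))\<^sup>2) powr alpha"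
        using al(1) m2_nonneg by (intro powr_mono2 divide_right_mono) auto
      also have "\<dots> = exp (alpha * X v w)" unfolding X_def by (rule pe[OF p])
      also have "\<dots> \<le> 1 + alpha * X v w + (alpha * X v w)\<^sup>2"
      proof (rule exp_le_quadratic)
        have "\<bar>alpha * X v w\<bar> \<le> alpha * R" using XR al(1) by (simp add: abs_mult mult_left_mono)
        then show "\<bar>alpha * X v w\<bar> \<le> 1" using al(3) by linarith
      qed
      also have "(alpha * X v w)\<^sup>2 \<le> (alpha * R)\<^sup>2"
        using XR al(1) R1 by (intro abs_le_square_iff[THEN iffD1]) (simp add: abs_mult)
      finally show ?thesis by (simp add: power_mult_distrib)
    qed
    then have "wex P n (\<lambda>w. (m2 N (fold D w) / (norm (fold D w v))\<^sup>2) powr alpha)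
        \<le> wex P n (\<lambda>w. 1 + alpha * X v w + alpha\<^sup>2 * R\<^sup>2)" by (rule wex_mono)
    also have "\<dots> = 1 + alpha * wex P n (X v) + alpha\<^sup>2 * R\<^sup>2"
      by (simp only: wex_add wex_cmult wex_const)
    also have "\<dots> \<le> 1 + alpha * (-1) + alpha\<^sup>2 * R\<^sup>2"
      using Xm al(1) by (intro add_mono mult_left_mono) auto
    also have "alpha\<^sup>2 * R\<^sup>2 = alpha / 2" using R1 by (simp add: alpha_def power2_eq_square)
    finally show ?thesis by simp
  qed
  have "0 < 1 - alpha / 2" "1 - alpha / 2 < 1" using al by auto
  then show ?thesis using n(4) al main by blast
qed

end

section \<open>Stability of the contraction\<close>

lemma norm_triangle_sub': "norm x \<le> norm y + norm (y - x :: 'v::real_normed_vector)"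
  using norm_triangle_sub[of x y] by (simp add: norm_minus_commute)

lemma op_diff_le:
  assumes "opN N T" "opN N T'" and d: "\<And>q. q < N \<Longrightarrow> norm (T' (ev q) - T (ev q)) \<le> z"
  shows "norm (T' x - T x) \<le> real N * z * norm x"
proof -
  have "T' x - T x = (\<Sum>q<N. x q *\<^sub>R (T' (ev q) - T (ev q)))"
    using opN_expand[OF assms(1), of x] opN_expand[OF assms(2), of x]
    by (simp add: scaleR_diff_right sum_subtractf)
  also have "norm \<dots> \<le> (\<Sum>q<N. norm (x q *\<^sub>R (T' (ev q) - T (ev q))))" by (rule norm_sum)
  also have "\<dots> \<le> (\<Sum>q<N. norm x * z)"
    by (intro sum_mono) (auto intro!: mult_mono abs_apply_le_norm d)
  finally show ?thesis by (simp add: mult_ac)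
qed

lemma wd_perturb:
  assumes a: "norm (a' - a) \<le> s" and b: "norm (b' - b) \<le> s"
    and L: "norm a \<le> L" "norm b' \<le> L"
  shows "wd N a' b' \<le> wd N a b + 4 * (real N)\<^sup>2 * L * s"
proof -
  have s0: "0 \<le> s" "0 \<le> L" using a L norm_ge_zero order_trans by blast+
  have t: "\<bar>a' p * b' q - a p * b q\<bar> \<le> 2 * L * s" for p q
  proof -
    have "a' p * b' q - a p * b q = (a' - a) p * b' q + a p * (b' - b) q" by (simp add: algebra_simps)
    also have "\<bar>\<dots>\<bar> \<le> \<bar>(a' - a) p * b' q\<bar> + \<bar>a p * (b' - b) q\<bar>" by (rule abs_triangle_ineq)
    also have "\<dots> \<le> s * L + L * s"
      unfolding abs_mult
      by (intro add_mono mult_mono order_trans[OF abs_apply_le_norm] a b L) (use s0 in auto)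
    finally show ?thesis by simp
  qed
  have "\<bar>a' p * b' q - a' q * b' p\<bar> \<le> \<bar>a p * b q - a q * b p\<bar> + 4 * L * s" for p q
    using t[of p q] t[of q p] by linarith
  then have "wd N a' b' \<le> (\<Sum>p<N. \<Sum>q<N. \<bar>a p * b q - a q * b p\<bar> + 4 * L * s)"
    unfolding wd_def by (intro sum_mono)
  also have "\<dots> = wd N a b + 4 * (real N)\<^sup>2 * L * s"
    by (simp add: wd_def sum.distrib power2_eq_square)
  finally show ?thesis .
qed

text \<open>The vectors \<open>T (b p)\<close> have a left inverse \<open>Hh\<close>, so they are
  well conditioned, and the \<open>T' (b p)\<close> remain independent for small \<open>z\<close>.
  The span condition leaves the range of \<open>T'\<close> no further directions, so they span it;
  replacing \<open>T'\<close> by \<open>T\<close> in a combination gives the approximating vector.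
  This is where constant rank of the neighbours enters: an increase of rank would create new
  directions unrelated to the range of \<open>T\<close>.\<close>

lemma range_approximation:
  fixes b :: "'p \<Rightarrow> rvec"
  assumes T: "opN N T" and T': "opN N T'" and Hh: "opN N Hh"
    and J: "finite J" "\<And>p. p \<in> J \<Longrightarrow> Hh (T (b p)) = ev (k p)" "inj_on k J"
    and S: "finite S" "card S \<le> card J" "range T' \<subseteq> span S"
    and d: "\<And>q. q < N \<Longrightarrow> norm (T' (ev q) - T (ev q)) \<le> z" "0 \<le> z"
    and e: "nm N Hh * real N * z * (\<Sum>p\<in>J. norm (b p)) \<le> e" "e \<le> 1 / 2"
    and y: "y \<in> range T'"
  shows "\<exists>y'\<in>range T. norm (y - y') \<le> 2 * e * norm y"
proof -
  have coef: "norm (\<Sum>p\<in>J. c p *\<^sub>R T' (b p)) \<ge> 1 / 2 * norm (\<Sum>p\<in>J. c p *\<^sub>R T (b p))"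
    "norm ((\<Sum>p\<in>J. c p *\<^sub>R T' (b p)) - (\<Sum>p\<in>J. c p *\<^sub>R T (b p))) \<le> e * norm (\<Sum>p\<in>J. c p *\<^sub>R T (b p))"
    "\<And>p. p \<in> J \<Longrightarrow> \<bar>c p\<bar> \<le> nm N Hh * norm (\<Sum>p\<in>J. c p *\<^sub>R T (b p))" for c
  proof -
    let ?y' = "\<Sum>p\<in>J. c p *\<^sub>R T (b p)" and ?y = "\<Sum>p\<in>J. c p *\<^sub>R T' (b p)"
    have Hy: "Hh ?y' = (\<Sum>p\<in>J. c p *\<^sub>R ev (k p))"
      using J(2) by (simp add: linear_sum[OF opN_linear[OF Hh]] linear_scale[OF opN_linear[OF Hh]])
    show c: "\<bar>c p\<bar> \<le> nm N Hh * norm ?y'" if p: "p \<in> J" for p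
    proof -
      have "(\<Sum>p'\<in>J. c p' *\<^sub>R ev (k p')) (k p) = (\<Sum>p'\<in>J. if p' = p then c p' else 0)"
        unfolding sum_bcontfun_apply using J(3) p by (intro sum.cong) (auto simp: inj_on_def)
      then have "c p = Hh ?y' (k p)" using Hy p J(1) by simp
      then have "\<bar>c p\<bar> \<le> norm (Hh ?y')" using abs_apply_le_norm[of "Hh ?y'" "k p"] by simp
      also have "\<dots> \<le> nm N Hh * norm ?y'" by (rule opN_norm_le[OF Hh])
      finally show ?thesis .
    qed
    have "?y - ?y' = (\<Sum>p\<in>J. c p *\<^sub>R (T' (b p) - T (b p)))"
      by (simp add: scaleR_diff_right sum_subtractf)
    also have "norm \<dots> \<le> (\<Sum>p\<in>J. norm (c p *\<^sub>R (T' (b p) - T (b p))))" by (rule norm_sum)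
    also have "\<dots> \<le> (\<Sum>p\<in>J. (nm N Hh * norm ?y') * (real N * z * norm (b p)))"
    proof (intro sum_mono)
      fix p assume p: "p \<in> J"
      have "norm (T' (b p) - T (b p)) \<le> real N * z * norm (b p)" by (rule op_diff_le[OF T T' d(1)])
      then show "norm (c p *\<^sub>R (T' (b p) - T (b p))) \<le> (nm N Hh * norm ?y') * (real N * z * norm (b p))"
        unfolding norm_scaleR using c[OF p] by (intro mult_mono) (auto simp: nm_nonneg)
    qed
    also have "\<dots> = (nm N Hh * real N * z * (\<Sum>p\<in>J. norm (b p))) * norm ?y'"
      by (simp add: sum_distrib_left sum_distrib_right mult_ac)
    also have "\<dots> \<le> e * norm ?y'" by (intro mult_right_mono e) auto
    finally show 2: "norm (?y - ?y') \<le> e * norm ?y'" .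
    have "e * norm ?y' \<le> 1 / 2 * norm ?y'" by (intro mult_right_mono e) auto
    moreover have "norm ?y' \<le> norm ?y + norm (?y - ?y')" by (rule norm_triangle_sub')
    ultimately show "norm ?y \<ge> 1 / 2 * norm ?y'" using 2 by linarith
  qed
  have zero: "c p = 0" if "(\<Sum>p\<in>J. c p *\<^sub>R T' (b p)) = 0" "p \<in> J" for c p
    using coef(1)[of c] coef(3)[OF that(2), of c] that(1) by simp
  have inj: "inj_on (\<lambda>p. T' (b p)) J"
  proof (rule inj_onI, rule ccontr)
    fix p q assume pq: "p \<in> J" "q \<in> J" "T' (b p) = T' (b q)" "p \<noteq> q"
    let ?c = "\<lambda>r. (if r = p then 1 else 0) - (if r = q then 1 else (0::real))"
    have "(\<Sum>r\<in>J. ?c r *\<^sub>R T' (b r)) = (\<Sum>r\<in>J. (if r = p then T' (b r) else 0)) - (\<Sum>r\<in>J. (if r = q then T' (b r) else 0))"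
      unfolding sum_subtractf[symmetric] by (intro sum.cong) auto
    also have "\<dots> = 0" using pq J(1) by simp
    finally have "?c p = 0" using pq(1) by (rule zero)
    then show False using pq(4) by simp
  qed
  let ?F = "(\<lambda>p. T' (b p)) ` J"
  have ind: "independent ?F"
  proof (rule independent_if_scalars_zero)
    show "finite ?F" using J(1) by simp
    fix u x assume s: "(\<Sum>x\<in>?F. u x *\<^sub>R x) = 0" and x: "x \<in> ?F"
    have "(\<Sum>p\<in>J. u (T' (b p)) *\<^sub>R T' (b p)) = 0" using s sum.reindex[OF inj, of "\<lambda>x. u x *\<^sub>R x"] by simp
    then show "u x = 0" using x zero[of "\<lambda>p. u (T' (b p))"] by auto
  qed
  have "y \<in> span ?F"
  proof (rule ccontr)
    assume ny: "y \<notin> span ?F"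
    then have "independent (insert y ?F)" using ind by (rule independent_insertI)
    moreover have "insert y ?F \<subseteq> span S" using S(3) y by auto
    ultimately have "card (insert y ?F) \<le> card S" using independent_span_bound[OF S(1)] by auto
    moreover have "y \<notin> ?F" using ny span_base[of y ?F] by auto
    then have "card (insert y ?F) = Suc (card J)" using J(1) card_image[OF inj] by simp
    ultimately show False using S(2) by simp
  qed
  then obtain u where u: "y = (\<Sum>x\<in>?F. u x *\<^sub>R x)" using J(1) by (auto simp: span_finite)
  define c where "c = (\<lambda>p. u (T' (b p)))"
  have yc: "y = (\<Sum>p\<in>J. c p *\<^sub>R T' (b p))"
    unfolding u c_def using sum.reindex[OF inj, of "\<lambda>x. u x *\<^sub>R x"] by simp
  let ?y' = "\<Sum>p\<in>J. c p *\<^sub>R T (b p)"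
  have "0 \<le> nm N Hh * real N * z * (\<Sum>p\<in>J. norm (b p))"
    using d(2) by (intro mult_nonneg_nonneg nm_nonneg sum_nonneg) auto
  then have e0: "0 \<le> e" using e(1) by linarith
  have "norm (y - ?y') \<le> e * norm ?y'" using coef(2)[of c] by (simp only: yc)
  also have "\<dots> \<le> e * (2 * norm y)" using coef(1)[of c] e0 yc by (intro mult_left_mono) auto
  finally have "norm (y - ?y') \<le> 2 * e * norm y" by simp
  moreover have "?y' = T (\<Sum>p\<in>J. c p *\<^sub>R b p)"
    by (simp add: linear_sum[OF opN_linear[OF T]] linear_scale[OF opN_linear[OF T]])
  ultimately show ?thesis by (metis rangeI)
qed

text \<open>Reduces the contraction estimate for a pair of vectors, which involves the product of
  their norms, to estimates for each vector alone.\<close>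

lemma powr_geometric_mean_le:
  fixes m x y alpha :: real
  assumes "0 \<le> m" "0 < x" "0 < y"
  shows "(m / (x * y)) powr alpha \<le> ((m / x\<^sup>2) powr alpha + (m / y\<^sup>2) powr alpha) / 2"
proof -
  let ?s = "(m / (x * y)) powr alpha" and ?X = "(m / x\<^sup>2) powr alpha" and ?Y = "(m / y\<^sup>2) powr alpha"
  have "?s\<^sup>2 = ?X * ?Y"
    using assms by (simp add: powr_mult[symmetric] power2_eq_square powr_divide mult_ac)
  also have "\<dots> \<le> ((?X + ?Y) / 2)\<^sup>2"
    using sum_squares_bound[of ?X ?Y] by (simp add: power2_eq_square field_simps)
  finally show ?thesis by (rule power2_le_imp_le) simp
qed

lemma powr_add_le:
  fixes x y alpha :: real
  assumes "0 \<le> x" "0 \<le> y" "0 < alpha" "alpha \<le> 1"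
  shows "(x + y) powr alpha \<le> x powr alpha + y powr alpha"
proof (cases "x + y = 0")
  case True
  then show ?thesis using assms by auto
next
  case False
  then have s: "0 < x + y" using assms by linarith
  have *: "u / (x + y) \<le> (u / (x + y)) powr alpha" if "0 \<le> u" "u \<le> x + y" for u
  proof (cases "u = 0")
    case False
    then have "0 < u / (x + y)" "u / (x + y) \<le> 1" using that s by auto
    then show ?thesis using powr_mono'[of alpha 1 "u / (x + y)"] assms that by simp
  qed simp
  have "1 = x / (x + y) + y / (x + y)" using s by (simp add: add_divide_distrib[symmetric])
  also have "\<dots> \<le> (x / (x + y)) powr alpha + (y / (x + y)) powr alpha"
    using assms by (intro add_mono *) auto
  also have "\<dots> = (x powr alpha + y powr alpha) / (x + y) powr alpha"
    using assms s by (simp add: powr_divide add_divide_distrib)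
  finally show ?thesis using s by (simp add: field_simps)
qed

text \<open>Only the finitely many words of length \<open>n0\<close> matter, and strict inequalities
  about them survive a small perturbation. The bounds are relaxed by fixed amounts while
  \<open>alpha\<close>, \<open>n0\<close>, \<open>q0\<close> are kept, so a single list of
  parameters serves the whole neighbourhood.\<close>

theorem (in linear_cocycle) contraction_stable:
  fixes Hh :: "'a \<Rightarrow> rvec \<Rightarrow> rvec" and b :: "'a \<Rightarrow> nat \<Rightarrow> rvec"
  assumes n0: "1 \<le> n0" and al: "0 < alpha" "alpha \<le> 1" and th: "0 < theta" "theta < 1"
    and c0: "0 < c0" "c0 \<le> 1" and q0: "\<And>a. q0 a < N" "\<And>a. c0 \<le> norm (D a (ev (q0 a)))"
    and unif: "\<And>a v. v \<in> range (D a) \<Longrightarrow> norm v = 1 \<Longrightarrow>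
        wex P n0 (\<lambda>w. (m2 N (fold D w) / (norm (fold D w v))\<^sup>2) powr alpha) \<le> theta"
    and Hh: "\<And>a. opN N (Hh a)" and J: "finite J" "\<And>a p. p \<in> J \<Longrightarrow> Hh a (D a (b a p)) = ev p"
  shows "\<exists>z>0. z \<le> 1 \<and> (\<forall>D'. (\<forall>a. opN N (D' a)) \<and>
      (\<forall>a. \<exists>S. finite S \<and> card S \<le> card J \<and> range (D' a) \<subseteq> span S) \<and>
      (\<forall>a q. q < N \<longrightarrow> norm (D' a (ev q) - D a (ev q)) \<le> z) \<longrightarrow>
      contracting_cocycle P N D' (kap / 2) (K + 1) alpha ((1 + theta) / 2) (c0 / 2) n0 q0)"
proof -
  define Ce where "Ce = (\<Sum>a\<in>UNIV. nm N (Hh a) * real N * (\<Sum>p\<in>J. norm (b a p)))"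
  have Ce_ge: "nm N (Hh a) * real N * (\<Sum>p\<in>J. norm (b a p)) \<le> Ce" for a
    unfolding Ce_def by (rule member_le_sum[of a UNIV "\<lambda>a. nm N (Hh a) * real N * (\<Sum>p\<in>J. norm (b a p))"])
      (auto intro!: mult_nonneg_nonneg nm_nonneg sum_nonneg)
  have Ce0: "0 \<le> Ce" unfolding Ce_def by (intro sum_nonneg mult_nonneg_nonneg nm_nonneg) auto
  \<comment> \<open>\<open>eta\<close> is the relative distance between the ranges, \<open>s\<close>
    the change of a product of \<open>n0\<close> operators, \<open>s2\<close> the resulting change
    of \<open>m2\<close>, and \<open>eta1\<close> the relative loss of norm along the orbit.
    \<open>F\<close> bounds what \<open>theta\<close> becomes; it tends to \<open>theta\<close> as
    \<open>z\<close> tends to 0, the others to 0.\<close>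
  define eta where "eta = (\<lambda>z. 2 * (Ce * z))"
  define s where "s = (\<lambda>z. real N * (2 * (K + 1)) ^ n0 * z)"
  define eta1 where "eta1 = (\<lambda>z. eta z + (s z + K ^ n0 * eta z) / kap ^ n0)"
  define s2 where "s2 = (\<lambda>z. (real N)\<^sup>2 * (4 * (real N)\<^sup>2 * (K + 1) ^ n0 * s z))"
  define F where "F = (\<lambda>z. (1 - eta1 z) powr (- 2 * alpha) * (theta + (s2 z / (kap ^ n0)\<^sup>2) powr alpha))"
  define good where "good = (\<lambda>z. z \<le> 1 \<and> Ce * z \<le> 1 / 2 \<and> real N * z \<le> 1 \<and> z \<le> c0 / 2
     \<and> kap * eta z + K * eta z + real N * z \<le> kap / 2 \<and> eta1 z \<le> 1 / 2 \<and> F z \<le> (1 + theta) / 2)"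
  have kn: "0 < kap ^ n0" "kap ^ n0 \<le> 1" using kap by (auto simp: power_le_one)
  have K0: "0 \<le> K" using K by simp
  have lin: "\<forall>\<^sub>F z in at_right (0::real). c * z \<le> d" if "0 < d" for c d :: real
  proof -
    have "((\<lambda>z. c * z) \<longlongrightarrow> c * 0) (at_right 0)" by (intro tendsto_intros)
    then have "\<forall>\<^sub>F z in at_right 0. c * z < d" using that by (intro order_tendstoD(2)) auto
    then show ?thesis by (rule eventually_mono) simp
  qed
  have ev: "\<forall>\<^sub>F z in at_right (0::real). 0 < z \<and> good z"
  proof -
    have id: "((\<lambda>z::real. z) \<longlongrightarrow> 0) (at_right 0)" by (rule tendsto_ident_at)
    have eta_lim: "(eta \<longlongrightarrow> 0) (at_right 0)"
      unfolding eta_def by (intro tendsto_mult_right_zero id)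
    have s_lim: "(s \<longlongrightarrow> 0) (at_right 0)"
      unfolding s_def by (intro tendsto_mult_right_zero id)
    have eta1_lim: "(eta1 \<longlongrightarrow> 0) (at_right 0)"
    proof -
      have "((\<lambda>z. eta z + (s z + K ^ n0 * eta z) / kap ^ n0) \<longlongrightarrow> 0 + (0 + K ^ n0 * 0) / kap ^ n0) (at_right 0)"
        using kap by (intro tendsto_intros eta_lim s_lim) auto
      then show ?thesis by (simp add: eta1_def[abs_def])
    qed
    have s2_lim: "((\<lambda>z. s2 z / (kap ^ n0)\<^sup>2) \<longlongrightarrow> 0) (at_right 0)"
      unfolding s2_def by (intro tendsto_divide_zero tendsto_mult_right_zero s_lim)
    have F_lim: "(F \<longlongrightarrow> theta) (at_right 0)"
    proof -
      have "((\<lambda>z. (s2 z / (kap ^ n0)\<^sup>2) powr alpha) \<longlongrightarrow> 0) (at_right 0)"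
      proof (rule tendsto_zero_powrI[OF s2_lim tendsto_const _ al(1)])
        show "\<forall>\<^sub>F z in at_right 0. 0 \<le> s2 z / (kap ^ n0)\<^sup>2"
          using eventually_at_right_less[of 0] by eventually_elim (use K0 in \<open>auto simp: s2_def s_def\<close>)
      qed
      then have "(F \<longlongrightarrow> (1 - 0) powr (- 2 * alpha) * (theta + 0)) (at_right 0)"
        unfolding F_def by (intro tendsto_mult tendsto_add tendsto_powr tendsto_diff tendsto_const eta1_lim) auto
      then show ?thesis by simp
    qed
    have F1: "\<forall>\<^sub>F z in at_right 0. F z < (1 + theta) / 2"
      using F_lim th by (intro order_tendstoD(2)) auto
    have E1: "\<forall>\<^sub>F z in at_right 0. eta1 z < 1 / 2"
      using eta1_lim by (rule order_tendstoD(2)) simp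
    have X: "\<forall>\<^sub>F z in at_right 0. ((kap + K) * (2 * Ce) + real N) * z \<le> kap / 2"
      by (rule lin) (use kap in simp)
    have l: "\<forall>\<^sub>F z in at_right (0::real). 1 * z \<le> 1" "\<forall>\<^sub>F z in at_right 0. Ce * z \<le> 1 / 2"
      "\<forall>\<^sub>F z in at_right 0. real N * z \<le> 1" "\<forall>\<^sub>F z in at_right 0. 1 * z \<le> c0 / 2"
      by (rule lin, use c0 in simp)+
    show ?thesis
      using F1 E1 X l eventually_at_right_less[of "0::real"]
    proof eventually_elim
      case (elim z)
      have "kap * eta z + K * eta z + real N * z = ((kap + K) * (2 * Ce) + real N) * z"
        by (simp add: eta_def algebra_simps)
      then show ?case using elim by (simp add: good_def)
    qed
  qed
  then obtain z where z: "0 < z" "good z"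
    using eventually_happens'[OF trivial_limit_at_right_real] by blast
  have g: "z \<le> 1" "Ce * z \<le> 1 / 2" "real N * z \<le> 1" "z \<le> c0 / 2"
     "kap * eta z + K * eta z + real N * z \<le> kap / 2" "eta1 z \<le> 1 / 2" "F z \<le> (1 + theta) / 2"
    using z(2) by (auto simp: good_def)
  have et0: "0 \<le> eta z" using Ce0 z by (simp add: eta_def)
  have s0: "0 \<le> s z" using K0 z by (simp add: s_def)
  have s20: "0 \<le> s2 z" using K0 s0 by (simp add: s2_def)
  have main: "contracting_cocycle P N D' (kap / 2) (K + 1) alpha ((1 + theta) / 2) (c0 / 2) n0 q0"
    if op': "\<And>a. opN N (D' a)" and S: "\<And>a. \<exists>S. finite S \<and> card S \<le> card J \<and> range (D' a) \<subseteq> span S"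
      and d: "\<And>a q. q < N \<Longrightarrow> norm (D' a (ev q) - D a (ev q)) \<le> z" for D'
  proof -
    have dd: "norm (D' c x - D c x) \<le> real N * z * norm x" for c x
      by (rule op_diff_le[OF op op' d])
    have approx: "\<exists>y'\<in>range (D a). norm (y - y') \<le> eta z * norm y" if y: "y \<in> range (D' a)" for a y
    proof -
      from S[of a] obtain S where S0: "finite S \<and> card S \<le> card J \<and> range (D' a) \<subseteq> span S" ..
      note S = conjunct1[OF S0] conjunct1[OF conjunct2[OF S0]] conjunct2[OF conjunct2[OF S0]]
      have "nm N (Hh a) * real N * (\<Sum>p\<in>J. norm (b a p)) * z \<le> Ce * z"
        by (rule mult_right_mono[OF Ce_ge less_imp_le[OF z(1)]])
      then have e: "nm N (Hh a) * real N * z * (\<Sum>p\<in>J. norm (b a p)) \<le> Ce * z"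
        by (simp only: mult.assoc mult.commute mult.left_commute)
      have "\<exists>y'\<in>range (D a). norm (y - y') \<le> 2 * (Ce * z) * norm y"
      proof (rule range_approximation[OF op op' Hh J(1) _ _ S d _ e g(2) y])
        show "Hh a (D a (b a p)) = ev p" if "p \<in> J" for p by (rule J(2)[OF that])
        show "inj_on (\<lambda>p. p) J" by (rule inj_onI)
        show "0 \<le> z" using z(1) by simp
      qed
      then show ?thesis by (simp add: eta_def)
    qed
    interpret C: linear_cocycle P N D' "kap / 2" "K + 1"
    proof
      show "opN N (D' a)" for a by (rule op')
      show "0 < kap / 2" "kap / 2 \<le> 1" "1 \<le> K + 1" using kap K by auto
      fix a c x
      show "norm (D' a v) \<le> (K + 1) * norm v" for v
      proof -
        have "norm (D' a v) \<le> norm (D a v) + norm (D' a v - D a v)" by (rule norm_triangle_sub)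
        also have "\<dots> \<le> K * norm v + 1 * norm v"
          by (intro add_mono upper order_trans[OF dd] mult_right_mono g) auto
        finally show ?thesis by (simp add: distrib_right)
      qed
      let ?y = "D' a x"
      \<comment> \<open>The lower bound is known on the range of \<open>D a\<close>, so the vector
        of the perturbed range is moved there first; the three error terms are those collected in
        \<open>good\<close>.\<close>
      obtain y' where y': "y' \<in> range (D a)" "norm (?y - y') \<le> eta z * norm ?y"
        using approx[of ?y a] by blast
      obtain x' where x': "y' = D a x'" using y'(1) by blast
      have l: "kap * norm y' \<le> norm (D c y')" using lower[of a x' c] x' by simp
      have "norm ?y \<le> norm y' + norm (?y - y')" by (rule norm_triangle_sub)
      then have "kap * (norm ?y - eta z * norm ?y) \<le> kap * norm y'"
        using y'(2) kap by (intro mult_left_mono) auto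
      moreover have "norm (D c y') \<le> norm (D c ?y) + norm (D c (?y - y'))"
        using norm_triangle_ineq4[of "D c ?y" "D c (?y - y')"] by (simp add: linear_diff[OF opN_linear[OF op]])
      moreover have "norm (D c (?y - y')) \<le> K * (eta z * norm ?y)"
        using order_trans[OF upper mult_left_mono[OF y'(2) K0]] .
      moreover have "norm (D c ?y) \<le> norm (D' c ?y) + norm (D' c ?y - D c ?y)"
        by (rule norm_triangle_sub')
      moreover have "norm (D' c ?y - D c ?y) \<le> real N * z * norm ?y" by (rule dd)
      ultimately have "kap * norm ?y - (kap * eta z + K * eta z + real N * z) * norm ?y \<le> norm (D' c ?y)"
        using l by (simp add: algebra_simps)
      moreover have "(kap * eta z + K * eta z + real N * z) * norm ?y \<le> kap / 2 * norm ?y"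
        by (intro mult_right_mono g) auto
      ultimately show "kap / 2 * norm (D' a x) \<le> norm (D' c (D' a x))" by linarith
    qed
    have fd: "norm (fold D' w x - fold D w x) \<le> real N * (2 * (K + 1)) ^ length w * z * norm x" for w x
    proof (induction w rule: rev_induct)
      case Nil
      then show ?case using z by simp
    next
      case (snoc c w)
      let ?x' = "fold D' w x" and ?x = "fold D w x" and ?n = "length w"
      have "D' c ?x' - D c ?x = (D' c ?x' - D c ?x') + D c (?x' - ?x)"
        by (simp add: linear_diff[OF opN_linear[OF op]])
      then have "norm (D' c ?x' - D c ?x) \<le> norm (D' c ?x' - D c ?x') + norm (D c (?x' - ?x))"
        by (simp only: norm_triangle_ineq)
      also have "\<dots> \<le> real N * z * ((K + 1) ^ ?n * norm x) + K * (real N * (2 * (K + 1)) ^ ?n * z * norm x)"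
        using z(1) K0 by (intro add_mono order_trans[OF dd] order_trans[OF upper] mult_left_mono snoc C.norm_fold_upper) auto
      also have "real N * z * ((K + 1) ^ ?n * norm x) \<le> real N * z * ((2 * (K + 1)) ^ ?n * norm x)"
        using z(1) K0 by (intro mult_left_mono mult_right_mono power_mono) auto
      also have "real N * z * ((2 * (K + 1)) ^ ?n * norm x) + K * (real N * (2 * (K + 1)) ^ ?n * z * norm x)
          = (K + 1) * (real N * (2 * (K + 1)) ^ ?n * z * norm x)" by (simp add: algebra_simps)
      also have "\<dots> \<le> (2 * (K + 1)) * (real N * (2 * (K + 1)) ^ ?n * z * norm x)"
        using z(1) K0 by (intro mult_right_mono) auto
      finally show ?case by (simp add: mult_ac)
    qed
    have fd0: "norm (fold D' w x - fold D w x) \<le> s z * norm x" if "length w = n0" for w x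
      using fd[of w x] that by (simp add: s_def)
    have m2d: "m2 N (fold D' w) \<le> m2 N (fold D w) + s2 z" if w: "length w = n0" for w
    proof -
      have "wd N (fold D' w (ev q)) (fold D' w (ev r))
          \<le> wd N (fold D w (ev q)) (fold D w (ev r)) + 4 * (real N)\<^sup>2 * (K + 1) ^ n0 * s z" for q r
      proof (rule wd_perturb)
        show "norm (fold D' w (ev q) - fold D w (ev q)) \<le> s z" using fd0[OF w, of "ev q"] by simp
        show "norm (fold D' w (ev r) - fold D w (ev r)) \<le> s z" using fd0[OF w, of "ev r"] by simp
        show "norm (fold D' w (ev r)) \<le> (K + 1) ^ n0" using C.norm_fold_upper[of w "ev r"] w by simp
        have "norm (fold D w (ev q)) \<le> K ^ n0" using norm_fold_upper[of w "ev q"] w by simp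
        also have "\<dots> \<le> (K + 1) ^ n0" using K0 by (intro power_mono) auto
        finally show "norm (fold D w (ev q)) \<le> (K + 1) ^ n0" .
      qed
      then have "m2 N (fold D' w) \<le> (\<Sum>q<N. \<Sum>r<N. wd N (fold D w (ev q)) (fold D w (ev r)) + 4 * (real N)\<^sup>2 * (K + 1) ^ n0 * s z)"
        unfolding m2_def by (intro sum_mono)
      also have "\<dots> = m2 N (fold D w) + s2 z"
        by (simp add: m2_def s2_def sum.distrib power2_eq_square)
      finally show ?thesis .
    qed
    have unif': "wex P n0 (\<lambda>w. (m2 N (fold D' w) / (norm (fold D' w y))\<^sup>2) powr alpha) \<le> (1 + theta) / 2"
      if y: "y \<in> range (D' a)" "norm y = 1" for a y
    proof -
      \<comment> \<open>A nearby vector of the unperturbed range, normalised below to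
        \<open>v\<close>, carries the assumption \<open>unif\<close> over to
        \<open>y\<close>.\<close>
      obtain y' where y': "y' \<in> range (D a)" "norm (y - y') \<le> eta z" using approx[OF y(1)] y(2) by auto
      have ny: "1 - eta z \<le> norm y'" using norm_triangle_sub[of y y'] y y' by linarith
      have "eta z \<le> eta1 z" using s0 et0 kn K0 by (simp add: eta1_def)
      then have "eta z \<le> 1 / 2" using g(6) by linarith
      then have ny0: "0 < norm y'" using ny by linarith
      define v where "v = y' /\<^sub>R norm y'"
      have v: "v \<in> range (D a)" "norm v = 1" "y' = norm y' *\<^sub>R v"
      proof -
        obtain x where "y' = D a x" using y'(1) by blast
        then have "v = D a (x /\<^sub>R norm y')" unfolding v_def by (simp add: linear_scale[OF opN_linear[OF op]])
        then show "v \<in> range (D a)" by simp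
        show "norm v = 1" "y' = norm y' *\<^sub>R v" using ny0 by (auto simp: v_def)
      qed
      have stv: "st a v" using v by (auto simp: st_def)
      have pt: "(m2 N (fold D' w) / (norm (fold D' w y))\<^sup>2) powr alpha
          \<le> (1 - eta1 z) powr (- 2 * alpha) * ((m2 N (fold D w) / (norm (fold D w v))\<^sup>2) powr alpha + (s2 z / (kap ^ n0)\<^sup>2) powr alpha)"
        if w: "length w = n0" for w
      proof -
        let ?x = "norm (fold D w v)"
        have x: "kap ^ n0 \<le> ?x" using norm_fold_lower[OF stv, of w] w v(2) by simp
        then have x0: "0 < ?x" using kn by linarith
        have "fold D w y' = norm y' *\<^sub>R fold D w v"
          by (subst v(3)) (rule linear_scale[OF linear_fold])
        then have a1: "norm (fold D w y') = norm y' * ?x" by simp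
        have a2: "norm (fold D w y') \<le> norm (fold D' w y) + norm (fold D' w y - fold D w y) + norm (fold D w (y - y'))"
        proof -
          have "fold D w y' = fold D' w y - (fold D' w y - fold D w y) - fold D w (y - y')"
            by (simp add: linear_diff[OF linear_fold])
          then have "norm (fold D w y') \<le> norm (fold D' w y - (fold D' w y - fold D w y)) + norm (fold D w (y - y'))"
            by (simp only: norm_triangle_ineq4)
          then show ?thesis using norm_triangle_ineq4[of "fold D' w y" "fold D' w y - fold D w y"] by linarith
        qed
        have a3: "norm (fold D' w y - fold D w y) \<le> s z" using fd0[OF w, of y] y by simp
        have a4: "norm (fold D w (y - y')) \<le> K ^ n0 * eta z"
          using norm_fold_upper[of w "y - y'"] w y' K0 mult_left_mono[OF y'(2), of "K ^ n0"] by simp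
        have a5: "(1 - eta z) * ?x \<le> norm y' * ?x" using ny by (intro mult_right_mono) auto
        have a6: "s z + K ^ n0 * eta z \<le> (s z + K ^ n0 * eta z) / kap ^ n0 * ?x"
        proof -
          have "(s z + K ^ n0 * eta z) / kap ^ n0 * kap ^ n0 \<le> (s z + K ^ n0 * eta z) / kap ^ n0 * ?x"
            using x s0 et0 K0 kn by (intro mult_left_mono) auto
          then show ?thesis using kap by simp
        qed
        have low: "(1 - eta1 z) * ?x \<le> norm (fold D' w y)"
          using a1 a2 a3 a4 a5 a6 by (simp add: eta1_def algebra_simps)
        have e1: "0 < 1 - eta1 z" using g(6) by linarith
        have "m2 N (fold D' w) / (norm (fold D' w y))\<^sup>2 \<le> (m2 N (fold D w) + s2 z) / ((1 - eta1 z) * ?x)\<^sup>2"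
          using m2d[OF w] low e1 x0 m2_nonneg[of N "fold D w"] m2_nonneg[of N "fold D' w"] s20
          by (intro frac_le power_mono) auto
        also have "\<dots> = (m2 N (fold D w) / ?x\<^sup>2 + s2 z / ?x\<^sup>2) / (1 - eta1 z)\<^sup>2"
          by (simp add: power_mult_distrib add_divide_distrib mult.commute)
        also have "\<dots> \<le> (m2 N (fold D w) / ?x\<^sup>2 + s2 z / (kap ^ n0)\<^sup>2) / (1 - eta1 z)\<^sup>2"
        proof (intro divide_right_mono add_left_mono)
          have "(kap ^ n0)\<^sup>2 \<le> ?x\<^sup>2" using x kn by (intro power_mono) auto
          moreover have "0 < ?x\<^sup>2 * (kap ^ n0)\<^sup>2" by (intro mult_pos_pos zero_less_power x0 kn)
          ultimately show "s2 z / ?x\<^sup>2 \<le> s2 z / (kap ^ n0)\<^sup>2" using s20 by (intro divide_left_mono)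
        qed simp
        finally have "(m2 N (fold D' w) / (norm (fold D' w y))\<^sup>2) powr alpha
            \<le> ((m2 N (fold D w) / ?x\<^sup>2 + s2 z / (kap ^ n0)\<^sup>2) / (1 - eta1 z)\<^sup>2) powr alpha"
          using al m2_nonneg by (intro powr_mono2) auto
        also have "\<dots> = (m2 N (fold D w) / ?x\<^sup>2 + s2 z / (kap ^ n0)\<^sup>2) powr alpha / ((1 - eta1 z)\<^sup>2) powr alpha"
          by (rule powr_divide)
        also have "((1 - eta1 z)\<^sup>2) powr alpha = (1 - eta1 z) powr (2 * alpha)"
          using e1 by (simp add: powr_powr[symmetric] powr_numeral)
        also have "(m2 N (fold D w) / ?x\<^sup>2 + s2 z / (kap ^ n0)\<^sup>2) powr alpha / (1 - eta1 z) powr (2 * alpha)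
            = (1 - eta1 z) powr (- 2 * alpha) * (m2 N (fold D w) / ?x\<^sup>2 + s2 z / (kap ^ n0)\<^sup>2) powr alpha"
          by (simp add: powr_minus field_simps)
        also have "\<dots> \<le> (1 - eta1 z) powr (- 2 * alpha) * ((m2 N (fold D w) / ?x\<^sup>2) powr alpha + (s2 z / (kap ^ n0)\<^sup>2) powr alpha)"
          using al m2_nonneg s20 by (intro mult_left_mono powr_add_le) auto
        finally show ?thesis .
      qed
      have "wex P n0 (\<lambda>w. (m2 N (fold D' w) / (norm (fold D' w y))\<^sup>2) powr alpha)
         \<le> wex P n0 (\<lambda>w. (1 - eta1 z) powr (- 2 * alpha) * ((m2 N (fold D w) / (norm (fold D w v))\<^sup>2) powr alpha + (s2 z / (kap ^ n0)\<^sup>2) powr alpha))"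
        by (rule wex_mono) (rule pt)
      also have "\<dots> = (1 - eta1 z) powr (- 2 * alpha) * (wex P n0 (\<lambda>w. (m2 N (fold D w) / (norm (fold D w v))\<^sup>2) powr alpha) + (s2 z / (kap ^ n0)\<^sup>2) powr alpha)"
        by (simp only: wex_cmult wex_add wex_const)
      also have "\<dots> \<le> F z"
        unfolding F_def by (intro mult_left_mono add_right_mono unif[OF v(1,2)]) auto
      also have "\<dots> \<le> (1 + theta) / 2" by (rule g(7))
      finally show ?thesis .
    qed
    show ?thesis
    proof
      show "0 < alpha" "alpha \<le> 1" "0 < (1 + theta) / 2" "(1 + theta) / 2 < 1" "1 \<le> n0" "0 < c0 / 2" "c0 / 2 \<le> 1"
        using al th n0 c0 by auto
      show "q0 a < N" for a by (rule q0)
      show "c0 / 2 \<le> norm (D' a (ev (q0 a)))" for a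
      proof -
        have "norm (D a (ev (q0 a))) \<le> norm (D' a (ev (q0 a))) + norm (D' a (ev (q0 a)) - D a (ev (q0 a)))"
          by (rule norm_triangle_sub')
        then show ?thesis using d[OF q0(1)[of a], of a] q0(2)[of a] g(4) by linarith
      qed
      fix v a w assume vw: "v \<in> range (D' a)" "w \<in> range (D' a)" "v \<noteq> 0" "w \<noteq> 0"
      have sv: "C.st a v" "C.st a w" using vw by (auto simp: C.st_def)
      define v1 where "v1 = v /\<^sub>R norm v"
      define w1 where "w1 = w /\<^sub>R norm w"
      have unit: "x /\<^sub>R norm x \<in> range (D' a)" "norm (x /\<^sub>R norm x) = 1" if x: "x \<in> range (D' a)" "x \<noteq> 0" for x
      proof -
        obtain t where "x = D' a t" using x(1) by blast
        then have "x /\<^sub>R norm x = D' a (t /\<^sub>R norm x)" by (simp add: linear_scale[OF opN_linear[OF op']])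
        then show "x /\<^sub>R norm x \<in> range (D' a)" by simp
        show "norm (x /\<^sub>R norm x) = 1" using x by simp
      qed
      let ?X = "\<lambda>x u. (m2 N (fold D' u) / (norm (fold D' u x))\<^sup>2) powr alpha"
      \<comment> \<open>\<open>wd_image_le\<close> extracts \<open>m2\<close> for the pair, and the
        geometric mean separates the two norms, so the estimate for single unit vectors can be
        applied twice.\<close>
      have pt: "dl N (fold D' u v) (fold D' u w) powr alpha \<le> dl N v w powr alpha / 2 * (?X v1 u + ?X w1 u)"
        if u: "length u = n0" for u
      proof -
        have ne: "u \<noteq> []" using u n0 by auto
        have p: "0 < norm (fold D' u v1)" "0 < norm (fold D' u w1)"
        proof -
          have pos: "0 < norm (fold D' u (x /\<^sub>R norm x))" if x: "x \<in> range (D' a)" "x \<noteq> 0" for x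
          proof -
            have "C.st a (x /\<^sub>R norm x)" using unit[OF x] by (auto simp: C.st_def)
            then obtain b where "C.st b (fold D' u (x /\<^sub>R norm x))" using C.fold_st by blast
            then show ?thesis by (simp add: C.st_def)
          qed
          show "0 < norm (fold D' u v1)" unfolding v1_def using vw by (intro pos)
          show "0 < norm (fold D' u w1)" unfolding w1_def using vw by (intro pos)
        qed
        have fv: "norm (fold D' u v) = norm v * norm (fold D' u v1)" "norm (fold D' u w) = norm w * norm (fold D' u w1)"
          using vw by (simp_all add: v1_def w1_def linear_scale[OF C.linear_fold])
        have "dl N (fold D' u v) (fold D' u w) \<le> (m2 N (fold D' u) * wd N v w) / (norm (fold D' u v) * norm (fold D' u w))"
          unfolding dl_def by (intro divide_right_mono wd_image_le C.opN_fold ne) auto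
        also have "\<dots> = dl N v w * (m2 N (fold D' u) / (norm (fold D' u v1) * norm (fold D' u w1)))"
          unfolding fv dl_def by (simp add: field_simps)
        finally have "dl N (fold D' u v) (fold D' u w) powr alpha \<le> (dl N v w * (m2 N (fold D' u) / (norm (fold D' u v1) * norm (fold D' u w1)))) powr alpha"
          using al dl_nonneg by (intro powr_mono2) auto
        also have "\<dots> = dl N v w powr alpha * (m2 N (fold D' u) / (norm (fold D' u v1) * norm (fold D' u w1))) powr alpha"
          by (rule powr_mult)
        also have "\<dots> \<le> dl N v w powr alpha * ((?X v1 u + ?X w1 u) / 2)"
          using p m2_nonneg by (intro mult_left_mono powr_geometric_mean_le) auto
        finally show ?thesis by simp
      qed
      have u1: "wex P n0 (?X v1) \<le> (1 + theta) / 2"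
        unfolding v1_def by (rule unif'[OF unit(1)[OF vw(1,3)] unit(2)[OF vw(1,3)]])
      have u2: "wex P n0 (?X w1) \<le> (1 + theta) / 2"
        unfolding w1_def by (rule unif'[OF unit(1)[OF vw(2,4)] unit(2)[OF vw(2,4)]])
      have "wex P n0 (\<lambda>u. dl N (fold D' u v) (fold D' u w) powr alpha)
        \<le> wex P n0 (\<lambda>u. dl N v w powr alpha / 2 * (?X v1 u + ?X w1 u))"
        by (rule wex_mono) (rule pt)
      also have "\<dots> = dl N v w powr alpha / 2 * (wex P n0 (?X v1) + wex P n0 (?X w1))"
        by (simp only: wex_cmult wex_add)
      also have "\<dots> \<le> dl N v w powr alpha / 2 * ((1 + theta) / 2 + (1 + theta) / 2)"
        by (intro mult_left_mono add_mono u1 u2) simp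
      finally show "wex P n0 (\<lambda>u. dl N (fold D' u v) (fold D' u w) powr alpha) \<le> (1 + theta) / 2 * dl N v w powr alpha"
        by (simp add: field_simps)
    qed
  qed
  show ?thesis using z(1) g(1) main by (intro exI[of _ z]) auto
qed

section \<open>Exterior powers\<close>

text \<open>Index lists in place of index sets give direct access to the entries, as expansions over
  permutations require; for increasing lists this is the determinant of the submatrix.\<close>

definition minor :: "nat \<Rightarrow> real mat \<Rightarrow> nat list \<Rightarrow> nat list \<Rightarrow> real" where
  "minor i A l l' = det (mat i i (\<lambda>(p, q). A $$ (l ! p, l' ! q)))"

lemma set_ext_idx: "set (ext_idx d i) = {l. length l = i \<and> set l \<subseteq> {0..<d} \<and> sorted_wrt (<) l}"
  by (auto simp: ext_idx_def set_n_lists)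

lemma distinct_ext_idx: "distinct (ext_idx d i)"
  unfolding ext_idx_def by (intro distinct_filter distinct_n_lists) simp

lemma pick_set_sorted:
  assumes "sorted_wrt (<) l" "p < length l" shows "pick (set l) p = l ! p"
proof -
  have lt: "l ! a < l ! b \<longleftrightarrow> a < b" if "a < length l" "b < length l" for a b
    using assms(1) that by (metis linorder_neqE_nat not_less_iff_gr_or_eq sorted_wrt_iff_nth_less)
  have "{a \<in> set l. a < l ! p} = (!) l ` {..<p}"
  proof (intro equalityI subsetI)
    fix x assume "x \<in> {a \<in> set l. a < l ! p}"
    then obtain q where "q < length l" "x = l ! q" "l ! q < l ! p" by (auto simp: in_set_conv_nth)
    then show "x \<in> (!) l ` {..<p}" using lt[of q p] assms(2) by auto
  next
    fix x assume "x \<in> (!) l ` {..<p}"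
    then obtain q where "q < p" "x = l ! q" by auto
    then show "x \<in> {a \<in> set l. a < l ! p}" using lt[of q p] assms(2) by auto
  qed
  moreover have "inj_on ((!) l) {..<p}"
    using assms by (intro inj_on_nth) (auto simp: strict_sorted_iff)
  ultimately have "card {a \<in> set l. a < l ! p} = p" by (simp add: card_image)
  moreover have "l ! p \<in> set l" using assms(2) by simp
  ultimately show ?thesis using pick_card_in_set[of "l ! p" "set l"] by simp
qed

lemma list_nth_less: "set l \<subseteq> {0..<d} \<Longrightarrow> p < length l \<Longrightarrow> l ! p < (d::nat)"
  by (meson atLeastLessThan_iff nth_mem subsetD)

lemma dim_ext_pow [simp]: "dim_row (ext_pow i A) = ext_dim (dim_row A) i" "dim_col (ext_pow i A) = ext_dim (dim_row A) i"
  by (simp_all add: ext_pow_def ext_dim_def Let_def)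

lemma ext_pow_carrier: "A \<in> carrier_mat d d \<Longrightarrow> ext_pow i A \<in> carrier_mat (ext_dim d i) (ext_dim d i)"
  by (metis carrier_matD(1) carrier_matI dim_ext_pow)

lemma ext_idx_nth:
  assumes "r < ext_dim d i"
  shows "length (ext_idx d i ! r) = i" "set (ext_idx d i ! r) \<subseteq> {0..<d}" "sorted_wrt (<) (ext_idx d i ! r)"
    "distinct (ext_idx d i ! r)"
proof -
  have "ext_idx d i ! r \<in> set (ext_idx d i)" using assms by (simp add: ext_dim_def)
  then show "length (ext_idx d i ! r) = i" "set (ext_idx d i ! r) \<subseteq> {0..<d}" and s: "sorted_wrt (<) (ext_idx d i ! r)"
    by (auto simp: set_ext_idx)
  show "distinct (ext_idx d i ! r)" using s strict_sorted_iff by blast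
qed

lemma ext_pow_index:
  assumes A: "A \<in> carrier_mat d d" and r: "r < ext_dim d i" and c: "c < ext_dim d i"
  shows "ext_pow i A $$ (r, c) = minor i A (ext_idx d i ! r) (ext_idx d i ! c)"
proof -
  have card: "card {x. x < d \<and> x \<in> set (ext_idx d i ! s)} = i" if s: "s < ext_dim d i" for s
  proof -
    have "{x. x < d \<and> x \<in> set (ext_idx d i ! s)} = set (ext_idx d i ! s)" using ext_idx_nth(2)[OF s] by auto
    then show ?thesis using ext_idx_nth[OF s] by (simp add: distinct_card)
  qed
  have "submatrix A (set (ext_idx d i ! r)) (set (ext_idx d i ! c))
      = mat i i (\<lambda>(p, q). A $$ (ext_idx d i ! r ! p, ext_idx d i ! c ! q))"
    using A unfolding submatrix_def
    by (intro eq_matI) (auto simp: card[OF r] card[OF c] pick_set_sorted ext_idx_nth[OF r] ext_idx_nth[OF c])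
  moreover have "r < length (ext_idx d i)" "c < length (ext_idx d i)" using r c by (auto simp: ext_dim_def)
  ultimately show ?thesis using A by (simp add: ext_pow_def minor_def Let_def)
qed

lemma sum_ext_idx: "(\<Sum>k<ext_dim d i. f (ext_idx d i ! k)) = (\<Sum>l\<in>set (ext_idx d i). f l)"
proof -
  have "bij_betw ((!) (ext_idx d i)) {..<length (ext_idx d i)} (set (ext_idx d i))"
    by (rule bij_betw_nth[OF distinct_ext_idx]) auto
  then show ?thesis unfolding ext_dim_def by (rule sum.reindex_bij_betw)
qed

text \<open>An injective map is determined by its image, listed increasingly as \<open>h\<close>,
  and the permutation \<open>s\<close> that reorders this list. Restriction on one side and
  permutations fixed outside the interval on the other make the correspondence one-to-one.\<close>

lemma bij_sorted_perm:
  "bij_betw (\<lambda>(h, s). restrict (\<lambda>p. h ! (s p)) {0..<i})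
     (set (ext_idx d i) \<times> {s. s permutes {0..<i}})
     {f \<in> {0..<i} \<rightarrow>\<^sub>E {0..<d}. inj_on f {0..<i}}" (is "bij_betw ?F ?A ?B")
proof (rule bij_betw_imageI)
  have dist: "distinct h" "length h = i" "sorted_wrt (<) h" "set h \<subseteq> {0..<d}" if "h \<in> set (ext_idx d i)" for h
    using that by (auto simp: set_ext_idx strict_sorted_iff)
  have img: "(\<lambda>p. h ! (s p)) ` {0..<i} = set h" if "h \<in> set (ext_idx d i)" "s permutes {0..<i}" for h s
  proof -
    have "(\<lambda>p. h ! (s p)) ` {0..<i} = (!) h ` (s ` {0..<i})" by (simp add: image_image)
    also have "s ` {0..<i} = {0..<i}" by (rule permutes_image[OF that(2)])
    also have "(!) h ` {0..<i} = set h" using dist(2)[OF that(1)] by (auto simp: set_conv_nth)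
    finally show ?thesis .
  qed
  show "inj_on ?F ?A"
  proof (rule inj_onI, clarify)
    fix h s h' s'
    assume h: "h \<in> set (ext_idx d i)" "h' \<in> set (ext_idx d i)" and s: "s permutes {0..<i}" "s' permutes {0..<i}"
      and eq: "restrict (\<lambda>p. h ! (s p)) {0..<i} = restrict (\<lambda>p. h' ! (s' p)) {0..<i}"
    have pt: "h ! (s p) = h' ! (s' p)" if "p \<in> {0..<i}" for p using fun_cong[OF eq, of p] that by simp
    then have "set h = set h'" using img[OF h(1) s(1)] img[OF h(2) s(2)] by (metis (no_types, lifting) image_cong)
    then have hh: "h = h'" using dist(3)[OF h(1)] dist(3)[OF h(2)] strict_sorted_equal by blast
    have "s p = s' p" for p
    proof (cases "p \<in> {0..<i}")
      case True
      then have "s p \<in> {0..<i}" "s' p \<in> {0..<i}" using s by (simp_all only: permutes_in_image)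
      then show ?thesis using pt[OF True] hh nth_eq_iff_index_eq[OF dist(1)[OF h(2)], of "s p" "s' p"] dist(2)[OF h(2)] by simp
    next
      case False
      then show ?thesis using s by (simp add: permutes_not_in)
    qed
    then show "h = h' \<and> s = s'" using hh by auto
  qed
  show "?F ` ?A = ?B"
  proof (intro equalityI subsetI)
    fix f assume "f \<in> ?F ` ?A"
    then obtain h s where hs: "h \<in> set (ext_idx d i)" "s permutes {0..<i}" "f = restrict (\<lambda>p. h ! (s p)) {0..<i}"
      by auto
    have sp: "s p < i" if "p < i" for p using permutes_in_image[OF hs(2), of p] that by simp
    have "h ! (s p) < d" if "p < i" for p
    proof -
      have "h ! (s p) \<in> set h" using sp[OF that] dist(2)[OF hs(1)] by simp
      then show ?thesis using dist(4)[OF hs(1)] by auto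
    qed
    then have 1: "f \<in> {0..<i} \<rightarrow>\<^sub>E {0..<d}" by (auto simp: hs(3))
    have "inj_on f {0..<i}"
    proof (rule inj_onI)
      fix p q assume pq: "p \<in> {0..<i}" "q \<in> {0..<i}" "f p = f q"
      then have "s p = s q" using sp nth_eq_iff_index_eq[OF dist(1)[OF hs(1)]] dist(2)[OF hs(1)] by (simp add: hs(3))
      then show "p = q" using permutes_inj[OF hs(2)] by (simp add: inj_eq)
    qed
    then show "f \<in> ?B" using 1 by simp
  next
    fix f assume f: "f \<in> ?B"
    define h where "h = sorted_list_of_set (f ` {0..<i})"
    have seth: "set h = f ` {0..<i}" by (simp add: h_def)
    have h: "h \<in> set (ext_idx d i)"
      using f by (auto simp: h_def set_ext_idx card_image)
    have b1: "bij_betw f {0..<i} (set h)" using f by (simp add: bij_betw_def seth)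
    have b2: "bij_betw ((!) h) {0..<i} (set h)"
      using bij_betw_nth[OF dist(1)[OF h], of "{0..<i}" "set h"] dist(2)[OF h] by (simp add: lessThan_atLeast0)
    define s where "s = (\<lambda>p. if p \<in> {0..<i} then inv_into {0..<i} ((!) h) (f p) else p)"
    have "bij_betw (inv_into {0..<i} ((!) h) \<circ> f) {0..<i} {0..<i}"
      by (rule bij_betw_trans[OF b1 bij_betw_inv_into[OF b2]])
    then have "bij_betw s {0..<i} {0..<i}" by (rule bij_betw_cong[THEN iffD1, rotated]) (simp add: s_def)
    then have sp: "s permutes {0..<i}" by (rule bij_imp_permutes) (simp add: s_def)
    have "h ! (s p) = f p" if "p \<in> {0..<i}" for p
    proof -
      have "f p \<in> (!) h ` {0..<i}" using b1 b2 that by (auto simp: bij_betw_def)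
      then show ?thesis using that by (simp add: s_def f_inv_into_f)
    qed
    then have "f = restrict (\<lambda>p. h ! (s p)) {0..<i}"
      using f by (intro ext) (auto simp: PiE_def extensional_def)
    then show "f \<in> ?F ` ?A" using h sp by (intro image_eqI[of _ _ "(h, s)"]) auto
  qed
qed

text \<open>Expanding the determinant and the entries of \<open>A * B\<close> gives a sum over all
  maps from rows to inner indices. Maps that repeat a value contribute a determinant with two equal
  rows; the injective ones are regrouped by \<open>bij_sorted_perm\<close>, where the permutation
  splits off as a sign and completes the minor of \<open>A\<close>.\<close>

theorem Cauchy_Binet_minor:
  assumes A: "A \<in> carrier_mat d d" and B: "B \<in> carrier_mat d d"
    and l: "length l = i" "set l \<subseteq> {0..<d}" and l': "length l' = i" "set l' \<subseteq> {0..<d}"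
  shows "minor i (A * B) l l' = (\<Sum>h\<in>set (ext_idx d i). minor i A l h * minor i B h l')"
proof -
  let ?I = "{0..<i}" and ?D = "{0..<d}"
  have ld: "l ! p < d" "l' ! p < d" if "p < i" for p
    using list_nth_less[OF l(2), of p] list_nth_less[OF l'(2), of p] l(1) l'(1) that by auto
  have minor_eq: "minor i M x y = (\<Sum>s | s permutes ?I. signof s * (\<Prod>p\<in>?I. M $$ (x ! p, y ! (s p))))" for M x y
  proof -
    have "minor i M x y = (\<Sum>s | s permutes ?I. signof s * (\<Prod>p\<in>?I. mat i i (\<lambda>(p, q). M $$ (x ! p, y ! q)) $$ (p, s p)))"
      unfolding minor_def by (rule det_def'[of _ i]) simp
    also have "\<dots> = (\<Sum>s | s permutes ?I. signof s * (\<Prod>p\<in>?I. M $$ (x ! p, y ! (s p))))"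
    proof (intro sum.cong refl arg_cong2[where f="(*)"] prod.cong)
      fix s p assume "s \<in> {s. s permutes ?I}" "p \<in> ?I"
      then have "s p \<in> ?I" by (simp only: permutes_in_image mem_Collect_eq)
      then show "mat i i (\<lambda>(p, q). M $$ (x ! p, y ! q)) $$ (p, s p) = M $$ (x ! p, y ! (s p))"
        using \<open>p \<in> ?I\<close> by simp
    qed
    finally show ?thesis .
  qed
  \<comment> \<open>The determinant of the matrix with row \<open>f p\<close> of \<open>B\<close> in
    position \<open>p\<close>, columns taken from \<open>l'\<close>; \<open>f\<close> may repeat
    rows.\<close>
  define Bf where "Bf = (\<lambda>f. \<Sum>s | s permutes ?I. signof s * (\<Prod>p\<in>?I. B $$ (f p, l' ! (s p))))"
  have Bf_det: "Bf f = det (mat i i (\<lambda>(p, q). B $$ (f p, l' ! q)))" for f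
  proof -
    have "det (mat i i (\<lambda>(p, q). B $$ (f p, l' ! q)))
        = (\<Sum>s | s permutes ?I. signof s * (\<Prod>p\<in>?I. mat i i (\<lambda>(p, q). B $$ (f p, l' ! q)) $$ (p, s p)))"
      by (rule det_def'[of _ i]) simp
    also have "\<dots> = Bf f" unfolding Bf_def
    proof (intro sum.cong refl arg_cong2[where f="(*)"] prod.cong)
      fix s p assume "s \<in> {s. s permutes ?I}" "p \<in> ?I"
      then have "s p \<in> ?I" by (simp only: permutes_in_image mem_Collect_eq)
      then show "mat i i (\<lambda>(p, q). B $$ (f p, l' ! q)) $$ (p, s p) = B $$ (f p, l' ! (s p))"
        using \<open>p \<in> ?I\<close> by simp
    qed
    finally show ?thesis ..
  qed
  have "minor i (A * B) l l' = (\<Sum>s | s permutes ?I. signof s * (\<Prod>p\<in>?I. \<Sum>k\<in>?D. A $$ (l ! p, k) * B $$ (k, l' ! (s p))))"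
    unfolding minor_eq
  proof (intro sum.cong refl arg_cong2[where f="(*)"] prod.cong)
    fix s p assume s: "s \<in> {s. s permutes ?I}" and p: "p \<in> ?I"
    then have "s p \<in> ?I" by (simp only: permutes_in_image mem_Collect_eq)
    then show "(A * B) $$ (l ! p, l' ! (s p)) = (\<Sum>k\<in>?D. A $$ (l ! p, k) * B $$ (k, l' ! (s p)))"
      using A B p ld[of p] ld[of "s p"] by (simp add: scalar_prod_def)
  qed
  also have "\<dots> = (\<Sum>s | s permutes ?I. signof s * (\<Sum>f\<in>?I \<rightarrow>\<^sub>E ?D. (\<Prod>p\<in>?I. A $$ (l ! p, f p) * B $$ (f p, l' ! (s p)))))"
    by (subst prod_sum_PiE) auto
  also have "\<dots> = (\<Sum>s | s permutes ?I. \<Sum>f\<in>?I \<rightarrow>\<^sub>E ?D. (\<Prod>p\<in>?I. A $$ (l ! p, f p)) * (signof s * (\<Prod>p\<in>?I. B $$ (f p, l' ! (s p)))))"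
    by (simp add: sum_distrib_left prod.distrib mult_ac)
  also have "\<dots> = (\<Sum>f\<in>?I \<rightarrow>\<^sub>E ?D. (\<Prod>p\<in>?I. A $$ (l ! p, f p)) * Bf f)"
    unfolding Bf_def sum_distrib_left by (rule sum.swap)
  also have "\<dots> = (\<Sum>f | f \<in> ?I \<rightarrow>\<^sub>E ?D \<and> inj_on f ?I. (\<Prod>p\<in>?I. A $$ (l ! p, f p)) * Bf f)"
  proof (rule sum.mono_neutral_right)
    show "finite (?I \<rightarrow>\<^sub>E ?D)" by (intro finite_PiE) auto
    show "\<forall>f\<in>(?I \<rightarrow>\<^sub>E ?D) - {f. f \<in> ?I \<rightarrow>\<^sub>E ?D \<and> inj_on f ?I}. (\<Prod>p\<in>?I. A $$ (l ! p, f p)) * Bf f = 0"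
    proof
      fix f assume "f \<in> (?I \<rightarrow>\<^sub>E ?D) - {f. f \<in> ?I \<rightarrow>\<^sub>E ?D \<and> inj_on f ?I}"
      then obtain p q where pq: "p < i" "q < i" "p \<noteq> q" "f p = f q" by (auto simp: inj_on_def)
      have "Bf f = 0" unfolding Bf_det
        using pq by (intro det_identical_rows[of _ i p q]) (auto intro!: eq_vecI)
      then show "(\<Prod>p\<in>?I. A $$ (l ! p, f p)) * Bf f = 0" by simp
    qed
  qed auto
  also have "\<dots> = (\<Sum>(h, s)\<in>set (ext_idx d i) \<times> {s. s permutes ?I}.
      (\<Prod>p\<in>?I. A $$ (l ! p, restrict (\<lambda>p. h ! (s p)) ?I p)) * Bf (restrict (\<lambda>p. h ! (s p)) ?I))"
    using sum.reindex_bij_betw[OF bij_sorted_perm[of i d], of "\<lambda>f. (\<Prod>p\<in>?I. A $$ (l ! p, f p)) * Bf f"]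
    by (simp add: case_prod_unfold)
  also have "\<dots> = (\<Sum>h\<in>set (ext_idx d i). \<Sum>s | s permutes ?I.
      (\<Prod>p\<in>?I. A $$ (l ! p, restrict (\<lambda>p. h ! (s p)) ?I p)) * Bf (restrict (\<lambda>p. h ! (s p)) ?I))"
    by (rule sum.cartesian_product[symmetric])
  also have "\<dots> = (\<Sum>h\<in>set (ext_idx d i). minor i A l h * minor i B h l')"
  proof (rule sum.cong[OF refl])
    fix h assume h: "h \<in> set (ext_idx d i)"
    have Bh: "Bf (restrict (\<lambda>p. h ! (s p)) ?I) = signof s * minor i B h l'" if s: "s permutes ?I" for s
    proof -
      let ?M = "mat i i (\<lambda>(p, q). B $$ (h ! p, l' ! q))"
      have sp: "s p < i" if "p < i" for p using permutes_in_image[OF s, of p] that by simp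
      have "mat i i (\<lambda>(p, q). B $$ (restrict (\<lambda>p. h ! (s p)) ?I p, l' ! q)) = mat i i (\<lambda>(p, q). ?M $$ (s p, q))"
        by (rule eq_matI) (auto simp: sp)
      then show ?thesis
        unfolding Bf_det minor_def using det_permute_rows[of ?M i s] s by simp
    qed
    have "(\<Sum>s | s permutes ?I. (\<Prod>p\<in>?I. A $$ (l ! p, restrict (\<lambda>p. h ! (s p)) ?I p)) * Bf (restrict (\<lambda>p. h ! (s p)) ?I))
       = (\<Sum>s | s permutes ?I. (signof s * (\<Prod>p\<in>?I. A $$ (l ! p, h ! (s p)))) * minor i B h l')"
      by (intro sum.cong refl) (simp add: Bh)
    also have "\<dots> = minor i A l h * minor i B h l'"
      by (simp add: minor_eq[of A] sum_distrib_right)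
    finally show "(\<Sum>s | s permutes ?I. (\<Prod>p\<in>?I. A $$ (l ! p, restrict (\<lambda>p. h ! (s p)) ?I p)) * Bf (restrict (\<lambda>p. h ! (s p)) ?I))
       = minor i A l h * minor i B h l'" .
  qed
  finally show ?thesis .
qed

lemma ext_pow_mult:
  assumes A: "A \<in> carrier_mat d d" and B: "B \<in> carrier_mat d d"
  shows "ext_pow i (A * B) = ext_pow i A * ext_pow i B"
proof (rule eq_matI)
  have AB: "A * B \<in> carrier_mat d d" using A B by simp
  fix r c assume "r < dim_row (ext_pow i A * ext_pow i B)" "c < dim_col (ext_pow i A * ext_pow i B)"
  then have r: "r < ext_dim d i" and c: "c < ext_dim d i" using A B by auto
  have "ext_pow i (A * B) $$ (r, c) = minor i (A * B) (ext_idx d i ! r) (ext_idx d i ! c)"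
    by (rule ext_pow_index[OF AB r c])
  also have "\<dots> = (\<Sum>h\<in>set (ext_idx d i). minor i A (ext_idx d i ! r) h * minor i B h (ext_idx d i ! c))"
    by (intro Cauchy_Binet_minor[OF A B] ext_idx_nth[OF r] ext_idx_nth[OF c])
  also have "\<dots> = (\<Sum>k<ext_dim d i. minor i A (ext_idx d i ! r) (ext_idx d i ! k) * minor i B (ext_idx d i ! k) (ext_idx d i ! c))"
    by (rule sum_ext_idx[symmetric])
  also have "\<dots> = (\<Sum>k<ext_dim d i. ext_pow i A $$ (r, k) * ext_pow i B $$ (k, c))"
    by (intro sum.cong refl) (simp add: ext_pow_index[OF A r] ext_pow_index[OF B _ c])
  also have "\<dots> = (ext_pow i A * ext_pow i B) $$ (r, c)"
    using A B r c by (simp add: scalar_prod_def lessThan_atLeast0)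
  finally show "ext_pow i (A * B) $$ (r, c) = (ext_pow i A * ext_pow i B) $$ (r, c)" .
qed (use A B in auto)

section \<open>Compounds of projections, transposes and triangular matrices\<close>

definition proj_mat :: "nat \<Rightarrow> nat \<Rightarrow> real mat" where
  "proj_mat d k = mat d d (\<lambda>(r, c). if r = c \<and> r < k then 1 else 0)"

lemma proj_mat_carrier [simp]: "proj_mat d k \<in> carrier_mat d d"
  by (simp add: proj_mat_def)

text \<open>In all cases but the diagonal one with indices below \<open>k\<close>, some row of the
  minor vanishes. Together with rank factorisations this controls the dimension of the range of an
  exterior power.\<close>

lemma ext_pow_proj:
  assumes r: "r < ext_dim d i" and c: "c < ext_dim d i"
  shows "ext_pow i (proj_mat d k) $$ (r, c) = (if r = c \<and> set (ext_idx d i ! r) \<subseteq> {0..<k} then 1 else 0)"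
proof -
  let ?l = "ext_idx d i ! r" and ?l' = "ext_idx d i ! c"
  let ?M = "mat i i (\<lambda>(p, q). proj_mat d k $$ (?l ! p, ?l' ! q))"
  note l = ext_idx_nth[OF r] and l' = ext_idx_nth[OF c]
  have nth: "?l ! p < d" "?l' ! p < d" if "p < i" for p
    using list_nth_less[OF l(2), of p] list_nth_less[OF l'(2), of p] l(1) l'(1) that by auto
  have e: "ext_pow i (proj_mat d k) $$ (r, c) = det ?M"
    by (simp add: ext_pow_index[OF proj_mat_carrier r c] minor_def)
  show ?thesis
  proof (cases "r = c \<and> set ?l \<subseteq> {0..<k}")
    case True
    have "?M = 1\<^sub>m i"
    proof (rule eq_matI)
      fix p q assume "p < dim_row (1\<^sub>m i)" "q < dim_col (1\<^sub>m i)"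
      then have pq: "p < i" "q < i" by auto
      have "?l ! p < k" using True pq l(1) list_nth_less[of ?l k p] by auto
      moreover have "?l ! p = ?l ! q \<longleftrightarrow> p = q" using l pq by (simp add: nth_eq_iff_index_eq)
      ultimately show "?M $$ (p, q) = 1\<^sub>m i $$ (p, q)" using True pq nth by (auto simp: proj_mat_def)
    qed auto
    then have "det ?M = 1" by simp
    then show ?thesis unfolding e if_P[OF True] .
  next
    case False
    have "\<exists>p<i. \<forall>q<i. ?M $$ (p, q) = 0"
    proof (cases "r = c")
      case True
      then obtain x where x: "x \<in> set ?l" "x \<notin> {0..<k}" using False by blast
      then obtain p where "p < i" "?l ! p = x" using l(1) by (auto simp: in_set_conv_nth)
      then show ?thesis using x nth by (intro exI[of _ p]) (auto simp: proj_mat_def)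
    next
      case ne: False
      have "?l \<noteq> ?l'" using ne r c nth_eq_iff_index_eq[OF distinct_ext_idx, of r d i c] unfolding ext_dim_def by simp
      then have "set ?l \<noteq> set ?l'" using l(3) l'(3) strict_sorted_equal by blast
      moreover have "card (set ?l) = card (set ?l')" using l l' by (simp add: distinct_card)
      ultimately have "\<not> set ?l \<subseteq> set ?l'" using card_subset_eq[of "set ?l'" "set ?l"] by auto
      then obtain x where x: "x \<in> set ?l" "x \<notin> set ?l'" by auto
      then obtain p where p: "p < i" "?l ! p = x" using l(1) by (auto simp: in_set_conv_nth)
      have "?l' ! q \<noteq> x" if "q < i" for q using x(2) l'(1) that by (metis nth_mem)
      then show ?thesis using p nth by (intro exI[of _ p]) (force simp: proj_mat_def)
    qed
    then obtain p where p: "p < i" "\<forall>q<i. ?M $$ (p, q) = 0" by blast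
    have "det ?M = (\<Sum>s | s permutes {0..<i}. signof s * (\<Prod>p\<in>{0..<i}. ?M $$ (p, s p)))"
      by (rule det_def'[of _ i]) simp
    also have "\<dots> = 0"
    proof (intro sum.neutral ballI)
      fix s assume s: "s \<in> {s. s permutes {0..<i}}"
      then have "s p < i" using permutes_in_image[of s "{0..<i}" p] p(1) by simp
      then have "?M $$ (p, s p) = 0" using p by blast
      then have "(\<Prod>p\<in>{0..<i}. ?M $$ (p, s p)) = 0" using p(1) by (intro prod_zero) auto
      then show "signof s * (\<Prod>p\<in>{0..<i}. ?M $$ (p, s p)) = 0" by simp
    qed
    finally show ?thesis unfolding e if_not_P[OF False] .
  qed
qed

lemma ext_pow_transpose:
  assumes A: "A \<in> carrier_mat d d" shows "ext_pow i (transpose_mat A) = transpose_mat (ext_pow i A)"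
proof (rule eq_matI)
  have A': "transpose_mat A \<in> carrier_mat d d" using A by simp
  fix r c assume "r < dim_row (transpose_mat (ext_pow i A))" "c < dim_col (transpose_mat (ext_pow i A))"
  then have r: "r < ext_dim d i" and c: "c < ext_dim d i" using A by auto
  let ?l = "ext_idx d i ! r" and ?l' = "ext_idx d i ! c"
  have nth: "?l ! p < d" "?l' ! p < d" if "p < i" for p
    using list_nth_less[OF ext_idx_nth(2)[OF r], of p] list_nth_less[OF ext_idx_nth(2)[OF c], of p]
      ext_idx_nth(1)[OF r] ext_idx_nth(1)[OF c] that by auto
  have "mat i i (\<lambda>(p, q). transpose_mat A $$ (?l ! p, ?l' ! q)) = transpose_mat (mat i i (\<lambda>(p, q). A $$ (?l' ! p, ?l ! q)))"
    using A nth by (intro eq_matI) auto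
  then have "minor i (transpose_mat A) ?l ?l' = minor i A ?l' ?l"
    unfolding minor_def by (simp add: det_transpose[of _ i])
  then show "ext_pow i (transpose_mat A) $$ (r, c) = transpose_mat (ext_pow i A) $$ (r, c)"
    using A r c by (simp add: ext_pow_index[OF A' r c] ext_pow_index[OF A c r])
qed (use A in auto)

definition mtrace :: "nat \<Rightarrow> real mat \<Rightarrow> real" where
  "mtrace n A = (\<Sum>k<n. A $$ (k, k))"

lemma mtrace_mult:
  assumes "A \<in> carrier_mat n n" "B \<in> carrier_mat n n"
  shows "mtrace n (A * B) = (\<Sum>r<n. \<Sum>k<n. A $$ (r, k) * B $$ (k, r))"
  unfolding mtrace_def using assms by (intro sum.cong refl) (simp add: scalar_prod_def lessThan_atLeast0)

lemma mtrace_comm: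
  assumes "A \<in> carrier_mat n n" "B \<in> carrier_mat n n"
  shows "mtrace n (A * B) = mtrace n (B * A)"
  unfolding mtrace_mult[OF assms] mtrace_mult[OF assms(2,1)] by (subst sum.swap) (simp add: mult.commute)

text \<open>A minor of an upper triangular matrix on equal increasing index lists is again upper
  triangular. The value is the elementary symmetric polynomial of degree \<open>i\<close> in the
  diagonal entries.\<close>

lemma mtrace_ext_pow_upper_triangular:
  assumes T: "T \<in> carrier_mat d d" and ut: "upper_triangular T"
  shows "mtrace (ext_dim d i) (ext_pow i T) = (\<Sum>l\<in>set (ext_idx d i). \<Prod>p<i. T $$ (l ! p, l ! p))"
proof -
  have "ext_pow i T $$ (r, r) = (\<Prod>p<i. T $$ (ext_idx d i ! r ! p, ext_idx d i ! r ! p))" if r: "r < ext_dim d i" for r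
  proof -
    let ?l = "ext_idx d i ! r"
    let ?M = "mat i i (\<lambda>(p, q). T $$ (?l ! p, ?l ! q))"
    note l = ext_idx_nth[OF r]
    have "upper_triangular ?M"
    proof (rule upper_triangularI)
      fix q p assume pq: "q < p" "p < dim_row ?M"
      then have "?l ! q < ?l ! p" using l(1,3) by (simp add: sorted_wrt_iff_nth_less)
      moreover have "?l ! p < d" using list_nth_less[OF l(2), of p] l(1) pq by auto
      ultimately show "?M $$ (p, q) = 0" using pq ut T by (auto dest: upper_triangularD)
    qed
    then have "det ?M = prod_list (diag_mat ?M)" by (rule det_upper_triangular[of _ i]) simp
    also have "\<dots> = (\<Prod>p<i. T $$ (?l ! p, ?l ! p))"
      by (simp add: diag_mat_def prod.list_conv_set_nth lessThan_atLeast0)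
    finally show ?thesis by (simp add: ext_pow_index[OF T r r] minor_def)
  qed
  then show ?thesis unfolding mtrace_def sum_ext_idx[symmetric] by (intro sum.cong) auto
qed

section \<open>Singular values\<close>

lemma map_poly_of_real_mult:
  "map_poly complex_of_real (p * q) = map_poly complex_of_real p * map_poly complex_of_real q"
  by (rule poly_eqI) (simp add: coeff_map_poly coeff_mult)

lemma map_poly_of_real_linear_factors:
  "map_poly complex_of_real (prod_list (map (\<lambda>e. [:- e, 1:]) es))
    = prod_list (map (\<lambda>e. [:- e, 1:]) (map complex_of_real es))"
  by (induction es) (simp_all add: map_poly_of_real_mult map_poly_pCons del: mult_pCons_left)

text \<open>If v is an eigenvector, then a <v, v> = <M v, M v>, taken with the Hermitian product
  because the eigenvector is a priori complex.\<close>

lemma gram_eigenvalue_nonneg: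
  fixes M :: "real mat"
  assumes M: "M \<in> carrier_mat N N"
    and ev: "eigenvalue (map_mat complex_of_real (transpose_mat M * M)) a"
  shows "a = complex_of_real (Re a) \<and> 0 \<le> Re a"
proof -
  let ?c = "map_mat complex_of_real"
  let ?M = "?c M"
  have cM: "?M \<in> carrier_mat N N" using M by simp
  have G: "?c (transpose_mat M * M) = transpose_mat ?M * ?M"
    using M by (intro eq_matI) (auto simp: scalar_prod_def)
  obtain v where v: "v \<in> carrier_vec N" "v \<noteq> 0\<^sub>v N" "(transpose_mat ?M * ?M) *\<^sub>v v = a \<cdot>\<^sub>v v"
    using ev M unfolding eigenvalue_def eigenvector_def G by auto
  let ?w = "?M *\<^sub>v v"
  have w: "?w \<in> carrier_vec N" using cM v(1) by simp
  have conj: "?M *\<^sub>v conjugate v = conjugate ?w"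
    using M v(1) by (intro eq_vecI) (auto simp: scalar_prod_def sum_conjugate conjugate_complex_def cnj_sum)
  have "a * (v \<bullet>c v) = (a \<cdot>\<^sub>v v) \<bullet> conjugate v" using v(1) by simp
  also have "\<dots> = (transpose_mat ?M *\<^sub>v ?w) \<bullet> conjugate v"
    using v cM by (simp add: v(3)[symmetric] assoc_mult_mat_vec[of _ N N _ N])
  also have "\<dots> = ?w \<bullet> (?M *\<^sub>v conjugate v)"
    using v(1) by (intro transpose_vec_mult_scalar[OF cM _ w]) simp
  finally have e: "a * (v \<bullet>c v) = ?w \<bullet>c ?w" by (simp add: conj)
  have n1: "0 \<le> ?w \<bullet>c ?w" "0 \<le> v \<bullet>c v" by (rule conjugate_square_ge_0_vec)+
  have n2: "v \<bullet>c v \<noteq> 0" using conjugate_square_eq_0_vec[OF v(1)] v(2) by simp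
  define x y where "x = Re (?w \<bullet>c ?w)" and "y = Re (v \<bullet>c v)"
  have x: "?w \<bullet>c ?w = complex_of_real x" "0 \<le> x" using n1(1) by (auto simp: x_def less_eq_complex_def complex_eq_iff)
  have y: "v \<bullet>c v = complex_of_real y" "0 \<le> y" using n1(2) by (auto simp: y_def less_eq_complex_def complex_eq_iff)
  have y0: "0 < y" using y n2 by (auto simp: order_less_le)
  have "a = complex_of_real (x / y)" using e y0 unfolding x(1) y(1) by (simp add: field_simps)
  then show ?thesis using x(2) y0 by simp
qed

lemma gram_char_poly_splits:
  fixes M :: "real mat"
  assumes M: "M \<in> carrier_mat N N"
  shows "\<exists>es. length es = N \<and> (\<forall>e\<in>set es. 0 \<le> e) \<and>
     char_poly (transpose_mat M * M) = prod_list (map (\<lambda>e. [:- e, 1:]) es)"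
proof -
  let ?G = "transpose_mat M * M"
  let ?G' = "map_mat complex_of_real ?G"
  have G: "?G \<in> carrier_mat N N" using M by simp
  then have G': "?G' \<in> carrier_mat N N" by simp
  obtain as where as: "char_poly ?G' = (\<Prod>a\<leftarrow>as. [:- a, 1:])" "length as = N"
    using char_poly_factorized[OF G'] by blast
  have real: "a = complex_of_real (Re a) \<and> 0 \<le> Re a" if "a \<in> set as" for a
  proof (rule gram_eigenvalue_nonneg[OF M])
    have "poly (char_poly ?G') a = 0" unfolding as(1) using that by (induction as) auto
    then show "eigenvalue ?G' a" using eigenvalue_root_char_poly[OF G'] by simp
  qed
  define es where "es = map Re as"
  have "map complex_of_real es = as" unfolding es_def map_map using real by (intro map_idI) auto
  then have "map_poly complex_of_real (prod_list (map (\<lambda>e. [:- e, 1:]) es)) = char_poly ?G'"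
    by (simp only: map_poly_of_real_linear_factors as(1))
  also have "\<dots> = map_poly complex_of_real (char_poly ?G)" by (rule of_real_hom.char_poly_hom[OF G])
  finally have eq: "map_poly complex_of_real (prod_list (map (\<lambda>e. [:- e, 1:]) es)) = map_poly complex_of_real (char_poly ?G)" .
  have "char_poly ?G = prod_list (map (\<lambda>e. [:- e, 1:]) es)"
  proof (rule poly_eqI)
    fix n
    have "complex_of_real (coeff (prod_list (map (\<lambda>e. [:- e, 1:]) es)) n) = complex_of_real (coeff (char_poly ?G) n)"
      using arg_cong[OF eq, of "\<lambda>p. coeff p n"] by (simp add: coeff_map_poly)
    then show "coeff (char_poly ?G) n = coeff (prod_list (map (\<lambda>e. [:- e, 1:]) es)) n" by simp
  qed
  moreover have "length es = N" "\<forall>e\<in>set es. 0 \<le> e" using as(2) real by (auto simp: es_def)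
  ultimately show ?thesis by blast
qed

lemma order_linear_factors:
  "Polynomial.order x (prod_list (map (\<lambda>e. [:- e, 1:]) es)) = count (mset es) (x :: real)"
proof (induction es)
  case (Cons e es)
  have nz: "prod_list (map (\<lambda>e. [:- e, 1:]) es) \<noteq> (0 :: real poly)"
    by (auto simp: prod_list_zero_iff)
  have "Polynomial.order x (prod_list (map (\<lambda>e. [:- e, 1:]) (e # es))) = Polynomial.order x [:- e, 1:] + count (mset es) x"
    using nz Cons by (simp add: order_mult del: mult_pCons_left)
  also have "Polynomial.order x [:- e, 1:] = (if x = e then 1 else 0)"
    by (auto simp: order_linear intro: order_0I)
  finally show ?case by simp
qed simp

text \<open>Discharges the definite description: the characteristic polynomial splits with real
  nonnegative roots, and a sorted list is determined by the multiplicities of the roots.\<close>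

lemma sv_sq_list:
  assumes M: "M \<in> carrier_mat N N"
  shows "length (sv_sq_list M) = N" "sorted_wrt (\<ge>) (sv_sq_list M)" "\<And>e. e \<in> set (sv_sq_list M) \<Longrightarrow> 0 \<le> e"
    "char_poly (transpose_mat M * M) = prod_list (map (\<lambda>e. [:- e, 1:]) (sv_sq_list M))"
proof -
  let ?Q = "\<lambda>ev. length ev = dim_col M \<and> sorted_wrt (\<ge>) ev \<and>
      char_poly (transpose_mat M * M) = prod_list (map (\<lambda>e. [:- e, 1:]) ev)"
  obtain es where es: "length es = N" "\<forall>e\<in>set es. 0 \<le> e"
     "char_poly (transpose_mat M * M) = prod_list (map (\<lambda>e. [:- e, 1:]) es)"
    using gram_char_poly_splits[OF M] by blast
  have prod_mset: "prod_list (map f xs) = prod_mset (image_mset f (mset xs))" for f :: "real \<Rightarrow> real poly" and xs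
    by (induction xs) simp_all
  have Q: "?Q (rev (sort es))"
    using es M by (simp add: sorted_wrt_rev prod_mset)
  have uniq: "ev = rev (sort es)" if ev: "?Q ev" for ev
  proof -
    have "count (mset ev) x = count (mset es) x" for x
      using ev es(3) by (simp only: order_linear_factors[symmetric])
    then have "mset (rev ev) = mset es" by (simp add: multiset_eq_iff)
    moreover have "sorted (rev ev)" using ev by (simp add: sorted_wrt_rev)
    ultimately have "sort es = rev ev" by (intro properties_for_sort) auto
    then show ?thesis by simp
  qed
  have e: "sv_sq_list M = rev (sort es)"
    unfolding sv_sq_list_def using Q uniq by (rule the_equality)
  show "length (sv_sq_list M) = N" "sorted_wrt (\<ge>) (sv_sq_list M)"
    "char_poly (transpose_mat M * M) = prod_list (map (\<lambda>e. [:- e, 1:]) (sv_sq_list M))"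
    using Q M unfolding e by auto
  show "\<And>e. e \<in> set (sv_sq_list M) \<Longrightarrow> 0 \<le> e" using es(2) unfolding e by simp
qed

text \<open>Triangular form by a similarity that need not be orthogonal. This is enough because only
  traces of compounds are read off, and these are invariant under similarity.\<close>

lemma gram_similar:
  assumes M: "M \<in> carrier_mat N N"
  shows "\<exists>T P Q. T \<in> carrier_mat N N \<and> P \<in> carrier_mat N N \<and> Q \<in> carrier_mat N N \<and> Q * P = 1\<^sub>m N \<and>
     transpose_mat M * M = P * T * Q \<and> upper_triangular T \<and> (\<forall>k<N. T $$ (k, k) = sv_sq_list M ! k)"
proof -
  have G: "transpose_mat M * M \<in> carrier_mat N N" using M by simp
  obtain T P Q :: "real mat" where s: "schur_decomposition (transpose_mat M * M) (sv_sq_list M) = (T, P, Q)"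
    by (cases "schur_decomposition (transpose_mat M * M) (sv_sq_list M)") auto
  have r: "similar_mat_wit (transpose_mat M * M) T P Q \<and> upper_triangular T \<and> diag_mat T = sv_sq_list M"
    by (rule schur_decomposition[OF G sv_sq_list(4)[OF M] s])
  note w = similar_mat_witD2[OF G conjunct1[OF r]]
  have "T $$ (k, k) = sv_sq_list M ! k" if "k < N" for k
    using arg_cong[OF conjunct2[OF conjunct2[OF r]], of "\<lambda>l. l ! k"] that w(5) by (simp add: diag_mat_def)
  then show ?thesis using w r by blast
qed

section \<open>Squared Frobenius norms of compounds\<close>

definition fro :: "nat \<Rightarrow> real mat \<Rightarrow> real" where
  "fro N X = (\<Sum>r<N. \<Sum>c<N. (X $$ (r, c))\<^sup>2)"

lemma mtrace_gram: "X \<in> carrier_mat N N \<Longrightarrow> mtrace N (transpose_mat X * X) = fro N X"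
  by (subst mtrace_mult[of _ N]) (auto simp: fro_def power2_eq_square intro!: sum.swap[THEN trans] sum.cong)

definition lam :: "real mat \<Rightarrow> nat list \<Rightarrow> nat \<Rightarrow> real" where
  "lam M l i = (\<Prod>p<i. sv_sq_list M ! (l ! p))"

text \<open>Both quantities are traces of compounds of powers of the Gram matrix. Compounds are
  multiplicative, so the similarity passes through them and cancels in the trace; a triangular
  matrix remains, whose compound has the eigenvalues \<open>lam M l i\<close>.\<close>

lemma fro_ext_pow:
  assumes M: "M \<in> carrier_mat d d"
  shows "fro (ext_dim d i) (ext_pow i M) = (\<Sum>l\<in>set (ext_idx d i). lam M l i)"
    and "mtrace (ext_dim d i) (ext_pow i (transpose_mat M * M) * ext_pow i (transpose_mat M * M))
        = (\<Sum>l\<in>set (ext_idx d i). (lam M l i)\<^sup>2)"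
proof -
  let ?G = "transpose_mat M * M" and ?N = "ext_dim d i" and ?e = "ext_pow i"
  have M': "transpose_mat M \<in> carrier_mat d d" using M by simp
  obtain T P Q where T: "T \<in> carrier_mat d d" and P: "P \<in> carrier_mat d d" and Q: "Q \<in> carrier_mat d d"
    and QP: "Q * P = 1\<^sub>m d" and G: "?G = P * T * Q" and ut: "upper_triangular T"
    and dg: "\<forall>k<d. T $$ (k, k) = sv_sq_list M ! k"
    using gram_similar[OF M] by blast
  note eT = ext_pow_carrier[OF T, of i] and eP = ext_pow_carrier[OF P, of i] and eQ = ext_pow_carrier[OF Q, of i]
  have tr: "mtrace ?N (?e (P * S * Q)) = mtrace ?N (?e S)" if S: "S \<in> carrier_mat d d" for S
  proof -
    note eS = ext_pow_carrier[OF S, of i]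
    have "?e (P * S * Q) = ?e P * (?e S * ?e Q)"
      using P S Q eP eS eQ by (simp add: ext_pow_mult[of _ d] assoc_mult_mat[of _ ?N ?N _ ?N _ ?N])
    then have "mtrace ?N (?e (P * S * Q)) = mtrace ?N ((?e S * ?e Q) * ?e P)"
      using mtrace_comm[OF eP, of "?e S * ?e Q"] eS eQ by simp
    also have "(?e S * ?e Q) * ?e P = ?e (S * (Q * P))"
      using P S Q eP eS eQ by (simp add: ext_pow_mult[of _ d] assoc_mult_mat[of _ ?N ?N _ ?N _ ?N])
    also have "S * (Q * P) = S" using S QP by simp
    finally show ?thesis .
  qed
  have nth: "l ! p < d" if "l \<in> set (ext_idx d i)" "p < i" for l p
    using that list_nth_less[of l d p] by (auto simp: set_ext_idx)
  have "mtrace ?N (transpose_mat (?e M) * ?e M) = fro ?N (?e M)"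
    by (rule mtrace_gram[OF ext_pow_carrier[OF M]])
  then have "fro ?N (?e M) = mtrace ?N (?e ?G)"
    by (simp add: ext_pow_mult[OF M' M] ext_pow_transpose[OF M])
  also have "\<dots> = mtrace ?N (?e T)" unfolding G by (rule tr[OF T])
  also have "\<dots> = (\<Sum>l\<in>set (ext_idx d i). lam M l i)"
    unfolding mtrace_ext_pow_upper_triangular[OF T ut] lam_def
    by (intro sum.cong prod.cong refl) (use dg nth in auto)
  finally show "fro ?N (?e M) = (\<Sum>l\<in>set (ext_idx d i). lam M l i)" .
  have TT: "T * T \<in> carrier_mat d d" using T by simp
  have TTe: "(T * T) $$ (p, q) = (\<Sum>k<d. T $$ (p, k) * T $$ (k, q))" if "p < d" "q < d" for p q
    using T that by (simp add: scalar_prod_def lessThan_atLeast0)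
  have Tz: "T $$ (p, q) = 0" if "q < p" "p < d" for p q using ut T that by (auto dest: upper_triangularD)
  have utTT: "upper_triangular (T * T)"
  proof (rule upper_triangularI)
    fix p q assume pq: "q < p" "p < dim_row (T * T)"
    then have pd: "p < d" "q < d" using T by auto
    have "T $$ (p, k) * T $$ (k, q) = 0" if "k < d" for k
      using Tz[of k p] Tz[of q k] pd pq(1) that by (cases "k < p") auto
    then show "(T * T) $$ (p, q) = 0" unfolding TTe[OF pd] by (intro sum.neutral) auto
  qed
  have dgTT: "(T * T) $$ (p, p) = (sv_sq_list M ! p)\<^sup>2" if p: "p < d" for p
  proof -
    have "(\<Sum>k<d. T $$ (p, k) * T $$ (k, p)) = (\<Sum>k<d. if k = p then (T $$ (p, p))\<^sup>2 else 0)"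
    proof (intro sum.cong refl)
      fix k assume "k \<in> {..<d}"
      then show "T $$ (p, k) * T $$ (k, p) = (if k = p then (T $$ (p, p))\<^sup>2 else 0)"
        using Tz[of k p] Tz[of p k] p by (cases k p rule: linorder_cases) (auto simp: power2_eq_square)
    qed
    then show ?thesis using p dg by (simp add: TTe)
  qed
  have GG: "?G * ?G = P * (T * T) * Q"
  proof -
    have "?G * ?G = P * T * (Q * P) * T * Q" unfolding G
      using P T Q by (simp add: assoc_mult_mat[of _ d d _ d _ d])
    then show ?thesis using P T Q by (simp add: QP assoc_mult_mat[of _ d d _ d _ d])
  qed
  have "mtrace ?N (?e ?G * ?e ?G) = mtrace ?N (?e (?G * ?G))"
    using M by (simp add: ext_pow_mult[of ?G d ?G i])
  also have "\<dots> = mtrace ?N (?e (T * T))" unfolding GG by (rule tr[OF TT])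
  also have "\<dots> = (\<Sum>l\<in>set (ext_idx d i). (lam M l i)\<^sup>2)"
    unfolding mtrace_ext_pow_upper_triangular[OF TT utTT] lam_def prod_power_distrib
    by (intro sum.cong prod.cong refl) (use dgTT nth in auto)
  finally show "mtrace ?N (?e ?G * ?e ?G) = (\<Sum>l\<in>set (ext_idx d i). (lam M l i)\<^sup>2)" .
qed

section \<open>Products of singular values\<close>

definition sprod :: "nat \<Rightarrow> real mat \<Rightarrow> real" where
  "sprod i M = (\<Prod>p<i. sval (p + 1) M)"

lemma sval_eq: "M \<in> carrier_mat d d \<Longrightarrow> p < d \<Longrightarrow> sval (p + 1) M = sqrt (sv_sq_list M ! p)"
  by (simp add: sval_def)

lemma sval_nonneg: "M \<in> carrier_mat d d \<Longrightarrow> 0 \<le> sval j M"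
  using sv_sq_list(1,3)[of M d] by (auto simp: sval_def)

lemma sv_sq_mono: "M \<in> carrier_mat d d \<Longrightarrow> p \<le> q \<Longrightarrow> q < d \<Longrightarrow> sv_sq_list M ! q \<le> sv_sq_list M ! p"
  using sv_sq_list(1,2)[of M d] by (cases "p = q") (auto simp: sorted_wrt_iff_nth_less)

lemma sv_sq_nonneg: "M \<in> carrier_mat d d \<Longrightarrow> q < d \<Longrightarrow> 0 \<le> sv_sq_list M ! q"
  using sv_sq_list(1,3)[of M d] by simp

lemma sval_sq: "M \<in> carrier_mat d d \<Longrightarrow> p < d \<Longrightarrow> (sval (p + 1) M)\<^sup>2 = sv_sq_list M ! p"
  by (simp only: sval_eq sv_sq_nonneg real_sqrt_pow2)

lemma sprod_nonneg: "M \<in> carrier_mat d d \<Longrightarrow> 0 \<le> sprod i M"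
  unfolding sprod_def by (intro prod_nonneg) (auto intro: sval_nonneg)

lemma sorted_nth_ge: "sorted_wrt (<) (l :: nat list) \<Longrightarrow> p < length l \<Longrightarrow> p \<le> l ! p"
proof (induction p)
  case (Suc p)
  then have "l ! p < l ! Suc p" by (simp add: sorted_wrt_iff_nth_less)
  then show ?case using Suc by simp
qed simp

lemma sprod_sq: "M \<in> carrier_mat d d \<Longrightarrow> i \<le> d \<Longrightarrow> (sprod i M)\<^sup>2 = (\<Prod>p<i. sv_sq_list M ! p)"
  unfolding sprod_def prod_power_distrib by (intro prod.cong refl sval_sq[of M d]) auto

text \<open>An increasing list of length \<open>i\<close> dominates \<open>[0..<i]\<close> entry by
  entry, and the singular values decrease.\<close>

lemma lam_le:
  assumes M: "M \<in> carrier_mat d d" and l: "l \<in> set (ext_idx d i)" and i: "i \<le> d"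
  shows "lam M l i \<le> (sprod i M)\<^sup>2" "0 \<le> lam M l i"
proof -
  have nth: "l ! p < d" "p \<le> l ! p" if "p < i" for p
    using that l list_nth_less[of l d p] sorted_nth_ge[of l p] by (auto simp: set_ext_idx)
  show "lam M l i \<le> (sprod i M)\<^sup>2"
    unfolding sprod_sq[OF M i] lam_def using nth
    by (intro prod_mono) (auto intro: sv_sq_mono[OF M] sv_sq_nonneg[OF M])
  show "0 \<le> lam M l i" unfolding lam_def using nth by (intro prod_nonneg) (auto intro: sv_sq_nonneg[OF M])
qed

lemma card_ext_idx: "card (set (ext_idx d i)) = ext_dim d i"
  using distinct_card[OF distinct_ext_idx] by (simp add: ext_dim_def)

lemma upt_in_ext_idx: "i \<le> d \<Longrightarrow> [0..<i] \<in> set (ext_idx d i)"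
  by (auto simp: set_ext_idx sorted_wrt_upt)

lemma sprod_fro:
  assumes M: "M \<in> carrier_mat d d" and i: "i \<le> d"
  shows "(sprod i M)\<^sup>2 \<le> fro (ext_dim d i) (ext_pow i M)"
    "fro (ext_dim d i) (ext_pow i M) \<le> ext_dim d i * (sprod i M)\<^sup>2"
proof -
  have "(sprod i M)\<^sup>2 = lam M [0..<i] i" unfolding sprod_sq[OF M i] lam_def by (intro prod.cong) auto
  also have "\<dots> \<le> (\<Sum>l\<in>set (ext_idx d i). lam M l i)"
    using upt_in_ext_idx[OF i] lam_le(2)[OF M _ i] by (intro member_le_sum) auto
  finally show "(sprod i M)\<^sup>2 \<le> fro (ext_dim d i) (ext_pow i M)" by (simp only: fro_ext_pow(1)[OF M])
  have "(\<Sum>l\<in>set (ext_idx d i). lam M l i) \<le> (\<Sum>l\<in>set (ext_idx d i). (sprod i M)\<^sup>2)"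
    by (intro sum_mono lam_le(1)[OF M _ i])
  then show "fro (ext_dim d i) (ext_pow i M) \<le> ext_dim d i * (sprod i M)\<^sup>2"
    by (simp add: fro_ext_pow(1)[OF M] card_ext_idx)
qed

text \<open>Lagrange's identity: for the Gram matrix H of \<open>X\<close> the squares of the minors
  add up to twice (tr H)^2 - tr H^2. In terms of eigenvalues of H only products of two different
  ones remain; the square of the largest cancels.\<close>

lemma minors2_sum:
  assumes X: "X \<in> carrier_mat N N"
  shows "(\<Sum>p<N. \<Sum>q<N. \<Sum>r<N. \<Sum>s<N. (X $$ (p, r) * X $$ (q, s) - X $$ (p, s) * X $$ (q, r))\<^sup>2)
    = 2 * ((fro N X)\<^sup>2 - mtrace N ((transpose_mat X * X) * (transpose_mat X * X)))"
proof -
  let ?x = "\<lambda>p r. X $$ (p, r)"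
  have X': "transpose_mat X \<in> carrier_mat N N" and XX: "transpose_mat X * X \<in> carrier_mat N N" using X by auto
  have H: "(transpose_mat X * X) $$ (r, s) = (\<Sum>p<N. ?x p r * ?x p s)" if "r < N" "s < N" for r s
    using X that by (simp add: scalar_prod_def lessThan_atLeast0)
  have sq: "(?x p r * ?x q s - ?x p s * ?x q r)\<^sup>2
     = (?x p r)\<^sup>2 * (?x q s)\<^sup>2 + (?x p s)\<^sup>2 * (?x q r)\<^sup>2 - 2 * ((?x p r * ?x p s) * (?x q s * ?x q r))" for p q r s
    by (simp add: power2_eq_square algebra_simps)
  have a: "(\<Sum>p<N. \<Sum>q<N. \<Sum>r<N. \<Sum>s<N. (?x p r)\<^sup>2 * (?x q s)\<^sup>2) = (fro N X)\<^sup>2"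
    unfolding fro_def power2_eq_square[of "\<Sum>r<N. \<Sum>c<N. (X $$ (r, c))\<^sup>2"] sum_product ..
  have b: "(\<Sum>p<N. \<Sum>q<N. \<Sum>r<N. \<Sum>s<N. (?x p s)\<^sup>2 * (?x q r)\<^sup>2) = (fro N X)\<^sup>2"
    unfolding a[symmetric] by (rule sum.cong[OF refl], rule sum.cong[OF refl], rule sum.swap)
  have c: "(\<Sum>p<N. \<Sum>q<N. \<Sum>r<N. \<Sum>s<N. (?x p r * ?x p s) * (?x q s * ?x q r))
     = mtrace N ((transpose_mat X * X) * (transpose_mat X * X))"
  proof -
    have "mtrace N ((transpose_mat X * X) * (transpose_mat X * X))
       = (\<Sum>r<N. \<Sum>s<N. (\<Sum>p<N. ?x p r * ?x p s) * (\<Sum>q<N. ?x q s * ?x q r))"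
      unfolding mtrace_mult[OF XX XX] by (intro sum.cong refl) (simp only: H lessThan_iff)
    also have "\<dots> = (\<Sum>r<N. \<Sum>s<N. \<Sum>p<N. \<Sum>q<N. (?x p r * ?x p s) * (?x q s * ?x q r))"
      by (simp only: sum_product)
    also have "\<dots> = (\<Sum>r<N. \<Sum>p<N. \<Sum>s<N. \<Sum>q<N. (?x p r * ?x p s) * (?x q s * ?x q r))"
      by (rule sum.cong[OF refl], rule sum.swap)
    also have "\<dots> = (\<Sum>p<N. \<Sum>r<N. \<Sum>s<N. \<Sum>q<N. (?x p r * ?x p s) * (?x q s * ?x q r))"
      by (rule sum.swap)
    also have "\<dots> = (\<Sum>p<N. \<Sum>r<N. \<Sum>q<N. \<Sum>s<N. (?x p r * ?x p s) * (?x q s * ?x q r))"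
      by (rule sum.cong[OF refl], rule sum.cong[OF refl], rule sum.swap)
    also have "\<dots> = (\<Sum>p<N. \<Sum>q<N. \<Sum>r<N. \<Sum>s<N. (?x p r * ?x p s) * (?x q s * ?x q r))"
      by (rule sum.cong[OF refl], rule sum.swap)
    finally show ?thesis ..
  qed
  have c2: "(\<Sum>p<N. \<Sum>q<N. \<Sum>r<N. \<Sum>s<N. 2 * ((?x p r * ?x p s) * (?x q s * ?x q r)))
     = 2 * mtrace N ((transpose_mat X * X) * (transpose_mat X * X))"
    by (simp only: c[symmetric] sum_distrib_left)
  show ?thesis
    unfolding sq sum_subtractf sum.distrib a b c2 by simp
qed

text \<open>The left side is a sum over pairs of distinct eigenvalues of the i-th compound of the Gram matrix,
  and at most one member of a pair is the top product.\<close>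
lemma minors2_bound:
  assumes M: "M \<in> carrier_mat d d" and i: "1 \<le> i" "i \<le> d"
  defines "N \<equiv> ext_dim d i" and "X \<equiv> ext_pow i M"
  shows "(\<Sum>p<N. \<Sum>q<N. \<Sum>r<N. \<Sum>s<N. (X $$ (p, r) * X $$ (q, s) - X $$ (p, s) * X $$ (q, r))\<^sup>2)
    \<le> 2 * (real N)\<^sup>2 * (sprod i M * (sprod (i - 1) M * sval (i + 1) M))\<^sup>2"
proof -
  let ?I = "set (ext_idx d i)"
  let ?b = "(sprod i M)\<^sup>2 * ((sprod (i - 1) M)\<^sup>2 * (sval (i + 1) M)\<^sup>2)"
  have X: "X \<in> carrier_mat N N" unfolding X_def N_def by (rule ext_pow_carrier[OF M])
  have XX: "transpose_mat X * X = ext_pow i (transpose_mat M * M)"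
    using M by (simp add: X_def ext_pow_mult[of _ d] ext_pow_transpose)
  have top: "lam M l i \<le> (sprod (i - 1) M)\<^sup>2 * (sval (i + 1) M)\<^sup>2" if l: "l \<in> ?I" "l \<noteq> [0..<i]" for l
  proof -
    have ll: "length l = i" "sorted_wrt (<) l" "set l \<subseteq> {0..<d}" using l(1) by (auto simp: set_ext_idx)
    have nth: "l ! p < d" "p \<le> l ! p" if "p < i" for p
      using that ll list_nth_less[of l d p] sorted_nth_ge[of l p] by auto
    \<comment> \<open>An increasing list of length \<open>i\<close> with last entry below
      \<open>i\<close> can only be \<open>[0..<i]\<close>, so any other list reaches position
      \<open>i\<close>, which counted from 0 belongs to s_(i+1).\<close>
    have last: "i \<le> l ! (i - 1)"
    proof (rule ccontr)
      assume lt: "\<not> i \<le> l ! (i - 1)"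
      have "set l \<subseteq> {0..<i}"
      proof
        fix x assume "x \<in> set l"
        then obtain p where p: "p < i" "x = l ! p" using ll(1) by (auto simp: in_set_conv_nth)
        have "l ! p \<le> l ! (i - 1)"
          using p ll by (cases "p = i - 1") (auto simp: sorted_wrt_iff_nth_less less_imp_le)
        then show "x \<in> {0..<i}" using lt p by simp
      qed
      moreover have "card (set l) = i" using ll distinct_card[of l] by (simp add: strict_sorted_iff)
      ultimately have "set l = {0..<i}" by (intro card_subset_eq) auto
      then have "l = [0..<i]" using ll(2) by (intro strict_sorted_equal) (auto simp: sorted_wrt_upt)
      then show False using l(2) by simp
    qed
    have id: "i < d" using last nth(1)[of "i - 1"] i by simp
    have "lam M l i = (\<Prod>p<i - 1. sv_sq_list M ! (l ! p)) * sv_sq_list M ! (l ! (i - 1))"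
      unfolding lam_def using i(1) by (cases i) auto
    also have "\<dots> \<le> (\<Prod>p<i - 1. sv_sq_list M ! p) * sv_sq_list M ! i"
    proof (intro mult_mono prod_mono conjI)
      show "sv_sq_list M ! (l ! (i - 1)) \<le> sv_sq_list M ! i" using last nth(1)[of "i - 1"] i by (intro sv_sq_mono[OF M]) auto
      show "0 \<le> sv_sq_list M ! (l ! (i - 1))" using nth(1)[of "i - 1"] i by (intro sv_sq_nonneg[OF M]) auto
      show "0 \<le> (\<Prod>p<i - 1. sv_sq_list M ! p)" using i by (intro prod_nonneg) (auto intro: sv_sq_nonneg[OF M])
      fix p assume "p \<in> {..<i - 1}"
      then have "p < i" by auto
      then show "0 \<le> sv_sq_list M ! (l ! p)" "sv_sq_list M ! (l ! p) \<le> sv_sq_list M ! p"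
        using nth[of p] by (auto intro: sv_sq_mono[OF M] sv_sq_nonneg[OF M])
    qed
    also have "\<dots> = (sprod (i - 1) M)\<^sup>2 * (sval (i + 1) M)\<^sup>2"
      using sprod_sq[OF M, of "i - 1"] sval_sq[OF M id] i by simp
    finally show ?thesis .
  qed
  have pair: "lam M l i * lam M l' i \<le> ?b" if l: "l \<in> ?I" "l' \<in> ?I" "l \<noteq> l'" for l l'
  proof (cases "l' = [0..<i]")
    case False
    then show ?thesis using lam_le[OF M _ i(2)] l top[of l'] by (intro mult_mono) auto
  next
    case True
    then have "lam M l' i * lam M l i \<le> ?b" using lam_le[OF M _ i(2)] l top[of l] by (intro mult_mono) auto
    then show ?thesis by (simp add: mult.commute)
  qed
  have b0: "0 \<le> ?b" by simp
  have "(fro N X)\<^sup>2 - mtrace N ((transpose_mat X * X) * (transpose_mat X * X))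
      = (\<Sum>l\<in>?I. \<Sum>l'\<in>?I. lam M l i * lam M l' i) - (\<Sum>l\<in>?I. (lam M l i)\<^sup>2)"
    unfolding XX unfolding N_def X_def fro_ext_pow[OF M] by (simp add: power2_eq_square sum_product)
  also have "\<dots> = (\<Sum>l\<in>?I. \<Sum>l'\<in>?I. if l = l' then 0 else lam M l i * lam M l' i)"
  proof -
    have "(\<Sum>l'\<in>?I. lam M l i * lam M l' i) - (lam M l i)\<^sup>2 = (\<Sum>l'\<in>?I. if l = l' then 0 else lam M l i * lam M l' i)"
      if l: "l \<in> ?I" for l
    proof -
      have "(\<Sum>l'\<in>?I. lam M l i * lam M l' i)
          = (\<Sum>l'\<in>?I. (if l = l' then (lam M l i)\<^sup>2 else 0) + (if l = l' then 0 else lam M l i * lam M l' i))"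
        by (intro sum.cong) (auto simp: power2_eq_square)
      also have "\<dots> = (lam M l i)\<^sup>2 + (\<Sum>l'\<in>?I. if l = l' then 0 else lam M l i * lam M l' i)"
        using l by (simp add: sum.distrib)
      finally show ?thesis by simp
    qed
    then show ?thesis unfolding sum_subtractf[symmetric] by (intro sum.cong) auto
  qed
  also have "\<dots> \<le> (\<Sum>l\<in>?I. \<Sum>l'\<in>?I. ?b)"
    using pair b0 by (intro sum_mono) (auto split: if_splits)
  also have "\<dots> = (real N)\<^sup>2 * ?b" by (simp add: card_ext_idx N_def power2_eq_square)
  finally have "(fro N X)\<^sup>2 - mtrace N ((transpose_mat X * X) * (transpose_mat X * X)) \<le> (real N)\<^sup>2 * ?b" .
  then show ?thesis unfolding minors2_sum[OF X] by (simp add: power_mult_distrib)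
qed

lemma sval_one_fro:
  assumes X: "X \<in> carrier_mat N N" and N: "1 \<le> N"
  shows "(sval 1 X)\<^sup>2 \<le> fro N X" "fro N X \<le> real N * (sval 1 X)\<^sup>2"
proof -
  obtain T P Q where T: "T \<in> carrier_mat N N" and P: "P \<in> carrier_mat N N" and Q: "Q \<in> carrier_mat N N"
    and QP: "Q * P = 1\<^sub>m N" and G: "transpose_mat X * X = P * T * Q"
    and dg: "\<forall>k<N. T $$ (k, k) = sv_sq_list X ! k"
    using gram_similar[OF X] by blast
  have "fro N X = mtrace N (P * (T * Q))"
    using mtrace_gram[OF X] P T Q by (simp add: G assoc_mult_mat[of _ N N _ N _ N])
  also have "\<dots> = mtrace N (T * Q * P)" using P T Q by (intro mtrace_comm) auto
  also have "T * Q * P = T" using P T Q by (simp add: assoc_mult_mat[of _ N N _ N _ N] QP)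
  finally have f: "fro N X = (\<Sum>k<N. sv_sq_list X ! k)" unfolding mtrace_def using dg by simp
  have s: "(sval 1 X)\<^sup>2 = sv_sq_list X ! 0" using sval_sq[OF X, of 0] N by simp
  show "(sval 1 X)\<^sup>2 \<le> fro N X" unfolding f s
    using N sv_sq_nonneg[OF X] by (intro member_le_sum[of 0]) auto
  have "(\<Sum>k<N. sv_sq_list X ! k) \<le> (\<Sum>k<N. sv_sq_list X ! 0)"
    by (intro sum_mono sv_sq_mono[OF X]) auto
  then show "fro N X \<le> real N * (sval 1 X)\<^sup>2" unfolding f s by simp
qed

section \<open>Matrices of constant rank\<close>

definition mop :: "nat \<Rightarrow> real mat \<Rightarrow> rvec \<Rightarrow> rvec" where
  "mop N X v = (\<Sum>p<N. (\<Sum>q<N. X $$ (p, q) * v q) *\<^sub>R ev p)"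

lemma mop_apply: "mop N X v p = (if p < N then \<Sum>q<N. X $$ (p, q) * v q else 0)"
  by (simp add: mop_def if_distrib cong: if_cong)

lemma mop_ev: "q < N \<Longrightarrow> mop N X (ev q) p = (if p < N then X $$ (p, q) else 0)"
  by (simp add: mop_apply if_distrib cong: if_cong)

lemma linear_mop: "linear (mop N X)"
  by (rule linearI; rule bcontfun_eqI)
     (auto simp: mop_apply sum.distrib sum_distrib_left distrib_left mult.left_commute)

lemma opN_mop: "opN N (mop N X)"
  unfolding opN_def
proof (intro conjI allI)
  show "linear (mop N X)" by (rule linear_mop)
  show "suppN N (mop N X v)" for v by (auto simp: suppN_def mop_apply)
  show "mop N X v = (\<Sum>q<N. v q *\<^sub>R mop N X (ev q))" for v
    by (rule bcontfun_eqI) (auto simp: mop_apply[of N X v] mop_ev mult.commute)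
qed

lemma mop_mult:
  assumes A: "A \<in> carrier_mat N N" and B: "B \<in> carrier_mat N N"
  shows "mop N (A * B) v = mop N A (mop N B v)"
proof (rule bcontfun_eqI)
  fix p
  show "mop N (A * B) v p = mop N A (mop N B v) p"
  proof (cases "p < N")
    case True
    have "(\<Sum>q<N. (A * B) $$ (p, q) * v q) = (\<Sum>q<N. (\<Sum>k<N. A $$ (p, k) * B $$ (k, q)) * v q)"
      using A B True by (intro sum.cong refl) (simp add: scalar_prod_def lessThan_atLeast0)
    also have "\<dots> = (\<Sum>q<N. \<Sum>k<N. A $$ (p, k) * (B $$ (k, q) * v q))"
      by (simp add: sum_distrib_right mult.assoc)
    also have "\<dots> = (\<Sum>k<N. \<Sum>q<N. A $$ (p, k) * (B $$ (k, q) * v q))" by (rule sum.swap)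
    also have "\<dots> = (\<Sum>k<N. A $$ (p, k) * (\<Sum>q<N. B $$ (k, q) * v q))" by (simp add: sum_distrib_left)
    finally show ?thesis using True by (simp add: mop_apply)
  qed (simp add: mop_apply)
qed

text \<open>In the corner cut out by the projection a one-sided inverse is two-sided: adding the
  complementary projection \<open>?K\<close> to both factors produces invertible matrices of full
  size, where left and right inverses agree.\<close>

lemma proj_inverse:
  assumes X: "X \<in> carrier_mat d d" and Y: "Y \<in> carrier_mat d d"
    and XJ: "X * proj_mat d k = X" "proj_mat d k * X = X" and YJ: "proj_mat d k * Y = Y" "Y * proj_mat d k = Y"
    and XY: "X * Y = proj_mat d k"
  shows "Y * X = proj_mat d k"
proof -
  let ?J = "proj_mat d k" and ?I = "1\<^sub>m d :: real mat"
  have J: "?J \<in> carrier_mat d d" and I: "?I \<in> carrier_mat d d" by auto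
  have JJ: "?J * ?J = ?J"
    by (subst (1 2) XY[symmetric], subst assoc_mult_mat[of _ d d _ d _ d])
       (use X Y XY XJ YJ in \<open>auto simp: assoc_mult_mat[of _ d d _ d _ d, symmetric]\<close>)
  let ?K = "?I - ?J"
  have K: "?K \<in> carrier_mat d d" by (rule minus_carrier_mat[OF J])
  have z: "X * ?K = 0\<^sub>m d d" "?K * X = 0\<^sub>m d d" "Y * ?K = 0\<^sub>m d d" "?K * Y = 0\<^sub>m d d" "?K * ?K = ?K"
  proof -
    show "X * ?K = 0\<^sub>m d d" using X J XJ by (simp add: mult_minus_distrib_mat[of _ d d _ d])
    show "?K * X = 0\<^sub>m d d" using X J XJ by (simp add: minus_mult_distrib_mat[of _ d d _ _ d])
    show "Y * ?K = 0\<^sub>m d d" using Y J YJ by (simp add: mult_minus_distrib_mat[of _ d d _ d])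
    show "?K * Y = 0\<^sub>m d d" using Y J YJ by (simp add: minus_mult_distrib_mat[of _ d d _ _ d])
    have "?J * ?K = ?J * ?I - ?J * ?J" by (rule mult_minus_distrib_mat[OF J I J])
    then have JK: "?J * ?K = 0\<^sub>m d d" unfolding JJ right_mult_one_mat[OF J] using J by (simp add: minus_r_inv_mat)
    have m0: "M - 0\<^sub>m d d = M" if "M \<in> carrier_mat d d" for M :: "real mat"
      using that by (intro eq_matI) auto
    have "?K * ?K = ?I * ?K - ?J * ?K" using K J by (intro minus_mult_distrib_mat[of _ d d _ _ d]) auto
    also have "\<dots> = ?K - 0\<^sub>m d d" unfolding JK left_mult_one_mat[OF K] ..
    also have "\<dots> = ?K" by (rule m0[OF K])
    finally show "?K * ?K = ?K" .
  qed
  have prod: "(U + ?K) * (V + ?K) = U * V + ?K"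
    if U: "U \<in> carrier_mat d d" "U * ?K = 0\<^sub>m d d" and V: "V \<in> carrier_mat d d" "?K * V = 0\<^sub>m d d" for U V
  proof -
    have "(U + ?K) * (V + ?K) = U * (V + ?K) + ?K * (V + ?K)" using U V K by (intro add_mult_distrib_mat[of _ d d _ _ d]) auto
    also have "U * (V + ?K) = U * V + U * ?K" using U V K by (intro mult_add_distrib_mat[of _ d d _ d]) auto
    also have "?K * (V + ?K) = ?K * V + ?K * ?K" using U V K by (intro mult_add_distrib_mat[of _ d d _ d]) auto
    finally show ?thesis using U V K by (simp add: z(5))
  qed
  have "(X + ?K) * (Y + ?K) = ?I"
    unfolding prod[OF X z(1) Y z(4)] XY by (intro eq_matI) (auto simp: proj_mat_def)
  then have "(Y + ?K) * (X + ?K) = ?I"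
    using mat_mult_left_right_inverse[of "X + ?K" d "Y + ?K"] X Y K by simp
  then have e: "Y * X + ?K = ?I" unfolding prod[OF Y z(3) X z(2)] .
  have YX: "Y * X \<in> carrier_mat d d" using X Y by simp
  show ?thesis
  proof (rule eq_matI)
    fix r c assume rc: "r < dim_row ?J" "c < dim_col ?J"
    then have "r < d" "c < d" by (auto simp: proj_mat_def)
    then show "(Y * X) $$ (r, c) = ?J $$ (r, c)"
      using arg_cong[OF e, of "\<lambda>M. M $$ (r, c)"] YX J X Y by (simp del: index_mult_mat(1))
  qed (use X Y J in \<open>auto simp: proj_mat_def\<close>)
qed

text \<open>The first \<open>k\<close> columns of \<open>F\<close> are a maximal independent set of
  columns of \<open>A\<close>, \<open>C\<close> holds the coordinates of all columns,
  \<open>S\<close> selects columns, and \<open>H\<close> is a left inverse on the column space. All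
  are padded with zeros to size d x d, so that exterior powers of one fixed size apply to each
  factor.\<close>

lemma rank_factorization:
  assumes A: "(A :: real mat) \<in> carrier_mat d d" and rk: "vec_space.rank d A = k"
  shows "k \<le> d \<and> (\<exists>F C S H. F \<in> carrier_mat d d \<and> C \<in> carrier_mat d d \<and> S \<in> carrier_mat d d \<and> H \<in> carrier_mat d d \<and>
     A = F * C \<and> F * proj_mat d k = F \<and> proj_mat d k * C = C \<and> F = A * S \<and> H * F = proj_mat d k)"
proof -
  interpret vs: vec_space "TYPE(real)" d .
  have kd: "k \<le> d" using vs.rank_le_nc[OF A] rk by simp
  let ?P = "\<lambda>T. T \<subseteq> set (cols A) \<and> vs.lin_indpt T"
  have "vs.lin_indpt {}" by (simp add: vs.lin_dep_def)
  then obtain S0 where S0: "finite S0" "maximal S0 ?P"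
    using maximal_exists_superset[of "set (cols A)" ?P "{}"] by auto
  have card: "card S0 = k" using vs.rank_card_indpt[OF A S0(2)] rk by simp
  have S0P: "S0 \<subseteq> set (cols A)" "vs.lin_indpt S0" using S0(2) by (auto simp: maximal_def)
  obtain fs where fs: "set fs = S0" "distinct fs" using finite_distinct_list[OF S0(1)] by blast
  have len: "length fs = k" using fs card distinct_card by force
  have colsA: "set (cols A) \<subseteq> carrier_vec d" using A cols_dim by blast
  have fsc: "set fs \<subseteq> carrier_vec d" using fs(1) S0P(1) colsA by blast
  define Fk where "Fk = mat_of_cols d fs"
  have Fk: "Fk \<in> carrier_mat d k" by (simp add: Fk_def len[symmetric])
  have colsF: "cols Fk = fs" unfolding Fk_def by (rule cols_mat_of_cols[OF fsc])
  have Fke: "Fk $$ (r, t) = fs ! t $ r" if "r < d" "t < k" for r t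
    using that len by (simp add: Fk_def mat_of_cols_index)
  have inj: "v = 0\<^sub>v k" if "v \<in> carrier_vec k" "Fk *\<^sub>v v = 0\<^sub>v d" for v
    using vs.lin_depI[OF Fk that(1) _ that(2)] fs S0P(2) by (auto simp: colsF)
  have span: "\<exists>v\<in>carrier_vec k. col A q = Fk *\<^sub>v v" if q: "q < d" for q
  proof -
    have cA: "col A q \<in> set (cols A)" using q A by (metis carrier_matD(2) cols_length cols_nth nth_mem)
    then have cc: "col A q \<in> carrier_vec d" using colsA by blast
    show ?thesis
    proof (cases "col A q \<in> S0")
      case True
      then obtain t where t: "t < k" "col A q = fs ! t" using fs(1) len by (metis in_set_conv_nth)
      have "Fk *\<^sub>v unit_vec k t = col Fk t" using Fk t(1) by (intro eq_vecI) auto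
      also have "\<dots> = fs ! t" using colsF Fk t(1) by (metis carrier_matD(2) cols_nth)
      finally show ?thesis using t(2) by (intro bexI[of _ "unit_vec k t"]) auto
    next
      case False
      let ?l = "col A q # fs"
      define X where "X = mat_of_cols d ?l"
      have X: "X \<in> carrier_mat d (Suc k)" using mat_of_cols_carrier(1)[of d ?l] by (simp add: X_def len)
      have lc: "set ?l \<subseteq> carrier_vec d" using fsc cc by simp
      have colsX: "cols X = ?l" unfolding X_def by (rule cols_mat_of_cols[OF lc])
      have "\<not> ?P (insert (col A q) S0)"
        using S0(2) False unfolding maximal_def by blast
      then have "vs.lin_dep (set (cols X))" using S0P cA fs(1) by (simp add: colsX)
      then obtain v where v: "v \<in> carrier_vec (Suc k)" "v \<noteq> 0\<^sub>v (Suc k)" "X *\<^sub>v v = 0\<^sub>v d"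
        using vs.lin_depE[OF X] False fs by (auto simp: colsX)
      define v' where "v' = vec k (\<lambda>t. v $ Suc t)"
      have exp: "v $ 0 * col A q $ r + (Fk *\<^sub>v v') $ r = 0" if r: "r < d" for r
      proof -
        have "(X *\<^sub>v v) $ r = (\<Sum>t\<in>{0..<Suc k}. X $$ (r, t) * v $ t)"
          using X v(1) r by (simp add: scalar_prod_def)
        also have "\<dots> = X $$ (r, 0) * v $ 0 + (\<Sum>t\<in>{0..<k}. X $$ (r, Suc t) * v $ Suc t)"
          by (subst sum.atLeast0_lessThan_Suc_shift) simp
        also have "X $$ (r, 0) = col A q $ r" using r by (simp add: X_def mat_of_cols_index)
        also have "(\<Sum>t\<in>{0..<k}. X $$ (r, Suc t) * v $ Suc t) = (\<Sum>t\<in>{0..<k}. Fk $$ (r, t) * v' $ t)"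
          using r len by (intro sum.cong refl) (simp add: X_def v'_def Fke mat_of_cols_index)
        also have "\<dots> = (Fk *\<^sub>v v') $ r" using Fk r by (simp add: scalar_prod_def v'_def)
        finally show ?thesis using v(3) r by (simp add: mult.commute)
      qed
      \<comment> \<open>A relation without the new column would be a relation among the independent
        columns \<open>fs\<close>.\<close>
      have v0: "v $ 0 \<noteq> 0"
      proof
        assume z: "v $ 0 = 0"
        have "Fk *\<^sub>v v' = 0\<^sub>v d" using exp z Fk by (intro eq_vecI) auto
        then have "v' = 0\<^sub>v k" by (intro inj) (simp_all add: v'_def)
        then have "v $ t = 0" if "t < Suc k" for t
        proof (cases t)
          case (Suc s)
          then have "v' $ s = 0" using \<open>v' = 0\<^sub>v k\<close> that by simp
          then show ?thesis using Suc that by (simp add: v'_def)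
        qed (use z in simp)
        then have "v = 0\<^sub>v (Suc k)" using v(1) by (intro eq_vecI) auto
        then show False using v(2) by simp
      qed
      have "col A q = Fk *\<^sub>v ((- 1 / v $ 0) \<cdot>\<^sub>v v')"
      proof (rule eq_vecI)
        fix r assume "r < dim_vec (Fk *\<^sub>v ((- 1 / v $ 0) \<cdot>\<^sub>v v'))"
        then have r: "r < d" using Fk by simp
        have "(Fk *\<^sub>v ((- 1 / v $ 0) \<cdot>\<^sub>v v')) $ r = (- 1 / v $ 0) * (Fk *\<^sub>v v') $ r"
          using Fk r by (simp add: mult_mat_vec[of _ d k] v'_def)
        also have "\<dots> = col A q $ r" using exp[OF r] v0 by (simp add: field_simps)
        finally show "col A q $ r = (Fk *\<^sub>v ((- 1 / v $ 0) \<cdot>\<^sub>v v')) $ r" ..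
      qed (use Fk A in auto)
      then show ?thesis by (intro bexI[of _ "(- 1 / v $ 0) \<cdot>\<^sub>v v'"]) (auto simp: v'_def)
    qed
  qed
  then obtain w where w: "\<And>q. q < d \<Longrightarrow> w q \<in> carrier_vec k" "\<And>q. q < d \<Longrightarrow> col A q = Fk *\<^sub>v w q"
    by metis
  have "\<exists>q<d. fs ! t = col A q" if "t < k" for t
  proof -
    have "fs ! t \<in> set (cols A)" using that len fs(1) S0P(1) by (metis nth_mem subsetD)
    then show ?thesis using A by (metis carrier_matD(2) cols_length cols_nth in_set_conv_nth)
  qed
  then obtain j where j: "\<And>t. t < k \<Longrightarrow> j t < d" "\<And>t. t < k \<Longrightarrow> fs ! t = col A (j t)" by metis
  define F where "F = mat d d (\<lambda>(r, t). if t < k then fs ! t $ r else 0)"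
  define C where "C = mat d d (\<lambda>(t, q). if t < k then w q $ t else 0)"
  define S where "S = mat d d (\<lambda>(q, t). if t < k \<and> q = j t then 1 else (0::real))"
  have car: "F \<in> carrier_mat d d" "C \<in> carrier_mat d d" "S \<in> carrier_mat d d" by (auto simp: F_def C_def S_def)
  have cut: "(\<Sum>t\<in>{0..<d}. if t < k then f t else 0) = (\<Sum>t\<in>{0..<k}. f t)" for f :: "nat \<Rightarrow> real"
    using kd by (intro sum.mono_neutral_cong_right) auto
  have AFC: "A = F * C"
  proof (rule eq_matI)
    fix r q assume "r < dim_row (F * C)" "q < dim_col (F * C)"
    then have rq: "r < d" "q < d" using car by auto
    have "(F * C) $$ (r, q) = (\<Sum>t\<in>{0..<d}. if t < k then fs ! t $ r * w q $ t else 0)"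
      using rq by (auto simp: F_def C_def scalar_prod_def intro!: sum.cong)
    also have "\<dots> = (\<Sum>t\<in>{0..<k}. fs ! t $ r * w q $ t)" by (rule cut)
    also have "\<dots> = (Fk *\<^sub>v w q) $ r"
      using Fk rq w(1)[OF rq(2)] by (auto simp: scalar_prod_def Fke intro!: sum.cong)
    also have "\<dots> = A $$ (r, q)" using w(2)[OF rq(2), symmetric] A rq by simp
    finally show "A $$ (r, q) = (F * C) $$ (r, q)" ..
  qed (use A car in auto)
  have FJ: "F * proj_mat d k = F"
  proof (rule eq_matI)
    fix r c assume "r < dim_row F" "c < dim_col F"
    then have rc: "r < d" "c < d" using car by auto
    have "(F * proj_mat d k) $$ (r, c) = (\<Sum>t\<in>{0..<d}. F $$ (r, t) * proj_mat d k $$ (t, c))"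
      using rc car by (simp add: proj_mat_def scalar_prod_def)
    also have "\<dots> = (\<Sum>t\<in>{0..<d}. if t = c then (if c < k then F $$ (r, c) else 0) else 0)"
      using rc by (intro sum.cong refl) (auto simp: proj_mat_def)
    also have "\<dots> = F $$ (r, c)" using rc by (simp add: F_def)
    finally show "(F * proj_mat d k) $$ (r, c) = F $$ (r, c)" .
  qed (use car in \<open>auto simp: proj_mat_def\<close>)
  have JC: "proj_mat d k * C = C"
  proof (rule eq_matI)
    fix r c assume "r < dim_row C" "c < dim_col C"
    then have rc: "r < d" "c < d" using car by auto
    have "(proj_mat d k * C) $$ (r, c) = (\<Sum>t\<in>{0..<d}. proj_mat d k $$ (r, t) * C $$ (t, c))"
      using rc car by (simp add: proj_mat_def scalar_prod_def)
    also have "\<dots> = (\<Sum>t\<in>{0..<d}. if t = r then (if r < k then C $$ (r, c) else 0) else 0)"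
      using rc by (intro sum.cong refl) (auto simp: proj_mat_def)
    also have "\<dots> = C $$ (r, c)" using rc by (simp add: C_def)
    finally show "(proj_mat d k * C) $$ (r, c) = C $$ (r, c)" .
  qed (use car in \<open>auto simp: proj_mat_def\<close>)
  have FS: "F = A * S"
  proof (rule eq_matI)
    fix r t assume "r < dim_row (A * S)" "t < dim_col (A * S)"
    then have rt: "r < d" "t < d" using car A by auto
    have "(A * S) $$ (r, t) = (\<Sum>q\<in>{0..<d}. A $$ (r, q) * S $$ (q, t))"
      using rt A car by (simp add: scalar_prod_def)
    also have "\<dots> = (\<Sum>q\<in>{0..<d}. if q = j t then (if t < k then A $$ (r, j t) else 0) else 0)"
      using rt by (intro sum.cong refl) (auto simp: S_def)
    also have "\<dots> = F $$ (r, t)" using rt A j[of t] by (auto simp: F_def)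
    finally show "F $$ (r, t) = (A * S) $$ (r, t)" ..
  qed (use car A in auto)
  \<comment> \<open>The left inverse is constructed for the linear map on sequences given by the
    columns, and its matrix is then read off.\<close>
  define ph where "ph = (\<lambda>x. \<Sum>r<d. (x $ r) *\<^sub>R ev r :: rvec)"
  define Fo where "Fo = (\<lambda>v :: rvec. \<Sum>t<k. v t *\<^sub>R ph (fs ! t))"
  have lin: "linear Fo" unfolding Fo_def
    by (rule linearI) (simp_all add: scaleR_add_left sum.distrib scaleR_sum_right)
  have Foe: "Fo v r = (if r < d then \<Sum>t<k. v t * fs ! t $ r else 0)" for v r
    by (simp add: Fo_def ph_def if_distrib cong: if_cong)
  have sub: "Real_Vector_Spaces.subspace {v. suppN k v}"
    by (rule subspaceI) (auto simp: suppN_def)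
  have injo: "inj_on Fo {v. suppN k v}"
  proof (rule inj_onI)
    fix x y assume x: "x \<in> {v. suppN k v}" and y: "y \<in> {v. suppN k v}" and e: "Fo x = Fo y"
    have "Fk *\<^sub>v vec k (\<lambda>t. x t - y t) = 0\<^sub>v d"
    proof (rule eq_vecI)
      fix r assume "r < dim_vec (0\<^sub>v d)"
      then have r: "r < d" by simp
      have "(Fk *\<^sub>v vec k (\<lambda>t. x t - y t)) $ r = (\<Sum>t<k. (x t - y t) * fs ! t $ r)"
        using Fk r by (auto simp: scalar_prod_def Fke lessThan_atLeast0 mult.commute intro!: sum.cong)
      also have "\<dots> = Fo x r - Fo y r" using r by (simp add: Foe left_diff_distrib sum_subtractf)
      also have "\<dots> = 0" using e by simp
      finally show "(Fk *\<^sub>v vec k (\<lambda>t. x t - y t)) $ r = 0\<^sub>v d $ r" using r by simp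
    qed (use Fk in simp)
    then have z: "vec k (\<lambda>t. x t - y t) = 0\<^sub>v k" by (intro inj) auto
    show "x = y"
    proof (rule bcontfun_eqI)
      fix t show "x t = y t"
      proof (cases "t < k")
        case True
        then show ?thesis using arg_cong[OF z, of "\<lambda>v. v $ t"] by simp
      next
        case False
        then show ?thesis using x y by (simp add: suppN_def)
      qed
    qed
  qed
  obtain g where g: "linear g" "\<forall>v\<in>{v. suppN k v}. g (Fo v) = v"
    using linear_exists_left_inverse_on[OF lin sub injo] by blast
  define H where "H = mat d d (\<lambda>(t, r). g (ev r) t)"
  have H: "H \<in> carrier_mat d d" by (simp add: H_def)
  have HF: "H * F = proj_mat d k"
  proof (rule eq_matI)
    fix t c assume "t < dim_row (proj_mat d k)" "c < dim_col (proj_mat d k)"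
    then have tc: "t < d" "c < d" by (auto simp: proj_mat_def)
    have e: "(H * F) $$ (t, c) = (\<Sum>r<d. g (ev r) t * F $$ (r, c))"
      using tc car by (simp add: H_def scalar_prod_def lessThan_atLeast0)
    show "(H * F) $$ (t, c) = proj_mat d k $$ (t, c)"
    proof (cases "c < k")
      case True
      have s: "suppN k (ev c)" using True by (auto simp: suppN_def)
      have "Fo (ev c) = ph (fs ! c)"
        unfolding Fo_def using True by (simp add: if_distrib[of "\<lambda>x. x *\<^sub>R _"] cong: if_cong)
      then have "ev c = g (ph (fs ! c))" using g(2) s by (metis mem_Collect_eq)
      also have "\<dots> = (\<Sum>r<d. (fs ! c $ r) *\<^sub>R g (ev r))"
        by (simp add: ph_def linear_sum[OF g(1)] linear_scale[OF g(1)])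
      finally have "ev c t = (\<Sum>r<d. (fs ! c $ r) * g (ev r) t)" by simp
      also have "\<dots> = (\<Sum>r<d. g (ev r) t * F $$ (r, c))"
        using True tc by (intro sum.cong refl) (simp add: F_def)
      finally show ?thesis using e True tc by (auto simp: proj_mat_def)
    next
      case False
      then show ?thesis unfolding e using tc by (auto simp: F_def proj_mat_def)
    qed
  qed (use H car in \<open>auto simp: proj_mat_def\<close>)
  show ?thesis using kd car H AFC FJ JC FS HF by blast
qed

text \<open>Equal rank of \<open>A * B\<close> and \<open>B\<close> makes \<open>A\<close> injective
  on the column space of \<open>B\<close>; equal rank of \<open>A * B\<close> and \<open>A\<close>
  makes the two column spaces agree. Both facts are put as matrix identities because these pass to
  exterior powers by multiplicativity.\<close>

lemma product_rank_cancel: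
  fixes A B :: "real mat"
  assumes A: "A \<in> carrier_mat d d" and B: "B \<in> carrier_mat d d"
    and rA: "vec_space.rank d A = k" and rB: "vec_space.rank d B = k" and rAB: "vec_space.rank d (A * B) = k"
  shows "\<exists>G\<in>carrier_mat d d. G * (A * B) = B" and "\<exists>G\<in>carrier_mat d d. A * B * G = A"
proof -
  let ?J = "proj_mat d k"
  note as = assoc_mult_mat[of _ d d _ d _ d] mult_carrier_mat[of _ d d _ d]
  have J: "?J \<in> carrier_mat d d" by simp
  obtain F C S H :: "real mat" where F: "F \<in> carrier_mat d d" "C \<in> carrier_mat d d" "B = F * C" "F * ?J = F" "?J * C = C"
    using rank_factorization[OF B rB] by blast
  have AB: "A * B \<in> carrier_mat d d" using A B by simp
  obtain F2 C2 S2 H2 :: "real mat" where F2: "F2 \<in> carrier_mat d d" "S2 \<in> carrier_mat d d" "H2 \<in> carrier_mat d d"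
     "F2 * ?J = F2" "F2 = A * B * S2" "H2 * F2 = ?J" "H2 \<in> carrier_mat d d"
    using rank_factorization[OF AB rAB] by blast
  obtain F3 C3 :: "real mat" where F3: "F3 \<in> carrier_mat d d" "C3 \<in> carrier_mat d d" "A = F3 * C3" "F3 * ?J = F3" "?J * C3 = C3"
    using rank_factorization[OF A rA] by blast
  have JJ: "?J * ?J = ?J"
  proof -
    have "?J * ?J = H2 * F2 * ?J" by (simp only: F2(6))
    also have "\<dots> = H2 * (F2 * ?J)" by (rule assoc_mult_mat[OF F2(7) F2(1) J])
    finally show ?thesis by (simp only: F2(4,6))
  qed
  \<comment> \<open>A pair of factors with product \<open>?J\<close> is cut down to the corner,
    where \<open>proj_inverse\<close> reverses the order of the product.\<close>
  have gen: "Y * ?J * (?J * X) = ?J"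
    if X: "X \<in> carrier_mat d d" "X * ?J = X" and Y: "Y \<in> carrier_mat d d" "?J * Y = Y" and XY: "X * Y = ?J" for X Y
  proof (rule proj_inverse)
    show "?J * X \<in> carrier_mat d d" by (rule mult_carrier_mat[OF J X(1)])
    show "Y * ?J \<in> carrier_mat d d" by (rule mult_carrier_mat[OF Y(1) J])
    show "?J * X * ?J = ?J * X" using X J by (simp add: as)
    show "?J * (?J * X) = ?J * X" using X J JJ by (simp add: assoc_mult_mat[of _ d d _ d _ d, symmetric] mult_carrier_mat[of _ d d _ d])
    show "?J * (Y * ?J) = Y * ?J" using Y J by (simp add: assoc_mult_mat[of _ d d _ d _ d, symmetric] mult_carrier_mat[of _ d d _ d])
    show "Y * ?J * ?J = Y * ?J" using Y J JJ by (simp add: as)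
    have "?J * X * (Y * ?J) = ?J * (X * Y) * ?J" using X Y J by (simp add: as)
    then show "?J * X * (Y * ?J) = ?J" by (simp add: XY JJ)
  qed
  show "\<exists>G\<in>carrier_mat d d. G * (A * B) = B"
  proof -
    let ?X = "H2 * A * F" and ?Y = "C * S2"
    have g: "?Y * ?J * (?J * ?X) = ?J"
    proof (rule gen)
      show "?X \<in> carrier_mat d d" "?Y \<in> carrier_mat d d" using A F F2 by auto
      have "?X * ?J = H2 * A * (F * ?J)" using A F(1,2) F2(1,2,7) J by (simp add: as)
      then show "?X * ?J = ?X" by (simp only: F(4))
      have "?J * ?Y = (?J * C) * S2" by (rule assoc_mult_mat[symmetric, OF J F(2) F2(2)])
      then show "?J * ?Y = ?Y" by (simp only: F(5))
      have "?X * ?Y = H2 * (A * (F * C) * S2)" using A F(1,2) F2(1,2,7) by (simp add: as)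
      then show "?X * ?Y = ?J" by (simp only: F(3)[symmetric] F2(5)[symmetric] F2(6))
    qed
    let ?G = "F * ?Y * ?J * ?J * H2"
    have "?G * (A * B) = F * (?Y * ?J * (?J * ?X)) * C" unfolding F(3) using A F(1,2) F2(1,2,7) J by (simp add: as)
    also have "\<dots> = B" unfolding g by (simp only: F(3,4))
    finally show ?thesis by (intro bexI[of _ ?G] mult_carrier_mat[of _ d d _ d] F(1,2) F2(1,2,7) J)
  qed
  show "\<exists>G\<in>carrier_mat d d. A * B * G = A"
  proof -
    let ?X = "H2 * F3" and ?Y = "C3 * B * S2"
    have "F3 * ?Y = (F3 * C3) * B * S2" using F3(1,2) B F2(1,2,7) by (simp add: as)
    then have Z: "F3 * ?Y = F2" by (simp only: F3(3)[symmetric] F2(5)[symmetric])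
    have g: "?Y * ?J * (?J * ?X) = ?J"
    proof (rule gen)
      show "?X \<in> carrier_mat d d" "?Y \<in> carrier_mat d d" using B F3 F2 by auto
      have "?X * ?J = H2 * (F3 * ?J)" using F3(1,2) F2(1,2,7) J by (simp add: as)
      then show "?X * ?J = ?X" by (simp only: F3(4))
      have "?J * ?Y = (?J * C3) * B * S2" using F3(1,2) F2(1,2) B J by (simp add: as)
      then show "?J * ?Y = ?Y" by (simp only: F3(5))
      have "?X * ?Y = H2 * (F3 * ?Y)" using F3(1,2) B F2(1,2,7) by (simp add: as)
      then show "?X * ?Y = ?J" by (simp only: Z F2(6))
    qed
    let ?G = "S2 * ?J * ?J * H2 * F3 * C3"
    have "A * B * ?G = (A * B * S2) * ?J * (?J * ?X) * C3" using F3(1,2) A B F2(1,2,7) J by (simp add: as)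
    also have "\<dots> = F3 * (?Y * ?J * (?J * ?X)) * C3" unfolding F2(5)[symmetric] Z[symmetric] using F3(1,2) B F2(1,2,7) J by (simp add: as)
    also have "\<dots> = A" unfolding g by (simp only: F3(3,4))
    finally show ?thesis by (intro bexI[of _ ?G] mult_carrier_mat[of _ d d _ d] F3(1,2) F2(1,2,7) J)
  qed
qed

text \<open>Coordinates that survive the exterior power of the projection of rank \<open>k\<close>;
  for \<open>k \<le> d\<close> their number is the rank of the \<open>i\<close>-th exterior power of
  any matrix of rank \<open>k\<close>.\<close>

definition top_idx :: "nat \<Rightarrow> nat \<Rightarrow> nat \<Rightarrow> nat set" where
  "top_idx d k i = {p. p < ext_dim d i \<and> set (ext_idx d i ! p) \<subseteq> {0..<k}}"

lemma finite_top_idx: "finite (top_idx d k i)"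
  by (rule finite_subset[of _ "{..<ext_dim d i}"]) (auto simp: top_idx_def)

lemma top_idx_nonempty: "i \<le> k \<Longrightarrow> k \<le> d \<Longrightarrow> top_idx d k i \<noteq> {}"
proof -
  assume ik: "i \<le> k" "k \<le> d"
  then have "[0..<i] \<in> set (ext_idx d i)" by (intro upt_in_ext_idx) simp
  then obtain p where "p < ext_dim d i" "ext_idx d i ! p = [0..<i]" by (auto simp: in_set_conv_nth ext_dim_def)
  then have "p \<in> top_idx d k i" using ik by (auto simp: top_idx_def)
  then show ?thesis by blast
qed

lemma mop_ext_proj:
  "mop (ext_dim d i) (ext_pow i (proj_mat d k)) v = (\<Sum>p\<in>top_idx d k i. v p *\<^sub>R ev p)"
proof (rule bcontfun_eqI)
  fix p
  show "mop (ext_dim d i) (ext_pow i (proj_mat d k)) v p = (\<Sum>p\<in>top_idx d k i. v p *\<^sub>R ev p) p"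
  proof (cases "p < ext_dim d i")
    case True
    have e: "ext_pow i (proj_mat d k) $$ (p, q) * v q
        = (if p = q then (if p \<in> top_idx d k i then v p else 0) else 0)" if "q < ext_dim d i" for q
      using True that by (auto simp: ext_pow_proj top_idx_def)
    have "mop (ext_dim d i) (ext_pow i (proj_mat d k)) v p
        = (\<Sum>q<ext_dim d i. ext_pow i (proj_mat d k) $$ (p, q) * v q)"
      using True by (simp add: mop_apply)
    also have "\<dots> = (\<Sum>q<ext_dim d i. if p = q then (if p \<in> top_idx d k i then v p else 0) else 0)"
      by (rule sum.cong) (simp_all add: e)
    also have "\<dots> = (if p \<in> top_idx d k i then v p else 0)" using True by simp
    also have "\<dots> = (\<Sum>p\<in>top_idx d k i. v p *\<^sub>R ev p) p"
      using finite_top_idx by (simp add: if_distrib cong: if_cong)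
    finally show ?thesis .
  next
    case False
    then have "p \<notin> top_idx d k i" by (simp add: top_idx_def)
    then show ?thesis using False finite_top_idx by (simp add: mop_apply if_distrib cong: if_cong)
  qed
qed

lemma mop_ext_mult:
  "A \<in> carrier_mat d d \<Longrightarrow> B \<in> carrier_mat d d \<Longrightarrow>
    mop (ext_dim d i) (ext_pow i (A * B)) v = mop (ext_dim d i) (ext_pow i A) (mop (ext_dim d i) (ext_pow i B) v)"
  by (simp only: ext_pow_mult mop_mult[OF ext_pow_carrier ext_pow_carrier])

text \<open>\<open>B\<close> factors through the projection of rank \<open>k\<close>. This supplies
  the dimension bound on perturbed operators in \<open>contraction_stable\<close>, for every matrix
  of rank \<open>k\<close>.\<close>

lemma range_ext_pow_span:
  assumes B: "B \<in> carrier_mat d d" and rk: "vec_space.rank d B = k"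
  shows "\<exists>S. finite S \<and> card S \<le> card (top_idx d k i) \<and> range (mop (ext_dim d i) (ext_pow i B)) \<subseteq> span S"
proof -
  let ?m = "\<lambda>X. mop (ext_dim d i) (ext_pow i X)"
  obtain F C :: "real mat" where F: "F \<in> carrier_mat d d" "C \<in> carrier_mat d d" "B = F * C" "F * proj_mat d k = F"
    using rank_factorization[OF B rk] by blast
  let ?S = "(\<lambda>p. ?m F (ev p)) ` top_idx d k i"
  have "?m B v \<in> span ?S" for v
  proof -
    have "?m B v = ?m F (?m C v)" unfolding F(3) by (rule mop_ext_mult[OF F(1,2)])
    also have "\<dots> = ?m (F * proj_mat d k) (?m C v)" by (simp only: F(4))
    also have "\<dots> = ?m F (\<Sum>p\<in>top_idx d k i. ?m C v p *\<^sub>R ev p)"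
      by (simp only: mop_ext_mult[OF F(1) proj_mat_carrier] mop_ext_proj)
    also have "\<dots> = (\<Sum>p\<in>top_idx d k i. ?m C v p *\<^sub>R ?m F (ev p))"
      by (simp add: linear_sum[OF linear_mop] linear_scale[OF linear_mop])
    also have "\<dots> \<in> span ?S" by (intro span_sum span_scale span_base) auto
    finally show ?thesis .
  qed
  then show ?thesis using finite_top_idx card_image_le[OF finite_top_idx] by (intro exI[of _ ?S]) auto
qed

text \<open>\<open>H\<close> and \<open>S\<close> of the rank factorisation satisfy
  \<open>H * A * S = proj_mat d k\<close>; their exterior powers are the left inverse and the
  preimages from which \<open>range_approximation\<close> starts.\<close>

lemma ext_pow_coordinates:
  assumes A: "A \<in> carrier_mat d d" and rk: "vec_space.rank d A = k"
  shows "\<exists>Hh b. opN (ext_dim d i) Hh \<and> (\<forall>p\<in>top_idx d k i. Hh (mop (ext_dim d i) (ext_pow i A) (b p)) = ev p)"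
proof -
  let ?m = "\<lambda>X. mop (ext_dim d i) (ext_pow i X)"
  obtain F S H :: "real mat" where F: "F \<in> carrier_mat d d" "S \<in> carrier_mat d d" "H \<in> carrier_mat d d" "F = A * S" "H * F = proj_mat d k"
    using rank_factorization[OF A rk] by blast
  have "?m H (?m A (?m S (ev p))) = ev p" if p: "p \<in> top_idx d k i" for p
  proof -
    have "?m H (?m A (?m S (ev p))) = ?m H (?m F (ev p))" by (simp only: F(4) mop_ext_mult[OF A F(2)])
    also have "\<dots> = ?m (proj_mat d k) (ev p)" by (simp only: F(5)[symmetric] mop_ext_mult[OF F(3) F(1)])
    also have "\<dots> = (\<Sum>q\<in>top_idx d k i. if q = p then ev p else 0)" unfolding mop_ext_proj by (intro sum.cong) auto
    also have "\<dots> = ev p" using p finite_top_idx by simp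
    finally show ?thesis .
  qed
  then show ?thesis using opN_mop[of "ext_dim d i" "ext_pow i H"] by (intro exI[of _ "?m H"] exI[of _ "\<lambda>p. ?m S (ev p)"]) auto
qed

section \<open>Exterior powers of the cocycle acting on sequences\<close>

definition extop :: "nat \<Rightarrow> nat \<Rightarrow> ('a \<Rightarrow> real mat) \<Rightarrow> 'a \<Rightarrow> rvec \<Rightarrow> rvec" where
  "extop d j B a = mop (ext_dim d j) (ext_pow j (B a))"

lemma opN_extop: "opN (ext_dim d j) (extop d j B a)"
  unfolding extop_def by (rule opN_mop)

lemma cpow_carrier: "(\<And>a. B a \<in> carrier_mat d d) \<Longrightarrow> cpow d B n \<omega> \<in> carrier_mat d d"
  by (induction n) (auto intro: mult_carrier_mat)

text \<open>For \<open>n = 0\<close> the left side would be the identity on all sequences, whereas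
  the right side cuts off after \<open>ext_dim d j\<close> coordinates; hence
  \<open>1 \<le> n\<close>.\<close>

lemma fold_extop_cpow:
  assumes B: "\<And>a. B a \<in> carrier_mat d d" and n: "1 \<le> n"
  shows "fold (extop d j B) (pre n \<omega>) = mop (ext_dim d j) (ext_pow j (cpow d B n \<omega>))"
  using n
proof (induction n rule: nat_induct_at_least)
  case base
  show ?case using B[of "\<omega> 0"] by (simp add: pre_Suc extop_def[abs_def] fun_eq_iff)
next
  case (Suc n)
  show ?case
  proof (rule ext)
    fix v
    have "fold (extop d j B) (pre (Suc n) \<omega>) v = extop d j B (\<omega> n) (mop (ext_dim d j) (ext_pow j (cpow d B n \<omega>)) v)"
      by (simp add: pre_Suc Suc.IH)
    then show "fold (extop d j B) (pre (Suc n) \<omega>) v = mop (ext_dim d j) (ext_pow j (cpow d B (Suc n) \<omega>)) v"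
      by (simp add: mop_ext_mult[OF B cpow_carrier[OF B]] extop_def)
  qed
qed

lemma ext_pow_cpow:
  assumes B: "\<And>a. B a \<in> carrier_mat d d" and n: "1 \<le> n"
  shows "ext_pow j (cpow d B n \<omega>) = cpow (ext_dim d j) (ext_cocycle j B) n \<omega>"
  using n
proof (induction n rule: nat_induct_at_least)
  case base
  have "ext_pow j (B (\<omega> 0)) * 1\<^sub>m (ext_dim d j) = ext_pow j (B (\<omega> 0))"
    by (rule right_mult_one_mat[OF ext_pow_carrier[OF B]])
  then show ?case using B[of "\<omega> 0"] by (simp add: ext_cocycle_def)
next
  case (Suc n)
  then show ?case by (simp add: ext_pow_mult[OF B cpow_carrier[OF B]] ext_cocycle_def)
qed

lemma pre_nth: "pre (length w) (\<lambda>n. w ! n) = w"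
  by (simp add: pre_def map_nth)

lemma ext_dim_pos: "i \<le> d \<Longrightarrow> 1 \<le> ext_dim d i"
  using upt_in_ext_idx[of i d] by (cases "ext_idx d i") (auto simp: ext_dim_def)

section \<open>Comparison of matrix norms up to the dimension\<close>

lemma abs_entry_le_fro: "p < N \<Longrightarrow> q < N \<Longrightarrow> \<bar>X $$ (p, q)\<bar> \<le> sqrt (fro N X)"
proof -
  assume pq: "p < N" "q < N"
  have "(X $$ (p, q))\<^sup>2 \<le> (\<Sum>c<N. (X $$ (p, c))\<^sup>2)"
    using pq by (intro member_le_sum[of q _ "\<lambda>c. (X $$ (p, c))\<^sup>2"]) auto
  also have "\<dots> \<le> fro N X" unfolding fro_def
    using pq by (intro member_le_sum[of p _ "\<lambda>p. \<Sum>c<N. (X $$ (p, c))\<^sup>2"]) (auto intro: sum_nonneg)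
  finally show ?thesis by (intro real_le_rsqrt) simp
qed

lemma fro_nonneg: "0 \<le> fro N X"
  by (simp add: fro_def sum_nonneg)

lemma norm_mop_ev_le:
  assumes "\<And>p. p < N \<Longrightarrow> \<bar>X $$ (p, q)\<bar> \<le> c" "q < N" "0 \<le> c"
  shows "norm (mop N X (ev q)) \<le> c"
  by (rule norm_bound) (use assms in \<open>auto simp: mop_ev\<close>)

lemma abs_entry_le_norm: "p < N \<Longrightarrow> q < N \<Longrightarrow> \<bar>X $$ (p, q)\<bar> \<le> norm (mop N X (ev q))"
  using abs_apply_le_norm[of "mop N X (ev q)" p] by (simp add: mop_ev)

lemma nm_le_sqrt_fro: "nm N (mop N X) \<le> real N * sqrt (fro N X)"
proof -
  have "nm N (mop N X) \<le> (\<Sum>q<N. sqrt (fro N X))"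
    unfolding nm_def by (intro sum_mono norm_mop_ev_le abs_entry_le_fro) (auto simp: fro_nonneg)
  then show ?thesis by simp
qed

lemma sqrt_fro_le_nm: "sqrt (fro N X) \<le> real N * nm N (mop N X)"
proof -
  have "\<bar>X $$ (p, q)\<bar> \<le> nm N (mop N X)" if "p < N" "q < N" for p q
    using abs_entry_le_norm[OF that, of X] that(2)
      member_le_sum[of q "{..<N}" "\<lambda>q. norm (mop N X (ev q))"] by (auto simp: nm_def)
  then have "(X $$ (p, q))\<^sup>2 \<le> (nm N (mop N X))\<^sup>2" if "p < N" "q < N" for p q
    using that power_mono[of "\<bar>X $$ (p, q)\<bar>" _ 2] by simp
  then have "fro N X \<le> (\<Sum>p<N. \<Sum>q<N. (nm N (mop N X))\<^sup>2)"
    unfolding fro_def by (intro sum_mono) auto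
  also have "\<dots> = (real N * nm N (mop N X))\<^sup>2" by (simp add: power2_eq_square)
  finally show ?thesis by (intro real_le_lsqrt) (simp_all add: nm_nonneg)
qed

lemma mult_power2_le: "real N * y\<^sup>2 \<le> (real N * y)\<^sup>2"
proof -
  have "N \<le> N * N" by simp
  then have "real N \<le> (real N)\<^sup>2" by (simp add: power2_eq_square flip: of_nat_mult)
  then show ?thesis by (simp add: power_mult_distrib mult_right_mono)
qed

lemma opnorm_fro:
  assumes X: "X \<in> carrier_mat N N" and N: "1 \<le> N"
  shows "0 \<le> opnorm X" "opnorm X \<le> sqrt (fro N X)" "sqrt (fro N X) \<le> real N * opnorm X"
proof -
  let ?S = "{vnorm (X *\<^sub>v v) |v. v \<in> carrier_vec (dim_col X) \<and> vnorm v = 1}"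
  have ub: "x \<le> sqrt (fro N X)" if x: "x \<in> ?S" for x
  proof -
    obtain v where v: "v \<in> carrier_vec N" "vnorm v = 1" "x = vnorm (X *\<^sub>v v)"
      using x unfolding carrier_matD(2)[OF X] by blast
    have v1: "(\<Sum>c<N. (v $ c)\<^sup>2) = 1" using v(1,2) by (simp add: vnorm_def)
    have "((X *\<^sub>v v) $ r)\<^sup>2 \<le> (\<Sum>c<N. (X $$ (r, c))\<^sup>2)" if r: "r < N" for r
    proof -
      have "(X *\<^sub>v v) $ r = (\<Sum>c<N. X $$ (r, c) * v $ c)"
        using X v(1) r by (simp add: scalar_prod_def lessThan_atLeast0)
      then have "((X *\<^sub>v v) $ r)\<^sup>2 \<le> (\<Sum>c<N. (X $$ (r, c))\<^sup>2) * (\<Sum>c<N. (v $ c)\<^sup>2)"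
        using Cauchy_Schwarz_ineq_sum[of "\<lambda>c. X $$ (r, c)" "\<lambda>c. v $ c" "{..<N}"] by simp
      then show ?thesis by (simp add: v1)
    qed
    then have "(\<Sum>r<N. ((X *\<^sub>v v) $ r)\<^sup>2) \<le> fro N X" unfolding fro_def by (intro sum_mono) auto
    then show ?thesis unfolding v(3) vnorm_def using X by (intro real_sqrt_le_mono) simp
  qed
  have un: "vnorm (unit_vec N c) = 1" if "c < N" for c
  proof -
    have "(\<Sum>r<N. (unit_vec N c $ r :: real)\<^sup>2) = (\<Sum>r<N. if r = c then 1 else 0)"
      using that by (intro sum.cong) auto
    then show ?thesis using that by (simp add: vnorm_def)
  qed
  have mem: "vnorm (X *\<^sub>v unit_vec N c) \<in> ?S" if "c < N" for c
    using X un[OF that] by auto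
  have bdd: "bdd_above ?S" using ub by (intro bdd_aboveI[of _ "sqrt (fro N X)"])
  have low: "vnorm (X *\<^sub>v unit_vec N c) \<le> opnorm X" if "c < N" for c
    unfolding opnorm_def by (rule cSup_upper[OF mem[OF that] bdd])
  have "0 \<le> vnorm (X *\<^sub>v unit_vec N 0)" by (simp add: vnorm_def sum_nonneg)
  then show n0: "0 \<le> opnorm X" using low[of 0] N by simp
  show "opnorm X \<le> sqrt (fro N X)"
    unfolding opnorm_def using mem[of 0] N by (intro cSup_least ub) auto
  have "(\<Sum>r<N. (X $$ (r, c))\<^sup>2) \<le> (opnorm X)\<^sup>2" if c: "c < N" for c
  proof -
    have "(vnorm (X *\<^sub>v unit_vec N c))\<^sup>2 = (\<Sum>r<N. (X $$ (r, c))\<^sup>2)"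
      using X c by (simp add: vnorm_def sum_nonneg)
    then show ?thesis using power_mono[OF low[OF c], of 2] by (simp add: vnorm_def sum_nonneg)
  qed
  then have "(\<Sum>c<N. \<Sum>r<N. (X $$ (r, c))\<^sup>2) \<le> (\<Sum>c<N. (opnorm X)\<^sup>2)" by (intro sum_mono) auto
  then have "fro N X \<le> real N * (opnorm X)\<^sup>2" unfolding fro_def by (subst sum.swap) simp
  also have "\<dots> \<le> (real N * opnorm X)\<^sup>2"
    by (rule mult_power2_le)
  finally show "sqrt (fro N X) \<le> real N * opnorm X" using n0 by (intro real_le_lsqrt) auto
qed

lemma sprod_sqrt_fro:
  assumes M: "M \<in> carrier_mat d d" and j: "j \<le> d"
  shows "sprod j M \<le> sqrt (fro (ext_dim d j) (ext_pow j M))"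
    "sqrt (fro (ext_dim d j) (ext_pow j M)) \<le> real (ext_dim d j) * sprod j M"
proof -
  show "sprod j M \<le> sqrt (fro (ext_dim d j) (ext_pow j M))"
    by (rule real_le_rsqrt) (rule sprod_fro(1)[OF M j])
  have "fro (ext_dim d j) (ext_pow j M) \<le> real (ext_dim d j) * (sprod j M)\<^sup>2" by (rule sprod_fro(2)[OF M j])
  also have "\<dots> \<le> (real (ext_dim d j) * sprod j M)\<^sup>2"
    by (rule mult_power2_le)
  finally show "sqrt (fro (ext_dim d j) (ext_pow j M)) \<le> real (ext_dim d j) * sprod j M"
    using sprod_nonneg[OF M, of j] by (intro real_le_lsqrt) auto
qed

lemma sval_one_sqrt_fro:
  assumes X: "X \<in> carrier_mat N N" and N: "1 \<le> N"
  shows "sval 1 X \<le> sqrt (fro N X)" "sqrt (fro N X) \<le> real N * sval 1 X"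
proof -
  show "sval 1 X \<le> sqrt (fro N X)" by (rule real_le_rsqrt) (rule sval_one_fro(1)[OF X N])
  have "fro N X \<le> real N * (sval 1 X)\<^sup>2" by (rule sval_one_fro(2)[OF X N])
  also have "\<dots> \<le> (real N * sval 1 X)\<^sup>2"
    by (rule mult_power2_le)
  finally show "sqrt (fro N X) \<le> real N * sval 1 X"
    using sval_nonneg[OF X, of 1] by (intro real_le_lsqrt) auto
qed

text \<open>Operator norm, largest singular value and product of singular values all lie within a
  factor of the dimension of the Frobenius norm, and so does \<open>nm\<close>. In the logarithm
  they differ by a bounded amount, which makes them interchangeable for exponents and, up to
  constants, for large deviations.\<close>

lemma ln_nm_comparison:
  assumes N: "1 \<le> N" and y: "0 \<le> y" "y \<le> sqrt (fro N X)" "sqrt (fro N X) \<le> real N * y"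
    and pos: "0 < nm N (mop N X)"
  shows "0 < y" "\<bar>ln y - ln (nm N (mop N X))\<bar> \<le> 2 * ln (real N)"
proof -
  let ?x = "nm N (mop N X)"
  have a: "y \<le> real N * ?x" using y sqrt_fro_le_nm[of N X] by linarith
  have "real N * sqrt (fro N X) \<le> real N * (real N * y)" using y(3) by (intro mult_left_mono) auto
  then have b: "?x \<le> real N * (real N * y)" using nm_le_sqrt_fro[of N X] by linarith
  show y0: "0 < y" using b pos y(1) by (cases "y = 0") auto
  have n: "0 < real N" "0 \<le> ln (real N)" using N by auto
  have "ln y \<le> ln (real N * ?x)" using a y0 by simp
  then have 1: "ln y \<le> ln (real N) + ln ?x" using n(1) pos by (simp add: ln_mult)
  have "ln ?x \<le> ln (real N * (real N * y))" using b pos by simp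
  then have 2: "ln ?x \<le> 2 * ln (real N) + ln y" using n(1) y0 by (simp add: ln_mult)
  show "\<bar>ln y - ln ?x\<bar> \<le> 2 * ln (real N)" using 1 2 n by linarith
qed

lemma nm_comp_le: "opN N S \<Longrightarrow> nm N (S \<circ> T) \<le> nm N S * nm N T"
  unfolding nm_def[of N "S \<circ> T"] nm_def[of N T] sum_distrib_left
  by (intro sum_mono) (simp add: opN_norm_le)

lemma m2_mop_le:
  assumes S: "(\<Sum>p<N. \<Sum>q<N. \<Sum>r<N. \<Sum>s<N. (X $$ (p, r) * X $$ (q, s) - X $$ (p, s) * X $$ (q, r))\<^sup>2) \<le> c\<^sup>2"
    and c: "0 \<le> c"
  shows "m2 N (mop N X) \<le> real N ^ 4 * c"
proof -
  let ?t = "\<lambda>p q r s. (X $$ (p, r) * X $$ (q, s) - X $$ (p, s) * X $$ (q, r))\<^sup>2"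
  have t: "\<bar>X $$ (p, r) * X $$ (q, s) - X $$ (q, r) * X $$ (p, s)\<bar> \<le> c"
    if pq: "p < N" "q < N" "r < N" "s < N" for p q r s
  proof -
    have "?t p q r s \<le> (\<Sum>s<N. ?t p q r s)"
      using pq by (intro member_le_sum[of s _ "\<lambda>s. ?t p q r s"]) auto
    also have "\<dots> \<le> (\<Sum>r<N. \<Sum>s<N. ?t p q r s)"
      using pq by (intro member_le_sum[of r _ "\<lambda>r. \<Sum>s<N. ?t p q r s"]) (auto intro: sum_nonneg)
    also have "\<dots> \<le> (\<Sum>q<N. \<Sum>r<N. \<Sum>s<N. ?t p q r s)"
      using pq by (intro member_le_sum[of q _ "\<lambda>q. \<Sum>r<N. \<Sum>s<N. ?t p q r s"]) (auto intro!: sum_nonneg)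
    also have "\<dots> \<le> (\<Sum>p<N. \<Sum>q<N. \<Sum>r<N. \<Sum>s<N. ?t p q r s)"
      using pq by (intro member_le_sum[of p _ "\<lambda>p. \<Sum>q<N. \<Sum>r<N. \<Sum>s<N. ?t p q r s"]) (auto intro!: sum_nonneg)
    finally have "?t p q r s \<le> c\<^sup>2" using S by linarith
    then show ?thesis using abs_le_square_iff[of _ c] c by (simp add: mult.commute)
  qed
  have "wd N (mop N X (ev r)) (mop N X (ev s)) \<le> (\<Sum>p<N. \<Sum>q<N. c)" if "r < N" "s < N" for r s
    unfolding wd_def using that by (intro sum_mono) (simp add: mop_ev t)
  then have "m2 N (mop N X) \<le> (\<Sum>r<N. \<Sum>s<N. \<Sum>p<N. \<Sum>q<N. c)"
    unfolding m2_def by (intro sum_mono) simp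
  then show ?thesis by (simp add: power4_eq_xxxx mult_ac)
qed

section \<open>Lipschitz dependence of minors on the entries\<close>

lemma abs_prod_diff_le:
  fixes x y :: "nat \<Rightarrow> real"
  assumes R: "1 \<le> R" and x: "\<And>p. p < i \<Longrightarrow> \<bar>x p\<bar> \<le> R" and y: "\<And>p. p < i \<Longrightarrow> \<bar>y p\<bar> \<le> R"
    and z: "\<And>p. p < i \<Longrightarrow> \<bar>x p - y p\<bar> \<le> z" and z0: "0 \<le> z"
  shows "\<bar>(\<Prod>p<i. x p) - (\<Prod>p<i. y p)\<bar> \<le> real i * R ^ i * z"
  using x y z
proof (induction i)
  case (Suc i)
  have IH: "\<bar>(\<Prod>p<i. x p) - (\<Prod>p<i. y p)\<bar> \<le> real i * R ^ i * z" using Suc by simp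
  have "\<bar>\<Prod>p<i. y p\<bar> \<le> R ^ i"
    using prod_mono[of "{..<i}" "\<lambda>p. \<bar>y p\<bar>" "\<lambda>_. R"] Suc.prems(2) by (simp add: abs_prod)
  then have 2: "\<bar>\<Prod>p<i. y p\<bar> * \<bar>x i - y i\<bar> \<le> R ^ i * z"
    using Suc.prems(3)[of i] R by (intro mult_mono) auto
  have 1: "\<bar>(\<Prod>p<i. x p) - (\<Prod>p<i. y p)\<bar> * \<bar>x i\<bar> \<le> (real i * R ^ i * z) * R"
    using IH Suc.prems(1)[of i] R z0 by (intro mult_mono) auto
  have "(\<Prod>p<Suc i. x p) - (\<Prod>p<Suc i. y p)
      = ((\<Prod>p<i. x p) - (\<Prod>p<i. y p)) * x i + (\<Prod>p<i. y p) * (x i - y i)"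
    by (simp add: left_diff_distrib right_diff_distrib)
  then have "\<bar>(\<Prod>p<Suc i. x p) - (\<Prod>p<Suc i. y p)\<bar> \<le> (real i * R ^ i * z) * R + R ^ i * z"
    using 1 2 abs_triangle_ineq[of "((\<Prod>p<i. x p) - (\<Prod>p<i. y p)) * x i" "(\<Prod>p<i. y p) * (x i - y i)"]
    by (simp add: abs_mult)
  moreover have "R ^ i * z \<le> R ^ Suc i * z"
    using R z0 by (intro mult_right_mono power_increasing) auto
  moreover have "(real i * R ^ i * z) * R + R ^ Suc i * z = real (Suc i) * R ^ Suc i * z"
    by (simp add: distrib_right distrib_left mult.assoc mult.commute mult.left_commute)
  ultimately show ?case by linarith
qed simp

lemma minor_diff_le:
  fixes X Y :: "real mat"
  assumes R: "1 \<le> R" and x: "\<And>r c. r < d \<Longrightarrow> c < d \<Longrightarrow> \<bar>X $$ (r, c)\<bar> \<le> R"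
    and y: "\<And>r c. r < d \<Longrightarrow> c < d \<Longrightarrow> \<bar>Y $$ (r, c)\<bar> \<le> R"
    and z: "\<And>r c. r < d \<Longrightarrow> c < d \<Longrightarrow> \<bar>X $$ (r, c) - Y $$ (r, c)\<bar> \<le> z" and z0: "0 \<le> z"
    and l: "length l = i" "set l \<subseteq> {0..<d}" and l': "length l' = i" "set l' \<subseteq> {0..<d}"
  shows "\<bar>minor i X l l' - minor i Y l l'\<bar> \<le> fact i * (real i * R ^ i * z)"
proof -
  let ?p = "\<lambda>X \<pi>. \<Prod>p<i. X $$ (l ! p, l' ! \<pi> p) :: real"
  have e: "minor i X l l' = (\<Sum>\<pi> | \<pi> permutes {0..<i}. signof \<pi> * ?p X \<pi>)" for X :: "real mat"
  proof -
    have "(\<Prod>p = 0..<i. mat i i (\<lambda>(p, q). X $$ (l ! p, l' ! q)) $$ (p, \<pi> p)) = ?p X \<pi>" if pm: "\<pi> permutes {0..<i}" for \<pi>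
    proof (rule prod.cong)
      fix p assume "p \<in> {..<i}"
      then have "p < i" "\<pi> p < i" using permutes_in_image[OF pm, of p] by auto
      then show "mat i i (\<lambda>(p, q). X $$ (l ! p, l' ! q)) $$ (p, \<pi> p) = X $$ (l ! p, l' ! \<pi> p)" by simp
    qed auto
    then show ?thesis unfolding minor_def det_def by (auto intro!: sum.cong)
  qed
  have "\<bar>minor i X l l' - minor i Y l l'\<bar> \<le> (\<Sum>\<pi> | \<pi> permutes {0..<i}. \<bar>signof \<pi> * ?p X \<pi> - signof \<pi> * ?p Y \<pi>\<bar>)"
    unfolding e sum_subtractf[symmetric] by (rule sum_abs)
  also have "\<dots> \<le> (\<Sum>\<pi> | \<pi> permutes {0..<i}. real i * R ^ i * z)"
  proof (intro sum_mono)
    fix \<pi> assume "\<pi> \<in> {\<pi>. \<pi> permutes {0..<i}}"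
    then have "\<pi> p < i" if "p < i" for p using that permutes_in_image[of \<pi> "{0..<i}" p] by simp
    then have n: "l ! p < d" "l' ! \<pi> p < d" if "p < i" for p
      using that list_nth_less[OF l(2)] list_nth_less[OF l'(2)] l(1) l'(1) by auto
    have "\<bar>?p X \<pi> - ?p Y \<pi>\<bar> \<le> real i * R ^ i * z"
      by (intro abs_prod_diff_le R x y z z0 n)
    moreover have "\<bar>signof \<pi> :: real\<bar> = 1" by (simp add: sign_def)
    ultimately show "\<bar>signof \<pi> * ?p X \<pi> - signof \<pi> * ?p Y \<pi>\<bar> \<le> real i * R ^ i * z"
      by (simp add: right_diff_distrib[symmetric] abs_mult)
  qed
  also have "\<dots> = fact i * (real i * R ^ i * z)" by (simp add: card_permutations)
  finally show ?thesis .
qed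

lemma abs_entry_le_cdist:
  fixes B B' :: "'a::finite \<Rightarrow> real mat"
  assumes "r < d" "c < d"
  shows "\<bar>B a $$ (r, c) - B' a $$ (r, c)\<bar> \<le> cdist d B B'"
proof -
  let ?t = "\<lambda>a r c. (B a $$ (r, c) - B' a $$ (r, c))\<^sup>2"
  have "?t a r c \<le> (\<Sum>c<d. ?t a r c)"
    using assms by (intro member_le_sum[of c _ "\<lambda>c. ?t a r c"]) auto
  also have "\<dots> \<le> (\<Sum>r<d. \<Sum>c<d. ?t a r c)"
    using assms by (intro member_le_sum[of r _ "\<lambda>r. \<Sum>c<d. ?t a r c"]) (auto intro: sum_nonneg)
  also have "\<dots> \<le> (\<Sum>a\<in>UNIV. \<Sum>r<d. \<Sum>c<d. ?t a r c)"
    by (intro member_le_sum[of a _ "\<lambda>a. \<Sum>r<d. \<Sum>c<d. ?t a r c"]) (auto intro!: sum_nonneg)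
  finally show ?thesis unfolding cdist_def by (intro real_le_rsqrt) simp
qed

lemma extop_lipschitz:
  fixes A :: "'a::finite \<Rightarrow> real mat"
  shows "\<exists>Cl\<ge>1. \<forall>B B'. (\<forall>a. B a \<in> carrier_mat d d) \<and> (\<forall>a. B' a \<in> carrier_mat d d) \<and> cdist d B A < 1 \<and> cdist d B' A < 1 \<longrightarrow>
    (\<forall>a q. q < ext_dim d i \<longrightarrow> norm (extop d i B a (ev q) - extop d i B' a (ev q)) \<le> Cl * cdist d B B')"
proof -
  \<comment> \<open>Bounds the entries of every cocycle at distance less than 1 from
    \<open>A\<close>.\<close>
  define R where "R = 1 + (\<Sum>a\<in>UNIV. \<Sum>r<d. \<Sum>c<d. \<bar>A a $$ (r, c)\<bar>)"
  have R1: "1 \<le> R" by (simp add: R_def sum_nonneg)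
  have AR: "\<bar>A a $$ (r, c)\<bar> \<le> R - 1" if "r < d" "c < d" for a r c
  proof -
    have "\<bar>A a $$ (r, c)\<bar> \<le> (\<Sum>c<d. \<bar>A a $$ (r, c)\<bar>)"
      using that by (intro member_le_sum[of c _ "\<lambda>c. \<bar>A a $$ (r, c)\<bar>"]) auto
    also have "\<dots> \<le> (\<Sum>r<d. \<Sum>c<d. \<bar>A a $$ (r, c)\<bar>)"
      using that by (intro member_le_sum[of r _ "\<lambda>r. \<Sum>c<d. \<bar>A a $$ (r, c)\<bar>"]) (auto intro: sum_nonneg)
    also have "\<dots> \<le> R - 1" unfolding R_def
      using member_le_sum[of a UNIV "\<lambda>a. \<Sum>r<d. \<Sum>c<d. \<bar>A a $$ (r, c)\<bar>"] by (simp add: sum_nonneg)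
    finally show ?thesis .
  qed
  have BR: "\<bar>B a $$ (r, c)\<bar> \<le> R" if "cdist d B A < 1" "r < d" "c < d" for B a r c
    using abs_entry_le_cdist[of r d c B a A] AR[of r c a] that by linarith
  define Cl where "Cl = 1 + fact i * (real i * R ^ i)"
  have Cl1: "1 \<le> Cl" using R1 by (simp add: Cl_def)
  have "norm (extop d i B a (ev q) - extop d i B' a (ev q)) \<le> Cl * cdist d B B'"
    if B: "\<forall>a. B a \<in> carrier_mat d d" "\<forall>a. B' a \<in> carrier_mat d d" "cdist d B A < 1" "cdist d B' A < 1"
      and q: "q < ext_dim d i" for B B' a q
  proof (rule norm_bound)
    fix p
    have c0: "0 \<le> cdist d B B'" by (simp add: cdist_def sum_nonneg)
    show "norm ((extop d i B a (ev q) - extop d i B' a (ev q)) p) \<le> Cl * cdist d B B'"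
    proof (cases "p < ext_dim d i")
      case True
      have "\<bar>minor i (B a) (ext_idx d i ! p) (ext_idx d i ! q) - minor i (B' a) (ext_idx d i ! p) (ext_idx d i ! q)\<bar>
          \<le> fact i * (real i * R ^ i * cdist d B B')"
        by (rule minor_diff_le[of R d, OF R1 BR[OF B(3)] BR[OF B(4)] abs_entry_le_cdist c0
              ext_idx_nth(1,2)[OF True] ext_idx_nth(1,2)[OF q]])
      also have "\<dots> \<le> Cl * cdist d B B'"
        unfolding Cl_def using c0 by (simp add: distrib_right mult.assoc)
      finally show ?thesis using True q
        by (simp add: extop_def mop_ev ext_pow_index[OF B(1)[rule_format]] ext_pow_index[OF B(2)[rule_format]])
    next
      case False
      then show ?thesis using Cl1 c0 q by (simp add: extop_def mop_ev)
    qed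
  qed
  then show ?thesis using Cl1 by (intro exI[of _ Cl]) blast
qed

text \<open>\<open>\<lambda>x. vec N x\<close> carries invariant families of subspaces over to column vectors.\<close>
lemma cvec_mop:
  assumes X: "X \<in> carrier_mat N N"
  shows "vec N (apply_bcontfun (mop N X x)) = X *\<^sub>v vec N (apply_bcontfun x)"
  using X by (intro eq_vecI) (auto simp: mop_apply scalar_prod_def lessThan_atLeast0)

lemma cvec_inj:
  assumes "suppN N x" "suppN N y" "vec N (apply_bcontfun x) = vec N (apply_bcontfun y)"
  shows "x = y"
proof (rule bcontfun_eqI)
  fix p
  show "x p = y p"
    using assms(1,2) arg_cong[OF assms(3), of "\<lambda>v. v $ p"] by (cases "p < N") (auto simp: suppN_def)
qed

lemma cvec_surj:
  fixes v :: "real vec"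
  assumes "v \<in> carrier_vec N"
  shows "\<exists>x. v = vec N (apply_bcontfun x)"
proof
  show "v = vec N (apply_bcontfun (\<Sum>p<N. (v $ p) *\<^sub>R ev p))"
    using assms by (intro eq_vecI) (auto simp: if_distrib cong: if_cong)
qed

lemma mat_range_mop:
  assumes X: "X \<in> carrier_mat N N"
  shows "mat_range N X = (\<lambda>x. vec N (apply_bcontfun x)) ` range (mop N X)"
proof -
  have "carrier_vec N = range (\<lambda>x :: rvec. vec N (apply_bcontfun x))"
    using cvec_surj[of _ N] by (auto simp: image_iff)
  then show ?thesis unfolding mat_range_def by (simp add: image_image cvec_mop[OF X])
qed

lemma irreducible_transfer:
  fixes D :: "'a \<Rightarrow> real mat"
  assumes D: "\<And>a. D a \<in> carrier_mat N N" and irr: "irreducible_cocycle N D"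
  shows "\<not> (\<exists>W. \<forall>a. Real_Vector_Spaces.subspace (W a) \<and> W a \<noteq> {0} \<and> W a \<subset> range (mop N (D a)) \<and>
    (\<forall>b. mop N (D a) ` W b = W a))"
proof
  assume "\<exists>W. \<forall>a. Real_Vector_Spaces.subspace (W a) \<and> W a \<noteq> {0} \<and> W a \<subset> range (mop N (D a)) \<and>
    (\<forall>b. mop N (D a) ` W b = W a)"
  then obtain W where W0: "\<forall>a. Real_Vector_Spaces.subspace (W a) \<and> W a \<noteq> {0} \<and> W a \<subset> range (mop N (D a)) \<and>
    (\<forall>b. mop N (D a) ` W b = W a)" ..
  have W: "Real_Vector_Spaces.subspace (W a)" "W a \<noteq> {0}" "W a \<subset> range (mop N (D a))" "mop N (D a) ` W b = W a" for a b
    using spec[OF W0, of a] by simp_all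
  let ?f = "\<lambda>x. vec N (apply_bcontfun x)"
  have sr: "suppN N x" if "x \<in> range (mop N (D a))" for x a
    using that opN_supp[OF opN_mop[of N "D a"]] by auto
  have inj: "inj_on ?f (range (mop N (D a)))" for a
    by (rule inj_onI) (rule cvec_inj[OF sr sr])
  have f0: "?f 0 = 0\<^sub>v N" by (intro eq_vecI) auto
  have m1: "lin_subsp N (?f ` W a)" for a
    unfolding lin_subsp_def
  proof (intro conjI ballI allI)
    show "?f ` W a \<subseteq> carrier_vec N" by auto
    show "0\<^sub>v N \<in> ?f ` W a" using subspace_0[OF W(1)] f0 by (metis image_eqI)
    fix u assume "u \<in> ?f ` W a"
    then obtain x where x: "x \<in> W a" "u = ?f x" by blast
    show "t \<cdot>\<^sub>v u \<in> ?f ` W a" for t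
    proof (rule image_eqI)
      show "t \<cdot>\<^sub>v u = ?f (t *\<^sub>R x)" unfolding x(2) by (intro eq_vecI) auto
      show "t *\<^sub>R x \<in> W a" by (rule subspace_scale[OF W(1) x(1)])
    qed
    fix v assume "v \<in> ?f ` W a"
    then obtain y where y: "y \<in> W a" "v = ?f y" by blast
    show "u + v \<in> ?f ` W a"
    proof (rule image_eqI)
      show "u + v = ?f (x + y)" unfolding x(2) y(2) by (intro eq_vecI) auto
      show "x + y \<in> W a" by (rule subspace_add[OF W(1) x(1) y(1)])
    qed
  qed
  have m2: "?f ` W a \<noteq> {0\<^sub>v N}" for a
  proof
    assume e: "?f ` W a = {0\<^sub>v N}"
    have z: "0 \<in> W a" by (rule subspace_0[OF W(1)])
    have "x = 0" if x: "x \<in> W a" for x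
    proof -
      have "?f x = ?f 0" using imageI[OF x, of ?f] unfolding e f0 by simp
      moreover have "x \<in> range (mop N (D a))" "0 \<in> range (mop N (D a))" using x z W(3)[of a] by (auto simp only: psubset_eq)
      ultimately show ?thesis by (rule inj_onD[OF inj])
    qed
    then have "W a = {0}" using z by blast
    then show False using W(2) by blast
  qed
  have m3: "?f ` W a \<subset> mat_range N (D a)" for a
  proof -
    have s: "W a \<subseteq> range (mop N (D a))" "W a \<noteq> range (mop N (D a))" using W(3)[of a] by (auto simp only: psubset_eq)
    have "?f ` W a \<noteq> ?f ` range (mop N (D a))"
      using inj_on_image_eq_iff[OF inj[of a] s(1) order_refl] s(2) by (simp only: not_False_eq_True)
    then show ?thesis unfolding mat_range_mop[OF D] psubset_eq using image_mono[OF s(1)] by (intro conjI)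
  qed
  have m4: "(\<lambda>v. D a *\<^sub>v v) ` ?f ` W b = ?f ` W a" for a b
    unfolding W(4)[of a b, symmetric] by (simp add: image_image cvec_mop[OF D])
  have "reducible N D" unfolding reducible_def
    by (rule exI[of _ "\<lambda>a. ?f ` W a"]) (intro allI conjI m1 m2 m3 m4)
  then show False using irr by (simp add: irreducible_cocycle_def)
qed

section \<open>Lyapunov exponents of exterior powers\<close>

lemma fold_extop_word:
  assumes B: "\<And>a. B a \<in> carrier_mat d d" and w: "w \<noteq> []"
  shows "fold (extop d j B) w = mop (ext_dim d j) (ext_pow j (cpow d B (length w) (\<lambda>n. w ! n)))"
proof -
  have "1 \<le> length w" using w by (cases w) auto
  from fold_extop_cpow[of B d "length w" j "\<lambda>n. w ! n", OF B this] show ?thesis by (simp only: pre_nth)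
qed

lemma nm_fold_extop_le:
  fixes B :: "'a::finite \<Rightarrow> real mat"
  assumes B: "\<And>a. B a \<in> carrier_mat d d"
  shows "\<exists>K\<ge>1. \<forall>w. w \<noteq> [] \<longrightarrow> nm (ext_dim d j) (fold (extop d j B) w) \<le> K ^ length w"
proof -
  let ?N = "ext_dim d j" and ?D = "extop d j B"
  define K where "K = 1 + (\<Sum>a\<in>UNIV. nm ?N (?D a))"
  have K1: "1 \<le> K" by (simp add: K_def sum_nonneg nm_nonneg)
  have Da: "nm ?N (?D a) \<le> K" for a
    using member_le_sum[of a UNIV "\<lambda>a. nm ?N (?D a)"] by (simp add: K_def nm_nonneg)
  have "nm ?N (fold ?D w) \<le> K ^ length w" if "w \<noteq> []" for w
    using that
  proof (induction w rule: list_nonempty_induct)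
    case (single a)
    then show ?case using Da[of a] by simp
  next
    case (cons a w)
    have o: "opN ?N (fold ?D w)" unfolding fold_extop_word[OF B cons(1)] by (rule opN_mop)
    have e: "fold ?D (a # w) = fold ?D w \<circ> ?D a" by simp
    have "nm ?N (fold ?D (a # w)) \<le> nm ?N (fold ?D w) * nm ?N (?D a)"
      unfolding e by (rule nm_comp_le[OF o])
    also have "\<dots> \<le> K ^ length w * K"
      using cons K1 by (intro mult_mono Da) (auto simp: nm_nonneg)
    also have "\<dots> = K ^ length (a # w)" by simp
    finally show ?case .
  qed
  then show ?thesis using K1 by blast
qed

lemma tendsto_div_bounded_diff:
  fixes a b :: "nat \<Rightarrow> real"
  assumes a: "(\<lambda>n. a n / real n) \<longlonglongrightarrow> l" and d: "\<And>n. 1 \<le> n \<Longrightarrow> \<bar>b n - a n\<bar> \<le> c"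
  shows "(\<lambda>n. b n / real n) \<longlonglongrightarrow> l"
proof -
  have "(\<lambda>n. b n / real n - a n / real n) \<longlonglongrightarrow> 0"
  proof (rule Lim_null_comparison)
    show "\<forall>\<^sub>F n in sequentially. norm (b n / real n - a n / real n) \<le> c / real n"
      using eventually_ge_at_top[of 1]
    proof eventually_elim
      case (elim n)
      then show ?case using d[OF elim]
        by (simp add: diff_divide_distrib[symmetric] divide_right_mono)
    qed
    show "(\<lambda>n. c / real n) \<longlonglongrightarrow> 0" by (rule lim_const_over_n)
  qed
  from tendsto_add[OF this a] show ?thesis by simp
qed

lemma lyap_eqI:
  assumes "AE \<omega> in bern P. (\<lambda>n. elog (sval j (cpow N B n \<omega>)) / ereal (real n)) \<longlonglongrightarrow> L"
  shows "lyap P N B j = L"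
  unfolding lyap_def
proof (rule the_equality)
  show "AE \<omega> in bern P. (\<lambda>n. elog (sval j (cpow N B n \<omega>)) / ereal (real n)) \<longlonglongrightarrow> L" by (rule assms)
  interpret B: prob_space "bern P" by (rule prob_space_bern)
  fix L' assume "AE \<omega> in bern P. (\<lambda>n. elog (sval j (cpow N B n \<omega>)) / ereal (real n)) \<longlonglongrightarrow> L'"
  with assms have "AE \<omega> in bern P. L' = L"
    by eventually_elim (rule LIMSEQ_unique)
  then show "L' = L" by simp
qed

text \<open>The exponential lower bound makes all logarithms finite and bounded by a multiple of the
  length, as the subadditive theorem requires, and it descends to smaller exterior powers.\<close>

locale nondegenerate_power =
  fixes P :: "'a::finite pmf" and d :: nat and B :: "'a \<Rightarrow> real mat" and h :: nat and c kap :: real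
  assumes carrier: "B a \<in> carrier_mat d d" and h: "h \<le> d" and c: "0 < c" and kap: "0 < kap"
    and low: "w \<noteq> [] \<Longrightarrow> c * kap ^ length w \<le> nm (ext_dim d h) (fold (extop d h B) w)"
begin

text \<open>The product s_1 ... s_h is (s_1 ... s_j) s_h with s_h \<le> s_1, and s_1 grows at most
  exponentially; dividing by it leaves an exponential lower bound for the product up to
  \<open>j\<close>.\<close>

lemma nondegenerate_pred:
  assumes "h = Suc j"
  shows "\<exists>c kap. nondegenerate_power d B j c kap"
proof -
  let ?nm = "\<lambda>j w. nm (ext_dim d j) (fold (extop d j B) w)"
  obtain K where K: "1 \<le> K" "\<And>w. w \<noteq> [] \<Longrightarrow> ?nm 1 w \<le> K ^ length w"
    using nm_fold_extop_le[of B d 1, OF carrier] by blast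
  have jd: "j \<le> d" "Suc j \<le> d" "1 \<le> d" using assms h by auto
  define b where "b = real (ext_dim d h) * (real (ext_dim d h) * (real (ext_dim d j) * real (ext_dim d 1)))"
  have b: "0 < b" using ext_dim_pos[OF h] ext_dim_pos[OF jd(1)] ext_dim_pos[OF jd(3)] by (simp add: b_def)
  have "c / b * (kap / K) ^ length w \<le> ?nm j w" if w: "w \<noteq> []" for w
  proof -
    define M where "M = cpow d B (length w) (\<lambda>n. w ! n)"
    have M: "M \<in> carrier_mat d d" unfolding M_def by (rule cpow_carrier[OF carrier])
    have f: "fold (extop d j B) w = mop (ext_dim d j) (ext_pow j M)" for j
      unfolding M_def by (rule fold_extop_word[OF carrier w])
    let ?n = "\<lambda>j. real (ext_dim d j)"
    have s1: "sval (Suc j) M \<le> sprod 1 M"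
      using sv_sq_mono[OF M, of 0 j] sval_eq[OF M, of j] sval_eq[OF M, of 0] jd by (simp add: sprod_def)
    have s1': "sprod 1 M \<le> ?n 1 * K ^ length w"
      using sprod_sqrt_fro(1)[OF M jd(3)] sqrt_fro_le_nm[of "ext_dim d 1" "ext_pow 1 M"] K(2)[OF w]
        mult_left_mono[OF K(2)[OF w], of "?n 1"] by (simp add: f)
    have sj: "sprod j M \<le> ?n j * ?nm j w"
      using sprod_sqrt_fro(1)[OF M jd(1)] sqrt_fro_le_nm[of "ext_dim d j" "ext_pow j M"] by (simp add: f)
    have "?nm h w \<le> ?n h * sqrt (fro (ext_dim d h) (ext_pow h M))" unfolding f by (rule nm_le_sqrt_fro)
    also have "\<dots> \<le> ?n h * (?n h * sprod h M)" by (intro mult_left_mono sprod_sqrt_fro(2)[OF M h]) simp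
    finally have nh: "?nm h w \<le> ?n h * (?n h * sprod h M)" .
    have "sprod h M = sprod j M * sval (Suc j) M" by (simp add: assms sprod_def)
    also have "\<dots> \<le> (?n j * ?nm j w) * (?n 1 * K ^ length w)"
      using s1 s1' sj sval_nonneg[OF M] sprod_nonneg[OF M] by (intro mult_mono) (auto intro: order_trans)
    finally have "?n h * (?n h * sprod h M) \<le> ?n h * (?n h * ((?n j * ?nm j w) * (?n 1 * K ^ length w)))"
      by (intro mult_left_mono) auto
    then have "c * kap ^ length w \<le> b * (K ^ length w * ?nm j w)"
      using low[OF w] nh unfolding b_def by (simp add: mult_ac)
    then show ?thesis using b K(1) by (simp add: field_simps power_divide)
  qed
  then have "nondegenerate_power d B j (c / b) (kap / K)"
    using carrier jd b c kap K(1) by unfold_locales auto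
  then show ?thesis by blast
qed

lemma nondegenerate_le: "j \<le> h \<Longrightarrow> \<exists>c kap. nondegenerate_power d B j c kap"
proof (induction rule: inc_induct)
  case base
  show ?case using nondegenerate_power_axioms by blast
next
  case (step j)
  then show ?case using nondegenerate_power.nondegenerate_pred by blast
qed

lemma nm_pos: "w \<noteq> [] \<Longrightarrow> 0 < nm (ext_dim d h) (fold (extop d h B) w)"
proof -
  assume w: "w \<noteq> []"
  have "0 < c * kap ^ length w" using c kap by simp
  also have "\<dots> \<le> nm (ext_dim d h) (fold (extop d h B) w)" by (rule low[OF w])
  finally show ?thesis .
qed

lemma nm_exponent_exists:
  "\<exists>l. AE \<omega> in bern P. (\<lambda>n. ln (nm (ext_dim d h) (fold (extop d h B) (pre n \<omega>))) / real n) \<longlonglongrightarrow> l"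
proof -
  let ?nm = "\<lambda>w. nm (ext_dim d h) (fold (extop d h B) w)"
  obtain K where K: "1 \<le> K" "\<And>w. w \<noteq> [] \<Longrightarrow> ?nm w \<le> K ^ length w"
    using nm_fold_extop_le[of B d h, OF carrier] by blast
  \<comment> \<open>The empty word gets the value 0: the identity has \<open>nm\<close> equal to the
    dimension, and its logarithm would violate a bound proportional to the length.\<close>
  define f where "f w = (if w = [] then 0 else ln (?nm w))" for w
  define C where "C = ln K + \<bar>ln c\<bar> + \<bar>ln kap\<bar>"
  have bnd: "\<bar>f w\<bar> \<le> C * real (length w)" for w
  proof (cases "w = []")
    case False
    have n1: "1 \<le> real (length w)" using False by (cases w) auto
    have "ln (?nm w) \<le> ln (K ^ length w)" using K(2)[OF False] nm_pos[OF False] by simp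
    then have u: "f w \<le> real (length w) * ln K" using False K(1) by (simp add: f_def ln_realpow)
    have "ln (c * kap ^ length w) \<le> ln (?nm w)" using low[OF False] nm_pos[OF False] c kap by simp
    then have l: "ln c + real (length w) * ln kap \<le> f w" using False c kap by (simp add: f_def ln_mult ln_realpow)
    have "\<bar>ln c\<bar> \<le> real (length w) * \<bar>ln c\<bar>" using mult_right_mono[OF n1, of "\<bar>ln c\<bar>"] by simp
    moreover have "- (real (length w) * \<bar>ln kap\<bar>) \<le> real (length w) * ln kap"
      using mult_left_mono[of "- \<bar>ln kap\<bar>" "ln kap" "real (length w)"] by linarith
    moreover have "0 \<le> real (length w) * ln K" "0 \<le> real (length w) * \<bar>ln c\<bar>" "0 \<le> real (length w) * \<bar>ln kap\<bar>"
      using K(1) by auto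
    moreover have "C * real (length w) = real (length w) * ln K + real (length w) * \<bar>ln c\<bar> + real (length w) * \<bar>ln kap\<bar>"
      by (simp only: C_def distrib_right distrib_left mult.commute[of _ "real (length w)"])
    ultimately show ?thesis using u l by linarith
  qed (simp add: f_def)
  have sub: "f (u @ w) \<le> f u + f w" for u w
  proof (cases "u = [] \<or> w = []")
    case False
    then have ne: "u \<noteq> []" "w \<noteq> []" "u @ w \<noteq> []" by auto
    have o: "opN (ext_dim d h) (fold (extop d h B) w)"
      unfolding fold_extop_word[OF carrier ne(2)] by (rule opN_mop)
    have "?nm (u @ w) \<le> ?nm w * ?nm u" using nm_comp_le[OF o, of "fold (extop d h B) u"] by simp
    then have "ln (?nm (u @ w)) \<le> ln (?nm w * ?nm u)" using nm_pos[OF ne(3)] by simp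
    then show ?thesis using ne nm_pos[OF ne(1)] nm_pos[OF ne(2)] by (simp add: f_def ln_mult)
  qed (auto simp: f_def)
  obtain l where l: "AE \<omega> in bern P. (\<lambda>n. f (pre n \<omega>) / real n) \<longlonglongrightarrow> l"
    using kingman_prefix[of f C P, OF bnd sub] by blast
  have "AE \<omega> in bern P. (\<lambda>n. ln (?nm (pre n \<omega>)) / real n) \<longlonglongrightarrow> l"
    using l
  proof eventually_elim
    case (elim \<omega>)
    have "pre n \<omega> \<noteq> []" if "1 \<le> n" for n by (rule pre_nonempty[OF that])
    then show ?case by (intro tendsto_div_bounded_diff[OF elim, of _ 0]) (simp add: f_def)
  qed
  then show ?thesis by blast
qed

lemma sprod_nm:
  assumes n: "1 \<le> n"
  shows "0 < sprod h (cpow d B n \<omega>)"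
    "\<bar>ln (sprod h (cpow d B n \<omega>)) - ln (nm (ext_dim d h) (fold (extop d h B) (pre n \<omega>)))\<bar> \<le> 2 * ln (real (ext_dim d h))"
proof -
  let ?M = "cpow d B n \<omega>"
  have M: "?M \<in> carrier_mat d d" by (rule cpow_carrier[OF carrier])
  have ne: "pre n \<omega> \<noteq> []" by (rule pre_nonempty[OF n])
  have f: "fold (extop d h B) (pre n \<omega>) = mop (ext_dim d h) (ext_pow h ?M)"
    using fold_extop_cpow[of B d n h \<omega>, OF carrier n] .
  show "0 < sprod h ?M" "\<bar>ln (sprod h ?M) - ln (nm (ext_dim d h) (fold (extop d h B) (pre n \<omega>)))\<bar> \<le> 2 * ln (real (ext_dim d h))"
    unfolding f
    using ln_nm_comparison[OF ext_dim_pos[OF h] sprod_nonneg[OF M] sprod_sqrt_fro[OF M h]] nm_pos[OF ne]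
    unfolding f by auto
qed

end

text \<open>The value at \<open>j = 0\<close> is the exponent of an empty product, so that L_j is
  the difference of consecutive values for \<open>j = 1\<close> as well.\<close>

definition power_exponent :: "'a::finite pmf \<Rightarrow> nat \<Rightarrow> ('a \<Rightarrow> real mat) \<Rightarrow> nat \<Rightarrow> real" where
  "power_exponent P d B j = (if j = 0 then 0 else
    SOME l. AE \<omega> in bern P. (\<lambda>n. ln (nm (ext_dim d j) (fold (extop d j B) (pre n \<omega>))) / real n) \<longlonglongrightarrow> l)"

context nondegenerate_power
begin

section \<open>Lyapunov exponents as differences of exponents of exterior powers\<close>

lemma AE_nm_exponent:
  assumes "1 \<le> h"
  shows "AE \<omega> in bern P. (\<lambda>n. ln (nm (ext_dim d h) (fold (extop d h B) (pre n \<omega>))) / real n) \<longlonglongrightarrow> power_exponent P d B h"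
  using someI_ex[OF nm_exponent_exists] assms by (simp add: power_exponent_def)

lemma AE_sprod_exponent:
  "AE \<omega> in bern P. (\<lambda>n. ln (sprod h (cpow d B n \<omega>)) / real n) \<longlonglongrightarrow> power_exponent P d B h"
proof (cases "h = 0")
  case False
  then have "1 \<le> h" by simp
  from AE_nm_exponent[OF this] show ?thesis
    by eventually_elim (erule tendsto_div_bounded_diff, rule sprod_nm(2))
qed (simp add: sprod_def power_exponent_def)

lemma lyap_power:
  assumes j: "1 \<le> j" "j \<le> h"
  shows "lyap P d B j = ereal (power_exponent P d B j - power_exponent P d B (j - 1))"
proof (rule lyap_eqI)
  obtain c1 k1 where "nondegenerate_power d B j c1 k1" using nondegenerate_le[OF j(2)] by blast
  then interpret J: nondegenerate_power P d B j c1 k1 .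
  have jm: "j - 1 \<le> h" using j by simp
  obtain c2 k2 where "nondegenerate_power d B (j - 1) c2 k2" using nondegenerate_le[OF jm] by blast
  then interpret I: nondegenerate_power P d B "j - 1" c2 k2 .
  from J.AE_sprod_exponent I.AE_sprod_exponent
  show "AE \<omega> in bern P. (\<lambda>n. elog (sval j (cpow d B n \<omega>)) / ereal (real n))
      \<longlonglongrightarrow> ereal (power_exponent P d B j - power_exponent P d B (j - 1))"
  proof eventually_elim
    case (elim \<omega>)
    have "(\<lambda>n. ereal (ln (sprod j (cpow d B n \<omega>)) / real n - ln (sprod (j - 1) (cpow d B n \<omega>)) / real n))
        \<longlonglongrightarrow> ereal (power_exponent P d B j - power_exponent P d B (j - 1))"
      by (intro tendsto_ereal tendsto_diff elim)
    then show ?case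
    proof (rule Lim_transform_eventually)
      show "\<forall>\<^sub>F n in sequentially. ereal (ln (sprod j (cpow d B n \<omega>)) / real n - ln (sprod (j - 1) (cpow d B n \<omega>)) / real n)
          = elog (sval j (cpow d B n \<omega>)) / ereal (real n)"
        using eventually_ge_at_top[of 1]
      proof eventually_elim
        case (elim n)
        let ?M = "cpow d B n \<omega>"
        have p: "0 < sprod j ?M" "0 < sprod (j - 1) ?M" using J.sprod_nm(1) I.sprod_nm(1) elim by auto
        obtain j' where j': "j = Suc j'" using j by (cases j) auto
        have "sprod j ?M = sprod (j - 1) ?M * sval j ?M" by (simp add: j' sprod_def)
        then have s: "sval j ?M = sprod j ?M / sprod (j - 1) ?M" using p by simp
        have "sval j ?M \<noteq> 0" "ln (sval j ?M) = ln (sprod j ?M) - ln (sprod (j - 1) ?M)"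
          using p unfolding s by (auto simp: ln_div)
        then show ?case using elim by (simp add: elog_def diff_divide_distrib)
      qed
    qed
  qed
qed

lemma sum_lyap_power: "i \<le> h \<Longrightarrow> (\<Sum>j\<in>{1..i}. lyap P d B j) = ereal (power_exponent P d B i)"
proof (induction i)
  case (Suc i)
  then show ?case using lyap_power[of "Suc i"] by simp
qed (simp add: power_exponent_def zero_ereal_def)

lemma lyap_ext_power:
  assumes "1 \<le> h"
  shows "lyap P (ext_dim d h) (ext_cocycle h B) 1 = ereal (power_exponent P d B h)"
proof (rule lyap_eqI)
  let ?N = "ext_dim d h"
  have N1: "1 \<le> ?N" by (rule ext_dim_pos[OF h])
  from AE_nm_exponent[OF assms]
  show "AE \<omega> in bern P. (\<lambda>n. elog (sval 1 (cpow ?N (ext_cocycle h B) n \<omega>)) / ereal (real n))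
      \<longlonglongrightarrow> ereal (power_exponent P d B h)"
  proof eventually_elim
    case (elim \<omega>)
    have cmp: "0 < sval 1 (cpow ?N (ext_cocycle h B) n \<omega>)"
      "\<bar>ln (sval 1 (cpow ?N (ext_cocycle h B) n \<omega>)) - ln (nm ?N (fold (extop d h B) (pre n \<omega>)))\<bar> \<le> 2 * ln (real ?N)"
      if n: "1 \<le> n" for n
    proof -
      let ?X = "ext_pow h (cpow d B n \<omega>)"
      have X: "?X \<in> carrier_mat ?N ?N" by (rule ext_pow_carrier[OF cpow_carrier[OF carrier]])
      have f: "fold (extop d h B) (pre n \<omega>) = mop ?N ?X" using fold_extop_cpow[of B d n h \<omega>, OF carrier n] .
      have e: "cpow ?N (ext_cocycle h B) n \<omega> = ?X" using ext_pow_cpow[of B d n h \<omega>, OF carrier n] by simp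
      show "0 < sval 1 (cpow ?N (ext_cocycle h B) n \<omega>)"
        "\<bar>ln (sval 1 (cpow ?N (ext_cocycle h B) n \<omega>)) - ln (nm ?N (fold (extop d h B) (pre n \<omega>)))\<bar> \<le> 2 * ln (real ?N)"
        using ln_nm_comparison[OF N1 sval_nonneg[OF X] sval_one_sqrt_fro[OF X N1]] nm_pos[OF pre_nonempty[OF n, of \<omega>]]
        unfolding f e by auto
    qed
    have "(\<lambda>n. ereal (ln (sval 1 (cpow ?N (ext_cocycle h B) n \<omega>)) / real n)) \<longlonglongrightarrow> ereal (power_exponent P d B h)"
      by (rule tendsto_ereal) (rule tendsto_div_bounded_diff[OF elim cmp(2)])
    then show ?case
    proof (rule Lim_transform_eventually)
      show "\<forall>\<^sub>F n in sequentially. ereal (ln (sval 1 (cpow ?N (ext_cocycle h B) n \<omega>)) / real n)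
          = elog (sval 1 (cpow ?N (ext_cocycle h B) n \<omega>)) / ereal (real n)"
        using eventually_ge_at_top[of 1]
      proof eventually_elim
        case (elim n)
        then show ?case using cmp(1)[OF elim] by (simp add: elog_def)
      qed
    qed
  qed
qed

end

text \<open>Identifies an almost sure limit with the centre of a large deviations estimate: if they
  differed, the events of a deviation by \<open>e\<close> would have probabilities tending to 1 by
  dominated convergence and to 0 by the estimate.\<close>

lemma prefix_limit_unique:
  fixes P :: "'a::finite pmf" and f :: "'a list \<Rightarrow> real"
  assumes l: "AE \<omega> in bern P. (\<lambda>n. f (pre n \<omega>) / real n) \<longlonglongrightarrow> l"
    and ld: "\<And>n e. 1 \<le> n \<Longrightarrow> 0 < e \<Longrightarrow> e \<le> e0 \<Longrightarrow>
        wex P n (\<lambda>w. if \<bar>f w - real n * L\<bar> > real n * e then 1 else 0) \<le> C * exp (- (real n * e\<^sup>2 / r))"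
    and e0: "0 < e0" and r: "0 < r"
  shows "l = L"
proof (rule ccontr)
  assume ne: "l \<noteq> L"
  interpret B: prob_space "bern P" by (rule prob_space_bern)
  define e where "e = min e0 (\<bar>l - L\<bar> / 2)"
  have e: "0 < e" "e \<le> e0" "e < \<bar>l - L\<bar>" using e0 ne by (auto simp: e_def min_def)
  define E where "E n = {\<omega>. pre n \<omega> \<in> {w. \<bar>f w - real n * L\<bar> > real n * e}}" for n
  have "{\<omega> \<in> space (bern P). pre n \<omega> \<in> {w. \<bar>f w - real n * L\<bar> > real n * e}} \<in> sets (bern P)" for n by measurable
  then have E[measurable]: "E n \<in> sets (bern P)" for n by (simp add: E_def)
  have m: "measure (bern P) (E n) = wex P n (\<lambda>w. if \<bar>f w - real n * L\<bar> > real n * e then 1 else 0)" for n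
    unfolding E_def by (subst measure_pre_in) simp
  have "(\<lambda>n. C * exp (- (e\<^sup>2 / r) * real n)) \<longlonglongrightarrow> C * 0"
  proof (intro tendsto_mult_left)
    have "(\<lambda>n. exp (- (e\<^sup>2 / r)) ^ n) \<longlonglongrightarrow> 0" using e r by (intro LIMSEQ_realpow_zero) auto
    then show "(\<lambda>n. exp (- (e\<^sup>2 / r) * real n)) \<longlonglongrightarrow> 0" by (simp add: exp_of_nat_mult[symmetric] mult.commute)
  qed
  then have up: "(\<lambda>n. C * exp (- (e\<^sup>2 / r) * real n)) \<longlonglongrightarrow> 0" by simp
  have z: "(\<lambda>n. measure (bern P) (E n)) \<longlonglongrightarrow> 0"
  proof (rule tendsto_sandwich[OF _ _ tendsto_const up])
    show "\<forall>\<^sub>F n in sequentially. measure (bern P) (E n) \<le> C * exp (- (e\<^sup>2 / r) * real n)"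
      using eventually_ge_at_top[of 1]
    proof eventually_elim
      case (elim n)
      show ?case unfolding m using ld[OF elim e(1,2)] by (simp add: mult.commute)
    qed
  qed simp
  have "AE \<omega> in bern P. (\<lambda>n. indicat_real (E n) \<omega>) \<longlonglongrightarrow> 1"
    using l
  proof eventually_elim
    case (elim \<omega>)
    have "(\<lambda>n. \<bar>f (pre n \<omega>) / real n - L\<bar>) \<longlonglongrightarrow> \<bar>l - L\<bar>" by (intro tendsto_intros elim)
    then have "\<forall>\<^sub>F n in sequentially. e < \<bar>f (pre n \<omega>) / real n - L\<bar>" using e(3) by (rule order_tendstoD)
    then have "\<forall>\<^sub>F n in sequentially. 1 = indicat_real (E n) \<omega>"
      using eventually_ge_at_top[of 1]
    proof eventually_elim
      case (elim n)
      then have n: "0 < real n" by simp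
      have "f (pre n \<omega>) - real n * L = real n * (f (pre n \<omega>) / real n - L)" using n by (simp add: right_diff_distrib)
      then have "\<bar>f (pre n \<omega>) - real n * L\<bar> = real n * \<bar>f (pre n \<omega>) / real n - L\<bar>" using n by (simp add: abs_mult)
      then have "\<bar>f (pre n \<omega>) - real n * L\<bar> > real n * e" using elim(1) n by simp
      then show ?case by (simp add: E_def)
    qed
    then show ?case by (rule Lim_transform_eventually[OF tendsto_const])
  qed
  then have "(\<lambda>n. \<integral>\<omega>. indicat_real (E n) \<omega> \<partial>bern P) \<longlonglongrightarrow> (\<integral>\<omega>. 1 \<partial>bern P)"
    by (intro integral_dominated_convergence[where w = "\<lambda>_. 1"]) (auto simp: indicator_def)
  then have "(\<lambda>n. measure (bern P) (E n)) \<longlonglongrightarrow> 1" using B.prob_space by simp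
  then show False using LIMSEQ_unique[OF z] by fastforce
qed

section \<open>Large deviations and continuity for exterior powers\<close>

lemma (in linear_cocycle) nm_fold_lower:
  assumes q0: "\<And>a. q0 a < N" "\<And>a. c0 \<le> norm (D a (ev (q0 a)))" and c0: "0 < c0" and w: "w \<noteq> []"
  shows "c0 * kap ^ length w \<le> nm N (fold D w)"
proof -
  obtain a u where w': "w = a # u" using w by (cases w) auto
  have s: "st a (D a (ev (q0 a)))" using q0(2)[of a] c0 by (auto simp: st_def)
  have "c0 * kap ^ length w \<le> kap ^ length u * c0"
    using kap c0 by (simp add: w' mult_left_le_one_le mult.commute[of c0])
  also have "\<dots> \<le> kap ^ length u * norm (D a (ev (q0 a)))" using kap by (intro mult_left_mono q0) auto
  also have "\<dots> \<le> norm (fold D u (D a (ev (q0 a))))" by (rule norm_fold_lower[OF s])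
  also have "\<dots> = norm (fold D w (ev (q0 a)))" by (simp add: w')
  also have "\<dots> \<le> nm N (fold D w)" unfolding nm_def
    using q0(1) by (intro member_le_sum[of _ _ "\<lambda>q. norm (fold D w (ev q))"]) auto
  finally show ?thesis .
qed

text \<open>The identities \<open>G * (A c * A a) = A a\<close> and
  \<open>A c * A a * F = A c\<close> survive exterior powers. The first gives the lower bound on
  ranges, with a constant taken from the norms of finitely many left factors; the second gives the
  equality of ranges.\<close>

lemma linear_cocycle_ext:
  fixes A :: "'a::finite \<Rightarrow> real mat"
  assumes rankA: "Ck d k A" and rank2: "\<forall>a b. vec_space.rank d (A a * A b) = k"
  shows "\<exists>kap K. linear_cocycle (ext_dim d j) (extop d j A) kap K"
    and "\<exists>y. extop d j A c x = extop d j A c (extop d j A a y)"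
proof -
  let ?N = "ext_dim d j" and ?D = "extop d j A"
  have A: "A a \<in> carrier_mat d d" "vec_space.rank d (A a) = k" for a using rankA by (auto simp: Ck_def)
  have r2: "vec_space.rank d (A a * A b) = k" for a b using rank2 by blast
  have two: "mop ?N (ext_pow j (A c * A a)) x = ?D c (?D a x)" for a c x
    by (simp only: extop_def mop_ext_mult[OF A(1) A(1)])
  have "\<exists>G\<in>carrier_mat d d. G * (A c * A a) = A a" for a c
    by (rule product_rank_cancel(1)[OF A(1) A(1) A(2) A(2) r2])
  then have ex: "\<exists>G. G \<in> carrier_mat d d \<and> G * (A c * A a) = A a" for a c by blast
  define G where "G a c = (SOME G. G \<in> carrier_mat d d \<and> G * (A c * A a) = A a)" for a c
  have G: "G a c \<in> carrier_mat d d" "G a c * (A c * A a) = A a" for a c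
    using someI_ex[OF ex[of c a]] unfolding G_def by blast+
  define g where "g a c = mop ?N (ext_pow j (G a c))" for a c
  have AA: "A c * A a \<in> carrier_mat d d" for a c by (rule mult_carrier_mat[OF A(1) A(1)])
  have gD: "?D a x = g a c (?D c (?D a x))" for a c x
  proof -
    have "?D a x = mop ?N (ext_pow j (G a c * (A c * A a))) x" by (simp only: extop_def G(2))
    then show ?thesis by (simp only: mop_ext_mult[OF G(1) AA] two g_def)
  qed
  define S where "S = 1 + (\<Sum>a\<in>UNIV. \<Sum>c\<in>UNIV. nm ?N (g a c))"
  have S1: "1 \<le> S" by (simp add: S_def sum_nonneg nm_nonneg)
  have gS: "nm ?N (g a c) \<le> S" for a c
  proof -
    have "nm ?N (g a c) \<le> (\<Sum>c\<in>UNIV. nm ?N (g a c))"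
      by (intro member_le_sum[of c _ "\<lambda>c. nm ?N (g a c)"]) (auto simp: nm_nonneg)
    also have "\<dots> \<le> (\<Sum>a\<in>UNIV. \<Sum>c\<in>UNIV. nm ?N (g a c))"
      by (intro member_le_sum[of a _ "\<lambda>a. \<Sum>c\<in>UNIV. nm ?N (g a c)"]) (auto simp: nm_nonneg sum_nonneg)
    finally show ?thesis by (simp add: S_def)
  qed
  define K where "K = 1 + (\<Sum>a\<in>UNIV. nm ?N (?D a))"
  have K1: "1 \<le> K" by (simp add: K_def sum_nonneg nm_nonneg)
  have DK: "nm ?N (?D a) \<le> K" for a
    using member_le_sum[of a UNIV "\<lambda>a. nm ?N (?D a)"] by (simp add: K_def nm_nonneg)
  have "linear_cocycle ?N ?D (1 / S) K"
  proof
    show "opN ?N (?D a)" for a by (rule opN_extop)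
    show "0 < 1 / S" "1 / S \<le> 1" using S1 by auto
    show "1 \<le> K" by (rule K1)
    show "1 / S * norm (?D a x) \<le> norm (?D c (?D a x))" for a x c
    proof -
      have "norm (?D a x) = norm (g a c (?D c (?D a x)))" using gD[of a x c] by (rule arg_cong)
      also have "\<dots> \<le> nm ?N (g a c) * norm (?D c (?D a x))" unfolding g_def by (rule opN_norm_le[OF opN_mop])
      also have "\<dots> \<le> S * norm (?D c (?D a x))" by (intro mult_right_mono gS) simp
      finally show ?thesis using S1 by (simp add: field_simps)
    qed
    show "norm (?D a v) \<le> K * norm v" for a v
      by (rule order_trans[OF opN_norm_le[OF opN_extop]]) (intro mult_right_mono DK norm_ge_zero)
  qed
  then show "\<exists>kap K. linear_cocycle (ext_dim d j) (extop d j A) kap K" by blast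
  obtain F where F: "F \<in> carrier_mat d d" "A c * A a * F = A c"
    using product_rank_cancel(2)[OF A(1) A(1) A(2) A(2) r2] by blast
  have "?D c x = mop ?N (ext_pow j (A c * A a * F)) x" by (simp only: extop_def F(2))
  also have "\<dots> = ?D c (?D a (mop ?N (ext_pow j F) x))" by (simp only: mop_ext_mult[OF AA F(1)] two)
  finally show "\<exists>y. extop d j A c x = extop d j A c (extop d j A a y)" by blast
qed

lemma extop_nonzero:
  fixes A :: "'a::finite \<Rightarrow> real mat"
  assumes rankA: "Ck d k A" and j: "j \<le> k" "k \<le> d"
  shows "\<exists>x. extop d j A a x \<noteq> 0"
    and "\<exists>q0 c0. 0 < c0 \<and> c0 \<le> 1 \<and> (\<forall>a. q0 a < ext_dim d j \<and> c0 \<le> norm (extop d j A a (ev (q0 a))))"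
proof -
  let ?N = "ext_dim d j" and ?D = "extop d j A"
  have A: "A a \<in> carrier_mat d d" "vec_space.rank d (A a) = k" for a using rankA by (auto simp: Ck_def)
  have nz: "\<exists>x. ?D a x \<noteq> 0" for a
  proof -
    obtain Hh b where Hb: "opN ?N Hh" "\<forall>p\<in>top_idx d k j. Hh (mop ?N (ext_pow j (A a)) (b p)) = ev p"
      using ext_pow_coordinates[OF A] by blast
    obtain p where p: "p \<in> top_idx d k j" using top_idx_nonempty[OF j] by blast
    have "?D a (b p) \<noteq> 0"
    proof
      assume "?D a (b p) = 0"
      then have "ev p = Hh 0" using Hb(2)[rule_format, OF p] by (simp add: extop_def)
      then have "ev p = 0" using linear_0[OF opN_linear[OF Hb(1)]] by simp
      then show False using norm_ev[of p] by simp
    qed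
    then show ?thesis by blast
  qed
  show "\<exists>x. ?D a x \<noteq> 0" by (rule nz)
  have "\<exists>q<?N. ?D a (ev q) \<noteq> 0" for a
  proof (rule ccontr)
    assume "\<not> (\<exists>q<?N. ?D a (ev q) \<noteq> 0)"
    then have z: "?D a (ev q) = 0" if "q < ?N" for q using that by blast
    obtain x where x: "?D a x \<noteq> 0" using nz by blast
    have "?D a x = (\<Sum>q<?N. x q *\<^sub>R ?D a (ev q))" by (rule opN_expand[OF opN_extop])
    also have "\<dots> = 0" using z by (intro sum.neutral) simp
    finally show False using x by simp
  qed
  then obtain q0 where q0: "\<And>a. q0 a < ?N" "\<And>a. ?D a (ev (q0 a)) \<noteq> 0" by metis
  define c0 where "c0 = min 1 (Min (range (\<lambda>a. norm (?D a (ev (q0 a))))))"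
  have m: "0 < Min (range (\<lambda>a. norm (?D a (ev (q0 a)))))" using q0(2) by (subst Min_gr_iff) auto
  have "c0 \<le> norm (?D a (ev (q0 a)))" for a
    unfolding c0_def by (rule min.coboundedI2) (rule Min_le, auto)
  moreover have "0 < c0" "c0 \<le> 1" using m by (auto simp: c0_def)
  ultimately show "\<exists>q0 c0. 0 < c0 \<and> c0 \<le> 1 \<and> (\<forall>a. q0 a < ?N \<and> c0 \<le> norm (?D a (ev (q0 a))))"
    using q0(1) by blast
qed

lemma linear_nondegenerate:
  assumes lc: "linear_cocycle (ext_dim d j) (extop d j B) kap K"
    and B: "\<And>a. B a \<in> carrier_mat d d" and j: "j \<le> d"
    and q0: "\<And>a. q0 a < ext_dim d j" "\<And>a. c0 \<le> norm (extop d j B a (ev (q0 a)))" "0 < c0"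
  shows "nondegenerate_power d B j c0 kap"
proof -
  interpret linear_cocycle _ "ext_dim d j" "extop d j B" kap K by (rule lc)
  show ?thesis using B j q0(3) kap nm_fold_lower[of q0 c0, OF q0] by unfold_locales auto
qed

text \<open>There are no \<open>k + 1\<close> distinct indices below \<open>k\<close>, so the
  exterior power of order \<open>k + 1\<close> vanishes and with it s_1 ... s_(k+1); dividing by the
  positive product up to \<open>k\<close> leaves s_(k+1) = 0. For \<open>k = d\<close> this is the
  default value of \<open>sval\<close>.\<close>

lemma sval_beyond_rank:
  assumes rankA: "Ck d k A" and k: "k \<le> d" and n: "1 \<le> n" and pos: "0 < sprod k (cpow d A n \<omega>)"
  shows "sval (k + 1) (cpow d A n \<omega>) = 0"
proof (cases "k < d")
  case False
  have A: "A a \<in> carrier_mat d d" for a using rankA by (simp add: Ck_def)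
  have "dim_col (cpow d A n \<omega>) = d" using cpow_carrier[of A d n \<omega>, OF A] by auto
  then show ?thesis using False k by (simp add: sval_def)
next
  case True
  let ?N = "ext_dim d (k + 1)" and ?M = "cpow d A n \<omega>"
  have A: "A a \<in> carrier_mat d d" "vec_space.rank d (A a) = k" for a using rankA by (auto simp: Ck_def)
  have M: "?M \<in> carrier_mat d d" by (rule cpow_carrier[OF A(1)])
  obtain m where m: "n = Suc m" using n by (cases n) auto
  have "top_idx d k (k + 1) = {}"
  proof (rule ccontr)
    assume "top_idx d k (k + 1) \<noteq> {}"
    then obtain p where p: "p < ?N" "set (ext_idx d (k + 1) ! p) \<subseteq> {0..<k}" by (auto simp: top_idx_def)
    have "card (set (ext_idx d (k + 1) ! p)) \<le> k" using card_mono[OF _ p(2)] by simp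
    then show False using distinct_card[OF ext_idx_nth(4)[OF p(1)]] ext_idx_nth(1)[OF p(1)] by simp
  qed
  then obtain S :: "rvec set" where S: "finite S" "card S \<le> 0" "range (mop ?N (ext_pow (k + 1) (A (\<omega> m)))) \<subseteq> span S"
    using range_ext_pow_span[OF A(1) A(2), where i = "k + 1" and a1 = "\<omega> m"] by auto
  have "S = {}" using S(1,2) by simp
  then have "mop ?N (ext_pow (k + 1) (A (\<omega> m))) v = 0" for v using S(3) by auto
  then have "mop ?N (ext_pow (k + 1) ?M) v = 0" for v
    by (simp add: m mop_ext_mult[OF A(1) cpow_carrier[OF A(1)]])
  then have "nm ?N (mop ?N (ext_pow (k + 1) ?M)) = 0" by (simp add: nm_def)
  then have "sqrt (fro ?N (ext_pow (k + 1) ?M)) \<le> 0" using sqrt_fro_le_nm[of ?N "ext_pow (k + 1) ?M"] by simp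
  moreover have "sprod (k + 1) ?M \<le> sqrt (fro ?N (ext_pow (k + 1) ?M))"
    by (rule sprod_sqrt_fro(1)[OF M]) (use True in simp)
  ultimately have "sprod (k + 1) ?M \<le> 0" by linarith
  then have "sprod (k + 1) ?M = 0" using sprod_nonneg[OF M, of "k + 1"] by linarith
  moreover have "sprod (k + 1) ?M = sprod k ?M * sval (k + 1) ?M" by (simp add: sprod_def)
  ultimately show ?thesis using pos by simp
qed

text \<open>By \<open>minors2_bound\<close>, \<open>m2\<close> is at most a constant times (s_1 ...
  s_(i-1)) (s_1 ... s_(i+1)). Divided by the square of s_1 ... s_i this has exponent L_(i+1) - L_i,
  which is negative.\<close>

lemma gap_decay:
  fixes P :: "'a::finite pmf"
  assumes ik: "1 \<le> i" "i \<le> k" "k \<le> d" and rankA: "Ck d k A" and nd: "nondegenerate_power d A k c kap"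
    and gap: "lyap P d A i > lyap P d A (i + 1)"
  shows "\<exists>g>0. AE \<omega> in bern P. \<forall>\<^sub>F n in sequentially.
    m2 (ext_dim d i) (fold (extop d i A) (pre n \<omega>)) \<le> exp (- g * real n) * (nm (ext_dim d i) (fold (extop d i A) (pre n \<omega>)))\<^sup>2"
proof -
  let ?N = "ext_dim d i" and ?D = "extop d i A"
  have A: "A a \<in> carrier_mat d d" for a using rankA by (simp add: Ck_def)
  have id: "i \<le> d" using ik by simp
  interpret K: nondegenerate_power P d A k c kap by (rule nd)
  have M: "cpow d A n \<omega> \<in> carrier_mat d d" for n \<omega> by (rule cpow_carrier[OF A])
  have N0: "0 < real ?N" using ext_dim_pos[OF id] by simp
  have m2le: "m2 ?N (fold ?D (pre n \<omega>)) \<le> 2 * real ?N ^ 5 *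
      (sprod i (cpow d A n \<omega>) * (sprod (i - 1) (cpow d A n \<omega>) * sval (i + 1) (cpow d A n \<omega>)))" (is "_ \<le> _ * ?Z")
    if n: "1 \<le> n" for n \<omega>
  proof -
    let ?X = "ext_pow i (cpow d A n \<omega>)"
    have Z0: "0 \<le> ?Z" using sprod_nonneg[OF M] sval_nonneg[OF M] by (intro mult_nonneg_nonneg)
    have "2 * (real ?N)\<^sup>2 * ?Z\<^sup>2 \<le> (2 * real ?N * ?Z)\<^sup>2" by (simp add: power_mult_distrib)
    with minors2_bound[OF M[of n \<omega>] ik(1) id]
    have "(\<Sum>p<?N. \<Sum>q<?N. \<Sum>r<?N. \<Sum>s<?N. (?X $$ (p, r) * ?X $$ (q, s) - ?X $$ (p, s) * ?X $$ (q, r))\<^sup>2) \<le> (2 * real ?N * ?Z)\<^sup>2"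
      by (rule order_trans)
    then have "m2 ?N (mop ?N ?X) \<le> real ?N ^ 4 * (2 * real ?N * ?Z)" using Z0 by (intro m2_mop_le) auto
    also have "\<dots> = 2 * real ?N ^ 5 * ?Z" by (simp add: eval_nat_numeral mult_ac)
    finally show ?thesis unfolding fold_extop_cpow[of A d n i \<omega>, OF A n] .
  qed
  have nmge: "sprod i (cpow d A n \<omega>) \<le> real ?N * nm ?N (fold ?D (pre n \<omega>))" if n: "1 \<le> n" for n \<omega>
    unfolding fold_extop_cpow[of A d n i \<omega>, OF A n]
    by (rule order_trans[OF sprod_sqrt_fro(1)[OF M id] sqrt_fro_le_nm])
  show ?thesis
  proof (cases "i = k")
    \<comment> \<open>Here L_(i+1) is minus infinity and there is no finite gap to measure;
      \<open>m2\<close> vanishes, so any rate serves and 1 is taken.\<close>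
    case True
    have "m2 ?N (fold ?D (pre n \<omega>)) \<le> exp (- 1 * real n) * (nm ?N (fold ?D (pre n \<omega>)))\<^sup>2" if n: "1 \<le> n" for n \<omega>
    proof -
      have "sval (i + 1) (cpow d A n \<omega>) = 0"
        using sval_beyond_rank[OF rankA ik(3) n K.sprod_nm(1)[OF n]] by (simp only: True)
      then have "m2 ?N (fold ?D (pre n \<omega>)) \<le> 0" using m2le[OF n, of \<omega>] by simp
      then show ?thesis by (rule order_trans) simp
    qed
    then have "\<forall>\<^sub>F n in sequentially. m2 ?N (fold ?D (pre n \<omega>)) \<le> exp (- 1 * real n) * (nm ?N (fold ?D (pre n \<omega>)))\<^sup>2" for \<omega>
      by (intro eventually_sequentiallyI[of 1])
    then show ?thesis by (intro exI[of _ 1]) (auto intro!: AE_I2)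
  next
    case False
    then have i1: "i + 1 \<le> k" "i - 1 \<le> k" using ik by auto
    obtain c1 k1 where "nondegenerate_power d A i c1 k1" using K.nondegenerate_le[OF ik(2)] by blast
    then interpret I: nondegenerate_power P d A i c1 k1 .
    obtain c2 k2 where "nondegenerate_power d A (i + 1) c2 k2" using K.nondegenerate_le[OF i1(1)] by blast
    then interpret J: nondegenerate_power P d A "i + 1" c2 k2 .
    obtain c3 k3 where "nondegenerate_power d A (i - 1) c3 k3" using K.nondegenerate_le[OF i1(2)] by blast
    then interpret H: nondegenerate_power P d A "i - 1" c3 k3 .
    let ?l = "power_exponent P d A"
    \<comment> \<open>Half of L_i - L_(i+1); the other half absorbs the constant and the
      fluctuations for large \<open>n\<close>.\<close>
    define g where "g = (2 * ?l i - ?l (i - 1) - ?l (i + 1)) / 2"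
    have g: "0 < g" using gap K.lyap_power[of i] K.lyap_power[of "i + 1"] ik i1 by (simp add: g_def)
    \<comment> \<open>2 N^5 comes from the bound on \<open>m2\<close>, the remaining N^2 from
      comparing the product of singular values with \<open>nm\<close>.\<close>
    define b where "b = ln (2 * real ?N ^ 7)"
    from I.AE_sprod_exponent J.AE_sprod_exponent H.AE_sprod_exponent
    have "AE \<omega> in bern P. \<forall>\<^sub>F n in sequentially.
      m2 ?N (fold ?D (pre n \<omega>)) \<le> exp (- g * real n) * (nm ?N (fold ?D (pre n \<omega>)))\<^sup>2"
    proof eventually_elim
      case (elim \<omega>)
      let ?s = "\<lambda>j n. sprod j (cpow d A n \<omega>)"
      have "(\<lambda>n. b / real n + ln (?s (i - 1) n) / real n + ln (?s (i + 1) n) / real n - 2 * (ln (?s i n) / real n))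
          \<longlonglongrightarrow> 0 + ?l (i - 1) + ?l (i + 1) - 2 * ?l i"
        by (intro tendsto_intros elim lim_const_over_n)
      then have "\<forall>\<^sub>F n in sequentially. b / real n + ln (?s (i - 1) n) / real n + ln (?s (i + 1) n) / real n - 2 * (ln (?s i n) / real n) < - g"
        by (rule order_tendstoD) (use g in \<open>simp add: g_def field_simps\<close>)
      then show ?case using eventually_ge_at_top[of 1]
      proof eventually_elim
        case (elim n)
        then have n: "1 \<le> n" "0 < real n" by auto
        note p = H.sprod_nm(1)[OF n(1), of \<omega>] J.sprod_nm(1)[OF n(1), of \<omega>] I.sprod_nm(1)[OF n(1), of \<omega>]
        have "(b + ln (?s (i - 1) n) + ln (?s (i + 1) n) - 2 * ln (?s i n)) / real n < - g"
          using elim(1) by (simp add: add_divide_distrib diff_divide_distrib)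
        then have "b + ln (?s (i - 1) n) + ln (?s (i + 1) n) \<le> - g * real n + 2 * ln (?s i n)"
          using n(2) by (simp add: pos_divide_less_eq)
        then have "exp (b + ln (?s (i - 1) n) + ln (?s (i + 1) n)) \<le> exp (- g * real n + 2 * ln (?s i n))" by simp
        moreover have "exp (b + ln (?s (i - 1) n) + ln (?s (i + 1) n)) = 2 * real ?N ^ 7 * (?s (i - 1) n * ?s (i + 1) n)"
          using p N0 by (simp add: exp_add b_def)
        moreover have "exp (2 * ln (?s i n)) = (?s i n)\<^sup>2"
          using p exp_of_nat_mult[of 2 "ln (?s i n)"] by simp
        then have "exp (- g * real n + 2 * ln (?s i n)) = exp (- g * real n) * (?s i n)\<^sup>2"
          by (simp only: exp_add)
        ultimately have e: "2 * real ?N ^ 7 * (?s (i - 1) n * ?s (i + 1) n) \<le> exp (- g * real n) * (?s i n)\<^sup>2"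
          by (simp only:)
        have "m2 ?N (fold ?D (pre n \<omega>)) \<le> 2 * real ?N ^ 5 * (?s (i - 1) n * ?s (i + 1) n)"
          using m2le[OF n(1), of \<omega>] by (simp add: sprod_def mult_ac)
        then have "(real ?N)\<^sup>2 * m2 ?N (fold ?D (pre n \<omega>)) \<le> (real ?N)\<^sup>2 * (2 * real ?N ^ 5 * (?s (i - 1) n * ?s (i + 1) n))"
          by (rule mult_left_mono) simp
        also have "\<dots> = 2 * real ?N ^ 7 * (?s (i - 1) n * ?s (i + 1) n)" by (simp add: eval_nat_numeral mult_ac)
        also have "\<dots> \<le> exp (- g * real n) * (?s i n)\<^sup>2" by (rule e)
        also have "\<dots> \<le> exp (- g * real n) * (real ?N * nm ?N (fold ?D (pre n \<omega>)))\<^sup>2"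
          using p nmge[OF n(1), of \<omega>] by (intro mult_left_mono power_mono) auto
        also have "\<dots> = (real ?N)\<^sup>2 * (exp (- g * real n) * (nm ?N (fold ?D (pre n \<omega>)))\<^sup>2)"
          by (simp add: power_mult_distrib mult_ac)
        finally show ?case using N0 by simp
      qed
    qed
    then show ?thesis using g by blast
  qed
qed

lemma contracting_neighbourhood:
  fixes P :: "'a::finite pmf" and A :: "'a \<Rightarrow> real mat" and d i k :: nat
  assumes pos: "set_pmf P = UNIV"
    and ik: "1 \<le> i" "i \<le> k" "k \<le> d"
    and rankA: "Ck d k A"
    and rank2: "\<forall>a b. vec_space.rank d (A a * A b) = k"
    and gap: "lyap P d A i > lyap P d A (i + 1)"
    and irr: "irreducible_cocycle (ext_dim d i) (ext_cocycle i A)"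
  shows "\<exists>\<delta>>0. \<exists>kap K alpha theta c0 n0 q0. \<forall>B. Ck d k B \<and> cdist d B A < \<delta> \<longrightarrow>
    contracting_cocycle P (ext_dim d i) (extop d i B) kap K alpha theta c0 n0 q0"
proof -
  let ?N = "ext_dim d i" and ?D = "extop d i A"
  have A: "A a \<in> carrier_mat d d" "vec_space.rank d (A a) = k" for a using rankA by (auto simp: Ck_def)
  \<comment> \<open>The exterior power of order \<open>k\<close> is treated first: its nondegeneracy
    descends to all smaller orders, which makes the exponents compared in \<open>gap_decay\<close>
    finite.\<close>
  obtain kk Kk where "linear_cocycle (ext_dim d k) (extop d k A) kk Kk" using linear_cocycle_ext(1)[OF rankA rank2] by blast
  moreover obtain qk ck where "0 < ck" "ck \<le> 1" "\<And>a. qk a < ext_dim d k" "\<And>a. ck \<le> norm (extop d k A a (ev (qk a)))"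
    using extop_nonzero(2)[OF rankA order_refl ik(3)] by blast
  ultimately have nd: "nondegenerate_power d A k ck kk" using A(1) ik(3) by (intro linear_nondegenerate) auto
  obtain g where g: "0 < g" "AE \<omega> in bern P. \<forall>\<^sub>F n in sequentially.
    m2 ?N (fold ?D (pre n \<omega>)) \<le> exp (- g * real n) * (nm ?N (fold ?D (pre n \<omega>)))\<^sup>2"
    using gap_decay[OF ik rankA nd gap] by blast
  obtain kap K where lc: "linear_cocycle ?N ?D kap K" using linear_cocycle_ext(1)[OF rankA rank2] by blast
  have Deq: "?D a = mop ?N (ext_cocycle i A a)" for a by (simp add: extop_def ext_cocycle_def fun_eq_iff)
  have cc: "ext_cocycle i A a \<in> carrier_mat ?N ?N" for a unfolding ext_cocycle_def by (rule ext_pow_carrier[OF A(1)])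
  interpret L: linear_cocycle P ?N ?D kap K by (rule lc)
  interpret I: irreducible_linear_cocycle P ?N ?D kap K g
  proof
    show "0 < pmf P c" for c using pos by (simp add: pmf_positive_iff)
    show "\<exists>y. ?D c x = ?D c (?D a y)" for c x a by (rule linear_cocycle_ext(2)[OF rankA rank2])
    show "\<exists>x. ?D a x \<noteq> 0" for a by (rule extop_nonzero(1)[OF rankA ik(2,3)])
    show "\<not> (\<exists>W. \<forall>a. Real_Vector_Spaces.subspace (W a) \<and> W a \<noteq> {0} \<and> W a \<subset> range (?D a) \<and> (\<forall>b. ?D a ` W b = W a))"
      unfolding Deq by (rule irreducible_transfer[OF cc irr])
  qed (rule g)+
  obtain n0 alpha theta where u: "1 \<le> n0" "0 < alpha" "alpha \<le> 1" "0 < theta" "theta < 1"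
    "\<forall>a v. v \<in> range (?D a) \<and> norm v = 1 \<longrightarrow> wex P n0 (\<lambda>w. (m2 ?N (fold ?D w) / (norm (fold ?D w v))\<^sup>2) powr alpha) \<le> theta"
    using I.uniform_contraction by blast
  have u': "wex P n0 (\<lambda>w. (m2 ?N (fold ?D w) / (norm (fold ?D w v))\<^sup>2) powr alpha) \<le> theta"
    if "v \<in> range (?D a)" "norm v = 1" for a v using u(6)[rule_format, of v a] that by simp
  obtain q0 c0 where q0: "0 < c0" "c0 \<le> 1" "\<And>a. q0 a < ?N" "\<And>a. c0 \<le> norm (?D a (ev (q0 a)))"
    using extop_nonzero(2)[OF rankA ik(2,3)] by blast
  have "\<forall>a. \<exists>Hh b. opN ?N Hh \<and> (\<forall>p\<in>top_idx d k i. Hh (?D a (b p)) = ev p)"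
    unfolding extop_def using ext_pow_coordinates[OF A] by blast
  then obtain Hh b where Hb: "\<And>a. opN ?N (Hh a)" "\<And>a p. p \<in> top_idx d k i \<Longrightarrow> Hh a (?D a (b a p)) = ev p" by metis
  have "\<exists>z>0. z \<le> 1 \<and> (\<forall>D'. (\<forall>a. opN ?N (D' a)) \<and>
      (\<forall>a. \<exists>S. finite S \<and> card S \<le> card (top_idx d k i) \<and> range (D' a) \<subseteq> span S) \<and>
      (\<forall>a q. q < ?N \<longrightarrow> norm (D' a (ev q) - ?D a (ev q)) \<le> z) \<longrightarrow>
      contracting_cocycle P ?N D' (kap / 2) (K + 1) alpha ((1 + theta) / 2) (c0 / 2) n0 q0)"
    by (rule L.contraction_stable[where Hh = Hh and b = b]) (fact u(1-5) q0 u' Hb finite_top_idx)+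
  then obtain z where z: "0 < z" "z \<le> 1" and zc: "\<And>D'. (\<forall>a. opN ?N (D' a)) \<and>
      (\<forall>a. \<exists>S. finite S \<and> card S \<le> card (top_idx d k i) \<and> range (D' a) \<subseteq> span S) \<and>
      (\<forall>a q. q < ?N \<longrightarrow> norm (D' a (ev q) - ?D a (ev q)) \<le> z) \<Longrightarrow>
      contracting_cocycle P ?N D' (kap / 2) (K + 1) alpha ((1 + theta) / 2) (c0 / 2) n0 q0"
    by (elim exE conjE) (rule that, assumption+, blast)
  obtain Cl where Cl: "1 \<le> Cl" "\<forall>B B'. (\<forall>a. B a \<in> carrier_mat d d) \<and> (\<forall>a. B' a \<in> carrier_mat d d) \<and> cdist d B A < 1 \<and> cdist d B' A < 1 \<longrightarrow>
    (\<forall>a q. q < ?N \<longrightarrow> norm (extop d i B a (ev q) - extop d i B' a (ev q)) \<le> Cl * cdist d B B')"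
    using extop_lipschitz[of d A i] by blast
  \<comment> \<open>The radius \<open>z / Cl\<close> is at most 1, as the Lipschitz estimate
    demands, and converts the distance of cocycles into the distance \<open>z\<close> of the columns
    of their exterior powers.\<close>
  have "contracting_cocycle P ?N (extop d i B) (kap / 2) (K + 1) alpha ((1 + theta) / 2) (c0 / 2) n0 q0"
    if B: "Ck d k B" "cdist d B A < z / Cl" for B
  proof (rule zc, intro conjI allI impI)
    have Bc: "B a \<in> carrier_mat d d" "vec_space.rank d (B a) = k" for a using B(1) by (auto simp: Ck_def)
    show "opN ?N (extop d i B a)" for a by (rule opN_extop)
    show "\<exists>S. finite S \<and> card S \<le> card (top_idx d k i) \<and> range (extop d i B a) \<subseteq> span S" for a
      using range_ext_pow_span[OF Bc(1)[of a] Bc(2)[of a], of i] by (simp add: extop_def)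
    have "z / Cl \<le> 1" using z Cl(1) by simp
    then have "cdist d B A < 1" using B(2) by linarith
    moreover have "cdist d A A < 1" by (simp add: cdist_def)
    ultimately have l: "norm (extop d i B a (ev q) - ?D a (ev q)) \<le> Cl * cdist d B A" if "q < ?N" for a q
      using Cl(2) Bc(1) A(1) that by blast
    have "Cl * cdist d B A \<le> z" using B(2) Cl(1) by (simp add: field_simps)
    then show "norm (extop d i B a (ev q) - ?D a (ev q)) \<le> z" if "q < ?N" for a q using l[OF that, of a] by linarith
  qed
  moreover have "0 < z / Cl" using z Cl by simp
  ultimately show ?thesis by blast
qed

section \<open>Uniform estimates on the neighbourhood\<close>

lemma contracting_exponent:
  assumes cc: "contracting_cocycle P (ext_dim d i) (extop d i B) kap K alpha theta c0 n0 q0"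
    and B: "Ck d k B" and i: "1 \<le> i" "i \<le> d"
  shows "nondegenerate_power d B i c0 kap"
    and "power_exponent P d B i = contracting_cocycle.L P (extop d i B) q0"
proof -
  interpret C: contracting_cocycle P "ext_dim d i" "extop d i B" kap K alpha theta c0 n0 q0 by (rule cc)
  have Bc: "B a \<in> carrier_mat d d" for a using B by (simp add: Ck_def)
  show nd: "nondegenerate_power d B i c0 kap"
    using Bc i C.q0 C.c0 by (intro linear_nondegenerate[OF C.linear_cocycle_axioms]) auto
  interpret ND: nondegenerate_power P d B i c0 kap by (rule nd)
  show "power_exponent P d B i = C.L"
    using C.R_ge1 by (intro prefix_limit_unique[OF ND.AE_nm_exponent[OF i(1)] C.large_deviations]) auto
qed

text \<open>\<open>opnorm\<close> and \<open>nm\<close> differ by at most t = 2 ln N in the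
  logarithm. If n \<epsilon> is at least 2 t, this is absorbed by halving \<epsilon>, which turns
  the 4 of \<open>large_deviations\<close> into 16; otherwise the exponent is at most 2 t in
  absolute value, and the additional constant makes the right side at least 1.\<close>

lemma contracting_large_deviations:
  assumes cc: "contracting_cocycle P (ext_dim d i) (extop d i B) kap K alpha theta c0 n0 q0"
    and B: "Ck d k B" and i: "1 \<le> i" "i \<le> d" and n: "1 \<le> n" and \<epsilon>: "0 < \<epsilon>" "\<epsilon> < 1"
  defines "R \<equiv> contracting_cocycle.R (ext_dim d i) kap K theta n0"
  shows "measure (bern P) {\<omega> \<in> space (bern P).
       \<not> (lyap P (ext_dim d i) (ext_cocycle i B) 1 - ereal \<epsilon> \<le> elog (opnorm (ext_pow i (cpow d B n \<omega>))) / ereal (real n) \<and>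
          elog (opnorm (ext_pow i (cpow d B n \<omega>))) / ereal (real n) \<le> lyap P (ext_dim d i) (ext_cocycle i B) 1 + ereal \<epsilon>)}
    \<le> (contracting_cocycle.C1 (ext_dim d i) kap K theta n0 + contracting_cocycle.C2 (ext_dim d i) kap K theta c0 n0
         + exp (4 * ln (real (ext_dim d i)))) * exp (- real n * (1 / (16 * R\<^sup>2)) * \<epsilon>\<^sup>2)" (is "measure _ ?bad \<le> (?c + ?e) * ?x")
proof -
  let ?N = "ext_dim d i" and ?D = "extop d i B"
  interpret C: contracting_cocycle P ?N ?D kap K alpha theta c0 n0 q0 by (rule cc)
  interpret Pr: prob_space "bern P" by (rule prob_space_bern)
  have Bc: "B a \<in> carrier_mat d d" for a using B by (simp add: Ck_def)
  note ce = contracting_exponent[OF cc B i]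
  interpret ND: nondegenerate_power P d B i c0 kap by (rule ce(1))
  have N1: "1 \<le> ?N" by (rule ext_dim_pos[OF i(2)])
  define t where "t = 2 * ln (real ?N)"
  have t0: "0 \<le> t" using N1 by (simp add: t_def)
  have R1: "1 \<le> R" unfolding R_def by (rule C.R_ge1)
  have n0: "0 < real n" using n by simp
  have ly: "lyap P ?N (ext_cocycle i B) 1 = ereal C.L" using ND.lyap_ext_power[OF i(1)] ce(2) by simp
  have x0: "0 \<le> ?x" by simp
  \<comment> \<open>Nonnegativity of the sum of constants is read off from the estimate itself,
    whose left side is the expectation of an indicator.\<close>
  have c12: "0 \<le> ?c" 
  proof -
    have "0 \<le> wex P 1 (\<lambda>w. if \<bar>ln (nm ?N (fold ?D w)) - real 1 * C.L\<bar> > real 1 * 1 then 1 else 0)"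
      by (rule wex_nonneg) simp
    also have "\<dots> \<le> ?c * exp (- (real 1 * 1\<^sup>2 / (4 * C.R\<^sup>2)))"
      using C.R_ge1 by (intro C.large_deviations) auto
    finally show ?thesis by (simp add: zero_le_mult_iff)
  qed
  show ?thesis
  proof (cases "real n * \<epsilon> < 2 * t")
    case True
    have "real n * (1 / (16 * R\<^sup>2)) * \<epsilon>\<^sup>2 \<le> 2 * t"
    proof -
      have "1 \<le> R\<^sup>2" using R1 by simp
      then have "1 / (16 * R\<^sup>2) \<le> 1" by (simp add: divide_le_eq)
      then have "(1 / (16 * R\<^sup>2)) * \<epsilon> \<le> 1 * 1" using \<epsilon> by (intro mult_mono) linarith+
      moreover have "0 \<le> (1 / (16 * R\<^sup>2)) * \<epsilon>" using \<epsilon> by simp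
      ultimately have "(real n * \<epsilon>) * ((1 / (16 * R\<^sup>2)) * \<epsilon>) \<le> (2 * t) * (1 * 1)"
        by (intro mult_mono[OF less_imp_le[OF True]]) (use t0 in linarith)+
      then show ?thesis by (simp add: power2_eq_square mult_ac)
    qed
    then have "1 \<le> exp (2 * t) * ?x" by (simp add: exp_add[symmetric])
    moreover have "exp (2 * t) = ?e" by (simp add: t_def)
    moreover have "0 \<le> ?c * ?x" using c12 by simp
    moreover have "measure (bern P) ?bad \<le> 1" by simp
    ultimately show ?thesis by (simp only: distrib_right)
  next
    case False
    let ?F = "{w. \<bar>ln (nm ?N (fold ?D w)) - real n * C.L\<bar> > real n * (\<epsilon> / 2)}"
    have "{\<omega> \<in> space (bern P). pre n \<omega> \<in> ?F} \<in> sets (bern P)" by measurable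
    then have Fs: "{\<omega>. pre n \<omega> \<in> ?F} \<in> sets (bern P)" by simp
    have sub: "?bad \<subseteq> {\<omega>. pre n \<omega> \<in> ?F}"
    proof (rule subsetI, rule ccontr)
      fix \<omega> assume bad: "\<omega> \<in> ?bad" and nF: "\<omega> \<notin> {\<omega>. pre n \<omega> \<in> ?F}"
      let ?X = "ext_pow i (cpow d B n \<omega>)"
      have X: "?X \<in> carrier_mat ?N ?N" by (rule ext_pow_carrier[OF cpow_carrier[OF Bc]])
      have f: "fold ?D (pre n \<omega>) = mop ?N ?X" using fold_extop_cpow[of B d n i \<omega>, OF Bc n] .
      have np: "0 < nm ?N (mop ?N ?X)" using ND.nm_pos[OF pre_nonempty[OF n, of \<omega>]] by (simp only: f)
      note cmp = ln_nm_comparison[OF N1 opnorm_fro[OF X N1] np]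
      have 1: "\<bar>ln (nm ?N (mop ?N ?X)) - real n * C.L\<bar> \<le> real n * (\<epsilon> / 2)" using nF by (simp add: f)
      have "t \<le> real n * (\<epsilon> / 2)" using False by simp
      then have "\<bar>ln (opnorm ?X) - real n * C.L\<bar> \<le> real n * \<epsilon>"
        using 1 cmp(2)[folded t_def] mult.assoc[of "real n" \<epsilon> "1 / 2"] by (simp, linarith)
      then have "C.L - \<epsilon> \<le> ln (opnorm ?X) / real n" "ln (opnorm ?X) / real n \<le> C.L + \<epsilon>"
        using n0 by (simp_all add: abs_le_iff field_simps)
      then show False using bad cmp(1) n0 unfolding ly by (simp add: elog_def)
    qed
    have "measure (bern P) ?bad \<le> measure (bern P) {\<omega>. pre n \<omega> \<in> ?F}" by (rule Pr.finite_measure_mono[OF sub Fs])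
    also have "\<dots> = wex P n (\<lambda>w. if \<bar>ln (nm ?N (fold ?D w)) - real n * C.L\<bar> > real n * (\<epsilon> / 2) then 1 else 0)"
      by (subst measure_pre_in) simp
    also have "\<dots> \<le> ?c * exp (- (real n * (\<epsilon> / 2)\<^sup>2 / (4 * C.R\<^sup>2)))"
      using C.R_ge1 \<epsilon> n by (intro C.large_deviations) auto
    also have "- (real n * (\<epsilon> / 2)\<^sup>2 / (4 * C.R\<^sup>2)) = - real n * (1 / (16 * R\<^sup>2)) * \<epsilon>\<^sup>2"
      by (simp add: R_def power_divide)
    finally show ?thesis using x0 by (simp add: distrib_right add_increasing2)
  qed
qed

lemma contracting_holder:
  fixes A :: "'a::finite \<Rightarrow> real mat"
  assumes cc: "\<And>B. Ck d k B \<Longrightarrow> cdist d B A < \<delta> \<Longrightarrow>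
      contracting_cocycle P (ext_dim d i) (extop d i B) kap K alpha theta c0 n0 q0"
    and A: "Ck d k A" and i: "1 \<le> i" "i \<le> d" and \<delta>: "0 < \<delta>"
  shows "\<exists>\<delta>>0. \<exists>H::real. \<exists>\<alpha>::real. 0 < \<alpha> \<and> \<alpha> \<le> 1 \<and>
    (\<forall>B B'. Ck d k B \<and> cdist d B A < \<delta> \<and> Ck d k B' \<and> cdist d B' A < \<delta> \<longrightarrow>
       \<bar>power_exponent P d B i - power_exponent P d B' i\<bar> \<le> H * cdist d B B' powr \<alpha>)"
proof -
  let ?N = "ext_dim d i"
  obtain Cl where Cl: "1 \<le> Cl" "\<forall>B B'. (\<forall>a. B a \<in> carrier_mat d d) \<and> (\<forall>a. B' a \<in> carrier_mat d d) \<and> cdist d B A < 1 \<and> cdist d B' A < 1 \<longrightarrow>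
    (\<forall>a q. q < ?N \<longrightarrow> norm (extop d i B a (ev q) - extop d i B' a (ev q)) \<le> Cl * cdist d B B')"
    using extop_lipschitz[of d A i] by blast
  have A0: "cdist d A A < \<delta>" using \<delta> by (simp add: cdist_def)
  interpret C0: contracting_cocycle P ?N "extop d i A" kap K alpha theta c0 n0 q0 by (rule cc[OF A A0])
  define b where "b = contracting_cocycle.beta kap K theta n0"
  have b: "0 < b" "b \<le> 1" using C0.beta by (auto simp: b_def)
  define H where "H = contracting_cocycle.CH ?N kap K theta c0 n0"
  \<comment> \<open>Close enough to \<open>A\<close> that any two cocycles of the neighbourhood have
    exterior powers with columns at distance at most 1.\<close>
  define \<eta> where "\<eta> = min \<delta> (1 / (2 * Cl))"
  have \<eta>: "0 < \<eta>" "\<eta> \<le> \<delta>" "\<eta> \<le> 1 / (2 * Cl)" using \<delta> Cl(1) by (auto simp: \<eta>_def)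
  have "1 / (2 * Cl) < 1" using Cl(1) by simp
  then have \<eta>1: "\<eta> < 1" using \<eta>(3) by linarith
  have "\<bar>power_exponent P d B i - power_exponent P d B' i\<bar> \<le> (\<bar>H\<bar> * Cl powr b) * cdist d B B' powr b"
    if B: "Ck d k B" "cdist d B A < \<eta>" "Ck d k B'" "cdist d B' A < \<eta>" for B B'
  proof -
    have Bc: "B a \<in> carrier_mat d d" "B' a \<in> carrier_mat d d" for a using B by (auto simp: Ck_def)
    have Ac: "A a \<in> carrier_mat d d" for a using A by (simp add: Ck_def)
    have d1: "cdist d B A < 1" "cdist d B' A < 1" using B \<eta>1 by linarith+
    have d2: "cdist d A A < 1" by (simp add: cdist_def)
    have near: "norm (extop d i Y a (ev q) - extop d i A a (ev q)) \<le> 1 / 2"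
      if Y: "Y = B \<or> Y = B'" and q: "q < ?N" for Y a q
    proof -
      have "cdist d Y A \<le> 1 / (2 * Cl)" using Y B \<eta>(3) by auto
      then have "Cl * cdist d Y A \<le> 1 / 2" using Cl(1) by (simp add: field_simps)
      moreover have "norm (extop d i Y a (ev q) - extop d i A a (ev q)) \<le> Cl * cdist d Y A"
        using Y Cl(2)[rule_format, of B A q a] Cl(2)[rule_format, of B' A q a] Bc Ac d1 d2 q by auto
      ultimately show ?thesis by linarith
    qed
    \<comment> \<open>\<open>exponent_holder\<close> requires a distance of at most 1, hence the
      minimum; the triangle inequality through \<open>A\<close> supplies the bound by 1.\<close>
    define z where "z = min 1 (Cl * cdist d B B')"
    have c0: "0 \<le> cdist d B B'" by (simp add: cdist_def sum_nonneg)
    have z: "0 \<le> z" "z \<le> 1" using c0 Cl(1) by (auto simp: z_def)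
    have diff: "norm (extop d i B a (ev q) - extop d i B' a (ev q)) \<le> z" if q: "q < ?N" for a q
    proof -
      have "norm (extop d i B a (ev q) - extop d i B' a (ev q)) \<le> Cl * cdist d B B'"
        using Cl(2)[rule_format, of B B' q a] Bc d1 q by auto
      moreover have "norm (extop d i B a (ev q) - extop d i B' a (ev q)) \<le> 1"
        using near[OF disjI1[OF refl] q, of a] near[OF disjI2[OF refl] q, of a]
          norm_triangle_ineq4[of "extop d i B a (ev q) - extop d i A a (ev q)" "extop d i B' a (ev q) - extop d i A a (ev q)"]
        by simp
      ultimately show ?thesis by (simp add: z_def)
    qed
    have Bd: "cdist d B A < \<delta>" "cdist d B' A < \<delta>" using B \<eta>(2) by auto
    note c = cc[OF B(1) Bd(1)] cc[OF B(3) Bd(2)]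
    have "\<bar>power_exponent P d B i - power_exponent P d B' i\<bar> \<le> H * z powr b"
      unfolding contracting_exponent(2)[OF c(1) B(1) i] contracting_exponent(2)[OF c(2) B(3) i] H_def b_def
      by (rule exponent_holder[OF c z diff])
    also have "\<dots> \<le> \<bar>H\<bar> * z powr b" by (intro mult_right_mono) auto
    also have "\<dots> \<le> \<bar>H\<bar> * (Cl * cdist d B B') powr b"
      using b z by (intro mult_left_mono powr_mono2) (auto simp: z_def)
    also have "(Cl * cdist d B B') powr b = Cl powr b * cdist d B B' powr b"
      using Cl(1) c0 by (intro powr_mult)
    finally show ?thesis by (simp add: mult_ac)
  qed
  then show ?thesis using \<eta>(1) b by blast
qed

theorem theorem2p5:
  fixes P :: "'a::finite pmf" and A :: "'a \<Rightarrow> real mat" and d i k :: nat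
  assumes pos: "set_pmf P = UNIV"
    and ik: "1 \<le> i" "i \<le> k" "k \<le> d"
    and rankA: "Ck d k A"
    and rank2: "\<forall>a b. vec_space.rank d (A a * A b) = k"
    and gap: "lyap P d A i > lyap P d A (i + 1)"
    and irr: "irreducible_cocycle (ext_dim d i) (ext_cocycle i A)"
  shows
    "(\<exists>\<delta>>0. \<exists>\<epsilon>0>0. \<exists>C::real. \<exists>c>0. \<forall>B. Ck d k B \<and> cdist d B A < \<delta> \<longrightarrow>
        (\<forall>n::nat. n \<ge> 1 \<longrightarrow> (\<forall>\<epsilon>::real. 0 < \<epsilon> \<and> \<epsilon> < \<epsilon>0 \<longrightarrow>
          measure (bern P)
            {\<omega> \<in> space (bern P).
               \<not> (lyap P (ext_dim d i) (ext_cocycle i B) 1 - ereal \<epsilon>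
                     \<le> elog (opnorm (ext_pow i (cpow d B n \<omega>))) / ereal (real n) \<and>
                   elog (opnorm (ext_pow i (cpow d B n \<omega>))) / ereal (real n)
                     \<le> lyap P (ext_dim d i) (ext_cocycle i B) 1 + ereal \<epsilon>)}
          \<le> C * exp (- real n * c * \<epsilon>^2))))
     \<and>
     (\<exists>\<delta>>0. \<exists>H::real. \<exists>\<alpha>::real. 0 < \<alpha> \<and> \<alpha> \<le> 1 \<and>
        (\<forall>B B'. Ck d k B \<and> cdist d B A < \<delta> \<and> Ck d k B' \<and> cdist d B' A < \<delta> \<longrightarrow>
           (\<Sum>j\<in>{1..i}. lyap P d B j) \<noteq> - \<infinity> \<and>
           \<bar>real_of_ereal (\<Sum>j\<in>{1..i}. lyap P d B j) - real_of_ereal (\<Sum>j\<in>{1..i}. lyap P d B' j)\<bar>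
             \<le> H * cdist d B B' powr \<alpha>))"
proof
  obtain \<delta> kap K alpha theta c0 n0 q0 where \<delta>: "0 < \<delta>" and cc: "\<And>B. Ck d k B \<Longrightarrow> cdist d B A < \<delta> \<Longrightarrow>
      contracting_cocycle P (ext_dim d i) (extop d i B) kap K alpha theta c0 n0 q0"
    using contracting_neighbourhood[OF assms] by blast
  have id: "i \<le> d" using ik by simp
  have "cdist d A A < \<delta>" using \<delta> by (simp add: cdist_def)
  then have R: "1 \<le> contracting_cocycle.R (ext_dim d i) kap K theta n0"
    by (rule contracting_cocycle.R_ge1[OF cc[OF rankA]])
  let ?c = "1 / (16 * (contracting_cocycle.R (ext_dim d i) kap K theta n0)\<^sup>2)"
  have c: "0 < ?c" using R by (intro divide_pos_pos mult_pos_pos zero_less_power) linarith+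
  \<comment> \<open>The witness for the bound on \<epsilon>: half of such a deviation stays below
    \<open>2 * R\<close>, where \<open>large_deviations\<close> applies, because
    \<open>R \<ge> 1\<close>.\<close>
  have one: "(0 :: real) < 1" by simp
  let ?C = "contracting_cocycle.C1 (ext_dim d i) kap K theta n0 + contracting_cocycle.C2 (ext_dim d i) kap K theta c0 n0
         + exp (4 * ln (real (ext_dim d i)))"
  have "\<forall>B. Ck d k B \<and> cdist d B A < \<delta> \<longrightarrow>
        (\<forall>n::nat. n \<ge> 1 \<longrightarrow> (\<forall>\<epsilon>::real. 0 < \<epsilon> \<and> \<epsilon> < 1 \<longrightarrow>
          measure (bern P)
            {\<omega> \<in> space (bern P).
               \<not> (lyap P (ext_dim d i) (ext_cocycle i B) 1 - ereal \<epsilon>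
                     \<le> elog (opnorm (ext_pow i (cpow d B n \<omega>))) / ereal (real n) \<and>
                   elog (opnorm (ext_pow i (cpow d B n \<omega>))) / ereal (real n)
                     \<le> lyap P (ext_dim d i) (ext_cocycle i B) 1 + ereal \<epsilon>)}
          \<le> ?C * exp (- real n * ?c * \<epsilon>^2)))"
    by (intro allI impI; elim conjE; rule contracting_large_deviations[OF cc _ ik(1) id])
  then show "\<exists>\<delta>>0. \<exists>\<epsilon>0>0. \<exists>C::real. \<exists>c>0. \<forall>B. Ck d k B \<and> cdist d B A < \<delta> \<longrightarrow>
        (\<forall>n::nat. n \<ge> 1 \<longrightarrow> (\<forall>\<epsilon>::real. 0 < \<epsilon> \<and> \<epsilon> < \<epsilon>0 \<longrightarrow>
          measure (bern P)
            {\<omega> \<in> space (bern P).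
               \<not> (lyap P (ext_dim d i) (ext_cocycle i B) 1 - ereal \<epsilon>
                     \<le> elog (opnorm (ext_pow i (cpow d B n \<omega>))) / ereal (real n) \<and>
                   elog (opnorm (ext_pow i (cpow d B n \<omega>))) / ereal (real n)
                     \<le> lyap P (ext_dim d i) (ext_cocycle i B) 1 + ereal \<epsilon>)}
          \<le> C * exp (- real n * c * \<epsilon>^2)))"
    using \<delta> c one by blast
  obtain \<delta>' H \<alpha> where h: "0 < \<delta>'" "0 < \<alpha>" "\<alpha> \<le> 1" "\<And>B B'. Ck d k B \<Longrightarrow> cdist d B A < \<delta>' \<Longrightarrow> Ck d k B' \<Longrightarrow> cdist d B' A < \<delta>' \<Longrightarrow>
       \<bar>power_exponent P d B i - power_exponent P d B' i\<bar> \<le> H * cdist d B B' powr \<alpha>"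
    using contracting_holder[of d k A \<delta>, OF cc rankA ik(1) id \<delta>] by blast
  have s: "(\<Sum>j\<in>{1..i}. lyap P d B j) = ereal (power_exponent P d B i)" if "Ck d k B" "cdist d B A < \<delta>" for B
    by (rule nondegenerate_power.sum_lyap_power[OF contracting_exponent(1)[OF cc[OF that] that(1) ik(1) id] order_refl])
  show "\<exists>\<delta>>0. \<exists>H::real. \<exists>\<alpha>::real. 0 < \<alpha> \<and> \<alpha> \<le> 1 \<and>
        (\<forall>B B'. Ck d k B \<and> cdist d B A < \<delta> \<and> Ck d k B' \<and> cdist d B' A < \<delta> \<longrightarrow>
           (\<Sum>j\<in>{1..i}. lyap P d B j) \<noteq> - \<infinity> \<and>
           \<bar>real_of_ereal (\<Sum>j\<in>{1..i}. lyap P d B j) - real_of_ereal (\<Sum>j\<in>{1..i}. lyap P d B' j)\<bar>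
             \<le> H * cdist d B B' powr \<alpha>)"
  \<comment> \<open>\<open>\<delta>\<close> guarantees that the sums of exponents are finite, and
    \<open>\<delta>'\<close> gives the Hoelder bound for them.\<close>
  proof (rule exI[of _ "min \<delta> \<delta>'"], rule conjI, simp add: \<delta> h, rule exI[of _ H], rule exI[of _ \<alpha>],
      intro conjI allI impI h(2,3))
    fix B B'
    assume B: "Ck d k B \<and> cdist d B A < min \<delta> \<delta>' \<and> Ck d k B' \<and> cdist d B' A < min \<delta> \<delta>'"
    then have sB: "(\<Sum>j\<in>{1..i}. lyap P d B j) = ereal (power_exponent P d B i)"
      "(\<Sum>j\<in>{1..i}. lyap P d B' j) = ereal (power_exponent P d B' i)"
      by (simp_all only: s min_less_iff_conj)
    show "(\<Sum>j\<in>{1..i}. lyap P d B j) \<noteq> - \<infinity>" unfolding sB by simp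
    show "\<bar>real_of_ereal (\<Sum>j\<in>{1..i}. lyap P d B j) - real_of_ereal (\<Sum>j\<in>{1..i}. lyap P d B' j)\<bar>
             \<le> H * cdist d B B' powr \<alpha>"
      unfolding sB using h(4) B by simp
  qed
qed

end
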